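(* Let $q$ be a power of a prime, and let $K$ and $L$ be finite separable extensions of $\mathbb{F}_q(T)$ inside a fixed algebraic closure of $\mathbb{F}_q(T)$ (no assumption is made on their fields of constants). The following are equivalent. 1) (Arithmetic equivalence) For every non-zero prime $\mathfrak{p}$ of $\mathbb{F}_q[T]$, up to a set of exceptions of Dirichlet density zero, one has $f_K(\mathfrak{p})=f_L(\mathfrak{p})$. 2) (Gassmann equivalence) If $N$ is a Galois extension of $\mathbb{F}_q(T)$ containing both $K$ and $L$, then for every conjugacy class $\mathcal{C}\subset \mathrm{Gal}(N/\mathbb{F}_q(T))$ one has $|\mathcal{C}\cap \mathrm{Gal}(N/K)| = |\mathcal{C}\cap \mathrm{Gal}(N/L)|$. 3) (Split equivalence) For every non-zero prime $\mathfrak{p}$ of $\mathbb{F}_q[T]$, up to a set of exceptions of Dirichlet density zero, the number of prime ideals of $\mathcal{O}_K$ above $\mathfrak{p}$ equals the number of prime ideals of $\mathcal{O}_L$ above $\mathfrak{p}$.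
   Context: For a finite separable extension $K/\mathbb{F}_q(T)$, $\mathcal{O}_K$ denotes the integral closure of $\mathbb{F}_q[T]$ in $K$. If $\mathfrak{p}$ is a non-zero prime ideal of $\mathbb{F}_q[T]$ (equivalently a monic irreducible polynomial) and $\mathfrak{p}\mathcal{O}_K=\mathfrak{P}_1^{e_1}\cdots\mathfrak{P}_r^{e_r}$ with inertia degrees $f_i$ of $\mathfrak{P}_i$ over $\mathfrak{p}$ ordered so that $f_1\le\cdots\le f_r$, the splitting type of $\mathfrak{p}$ in $K$ is the tuple $f_K(\mathfrak{p})=(f_1,\dots,f_r)$. Galois extensions $N$ are finite. *)

theory Defs
  imports
    "HOL-Library.Cardinality"
    "HOL-Analysis.Infinite_Sum"
    "HOL-Algebra.Algebraic_Closure_Type"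
    "HOL-Algebra.Ideal_Product"
    "HOL-Algebra.QuotRing"
    "HOL-Algebra.Bij"
begin

section \<open>Subextensions of a fixed algebraic closure\<close>

text \<open>
  A base field is given as a type \<open>'a\<close>, and the type \<open>'a alg_closure\<close> serves as the fixed algebraic
  closure, with embedding \<open>to_ac\<close>. Extensions of the base field inside it are carrier sets
  \<open>K :: 'a alg_closure set\<close>.
\<close>

abbreviation ambient :: "'a::field alg_closure ring"
  where "ambient \<equiv> ring_of_type_algebra"

abbreviation base_field :: "'a::field alg_closure set"
  where "base_field \<equiv> range to_ac"

text \<open>\<open>rsquarefree\<close> speaks of roots in the algebraic closure: the minimal polynomial has no
  repeated root there.\<close>

definition separable_element :: "'a::field alg_closure \<Rightarrow> bool"
  where "separable_element x \<longleftrightarrow>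
    (\<exists>p :: 'a poly. Factorial_Ring.irreducible p \<and> poly (map_poly to_ac p) x = 0 \<and>
       rsquarefree (map_poly to_ac p))"

definition finite_separable_extension :: "'a::field alg_closure set \<Rightarrow> bool"
  where "finite_separable_extension K \<longleftrightarrow>
    subfield K ambient \<and> base_field \<subseteq> K \<and>
    ring.finite_dimension ambient base_field K \<and>
    (\<forall>x\<in>K. separable_element x)"

definition normal_extension :: "'a::field alg_closure set \<Rightarrow> bool"
  where "normal_extension N \<longleftrightarrow>
    (\<forall>p :: 'a poly. Factorial_Ring.irreducible p \<longrightarrow> (\<exists>x\<in>N. poly (map_poly to_ac p) x = 0) \<longrightarrow>
       {x. poly (map_poly to_ac p) x = 0} \<subseteq> N)"

definition finite_galois_extension :: "'a::field alg_closure set \<Rightarrow> bool"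
  where "finite_galois_extension N \<longleftrightarrow> finite_separable_extension N \<and> normal_extension N"

text \<open>Elements of the Galois group are extensional functions on \<open>N\<close>, so that equality of group
  elements is equality of automorphisms of \<open>N\<close>.\<close>

definition galois_group ::
    "'a::field alg_closure set \<Rightarrow> 'a alg_closure set \<Rightarrow> ('a alg_closure \<Rightarrow> 'a alg_closure) monoid"
  where "galois_group N K = BijGroup N
    \<lparr>carrier := {\<sigma> \<in> Ring.ring_hom (ambient\<lparr>carrier := N\<rparr>) (ambient\<lparr>carrier := N\<rparr>) \<inter> Bij N.
                   \<forall>x\<in>K. \<sigma> x = x}\<rparr>"

definition conjugacy_classes :: "('g, 'm) monoid_scheme \<Rightarrow> 'g set set"
  where "conjugacy_classes G =
    {{h \<otimes>\<^bsub>G\<^esub> g \<otimes>\<^bsub>G\<^esub> inv\<^bsub>G\<^esub> h | h. h \<in> carrier G} | g. g \<in> carrier G}"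


section \<open>Primes in extensions of a rational function field\<close>

text \<open>
  A finite field with \<open>q = CARD('k)\<close> elements is a type \<open>'k :: {field, finite}\<close>, its polynomial ring
  is \<open>'k poly\<close> and its rational function field is \<open>'k poly fract\<close>. Nonzero primes of \<open>'k poly\<close> are
  represented by their monic generators.
\<close>

abbreviation poly_embed :: "'k::field poly \<Rightarrow> 'k poly fract alg_closure"
  where "poly_embed f \<equiv> to_ac (to_fract f)"

definition prime_polys :: "'k::field poly set"
  where "prime_polys = {p. Factorial_Ring.irreducible p \<and> Polynomial.lead_coeff p = 1}"

definition integral_closure :: "'k::field poly fract alg_closure set \<Rightarrow> 'k poly fract alg_closure set"
  where "integral_closure K =
    {x \<in> K. \<exists>g :: 'k poly poly. Polynomial.lead_coeff g = 1 \<and> poly (map_poly poly_embed g) x = 0}"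

definition ring_of_integers :: "'k::field poly fract alg_closure set \<Rightarrow> 'k poly fract alg_closure ring"
  where "ring_of_integers K = ambient\<lparr>carrier := integral_closure K\<rparr>"

definition primes_above ::
    "'k::field poly fract alg_closure set \<Rightarrow> 'k poly \<Rightarrow> 'k poly fract alg_closure set set"
  where "primes_above K p =
    {P. primeideal P (ring_of_integers K) \<and> P \<inter> range poly_embed = poly_embed ` {f. p dvd f}}"

text \<open>
  The residue field of the prime \<open>p\<close> below \<open>P\<close> is identified with its image in the residue field
  of \<open>P\<close>, which consists of the cosets represented by polynomials.
\<close>

definition inertia_degree ::
    "'k::field poly fract alg_closure set \<Rightarrow> 'k poly fract alg_closure set \<Rightarrow> nat"
  where "inertia_degree K P =
    (let R = ring_of_integers K; \<kappa> = R Quot P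
     in ring.dim \<kappa> (range (\<lambda>f. P +>\<^bsub>R\<^esub> poly_embed f)) (carrier \<kappa>))"

definition has_splitting_type ::
    "'k::field poly fract alg_closure set \<Rightarrow> 'k poly \<Rightarrow> nat list \<Rightarrow> bool"
  where "has_splitting_type K p fs \<longleftrightarrow>
    (\<exists>Ps es. distinct Ps \<and> length es = length Ps \<and>
       (\<forall>P\<in>set Ps. primeideal P (ring_of_integers K)) \<and> (\<forall>e\<in>set es. 1 \<le> e) \<and>
       Idl\<^bsub>ring_of_integers K\<^esub> {poly_embed p} =
         (\<Otimes>\<^bsub>ideals_set (ring_of_integers K)\<^esub> i\<in>{..<length Ps}.
            (Ps ! i) [^]\<^bsub>ideals_set (ring_of_integers K)\<^esub> (es ! i :: nat)) \<and>
       fs = map (inertia_degree K) Ps \<and> sorted fs)"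

text \<open>Well defined for prime \<open>p\<close> and finite separable \<open>K\<close>, by existence and uniqueness of the
  factorization of ideals into primes.\<close>

definition splitting_type :: "'k::field poly fract alg_closure set \<Rightarrow> 'k poly \<Rightarrow> nat list"
  where "splitting_type K p = (THE fs. has_splitting_type K p fs)"


section \<open>Dirichlet density\<close>

text \<open>The norm of the prime generated by \<open>p\<close> is \<open>q ^ degree p\<close>. The density is only meant for sets
  \<open>S \<subseteq> prime_polys\<close>.\<close>

definition prime_sum :: "'k::{field,finite} poly set \<Rightarrow> real \<Rightarrow> real"
  where "prime_sum S s = (\<Sum>\<^sub>\<infinity>p\<in>S. real (CARD('k) ^ Polynomial.degree p) powr (-s))"

definition has_dirichlet_density :: "'k::{field,finite} poly set \<Rightarrow> real \<Rightarrow> bool"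
  where "has_dirichlet_density S d \<longleftrightarrow>
    ((\<lambda>s. prime_sum S s / prime_sum (prime_polys :: 'k poly set) s) \<longlongrightarrow> d) (at_right 1)"

definition for_almost_all_primes :: "('k::{field,finite} poly \<Rightarrow> bool) \<Rightarrow> bool"
  where "for_almost_all_primes Q \<longleftrightarrow> has_dirichlet_density {p \<in> prime_polys. \<not> Q p} 0"


section \<open>The three equivalence relations\<close>

definition arithmetically_equivalent ::
    "'k::{field,finite} poly fract alg_closure set \<Rightarrow> 'k poly fract alg_closure set \<Rightarrow> bool"
  where "arithmetically_equivalent K L \<longleftrightarrow>
    for_almost_all_primes (\<lambda>p. splitting_type K p = splitting_type L p)"

definition gassmann_equivalent ::
    "'k::{field,finite} poly fract alg_closure set \<Rightarrow> 'k poly fract alg_closure set \<Rightarrow> bool"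
  where "gassmann_equivalent K L \<longleftrightarrow>
    (\<forall>N. finite_galois_extension N \<and> K \<subseteq> N \<and> L \<subseteq> N \<longrightarrow>
       (\<forall>C\<in>conjugacy_classes (galois_group N base_field).
          card (C \<inter> carrier (galois_group N K)) = card (C \<inter> carrier (galois_group N L))))"

definition split_equivalent ::
    "'k::{field,finite} poly fract alg_closure set \<Rightarrow> 'k poly fract alg_closure set \<Rightarrow> bool"
  where "split_equivalent K L \<longleftrightarrow>
    for_almost_all_primes (\<lambda>p. card (primes_above K p) = card (primes_above L p))"

end

theory Submission
  imports Defs "Jordan_Normal_Form.Char_Poly"
begin

text \<open>
  Let \<open>\<alpha>\<close> be an integral generator of \<open>K\<close> with minimal polynomial \<open>f\<close>, and let \<open>\<Delta> = u f + v f'\<close> be a nonzero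
  polynomial in \<open>T\<close>. For a prime \<open>p\<close> not dividing \<open>\<Delta>\<close>, with a root \<open>t\<close> in an algebraic closure of the
  finite field, the primes of \<open>K\<close> above \<open>p\<close> correspond to the orbits of \<open>y \<mapsto> y ^ (q ^ deg p)\<close> on the roots of
  \<open>f(t, _)\<close>, and the inertia degrees are the orbit sizes. Reduction at a point of a Galois extension \<open>N\<close>
  identifies these roots with the conjugates of \<open>\<alpha>\<close>, and the power map with a Frobenius element of
  \<open>N\<close>, so the splitting type of \<open>p\<close> is the cycle type of that element. Gassmann equivalence says that every
  \<open>g\<close> in the Galois group fixes equally many conjugates of the two generators; then the cycle types agree as well,
  because \<open>g\<close> may be replaced by its powers, and conversely Burnside's formula recovers the numbers of
  fixed points from the numbers of orbits.

  What remains is a weak form of Chebotarev's theorem: the primes whose Frobenius element generates a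
  conjugate of \<open>\<langle>g\<rangle>\<close> do not have density zero. The fixed field of \<open>\<langle>g\<rangle>\<close> is an affine curve \<open>f = 0\<close>, and
  for every such curve the sum of \<open>|p| powr (- s)\<close> over the roots fixed by Frobenius is
  \<open>log (1 / (s - 1)) + O(1)\<close>; sieving over the subgroups of \<open>\<langle>g\<rangle>\<close> gives the claim. This estimate needs neither the
  Riemann-Roch theorem nor a zeta function. By the pigeonhole principle some nonzero function of small
  height vanishes on any given small set of Frobenius orbits, which bounds the number of such sets from above, and
  the functions \<open>\<Delta> T ^ m + \<Delta> e + 1\<close> have essentially different divisors, which bounds the number
  of effective divisors from below.
\<close>

section \<open>Finite fields\<close>

text \<open>Constant factors are harmless throughout: counts only have to be of order q^n, because
  the logarithm of an Euler product turns a factor into a bounded error. The obstacle is the points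
  above \<Delta> = 0, where the curve may be singular or ramified and the ring of polynomials modulo
  f need not be integrally closed. They are left out, so the zeros of a function there are
  invisible. The 1 and the factor \<Delta> in \<Delta> T^m + \<Delta> e + 1 keep its zeros away from
  them, and the dominant term \<Delta> T^m fixes its behaviour at infinity; two such functions with
  the same visible zeros differ by one of boundedly many factors. An extension of the field of
  constants only restricts which degrees of places occur. The lower bound therefore counts divisors
  up to a given degree, in steps of the degree d of f. Counting degree one places sees only
  permutation characters, which cannot separate the generators of one cyclic group. This suffices,
  since all generators of a cyclic group have the same orbits.\<close>

lemma power_card_eq_1_of_closed:
  fixes c :: "'a::idom"
  assumes "finite S" "0 \<notin> S" "c \<noteq> 0" "\<And>s. s \<in> S \<Longrightarrow> c * s \<in> S"
  shows "c ^ card S = 1"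
proof -
  have inj: "inj_on ((*) c) S" using assms(3) by (auto simp: inj_on_def)
  have "(*) c ` S = S"
    using assms(1,4) inj by (intro card_subset_eq) (auto simp: card_image)
  then have "\<Prod>S = (\<Prod>s\<in>S. c * s)"
    using prod.reindex[OF inj, of "\<lambda>x. x"] by simp
  also have "\<dots> = c ^ card S * \<Prod>S" by (simp add: prod.distrib)
  finally have "c ^ card S * \<Prod>S = 1 * \<Prod>S" by simp
  moreover have "\<Prod>S \<noteq> 0" using assms(1,2) by auto
  ultimately show ?thesis by (metis mult_right_cancel)
qed

text \<open>Fermat's argument for a finite multiplicatively closed subset instead of a type, so that
  it covers both \<open>'k\<close> and the residue fields, which occur as subsets of the algebraic
  closure.\<close>

lemma power_card_of_closed:
  fixes c :: "'a::idom"
  assumes "finite S" "c \<in> S" "0 \<in> S" "\<And>s s'. s \<in> S \<Longrightarrow> s' \<in> S \<Longrightarrow> s * s' \<in> S"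
  shows "c ^ card S = c"
proof (cases "c = 0")
  case True
  then show ?thesis using assms(1,3) card_gt_0_iff[of S] by (auto simp: power_0_left)
next
  case False
  have "c ^ card (S - {0}) = 1"
    by (rule power_card_eq_1_of_closed) (use assms False in auto)
  moreover have "card S = Suc (card (S - {0}))"
    using assms by (metis card_Suc_Diff1)
  ultimately show ?thesis by simp
qed

lemma finite_field_power_card: "(x :: 'k::{field,finite}) ^ CARD('k) = x"
  by (rule power_card_of_closed) auto

lemma finite_field_card_gt_1: "1 < CARD('k::{field,finite})"
proof -
  have "card {0, 1 :: 'k} \<le> CARD('k)" by (rule card_mono) auto
  then show ?thesis by simp
qed

lemma card_power_fixed_le:
  assumes "1 < Q"
  shows "finite {x :: 'a::idom. x ^ Q = x}" "card {x :: 'a. x ^ Q = x} \<le> Q"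
proof -
  define p :: "'a poly" where "p = monom 1 Q - monom 1 1"
  have "coeff p Q = 1" using assms by (simp add: p_def)
  then have "p \<noteq> 0" by auto
  moreover have "{x. poly p x = 0} = {x. x ^ Q = x}"
    by (auto simp: p_def poly_monom)
  moreover have "degree p \<le> Q"
    unfolding p_def by (rule degree_diff_le) (use assms in \<open>auto intro: degree_monom_le order.trans[OF degree_monom_le]\<close>)
  ultimately show "finite {x :: 'a. x ^ Q = x}" "card {x :: 'a. x ^ Q = x} \<le> Q"
    using poly_roots_finite[of p] card_poly_roots_bound[of p] by auto
qed

text \<open>Both sides are monic of degree q, so the difference has degree below q; it vanishes on
  all q elements of the field.\<close>

lemma monom_diff_eq_prod_finite_field:
  "monom 1 CARD('k) - monom 1 1 = (\<Prod>a\<in>(UNIV :: 'k::{field,finite} set). [:-a, 1:])"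
proof (rule ccontr)
  let ?q = "CARD('k)" and ?P = "\<Prod>a\<in>(UNIV :: 'k set). [:-a, 1:]"
  let ?D = "monom 1 ?q - monom 1 1 - ?P"
  assume "monom 1 ?q - monom 1 1 \<noteq> ?P"
  then have nz: "?D \<noteq> 0" by simp
  have q: "1 < ?q" by (rule finite_field_card_gt_1)
  have degP: "degree ?P = ?q" by (subst degree_prod_eq_sum_degree) auto
  have lcP: "lead_coeff ?P = 1" by (subst lead_coeff_prod) auto
  have "degree ?D < ?q"
  proof -
    have "degree ?D \<le> ?q"
      using q degP by (intro degree_diff_le) (auto intro: order.trans[OF degree_monom_le])
    moreover have "coeff ?D ?q = 0" using q lcP degP by simp
    then have "degree ?D \<noteq> ?q" using nz q by (metis leading_coeff_0_iff)
    ultimately show ?thesis by linarith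
  qed
  moreover have "card {x. poly ?D x = 0} \<le> degree ?D"
    using nz by (rule card_poly_roots_bound)
  moreover have "{x. poly ?D x = 0} = UNIV"
    by (auto simp: poly_monom finite_field_power_card poly_prod)
  ultimately show False by simp
qed

interpretation to_ac: map_poly_inj_idom_hom "to_ac :: 'a::field \<Rightarrow> _"
  by unfold_locales auto

text \<open>Translating the factors of \<open>\<Prod>(X - a)\<close> by \<open>1\<close> permutes them; this avoids knowing that \<open>q\<close> is a
  power of the characteristic.\<close>

lemma frobenius_add_1:
  "((x :: 'k::{field,finite} alg_closure) + 1) ^ CARD('k) = x ^ CARD('k) + 1"
proof -
  let ?q = "CARD('k)"
  have ev: "z ^ ?q - z = (\<Prod>a\<in>(UNIV :: 'k set). z - to_ac a)" for z
  proof -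
    have "poly (map_poly to_ac (monom 1 ?q - monom 1 1 :: 'k poly)) z
        = poly (map_poly to_ac (\<Prod>a\<in>(UNIV :: 'k set). [:-a, 1:])) z"
      by (simp only: monom_diff_eq_prod_finite_field)
    then show ?thesis
      by (simp add: hom_distribs poly_monom poly_prod map_poly_monom algebra_simps)
  qed
  have "(x + 1) ^ ?q - (x + 1) = (\<Prod>a\<in>(UNIV :: 'k set). x - to_ac (a - 1))"
    unfolding ev by (simp add: algebra_simps)
  also have "\<dots> = (\<Prod>a\<in>(UNIV :: 'k set). x - to_ac a)"
    by (rule prod.reindex_bij_witness[of _ "\<lambda>a. a + 1" "\<lambda>a. a - 1"]) auto
  also have "\<dots> = x ^ ?q - x" by (rule ev[symmetric])
  finally show ?thesis by (simp add: algebra_simps)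
qed

lemma frobenius_add:
  "((x :: 'k::{field,finite} alg_closure) + y) ^ CARD('k) ^ n = x ^ CARD('k) ^ n + y ^ CARD('k) ^ n"
proof -
  have 1: "(x + y) ^ CARD('k) = x ^ CARD('k) + y ^ CARD('k)" for x y :: "'k alg_closure"
  proof (cases "y = 0")
    case False
    have "x + y = (x / y + 1) * y" using False by (simp add: field_simps)
    then show ?thesis
      using False by (simp only: power_mult_distrib frobenius_add_1) (simp add: power_divide field_simps)
  qed (simp add: power_0_left)
  show ?thesis
  proof (induction n)
    case (Suc n)
    have "(x + y) ^ CARD('k) ^ Suc n = ((x + y) ^ CARD('k) ^ n) ^ CARD('k)"
      by (simp add: power_mult[symmetric] mult.commute)
    also have "\<dots> = (x ^ CARD('k) ^ n) ^ CARD('k) + (y ^ CARD('k) ^ n) ^ CARD('k)"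
      by (simp add: Suc.IH 1)
    finally show ?case by (simp add: power_mult[symmetric] mult.commute)
  qed simp
qed

lemma to_ac_frobenius: "to_ac (c :: 'k::{field,finite}) ^ CARD('k) ^ n = to_ac c"
proof (induction n)
  case (Suc n)
  then show ?case
    by (simp add: power_mult to_ac_power[symmetric] finite_field_power_card del: to_ac_power)
qed simp

lemma frobenius_minus: "(- x :: 'k::{field,finite} alg_closure) ^ CARD('k) ^ n = - (x ^ CARD('k) ^ n)"
proof -
  have "(- 1 :: 'k alg_closure) ^ CARD('k) ^ n = - 1"
    using to_ac_frobenius[of "-1 :: 'k" n] by simp
  then show ?thesis by (metis mult_minus1 power_mult_distrib)
qed

lemma frobenius_comm_ring_hom:
  "comm_ring_hom (\<lambda>x :: 'k::{field,finite} alg_closure. x ^ CARD('k) ^ n)"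
  by standard (auto simp: frobenius_add power_mult_distrib power_0_left)

lemma frobenius_inj:
  assumes "(x :: 'k::{field,finite} alg_closure) ^ CARD('k) ^ n = y ^ CARD('k) ^ n"
  shows "x = y"
proof -
  have "(x - y) ^ CARD('k) ^ n = 0"
    using frobenius_add[of x "- y" n] assms by (simp add: frobenius_minus)
  then show ?thesis by simp
qed

text \<open>In \<open>'k poly poly\<close> the outer variable is Y and the inner one is T;
  \<open>tev\<close> specialises T, \<open>pev\<close> both. Over a general base field
  \<open>tev x\<close> also serves as evaluation at an algebraic element x.\<close>

definition tev :: "'k::field alg_closure \<Rightarrow> 'k poly \<Rightarrow> 'k alg_closure"
  where "tev t c = poly (map_poly to_ac c) t"

definition pev :: "'k::field alg_closure \<Rightarrow> 'k alg_closure \<Rightarrow> 'k poly poly \<Rightarrow> 'k alg_closure"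
  where "pev t y a = poly (map_poly (tev t) a) y"

interpretation tev: map_poly_idom_hom "tev t" for t
  by unfold_locales (auto simp: tev_def hom_distribs)

interpretation pev: idom_hom "pev t y" for t y
  by unfold_locales (auto simp: pev_def hom_distribs)

lemma tev_pCons [simp]: "tev t (pCons c p) = to_ac c + t * tev t p"
  by (simp add: tev_def hom_distribs)

lemma pev_pCons [simp]: "pev t y (pCons c p) = tev t c + y * pev t y p"
  by (simp add: pev_def hom_distribs)

lemma tev_frobenius:
  "tev ((t :: 'k::{field,finite} alg_closure) ^ CARD('k) ^ n) c = tev t c ^ CARD('k) ^ n"
  by (induction c) (auto simp: frobenius_add power_mult_distrib to_ac_frobenius power_0_left)

lemma pev_frobenius:
  "pev ((t :: 'k::{field,finite} alg_closure) ^ CARD('k) ^ n) (y ^ CARD('k) ^ n) a = pev t y a ^ CARD('k) ^ n"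
  by (induction a) (auto simp: frobenius_add power_mult_distrib tev_frobenius power_0_left)

lemma irreducible_field_polyD:
  assumes "Factorial_Ring.irreducible (p :: 'a::field poly)"
  shows "p \<noteq> 0" "0 < degree p"
  using assms unfolding Factorial_Ring.irreducible_def
  by (auto simp: is_unit_iff_degree)

text \<open>Among the nonzero divisors of p with property Q, one of least degree is irreducible,
  since Q passes to one of two factors. Minimal polynomials and prime divisors are both
  instances.\<close>

lemma exists_irreducible_of_closed:
  fixes Q :: "'a::field poly \<Rightarrow> bool"
  assumes "Q p" "p \<noteq> 0" "\<And>a b. Q (a * b) \<Longrightarrow> Q a \<or> Q b" "\<And>c. c \<noteq> 0 \<Longrightarrow> \<not> Q [:c:]"
  obtains r where "Factorial_Ring.irreducible r" "lead_coeff r = 1" "Q r" "r dvd p"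
proof -
  define r0 where "r0 = arg_min degree (\<lambda>r. Q r \<and> r \<noteq> 0 \<and> r dvd p)"
  have ex: "Q p \<and> p \<noteq> 0 \<and> p dvd p" using assms by simp
  have r0: "Q r0 \<and> r0 \<noteq> 0 \<and> r0 dvd p" unfolding r0_def by (rule arg_min_natI) (rule ex)
  have le: "degree r0 \<le> degree r" if "Q r" "r \<noteq> 0" "r dvd p" for r
    unfolding r0_def using that by (intro arg_min_nat_le) auto
  have unitQ: "\<not> Q r" if "r \<noteq> 0" "degree r = 0" for r
    using that assms(4) by (metis degree_eq_zeroE pCons_0_0)
  define r where "r = smult (inverse (lead_coeff r0)) r0"
  have r0_eq: "r0 = [:lead_coeff r0:] * r" using r0 by (simp add: r_def)
  have lc: "lead_coeff r = 1" using r0 by (simp add: r_def)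
  have degr: "degree r = degree r0" using r0 by (simp add: r_def)
  have Qr: "Q r" using assms(3)[of "[:lead_coeff r0:]" r] r0_eq r0 assms(4)[of "lead_coeff r0"] by auto
  have rp: "r dvd p" using r0 unfolding r_def by (simp add: smult_dvd_iff)
  have rnz: "r \<noteq> 0" using lc by auto
  have "Factorial_Ring.irreducible r"
  proof (rule Factorial_Ring.irreducibleI)
    show "r \<noteq> 0" by (rule rnz)
    show "\<not> is_unit r" using unitQ[OF rnz] Qr rnz by (auto simp: is_unit_iff_degree)
    fix a b assume ab: "r = a * b"
    then have nz: "a \<noteq> 0" "b \<noteq> 0" using rnz by auto
    have deg: "degree r = degree a + degree b" using ab nz by (simp add: degree_mult_eq)
    have "Q a \<or> Q b" using assms(3) Qr ab by blast
    then have "degree r \<le> degree a \<or> degree r \<le> degree b"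
      using le[of a] le[of b] nz degr rp ab by (metis dvd_mult_left dvd_mult_right)
    then show "is_unit a \<or> is_unit b" using deg nz by (auto simp: is_unit_iff_degree)
  qed
  then show ?thesis using that lc Qr rp by blast
qed

text \<open>A nonzero element of least degree in the ideal generated by p and c divides p and c. If
  it were not a unit, p would divide it and hence c.\<close>

lemma irreducible_bezout:
  assumes "Factorial_Ring.irreducible (p :: 'a::field poly)" "\<not> p dvd c"
  obtains a b where "a * p + b * c = 1"
proof -
  define r where "r = arg_min degree (\<lambda>r. r \<noteq> 0 \<and> (\<exists>a b. r = a * p + b * c))"
  have ex: "p \<noteq> 0 \<and> (\<exists>a b. p = a * p + b * c)"
    using irreducible_field_polyD[OF assms(1)] by (intro conjI exI[of _ 1] exI[of _ 0]) auto
  have r: "r \<noteq> 0 \<and> (\<exists>a b. r = a * p + b * c)"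
    unfolding r_def by (rule arg_min_natI) (rule ex)
  then obtain a b where ab: "r = a * p + b * c" by blast
  have le: "degree r \<le> degree s" if "s \<noteq> 0" "\<exists>a b. s = a * p + b * c" for s
    unfolding r_def using that by (intro arg_min_nat_le) auto
  have dvd: "r dvd x" if x: "x = a' * p + b' * c" for x a' b'
  proof (rule ccontr)
    assume "\<not> r dvd x"
    then have nz: "x mod r \<noteq> 0" by (simp add: mod_eq_0_iff_dvd)
    have "x mod r = x - (x div r) * r" by (simp add: minus_div_mult_eq_mod)
    also have "\<dots> = (a' - (x div r) * a) * p + (b' - (x div r) * b) * c"
      by (subst (2) ab) (simp add: x algebra_simps)
    finally have "degree r \<le> degree (x mod r)" using nz le by blast
    then show False using degree_mod_less'[of r x] r nz by auto
  qed
  have "r dvd p" "r dvd c" using dvd[of p 1 0] dvd[of c 0 1] by simp_all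
  have "is_unit r"
  proof (rule ccontr)
    assume "\<not> is_unit r"
    then have "p dvd r" using \<open>r dvd p\<close> assms(1) by (meson irreducibleD')
    then show False using \<open>r dvd c\<close> assms(2) dvd_trans by blast
  qed
  then obtain s where "1 = r * s" by (metis dvdE)
  then have "(s * a) * p + (s * b) * c = 1" by (simp add: ab algebra_simps)
  then show ?thesis by (rule that)
qed

lemma tev_eq_0_iff_dvd:
  assumes "Factorial_Ring.irreducible p" "tev t p = 0"
  shows "tev t c = 0 \<longleftrightarrow> p dvd c"
proof
  assume c: "tev t c = 0"
  show "p dvd c"
  proof (rule ccontr)
    assume "\<not> p dvd c"
    then obtain a b where "a * p + b * c = 1" using irreducible_bezout assms(1) by blast
    then have "tev t (a * p + b * c) = 1" by simp
    then show False using assms(2) c by (simp add: hom_distribs)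
  qed
qed (use assms in \<open>auto elim!: dvdE simp: hom_distribs\<close>)

lemma exists_minimal_poly:
  obtains p where "Factorial_Ring.irreducible p" "lead_coeff p = 1" "tev (t :: 'a::field alg_closure) p = 0"
proof -
  obtain p :: "'a poly" where p: "p \<noteq> 0" "tev t p = 0"
    using alg_closure_algebraic[of t] unfolding tev_def by metis
  show ?thesis
    by (rule exists_irreducible_of_closed[of "\<lambda>p. tev t p = 0" p])
      (use p that in \<open>auto simp: hom_distribs\<close>)
qed

lemma exists_prime_poly_dvd:
  assumes "c \<noteq> 0" "0 < degree (c :: 'a::field poly)"
  obtains p where "p \<in> prime_polys" "p dvd c"
proof (rule exists_irreducible_of_closed[of "\<lambda>p. 0 < degree p" c])
  fix a b :: "'a poly"
  assume "0 < degree (a * b)"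
  then show "0 < degree a \<or> 0 < degree b"
    by (metis add_is_0 bot_nat_0.not_eq_extremum degree_mult_le le_zero_eq)
qed (use assms that in \<open>auto simp: prime_polys_def\<close>)

lemma minimal_poly_unique:
  assumes "p \<in> prime_polys" "p' \<in> prime_polys" "tev t p = 0" "tev t p' = 0"
  shows "p = p'"
proof -
  have "p dvd p'" "p' dvd p"
    using assms tev_eq_0_iff_dvd unfolding prime_polys_def by blast+
  then show ?thesis using assms
    by (auto simp: prime_polys_def intro: poly_dvd_antisym)
qed

lemma tev_eq_exists_degree_less:
  assumes "Factorial_Ring.irreducible p" "tev t p = 0"
  obtains c' where "tev t c' = tev t c" "degree c' < degree p"
proof -
  have "c = c div p * p + c mod p" by simp
  then have "tev t c = tev t (c mod p)"
    by (metis add_0 assms(2) mult_zero_right tev.base.hom_add tev.base.hom_mult)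
  moreover have "degree (c mod p) < degree p"
    using irreducible_field_polyD[OF assms(1)] degree_mod_less'[of p c]
    by (cases "c mod p = 0") auto
  ultimately show ?thesis using that by metis
qed

lemma card_polys_coeffs_in:
  assumes "finite B" "(0 :: 'a::zero) \<in> B"
  shows "finite {p. (\<forall>i\<ge>n. coeff p i = 0) \<and> (\<forall>i. coeff p i \<in> B)} \<and>
    card {p. (\<forall>i\<ge>n. coeff p i = 0) \<and> (\<forall>i. coeff p i \<in> B)} = card B ^ n"
proof (induction n)
  case 0
  have "{p. (\<forall>i\<ge>0. coeff p i = 0) \<and> (\<forall>i. coeff p i \<in> B)} = {0}"
    using assms by (auto intro: poly_eqI)
  then show ?case by simp
next
  case (Suc n)
  let ?S = "\<lambda>n. {p. (\<forall>i\<ge>n. coeff p i = 0) \<and> (\<forall>i. coeff p i \<in> B)}"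
  have "?S (Suc n) = case_prod pCons ` (B \<times> ?S n)"
  proof (intro equalityI subsetI)
    fix p assume p: "p \<in> ?S (Suc n)"
    obtain c r where r: "p = pCons c r" by (cases p)
    have "coeff p 0 \<in> B" "\<And>i. coeff p (Suc i) \<in> B" "\<And>i. i \<ge> n \<Longrightarrow> coeff p (Suc i) = 0"
      using p by auto
    then show "p \<in> case_prod pCons ` (B \<times> ?S n)" using r by auto
  next
    fix p assume "p \<in> case_prod pCons ` (B \<times> ?S n)"
    then show "p \<in> ?S (Suc n)" by (auto simp: coeff_pCons split: nat.splits)
  qed
  moreover have "inj_on (case_prod pCons) (B \<times> ?S n)" by (auto simp: inj_on_def)
  ultimately show ?case
    using Suc assms by (simp add: card_image card_cartesian_product)
qed

lemma card_polys_degree_less: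
  "finite {p :: 'a::{zero,finite} poly. \<forall>i\<ge>n. coeff p i = 0}"
  "card {p :: 'a::{zero,finite} poly. \<forall>i\<ge>n. coeff p i = 0} = CARD('a) ^ n"
  using card_polys_coeffs_in[of "UNIV :: 'a set" n] by auto

text \<open>\<open>range (tev t)\<close> is a copy of the residue field of p; the polynomials of
  degree below that of p represent each residue exactly once.\<close>

lemma card_range_tev:
  assumes "p \<in> prime_polys" "tev (t :: 'k::{field,finite} alg_closure) p = 0"
  shows "card (range (tev t)) = CARD('k) ^ degree p" "finite (range (tev t))"
proof -
  have irr: "Factorial_Ring.irreducible p" using assms by (simp add: prime_polys_def)
  let ?B = "{c :: 'k poly. \<forall>i\<ge>degree p. coeff c i = 0}"
  have range: "range (tev t) = tev t ` ?B"
  proof safe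
    fix c
    obtain c' where "tev t c' = tev t c" "degree c' < degree p"
      using tev_eq_exists_degree_less[OF irr assms(2)] .
    then show "tev t c \<in> tev t ` ?B" by (auto intro!: image_eqI[of _ _ c'] coeff_eq_0)
  qed auto
  have inj: "inj_on (tev t) ?B"
  proof
    fix a b assume ab: "a \<in> ?B" "b \<in> ?B" "tev t a = tev t b"
    then have "tev t (a - b) = 0" by (simp add: hom_distribs)
    then have dvd: "p dvd a - b" using tev_eq_0_iff_dvd[OF irr assms(2)] by simp
    have "degree (a - b) < degree p"
    proof -
      have "\<forall>i\<ge>degree p. coeff (a - b) i = 0" using ab by simp
      then show ?thesis
        using irreducible_field_polyD[OF irr] by (metis degree_0 leading_coeff_0_iff linorder_not_less)
    qed
    then have "a - b = 0" using dvd by (meson dvd_imp_degree_le leD)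
    then show "a = b" by simp
  qed
  show "card (range (tev t)) = CARD('k) ^ degree p" "finite (range (tev t))"
    unfolding range by (simp_all add: card_image[OF inj] card_polys_degree_less)
qed

text \<open>Fermat's argument gives one inclusion, and X^Q - X has at most Q roots, which is already
  the size of the residue field.\<close>

lemma range_tev_eq:
  assumes "p \<in> prime_polys" "tev (t :: 'k::{field,finite} alg_closure) p = 0"
  shows "range (tev t) = {c. c ^ CARD('k) ^ degree p = c}"
proof (rule card_seteq)
  have deg: "0 < degree p" using assms irreducible_field_polyD by (auto simp: prime_polys_def)
  have Q: "1 < CARD('k) ^ degree p" using finite_field_card_gt_1 deg by (metis one_less_power)
  show "finite {c :: 'k alg_closure. c ^ CARD('k) ^ degree p = c}"
    by (rule card_power_fixed_le(1)[OF Q])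
  show "card {c :: 'k alg_closure. c ^ CARD('k) ^ degree p = c} \<le> card (range (tev t))"
    unfolding card_range_tev[OF assms] by (rule card_power_fixed_le(2)[OF Q])
  show "range (tev t) \<subseteq> {c. c ^ CARD('k) ^ degree p = c}"
  proof clarify
    fix c
    have "tev t c ^ card (range (tev t)) = tev t c"
    proof (rule power_card_of_closed)
      show "0 \<in> range (tev t)" by (rule image_eqI[of _ _ 0]) auto
      fix s s' assume "s \<in> range (tev t)" "s' \<in> range (tev t)"
      then show "s * s' \<in> range (tev t)" by (auto simp flip: tev.base.hom_mult)
    qed (use card_range_tev[OF assms] in auto)
    then show "tev t c ^ CARD('k) ^ degree p = tev t c" using card_range_tev[OF assms] by simp
  qed
qed

lemma frobenius_fixes_root:
  assumes "p \<in> prime_polys" "tev (t :: 'k::{field,finite} alg_closure) p = 0"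
  shows "t ^ CARD('k) ^ degree p = t"
proof -
  have "t = tev t [:0, 1:]" by simp
  then have "t \<in> range (tev t)" by (rule range_eqI)
  then show ?thesis using range_tev_eq[OF assms] by simp
qed

lemma degree_le_of_frobenius_fixes:
  assumes "p \<in> prime_polys" "tev (t :: 'k::{field,finite} alg_closure) p = 0"
    and "t ^ CARD('k) ^ m = t" "0 < m"
  shows "degree p \<le> m"
proof -
  have Q: "1 < CARD('k) ^ m" using finite_field_card_gt_1 assms(4) by (metis one_less_power)
  have "range (tev t) \<subseteq> {c. c ^ CARD('k) ^ m = c}"
    using tev_frobenius[of t m] assms(3) by auto
  then have "CARD('k) ^ degree p \<le> CARD('k) ^ m"
    unfolding card_range_tev(1)[OF assms(1,2), symmetric]
    by (rule order.trans[OF card_mono[OF card_power_fixed_le(1)[OF Q]] card_power_fixed_le(2)[OF Q]])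
  then show ?thesis using finite_field_card_gt_1 by (metis power_le_imp_le_exp)
qed

section \<open>Lifting simple roots to power series\<close>

text \<open>Taylor expansion to second order, for the Newton step below.\<close>

lemma poly_add_expansion:
  "\<exists>R. poly p (Y + Z) = poly p Y + Z * poly (pderiv p) Y + Z ^ 2 * (R :: 'a::idom)"
proof (induction p)
  case 0
  then show ?case by (intro exI[of _ 0]) simp
next
  case (pCons a p)
  then obtain R where R: "poly p (Y + Z) = poly p Y + Z * poly (pderiv p) Y + Z ^ 2 * R" by blast
  show ?case
    by (rule exI[of _ "poly (pderiv p) Y + Y * R + Z * R"])
      (simp add: R pderiv_pCons algebra_simps power2_eq_square)
qed

lemma poly_fps_cong_upto:
  assumes "\<And>i. i \<le> n \<Longrightarrow> fps_nth Y i = fps_nth Y' i" "i \<le> n"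
  shows "fps_nth (poly p Y) i = fps_nth (poly p (Y' :: 'a::comm_ring_1 fps)) i"
  using assms(2)
proof (induction p arbitrary: i)
  case (pCons a p)
  have "fps_nth (Y * poly p Y) i = fps_nth (Y' * poly p Y') i"
    unfolding fps_mult_nth using pCons assms(1) by (intro sum.cong) auto
  then show ?case by simp
qed simp

interpretation fps_nth_0: map_poly_idom_hom "\<lambda>g :: 'a::idom fps. fps_nth g 0"
  by unfold_locales auto

lemma poly_fps_nth_0:
  "fps_nth (poly p Y) 0 = poly (map_poly (\<lambda>g. fps_nth g 0) p) (fps_nth (Y :: 'a::idom fps) 0)"
  by (induction p) (auto simp: hom_distribs)

context
  fixes p :: "'a::field fps poly" and y :: 'a
begin

text \<open>Newton iteration that corrects one coefficient per step. The denominator stays the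
  derivative at the starting value, since only its constant term matters.\<close>

primrec hensel_approx :: "nat \<Rightarrow> 'a fps" where
  "hensel_approx 0 = fps_const y"
| "hensel_approx (Suc n) = hensel_approx n +
     fps_const (- fps_nth (poly p (hensel_approx n)) (Suc n) / fps_nth (poly (pderiv p) (fps_const y)) 0)
       * fps_X ^ Suc n"

end

lemma hensel_approx_nth:
  "i \<le> m \<Longrightarrow> m \<le> n \<Longrightarrow> fps_nth (hensel_approx p y n) i = fps_nth (hensel_approx p y m) i"
proof (induction n)
  case (Suc n)
  show ?case
  proof (cases "m = Suc n")
    case False
    then show ?thesis using Suc by (simp add: fps_X_power_mult_right_nth)
  qed simp
qed simp

text \<open>The correction Z starts in degree Suc n. Its square contributes only from degree 2n + 2
  on, and its linear contribution in degree Suc n cancels the remaining coefficient.\<close>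

lemma hensel_approx_root:
  fixes y :: "'a::field"
  assumes root: "fps_nth (poly p (fps_const y)) 0 = 0"
    and simple: "fps_nth (poly (pderiv p) (fps_const y)) 0 \<noteq> 0"
  shows "i \<le> n \<Longrightarrow> fps_nth (poly p (hensel_approx p y n)) i = 0"
proof (induction n arbitrary: i)
  case 0
  then show ?case using root by simp
next
  case (Suc n)
  let ?Y = "hensel_approx p y n" and ?D = "fps_nth (poly (pderiv p) (fps_const y)) 0"
  define c where "c = - fps_nth (poly p ?Y) (Suc n) / ?D"
  define Z where "Z = fps_const c * fps_X ^ Suc n"
  have next_eq: "hensel_approx p y (Suc n) = ?Y + Z" by (simp add: Z_def c_def)
  obtain R where R: "poly p (?Y + Z) = poly p ?Y + Z * poly (pderiv p) ?Y + Z ^ 2 * R"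
    using poly_add_expansion by blast
  have Y0: "fps_nth ?Y 0 = y" using hensel_approx_nth[of 0 0 n p y] by simp
  have D: "fps_nth (poly (pderiv p) ?Y) 0 = ?D" by (simp add: poly_fps_nth_0 Y0)
  have Z2: "fps_nth (Z ^ 2 * R) j = 0" if "j \<le> Suc n" for j
  proof -
    have "Z ^ 2 * R = fps_X ^ (Suc n + Suc n) * (fps_const c * fps_const c * R)"
      unfolding Z_def power2_eq_square power_add by (simp only: mult_ac)
    show ?thesis unfolding \<open>Z ^ 2 * R = _\<close> fps_X_power_mult_nth using that by simp
  qed
  have Z1: "fps_nth (Z * poly (pderiv p) ?Y) j = (if j = Suc n then c * ?D else 0)" if "j \<le> Suc n" for j
  proof -
    have "Z * poly (pderiv p) ?Y = fps_X ^ Suc n * (fps_const c * poly (pderiv p) ?Y)"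
      by (simp add: Z_def mult_ac)
    show ?thesis
      unfolding \<open>Z * poly (pderiv p) ?Y = _\<close> fps_X_power_mult_nth using that D by auto
  qed
  show ?case
  proof (cases "i = Suc n")
    case True
    then show ?thesis using Z1[of i] Z2[of i] simple unfolding next_eq R by (simp add: c_def)
  next
    case False
    then show ?thesis using Z1[of i] Z2[of i] Suc unfolding next_eq R by simp
  qed
qed

lemma hensel_root_exists:
  fixes y :: "'a::field"
  assumes "poly (map_poly (\<lambda>g. fps_nth g 0) p) y = 0" "poly (pderiv (map_poly (\<lambda>g. fps_nth g 0) p)) y \<noteq> 0"
  shows "\<exists>Y. poly p Y = 0 \<and> fps_nth Y 0 = y"
proof -
  define Y where "Y = Abs_fps (\<lambda>n. fps_nth (hensel_approx p y n) n)"
  have "fps_nth (poly p Y) n = 0" for n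
  proof -
    have "fps_nth (poly p Y) n = fps_nth (poly p (hensel_approx p y n)) n"
    proof (rule poly_fps_cong_upto[of n])
      fix i assume "i \<le> n"
      then show "fps_nth Y i = fps_nth (hensel_approx p y n) i"
        using hensel_approx_nth[of i i n p y] by (simp add: Y_def)
    qed simp
    also have "\<dots> = 0"
      by (rule hensel_approx_root) (use assms in \<open>auto simp: poly_fps_nth_0 hom_distribs\<close>)
    finally show ?thesis .
  qed
  then have "poly p Y = 0" by (intro fps_ext) simp
  moreover have "fps_nth Y 0 = y" by (simp add: Y_def)
  ultimately show ?thesis by blast
qed

section \<open>Expansion of bivariate polynomials at a point\<close>

text \<open>The substitution T = t + X: \<open>fps_X\<close> is the local parameter T - t.\<close>

definition tser :: "'k::field alg_closure \<Rightarrow> 'k poly \<Rightarrow> 'k alg_closure fps"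
  where "tser t c = fps_of_poly (pcompose (map_poly to_ac c) [:t, 1:])"

interpretation tser: map_poly_idom_hom "tser t" for t
  by unfold_locales (auto simp: tser_def hom_distribs fps_of_poly_add fps_of_poly_mult)

text \<open>When Y is a power series root of f, this is the expansion of the function a along the
  corresponding branch of the curve.\<close>

definition fev :: "'k::field alg_closure \<Rightarrow> 'k alg_closure fps \<Rightarrow> 'k poly poly \<Rightarrow> 'k alg_closure fps"
  where "fev t Y a = poly (map_poly (tser t) a) Y"

interpretation fev: idom_hom "fev t Y" for t Y
  by unfold_locales (auto simp: fev_def hom_distribs)

lemma fev_pCons [simp]: "fev t Y (pCons c p) = tser t c + Y * fev t Y p"
  by (simp add: fev_def hom_distribs)

lemma tser_nth_0 [simp]: "fps_nth (tser t c) 0 = tev t c"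
proof -
  have "coeff (pcompose (map_poly to_ac c) [:t, 1:]) 0 = poly (pcompose (map_poly to_ac c) [:t, 1:]) 0"
    by (rule poly_0_coeff_0[symmetric])
  also have "\<dots> = tev t c" by (simp add: poly_pcompose tev_def)
  finally show ?thesis by (simp add: tser_def)
qed

lemma fev_nth_0 [simp]: "fps_nth (fev t Y a) 0 = pev t (fps_nth Y 0) a"
  by (induction a) auto

lemma tser_eq_0_iff [simp]: "tser t c = 0 \<longleftrightarrow> c = 0"
  by (simp add: tser_def pcompose_eq_0_iff)

text \<open>A power X^k dividing c(t + X) becomes (T - t)^k dividing c after shifting back.\<close>

lemma subdegree_tser_le_order:
  assumes "c \<noteq> 0"
  shows "subdegree (tser (t :: 'a::field alg_closure) c) \<le> order t (map_poly to_ac c)"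
proof -
  define k where "k = subdegree (tser t c)"
  define P where "P = map_poly to_ac c"
  have "monom 1 k dvd pcompose P [:t, 1:]"
    unfolding monom_1_dvd_iff' k_def P_def
    using nth_less_subdegree_zero[of _ "tser t c"] by (simp add: tser_def)
  then obtain r where r: "pcompose P [:t, 1:] = monom 1 k * r" by (elim dvdE)
  have "P = pcompose (pcompose P [:t, 1:]) [:- t, 1:]"
    by (simp add: pcompose_assoc[symmetric] pcompose_pCons pcompose_idR)
  also have "\<dots> = [:- t, 1:] ^ k * pcompose r [:- t, 1:]"
  proof -
    have "monom 1 k = [:0, 1 :: 'a alg_closure:] ^ k" by (simp add: monom_altdef)
    then have "pcompose (monom 1 k) [:- t, 1:] = [:- t, 1:] ^ k"
      by (simp only: pcompose_hom.hom_power) (simp add: pcompose_pCons)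
    then show ?thesis by (simp add: r pcompose_mult)
  qed
  finally have "[:- t, 1:] ^ k dvd P" by (rule dvdI)
  moreover have "P \<noteq> 0" using assms by (simp add: P_def)
  ultimately show ?thesis by (simp add: order_divides k_def P_def)
qed

section \<open>Norms on an affine curve\<close>

interpretation to_fract: map_poly_inj_idom_hom "to_fract :: 'a::idom \<Rightarrow> _"
  by unfold_locales auto

lemma rsquarefree_iff_simple_roots:
  assumes "p \<noteq> (0 :: 'a::field poly)"
  shows "rsquarefree p \<longleftrightarrow> (\<forall>a. poly p a = 0 \<longrightarrow> poly (pderiv p) a \<noteq> 0)"
proof -
  have "order a p \<le> 1 \<longleftrightarrow> poly (pderiv p) a \<noteq> 0" if root: "poly p a = 0" for a
  proof -
    obtain q where q: "p = [:- a, 1:] * q" using root by (metis poly_eq_0_iff_dvd dvdE)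
    have "poly (pderiv p) a = poly q a" unfolding q pderiv_mult by (simp add: pderiv_pCons)
    moreover have "order a p = Suc (order a q)"
    proof -
      have "order a [:- a, 1:] = 1" using order_power_n_n[of a 1] by simp
      then show ?thesis using order_mult[of "[:- a, 1:]" q a] assms by (simp add: q)
    qed
    moreover have "order a q = 0 \<longleftrightarrow> poly q a \<noteq> 0"
      using assms q order_root[of q a] by auto
    ultimately show ?thesis by simp
  qed
  then have "order a p \<le> 1 \<longleftrightarrow> (poly p a = 0 \<longrightarrow> poly (pderiv p) a \<noteq> 0)" for a
    by (cases "poly p a = 0") (auto simp: order_0I)
  moreover have "order a p = 0 \<or> order a p = 1 \<longleftrightarrow> order a p \<le> 1" for a by auto
  ultimately show ?thesis using assms by (simp add: rsquarefree_def)
qed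

lemma poly_eq_sum_less:
  assumes "degree p < n" shows "poly (p :: 'a::idom poly) x = (\<Sum>i<n. coeff p i * x ^ i)"
  unfolding poly_altdef using assms by (intro sum.mono_neutral_left) (auto simp: coeff_eq_0)

lemma rsquarefree_split:
  fixes p :: "'a::alg_closed_field poly"
  assumes "rsquarefree p"
  shows "p = Polynomial.smult (lead_coeff p) (\<Prod>x | poly p x = 0. [:- x, 1:])"
    and "card {x. poly p x = 0} = degree p"
proof -
  have nz: "p \<noteq> 0" using assms by (simp add: rsquarefree_def)
  obtain A where A: "size A = degree p" "p = Polynomial.smult (lead_coeff p) (\<Prod>x\<in>#A. [:- x, 1:])"
    using alg_closed_imp_factorization[OF nz] by blast
  have le: "count A a \<le> 1" for a
  proof (rule ccontr)
    assume "\<not> count A a \<le> 1"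
    then have "replicate_mset 2 a \<subseteq># A" by (simp add: count_le_replicate_mset_subset_eq[symmetric])
    then obtain B where "A = replicate_mset 2 a + B" by (metis subset_mset.le_iff_add)
    then have "p = [:- a, 1:] ^ 2 * Polynomial.smult (lead_coeff p) (\<Prod>x\<in>#B. [:- x, 1:])"
      by (subst A(2)) (simp add: power2_eq_square)
    then have "2 \<le> order a p" using nz by (metis dvd_triv_left order_divides)
    then show False using assms by (auto simp: rsquarefree_def dest: spec[of _ a])
  qed
  have A_eq: "A = mset_set (set_mset A)"
  proof (rule multiset_eqI)
    fix a show "count A a = count (mset_set (set_mset A)) a"
    proof (cases "a \<in># A")
      case True
      then have "0 < count A a" by simp
      then have "count A a = 1" using le[of a] by linarith
      then show ?thesis using True by simp
    qed (simp add: not_in_iff)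
  qed
  have roots: "{x. poly p x = 0} = set_mset A"
  proof -
    have "poly p x = lead_coeff p * (\<Prod>a\<in>#A. x - a)" for x
      by (subst A(2)) (simp add: poly_prod_mset algebra_simps)
    then show ?thesis using nz by (auto simp: prod_mset_zero_iff)
  qed
  have "(\<Prod>x\<in>#A. [:- x, 1:]) = (\<Prod>x\<in>set_mset A. [:- x, 1:])"
    using A_eq by (metis prod_unfold_prod_mset)
  then show "p = Polynomial.smult (lead_coeff p) (\<Prod>x | poly p x = 0. [:- x, 1:])"
    unfolding roots using A(2) by simp
  have "size A = card (set_mset A)" using A_eq by (metis size_mset_set)
  then show "card {x. poly p x = 0} = degree p"
    unfolding roots using A(1) by simp
qed

lemma subdegree_prod_fps:
  "(\<And>i. i \<in> I \<Longrightarrow> g i \<noteq> 0) \<Longrightarrow> subdegree (\<Prod>i\<in>I. g i) = (\<Sum>i\<in>I. subdegree (g i :: 'a::idom fps))"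
  by (induction I rule: infinite_finite_induct) (auto simp: prod_zero_iff)

text \<open>For a monic divisor the scaling factor of pseudo-division is 1, so ordinary division
  with remainder is available over any domain.\<close>

lemma monic_division:
  fixes f :: "'a::idom poly"
  assumes "lead_coeff f = 1" "0 < degree f"
  obtains r where "f dvd a - r" "\<forall>i\<ge>degree f. coeff r i = 0"
proof -
  obtain q r where qr: "pseudo_divmod a f = (q, r)" by (cases "pseudo_divmod a f")
  have "f \<noteq> 0" using assms by auto
  from pseudo_divmod[OF this qr] have eq: "a = f * q + r" and deg: "r = 0 \<or> degree r < degree f"
    using assms by auto
  have "f dvd a - r" by (simp add: eq)
  moreover have "\<forall>i\<ge>degree f. coeff r i = 0" using deg by (auto simp: coeff_eq_0)
  ultimately show ?thesis by (rule that)
qed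

text \<open>\<Delta> is any nonzero polynomial in T from the ideal generated by f and its
  derivative, given together with its cofactors. It takes the part of the discriminant: where
  \<Delta>(t) is nonzero, the specialised polynomial f(t, _) has only simple roots.\<close>

locale affine_curve =
  fixes f :: "'k::{field,finite} poly poly" and \<Delta> :: "'k poly" and u v :: "'k poly poly"
  assumes monic: "lead_coeff f = 1"
    and irreducible_fract: "Factorial_Ring.irreducible (map_poly to_fract f)"
    and discriminant: "u * f + v * pderiv f = [:\<Delta>:]"
    and discriminant_nz: "\<Delta> \<noteq> 0"
begin

section \<open>The coordinate ring as a free module over the polynomials in T\<close>

abbreviation d where "d \<equiv> degree f"

definition reduced :: "'k poly poly \<Rightarrow> bool"
  where "reduced a \<longleftrightarrow> (\<forall>i\<ge>d. coeff a i = 0)"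

definition height_le :: "nat \<Rightarrow> 'k poly poly \<Rightarrow> bool"
  where "height_le m a \<longleftrightarrow> (\<forall>i. degree (coeff a i) \<le> m)"

definition red :: "'k poly poly \<Rightarrow> 'k poly poly"
  where "red a = (SOME r. f dvd a - r \<and> reduced r)"

lemma degree_pos: "0 < d"
  using irreducible_field_polyD(2)[OF irreducible_fract] by simp

lemma f_nz: "f \<noteq> 0" using degree_pos by auto

lemma red: "f dvd a - red a" "reduced (red a)"
proof -
  obtain r where "f dvd a - r" "\<forall>i\<ge>d. coeff r i = 0"
    by (rule monic_division[OF monic degree_pos])
  then have "f dvd a - r \<and> reduced r" by (simp add: reduced_def)
  then have "f dvd a - red a \<and> reduced (red a)" unfolding red_def by (rule someI)
  then show "f dvd a - red a" "reduced (red a)" by auto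
qed

lemma reduced_iff: "reduced a \<longleftrightarrow> degree a < d"
  unfolding reduced_def using degree_pos
  by (metis coeff_eq_0 degree_0 leading_coeff_0_iff linorder_not_less order.strict_trans2)

lemma reduced_dvd_eq_0: "reduced a \<Longrightarrow> f dvd a \<Longrightarrow> a = 0"
  unfolding reduced_iff by (meson dvd_imp_degree_le leD)

lemma reduced_add [simp]: "reduced a \<Longrightarrow> reduced b \<Longrightarrow> reduced (a + b)"
  and reduced_diff [simp]: "reduced a \<Longrightarrow> reduced b \<Longrightarrow> reduced (a - b)"
  and reduced_smult [simp]: "reduced a \<Longrightarrow> reduced (Polynomial.smult c a)"
  and reduced_0 [simp]: "reduced 0"
  by (auto simp: reduced_def)

lemma reduced_sum [simp]: "(\<And>i. i \<in> I \<Longrightarrow> reduced (g i)) \<Longrightarrow> reduced (sum g I)"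
  by (auto simp: reduced_def coeff_sum)

lemma red_eqI: "f dvd a - r \<Longrightarrow> reduced r \<Longrightarrow> red a = r"
proof -
  assume a: "f dvd a - r" "reduced r"
  have "f dvd (a - r) - (a - red a)" using a(1) red(1) by (rule dvd_diff)
  then have "red a - r = 0" using a red by (intro reduced_dvd_eq_0) (auto simp: algebra_simps)
  then show ?thesis by simp
qed

lemma red_add: "red (a + b) = red a + red b"
proof (rule red_eqI)
  have "a + b - (red a + red b) = (a - red a) + (b - red b)" by simp
  then show "f dvd a + b - (red a + red b)" using red by (metis dvd_add)
qed (use red in auto)

lemma red_smult: "red (Polynomial.smult c a) = Polynomial.smult c (red a)"
proof (rule red_eqI)
  have "Polynomial.smult c a - Polynomial.smult c (red a) = [:c:] * (a - red a)" by (simp add: smult_diff_right)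
  then show "f dvd Polynomial.smult c a - Polynomial.smult c (red a)" using red by (metis dvd_mult)
qed (use red in auto)

lemma red_0 [simp]: "red 0 = 0" by (rule red_eqI) auto

lemma red_sum: "red (sum g I) = (\<Sum>i\<in>I. red (g i))"
  by (induction I rule: infinite_finite_induct) (auto simp: red_add)

lemma red_eq_0_iff: "red a = 0 \<longleftrightarrow> f dvd a"
  using red(1)[of a] red_eqI[of a 0] by auto

text \<open>Gauss's lemma for a monic divisor: division already works over the polynomials, and the
  reduced remainder is too short to be divisible over the fraction field unless it vanishes.\<close>

lemma map_fract_dvd_iff: "map_poly to_fract f dvd map_poly to_fract a \<longleftrightarrow> f dvd a"
proof
  assume *: "map_poly to_fract f dvd map_poly to_fract a"
  have "map_poly to_fract f dvd map_poly to_fract (a - red a)"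
    using red(1)[of a] by (rule to_fract.hom_dvd)
  then have "map_poly to_fract f dvd map_poly to_fract a - map_poly to_fract (a - red a)"
    using * by (rule dvd_diff[rotated])
  then have dvd: "map_poly to_fract f dvd map_poly to_fract (red a)" by (simp add: hom_distribs)
  have "map_poly to_fract (red a) = 0"
  proof (rule ccontr)
    assume "map_poly to_fract (red a) \<noteq> 0"
    then have "degree (map_poly to_fract f) \<le> degree (map_poly to_fract (red a))"
      using dvd by (rule dvd_imp_degree_le[rotated])
    then show False using red(2)[of a] by (simp add: reduced_iff)
  qed
  then show "f dvd a" using red_eq_0_iff by simp
qed (rule to_fract.hom_dvd)

lemma prime_f: "f dvd a * b \<Longrightarrow> f dvd a \<or> f dvd b"
proof -
  assume "f dvd a * b"
  then have "map_poly to_fract f dvd map_poly to_fract (a * b)" by (rule to_fract.hom_dvd)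
  then have "map_poly to_fract f dvd map_poly to_fract a * map_poly to_fract b"
    by (simp add: hom_distribs)
  then show ?thesis
    using prime_elem_dvd_multD[OF field_poly_irreducible_imp_prime[OF irreducible_fract]]
      map_fract_dvd_iff by blast
qed

lemma height_le_add: "height_le m a \<Longrightarrow> height_le m b \<Longrightarrow> height_le m (a + b)"
  by (auto simp: height_le_def degree_add_le)

lemma height_le_diff: "height_le m a \<Longrightarrow> height_le m b \<Longrightarrow> height_le m (a - b)"
  by (auto simp: height_le_def degree_diff_le)

lemma height_le_sum: "(\<And>i. i \<in> I \<Longrightarrow> height_le m (g i)) \<Longrightarrow> height_le m (sum g I)"
  by (induction I rule: infinite_finite_induct) (auto simp: height_le_add, auto simp: height_le_def)

lemma height_le_smult:
  assumes "degree c \<le> m" "height_le n a" shows "height_le (m + n) (Polynomial.smult c a)"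
  unfolding height_le_def coeff_smult
proof
  fix i
  have "degree (c * coeff a i) \<le> degree c + degree (coeff a i)" by (rule degree_mult_le)
  then show "degree (c * coeff a i) \<le> m + n" using assms by (auto simp: height_le_def intro: order.trans add_mono)
qed

lemma height_le_mono: "height_le m a \<Longrightarrow> m \<le> n \<Longrightarrow> height_le n a"
  by (auto simp: height_le_def intro: order.trans)

lemma height_le_mult: "height_le m a \<Longrightarrow> height_le n b \<Longrightarrow> height_le (m + n) (a * b)"
  unfolding height_le_def coeff_mult
  by (auto intro!: degree_sum_le order.trans[OF degree_mult_le] add_mono)

lemma height_le_exists: "\<exists>m. height_le m a"
proof -
  have "degree (coeff a i) \<le> Max ((\<lambda>i. degree (coeff a i)) ` {..degree a})" for i
  proof (cases "i \<le> degree a")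
    case False
    then show ?thesis by (simp add: coeff_eq_0)
  qed (auto intro!: Max_ge)
  then show ?thesis unfolding height_le_def by blast
qed

text \<open>The amount by which reduction modulo f may raise the degree in T. The range up to 2 d
  covers products of two reduced elements.\<close>

definition height_defect :: nat
  where "height_defect = (SOME C. \<forall>k\<le>2*d. height_le C (red (monom 1 k)))"

lemma height_defect: "k \<le> 2 * d \<Longrightarrow> height_le height_defect (red (monom 1 k))"
proof -
  define g where "g k = (SOME m. height_le m (red (monom 1 k)))" for k
  have g: "height_le (g k) (red (monom 1 k))" for k
    unfolding g_def by (rule someI_ex) (rule height_le_exists)
  have "\<forall>k\<le>2*d. height_le (Max (g ` {..2*d})) (red (monom 1 k))"
    using g by (auto intro!: height_le_mono[OF g])
  then have "\<forall>k\<le>2*d. height_le height_defect (red (monom 1 k))"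
    unfolding height_defect_def by (rule someI)
  then show "k \<le> 2 * d \<Longrightarrow> height_le height_defect (red (monom 1 k))" by blast
qed

lemma height_le_red:
  assumes "height_le m a" "degree a \<le> 2 * d"
  shows "height_le (m + height_defect) (red a)"
proof -
  have "a = (\<Sum>k\<le>2*d. Polynomial.smult (coeff a k) (monom 1 k))"
    using poly_as_sum_of_monoms'[OF assms(2)] by (simp add: smult_monom)
  then have "red a = (\<Sum>k\<le>2*d. Polynomial.smult (coeff a k) (red (monom 1 k)))"
    by (metis (no_types, lifting) red_smult red_sum sum.cong)
  also have "height_le (m + height_defect) \<dots>"
    using assms(1) by (intro height_le_sum height_le_smult height_defect) (auto simp: height_le_def)
  finally show ?thesis .
qed

text \<open>Row i holds the coordinates of Y^i a in the basis 1, Y, ..., Y^(d-1), so that the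
  determinant is the norm of a down to the polynomials in T.\<close>

definition mult_mat :: "'k poly poly \<Rightarrow> 'k poly mat"
  where "mult_mat a = mat d d (\<lambda>(i, j). coeff (red (monom 1 i * a)) j)"

definition norm_poly :: "'k poly poly \<Rightarrow> 'k poly"
  where "norm_poly a = Determinant.det (mult_mat a)"

lemma mult_mat_carrier [simp]: "mult_mat a \<in> carrier_mat d d"
  by (simp add: mult_mat_def)

lemma degree_norm_poly_le:
  assumes "reduced a" "height_le m a"
  shows "degree (norm_poly a) \<le> (m + height_defect) * d"
  unfolding norm_poly_def
proof (rule degree_det_le)
  fix i j assume ij: "i < d" "j < d"
  have "height_le 0 (monom 1 i)" by (auto simp: height_le_def)
  then have "height_le m (monom 1 i * a)" using height_le_mult[of 0 _ m a] assms by simp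
  moreover have "degree (monom 1 i * a) \<le> 2 * d"
    using degree_mult_le[of "monom 1 i" a] assms(1) ij by (auto simp: reduced_iff degree_monom_eq)
  ultimately have "height_le (m + height_defect) (red (monom 1 i * a))" by (rule height_le_red)
  then show "degree (mult_mat a $$ (i, j)) \<le> m + height_defect"
    using ij by (simp add: mult_mat_def height_le_def)
qed simp

text \<open>A kernel vector of the transposed matrix is the coordinate vector of a nonzero reduced b
  with b a divisible by f, which contradicts the primality of f.\<close>

lemma norm_poly_nz:
  assumes "\<not> f dvd a" shows "norm_poly a \<noteq> 0"
proof
  assume "norm_poly a = 0"
  then have "Determinant.det (transpose_mat (mult_mat a)) = 0"
    by (simp add: norm_poly_def det_transpose[of _ d])
  then obtain w where w: "w \<in> carrier_vec d" "w \<noteq> 0\<^sub>v d" "transpose_mat (mult_mat a) *\<^sub>v w = 0\<^sub>v d"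
    using det_0_iff_vec_prod_zero[of "transpose_mat (mult_mat a)" d] by auto
  define b where "b = (\<Sum>i<d. Polynomial.smult (w $ i) (monom 1 i))"
  have cb: "coeff b i = w $ i" if "i < d" for i
    using that by (simp add: b_def coeff_sum if_distrib sum.delta cong: if_cong)
  have b0: "reduced b" unfolding b_def by (intro reduced_sum reduced_smult) (auto simp: reduced_def)
  have "b \<noteq> 0"
  proof
    assume "b = 0"
    then have "w = 0\<^sub>v d" using cb w(1) by (intro eq_vecI) auto
    then show False using w(2) by simp
  qed
  have "b * a = (\<Sum>i<d. Polynomial.smult (w $ i) (monom 1 i * a))"
    by (simp add: b_def sum_distrib_right)
  then have redba: "red (b * a) = (\<Sum>i<d. Polynomial.smult (w $ i) (red (monom 1 i * a)))"
    by (simp add: red_sum red_smult)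
  have "coeff (red (b * a)) j = 0" for j
  proof (cases "j < d")
    case True
    have "(transpose_mat (mult_mat a) *\<^sub>v w) $ j = (\<Sum>i<d. w $ i * coeff (red (monom 1 i * a)) j)"
      using True w(1) by (simp add: mult_mat_def scalar_prod_def lessThan_atLeast0 mult.commute)
    then show ?thesis using w(3) True by (simp add: redba coeff_sum)
  qed (use red(2)[of "b * a"] in \<open>auto simp: reduced_def\<close>)
  then have "red (b * a) = 0" by (intro poly_eqI) simp
  then have "f dvd b * a" by (simp only: red_eq_0_iff)
  then show False using prime_f assms reduced_dvd_eq_0[OF b0] \<open>b \<noteq> 0\<close> by blast
qed

section \<open>Points and multiplicities\<close>

definition good :: "'k alg_closure \<Rightarrow> bool"
  where "good t \<longleftrightarrow> tev t \<Delta> \<noteq> 0"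

definition fibre :: "'k alg_closure \<Rightarrow> 'k alg_closure set"
  where "fibre t = {y. pev t y f = 0}"

definition points :: "('k alg_closure \<times> 'k alg_closure) set"
  where "points = {(t, y). good t \<and> y \<in> fibre t}"

lemma degree_map_tev: "degree (map_poly (tev t) f) = d" "map_poly (tev t) f \<noteq> 0"
proof -
  have "coeff (map_poly (tev t) f) d = 1" using monic by simp
  then show *: "map_poly (tev t) f \<noteq> 0" by (metis coeff_0 zero_neq_one)
  show "degree (map_poly (tev t) f) = d"
    using degree_map_poly_le[of "tev t" f] \<open>coeff (map_poly (tev t) f) d = 1\<close>
    by (metis le_antisym le_degree zero_neq_one)
qed

lemma simple_root:
  assumes "good t" "y \<in> fibre t"
  shows "pev t y (pderiv f) \<noteq> 0"
proof
  assume "pev t y (pderiv f) = 0"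
  then have "pev t y (u * f + v * pderiv f) = 0"
    using assms by (simp add: fibre_def hom_distribs)
  then show False using assms by (simp add: discriminant good_def)
qed

lemma finite_fibre: "finite (fibre t)"
  unfolding fibre_def pev_def using poly_roots_finite[OF degree_map_tev(2)] .

lemma card_fibre: "good t \<Longrightarrow> card (fibre t) = d"
proof -
  assume t: "good t"
  have "rsquarefree (map_poly (tev t) f)"
    unfolding rsquarefree_iff_simple_roots[OF degree_map_tev(2)]
    using simple_root[OF t] by (auto simp: fibre_def pev_def hom_distribs)
  then have "card {y. poly (map_poly (tev t) f) y = 0} = d"
    using rsquarefree_split(2)[of "map_poly (tev t) f"] degree_map_tev by auto
  then show ?thesis by (simp add: fibre_def pev_def)
qed

text \<open>The branch of the curve through the point (t, y), parametrised by T - t.\<close>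

definition lift :: "'k alg_closure \<Rightarrow> 'k alg_closure \<Rightarrow> 'k alg_closure fps"
  where "lift t y = (SOME Y. fev t Y f = 0 \<and> fps_nth Y 0 = y)"

lemma lift:
  assumes "good t" "y \<in> fibre t"
  shows "fev t (lift t y) f = 0" "fps_nth (lift t y) 0 = y"
proof -
  have map: "map_poly (\<lambda>g. fps_nth g 0) (map_poly (tser t) a) = map_poly (tev t) a" for a
    by (simp add: map_poly_map_poly o_def)
  have "\<exists>Y. fev t Y f = 0 \<and> fps_nth Y 0 = y"
    unfolding fev_def
  proof (rule hensel_root_exists)
    show "poly (map_poly (\<lambda>g. fps_nth g 0) (map_poly (tser t) f)) y = 0"
      using assms by (simp add: map fibre_def pev_def)
    show "poly (pderiv (map_poly (\<lambda>g. fps_nth g 0) (map_poly (tser t) f))) y \<noteq> 0"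
      using simple_root[OF assms] by (simp add: map pev_def hom_distribs)
  qed
  then have "fev t (lift t y) f = 0 \<and> fps_nth (lift t y) 0 = y"
    unfolding lift_def by (rule someI_ex)
  then show "fev t (lift t y) f = 0" "fps_nth (lift t y) 0 = y" by auto
qed

lemma fev_lift_cong:
  assumes "good t" "y \<in> fibre t" "f dvd a - b"
  shows "fev t (lift t y) a = fev t (lift t y) b"
proof -
  obtain c where "a - b = f * c" using assms(3) by (elim dvdE)
  then have "fev t (lift t y) (a - b) = 0"
    using lift(1)[OF assms(1,2)] by (simp add: hom_distribs)
  then show ?thesis by (simp add: hom_distribs)
qed

lemma pev_cong: "y \<in> fibre t \<Longrightarrow> f dvd a - b \<Longrightarrow> pev t y a = pev t y b"
proof -
  assume *: "y \<in> fibre t" "f dvd a - b"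
  obtain c where "a - b = f * c" using * by (elim dvdE)
  then have "pev t y (a - b) = 0" using * by (simp add: hom_distribs fibre_def)
  then show ?thesis by (simp add: hom_distribs)
qed

lemma fev_reduced: "reduced a \<Longrightarrow> fev t Y a = (\<Sum>j<d. tser t (coeff a j) * Y ^ j)"
proof -
  assume "reduced a"
  then have "degree (map_poly (tser t) a) < d"
    using degree_map_poly_le[of "tser t" a] by (auto simp: reduced_iff intro: le_less_trans)
  then show ?thesis
    unfolding fev_def by (simp add: poly_eq_sum_less)
qed

text \<open>A norm is a product of conjugates, here of the expansions along the d branches above t.
  The Vandermonde matrix V of the branches diagonalises multiplication by a: M V = V D.\<close>

lemma tser_norm_poly:
  assumes "good t"
  shows "tser t (norm_poly a) = (\<Prod>y\<in>fibre t. fev t (lift t y) a)"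
proof -
  obtain ys where ys: "set ys = fibre t" "distinct ys" using finite_distinct_list[OF finite_fibre] by blast
  have len: "length ys = d" using ys card_fibre[OF assms] distinct_card by fastforce
  define Y where "Y k = lift t (ys ! k)" for k
  have mem: "ys ! k \<in> fibre t" if "k < d" for k using that len ys by (metis nth_mem)
  have Yinj: "Y k = Y l \<longleftrightarrow> k = l" if "k < d" "l < d" for k l
    using lift(2)[OF assms mem] that ys len unfolding Y_def by (metis nth_eq_iff_index_eq)
  define V where "V = mat d d (\<lambda>(i, k). Y k ^ i)"
  define D where "D = mat d d (\<lambda>(i, k). if i = k then fev t (Y k) a else 0)"
  define M where "M = map_mat (tser t) (mult_mat a)"
  have carr: "V \<in> carrier_mat d d" "D \<in> carrier_mat d d" "M \<in> carrier_mat d d"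
    by (simp_all add: V_def D_def M_def mult_mat_def)
  have "M * V = V * D"
  proof (rule eq_matI)
    fix i k assume "i < dim_row (V * D)" "k < dim_col (V * D)"
    then have ik: "i < d" "k < d" using carr by auto
    have "(M * V) $$ (i, k) = (\<Sum>j<d. tser t (coeff (red (monom 1 i * a)) j) * Y k ^ j)"
      using ik by (simp add: M_def V_def mult_mat_def scalar_prod_def lessThan_atLeast0)
    also have "\<dots> = fev t (Y k) (red (monom 1 i * a))" by (rule fev_reduced[OF red(2), symmetric])
    also have "\<dots> = fev t (Y k) (monom 1 i * a)"
      unfolding Y_def by (rule fev_lift_cong[OF assms mem[OF ik(2)] red(1), symmetric])
    also have "\<dots> = Y k ^ i * fev t (Y k) a"
      by (simp add: hom_distribs) (simp add: fev_def map_poly_monom poly_monom)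
    also have "\<dots> = (V * D) $$ (i, k)"
      using ik by (simp add: V_def D_def scalar_prod_def if_distrib sum.delta cong: if_cong)
    finally show "(M * V) $$ (i, k) = (V * D) $$ (i, k)" .
  qed (use carr in auto)
  then have "Determinant.det M * Determinant.det V = Determinant.det V * Determinant.det D"
    using det_mult carr by metis
  \<comment> \<open>A kernel vector of the transposed V would be a nonzero polynomial of degree
    below d with the d distinct branches as roots.\<close>
  moreover have "Determinant.det V \<noteq> 0"
  proof
    assume "Determinant.det V = 0"
    then have "Determinant.det (transpose_mat V) = 0" using carr by (simp add: det_transpose[of _ d])
    then obtain w where w: "w \<in> carrier_vec d" "w \<noteq> 0\<^sub>v d" "transpose_mat V *\<^sub>v w = 0\<^sub>v d"
      using det_0_iff_vec_prod_zero[of "transpose_mat V" d] carr by auto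
    define b where "b = (\<Sum>i<d. monom (w $ i) i)"
    have cb: "coeff b i = (if i < d then w $ i else 0)" for i
      by (simp add: b_def coeff_sum if_distrib sum.delta cong: if_cong)
    have "b \<noteq> 0"
    proof
      assume "b = 0"
      then have "w $ i = 0" if "i < d" for i using cb[of i] that by simp
      then have "w = 0\<^sub>v d" using w(1) by (intro eq_vecI) auto
      then show False using w(2) by simp
    qed
    have root: "poly b (Y k) = 0" if "k < d" for k
    proof -
      have "(transpose_mat V *\<^sub>v w) $ k = (\<Sum>i<d. Y k ^ i * w $ i)"
        using that w(1) by (simp add: V_def scalar_prod_def lessThan_atLeast0)
      then show ?thesis using w(3) that by (simp add: b_def poly_sum poly_monom mult.commute)
    qed
    have "card (Y ` {..<d}) = d" using Yinj by (subst card_image) (auto simp: inj_on_def)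
    moreover have "card (Y ` {..<d}) \<le> card {x. poly b x = 0}"
      using root poly_roots_finite[OF \<open>b \<noteq> 0\<close>] by (intro card_mono) auto
    moreover have "card {x. poly b x = 0} \<le> degree b" by (rule card_poly_roots_bound[OF \<open>b \<noteq> 0\<close>])
    moreover have "degree b < d"
      using degree_pos cb \<open>b \<noteq> 0\<close> by (metis leading_coeff_0_iff)
    ultimately show False by simp
  qed
  ultimately have "Determinant.det M = Determinant.det D" by (simp add: mult.commute)
  also have "\<dots> = prod_list (diag_mat D)"
    using carr by (intro det_upper_triangular[of _ d]) (auto simp: D_def)
  also have "\<dots> = (\<Prod>k<d. fev t (Y k) a)"
    using carr by (simp add: diag_mat_def prod.list_conv_set_nth D_def lessThan_atLeast0)
  also have "\<dots> = (\<Prod>y\<in>fibre t. fev t (lift t y) a)"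
    unfolding Y_def
    by (rule prod.reindex_bij_betw) (use bij_betw_nth[OF ys(2) _ ys(1)[symmetric]] len in auto)
  finally show ?thesis
    unfolding norm_poly_def M_def by (subst (asm) tser.base.hom_det) 
qed

definition val :: "'k poly poly \<Rightarrow> 'k alg_closure \<times> 'k alg_closure \<Rightarrow> nat"
  where "val a P = subdegree (fev (fst P) (lift (fst P) (snd P)) a)"

lemma fev_lift_nz:
  assumes "good t" "y \<in> fibre t" "\<not> f dvd a"
  shows "fev t (lift t y) a \<noteq> 0"
proof
  assume "fev t (lift t y) a = 0"
  then have "tser t (norm_poly a) = 0"
    unfolding tser_norm_poly[OF assms(1)] using assms(2) finite_fibre by (auto simp: prod_zero_iff)
  then show False using norm_poly_nz[OF assms(3)] by simp
qed

lemma val_pos_iff: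
  assumes "P \<in> points" "\<not> f dvd a"
  shows "0 < val a P \<longleftrightarrow> pev (fst P) (snd P) a = 0"
proof -
  obtain t y where P: "P = (t, y)" by (cases P)
  have "good t" "y \<in> fibre t" using assms(1) by (auto simp: points_def P)
  with fev_lift_nz[OF this assms(2)] lift[OF this] show ?thesis
    by (auto simp: val_def P subdegree_eq_0_iff simp flip: neq0_conv)
qed

text \<open>Over one good t the orders of vanishing add up to that of the norm at t, and the zeros
  of the norm are bounded by its degree. This replaces the statement that a function has as many
  zeros as poles.\<close>

lemma sum_val_le:
  assumes "a \<noteq> 0" "reduced a" "height_le m a" "finite S" "S \<subseteq> points"
  shows "(\<Sum>P\<in>S. val a P) \<le> (m + height_defect) * d"
proof -
  have nd: "\<not> f dvd a" using assms(1,2) reduced_dvd_eq_0 by blast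
  define N where "N = map_poly to_ac (norm_poly a)"
  have N: "N \<noteq> 0" using norm_poly_nz[OF nd] by (simp add: N_def)
  let ?T = "fst ` S"
  have good: "good t" if "t \<in> ?T" for t using that assms(5) by (auto simp: points_def)
  have "(\<Sum>P\<in>S. val a P) \<le> (\<Sum>P\<in>Sigma ?T fibre. val a P)"
    using assms(4,5) finite_fibre by (intro sum_mono2) (force simp: points_def)+
  also have "\<dots> = (\<Sum>t\<in>?T. \<Sum>y\<in>fibre t. val a (t, y))"
    using assms(4) finite_fibre by (subst sum.Sigma) auto
  also have "\<dots> \<le> (\<Sum>t\<in>?T. order t N)"
  proof (rule sum_mono)
    fix t assume t: "t \<in> ?T"
    have "(\<Sum>y\<in>fibre t. val a (t, y)) = subdegree (\<Prod>y\<in>fibre t. fev t (lift t y) a)"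
      using fev_lift_nz[OF good[OF t] _ nd] finite_fibre
      by (subst subdegree_prod_fps) (auto simp: val_def)
    also have "\<dots> \<le> order t N"
      unfolding N_def tser_norm_poly[OF good[OF t], symmetric]
      by (rule subdegree_tser_le_order[OF norm_poly_nz[OF nd]])
    finally show "(\<Sum>y\<in>fibre t. val a (t, y)) \<le> order t N" .
  qed
  also have "\<dots> = (\<Sum>t\<in>?T \<inter> {t. poly N t = 0}. order t N)"
    using assms(4) by (intro sum.mono_neutral_right) (auto simp: order_0I)
  also have "\<dots> \<le> (\<Sum>t | poly N t = 0. order t N)"
    using poly_roots_finite[OF N] by (intro sum_mono2) auto
  also have "\<dots> \<le> degree N" by (rule order_sum_degree[OF N])
  also have "\<dots> \<le> (m + height_defect) * d"
    using degree_norm_poly_le[OF assms(2,3)] by (simp add: N_def)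
  finally show ?thesis .
qed

end

section \<open>Orbits\<close>

definition orb :: "('a \<Rightarrow> 'a) \<Rightarrow> 'a \<Rightarrow> 'a set"
  where "orb F x = range (\<lambda>i. (F ^^ i) x)"

definition periodic :: "('a \<Rightarrow> 'a) \<Rightarrow> 'a \<Rightarrow> bool"
  where "periodic F x \<longleftrightarrow> (\<exists>m>0. (F ^^ m) x = x)"

lemma self_in_orb [simp]: "x \<in> orb F x"
  unfolding orb_def by (rule range_eqI[of _ _ 0]) simp

lemma orb_funpow: "(F ^^ i) x \<in> orb F x"
  by (auto simp: orb_def)

lemma
  assumes "periodic F x"
  shows finite_orb: "finite (orb F x)"
    and card_orb_pos: "0 < card (orb F x)"
    and funpow_eq_iff_card_orb_dvd: "(F ^^ m) x = x \<longleftrightarrow> card (orb F x) dvd m"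
    and bij_betw_funpow_orb: "bij_betw (\<lambda>i. (F ^^ i) x) {..<card (orb F x)} (orb F x)"
proof -
  define n where "n = (LEAST m. 0 < m \<and> (F ^^ m) x = x)"
  have n: "0 < n \<and> (F ^^ n) x = x"
    unfolding n_def using assms LeastI_ex[of "\<lambda>m. 0 < m \<and> (F ^^ m) x = x"] by (auto simp: periodic_def)
  have least: "n \<le> m" if "0 < m" "(F ^^ m) x = x" for m
    unfolding n_def using that by (intro Least_le) auto
  have mod_eq: "(F ^^ (m mod n)) x = (F ^^ m) x" for m using n funpow_mod_eq by metis
  have dvd_iff: "(F ^^ m) x = x \<longleftrightarrow> n dvd m" for m
  proof
    assume "(F ^^ m) x = x"
    then have "(F ^^ (m mod n)) x = x" by (simp add: mod_eq)
    then have "\<not> 0 < m mod n" using least[of "m mod n"] n by (metis mod_less_divisor not_less)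
    then show "n dvd m" by auto
  next
    assume "n dvd m"
    then have "m mod n = 0" by simp
    then show "(F ^^ m) x = x" using mod_eq[of m] by simp
  qed
  have orb_eq: "orb F x = (\<lambda>i. (F ^^ i) x) ` {..<n}"
  proof (intro equalityI subsetI)
    fix y assume "y \<in> orb F x"
    then obtain m where "y = (F ^^ (m mod n)) x" using mod_eq by (auto simp: orb_def)
    then show "y \<in> (\<lambda>i. (F ^^ i) x) ` {..<n}" using n by auto
  qed (auto simp: orb_def)
  have inj: "inj_on (\<lambda>i. (F ^^ i) x) {..<n}"
  proof (rule linorder_inj_onI')
    fix i j assume ij: "i \<in> {..<n}" "j \<in> {..<n}" "i < j"
    show "(F ^^ i) x \<noteq> (F ^^ j) x"
    proof
      assume "(F ^^ i) x = (F ^^ j) x"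
      then have "(F ^^ (n - j)) ((F ^^ i) x) = (F ^^ (n - j)) ((F ^^ j) x)" by simp
      then have "(F ^^ (n - j + i)) x = (F ^^ (n - j + j)) x" by (simp add: funpow_add)
      also have "\<dots> = x" using ij n by simp
      finally have "n dvd n - j + i" by (simp add: dvd_iff)
      then show False using ij by (auto dest!: dvd_imp_le)
    qed
  qed
  have card: "card (orb F x) = n" unfolding orb_eq using inj by (simp add: card_image)
  show "finite (orb F x)" by (simp add: orb_eq)
  show "0 < card (orb F x)" using card n by simp
  show "(F ^^ m) x = x \<longleftrightarrow> card (orb F x) dvd m" by (simp add: card dvd_iff)
  show "bij_betw (\<lambda>i. (F ^^ i) x) {..<card (orb F x)} (orb F x)"
    unfolding card using inj orb_eq by (simp add: bij_betw_def)
qed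

lemma orb_eq_of_mem:
  assumes "periodic F x" "y \<in> orb F x"
  shows "periodic F y" "orb F y = orb F x"
proof -
  obtain i where i: "y = (F ^^ i) x" using assms(2) by (auto simp: orb_def)
  obtain m where m: "0 < m" "(F ^^ m) x = x" using assms(1) by (auto simp: periodic_def)
  have "(F ^^ m) y = (F ^^ i) ((F ^^ m) x)"
    unfolding i using funpow_add[of m i F] funpow_add[of i m F] by (simp add: add.commute fun_eq_iff)
  then show "periodic F y" using m i by (auto simp: periodic_def)
  have "(F ^^ j) y = (F ^^ (j + i)) x" for j by (simp add: i funpow_add)
  then have 1: "orb F y \<subseteq> orb F x" by (auto simp: orb_def)
  have "x = (F ^^ (m * i - i)) y"
  proof -
    have "(F ^^ (m * i)) x = x" using funpow_mod_eq[OF m(2), of "m * i"] by simp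
    moreover have "m * i = m * i - i + i" using m by (cases m) auto
    ultimately have "(F ^^ (m * i - i + i)) x = x" by simp
    then show ?thesis unfolding i funpow_add comp_apply by (rule sym)
  qed
  then obtain l where l: "x = (F ^^ l) y" by blast
  have "(F ^^ j) x = (F ^^ (j + l)) y" for j by (simp add: funpow_add l[symmetric])
  then have "orb F x \<subseteq> orb F y" by (auto simp: orb_def)
  with 1 show "orb F y = orb F x" by simp
qed

text \<open>The q-power Frobenius on geometric points of the plane.\<close>

definition frob2 :: "'k::{field,finite} alg_closure \<times> 'k alg_closure \<Rightarrow> 'k alg_closure \<times> 'k alg_closure"
  where "frob2 P = (fst P ^ CARD('k), snd P ^ CARD('k))"

lemma frob2_funpow: "(frob2 ^^ i) P = (fst P ^ CARD('k) ^ i, snd (P :: _ \<times> 'k::{field,finite} alg_closure) ^ CARD('k) ^ i)"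
  by (induction i) (auto simp: frob2_def power_mult[symmetric] mult.commute)

lemma exists_frobenius_period: "\<exists>m>0. (t :: 'k::{field,finite} alg_closure) ^ CARD('k) ^ m = t"
proof -
  obtain p where p: "Factorial_Ring.irreducible p" "lead_coeff p = 1" "tev t p = 0"
    by (rule exists_minimal_poly)
  then have "p \<in> prime_polys" by (simp add: prime_polys_def)
  then have "t ^ CARD('k) ^ degree p = t" using p frobenius_fixes_root by blast
  then show ?thesis using irreducible_field_polyD(2)[OF p(1)] by blast
qed

lemma power_power_fixed: "(t :: 'a::monoid_mult) ^ Q = t \<Longrightarrow> t ^ Q ^ j = t"
  by (induction j) (auto simp: power_mult)

lemma periodic_frob2: "periodic frob2 (P :: 'k::{field,finite} alg_closure \<times> _)"
proof -
  obtain m where m: "0 < m" "fst P ^ CARD('k) ^ m = fst P"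
    using exists_frobenius_period[of "fst P"] by blast
  obtain n where n: "0 < n" "snd P ^ CARD('k) ^ n = snd P"
    using exists_frobenius_period[of "snd P"] by blast
  note mn = m n
  have "fst P ^ CARD('k) ^ (m * n) = fst P" "snd P ^ CARD('k) ^ (m * n) = snd P"
    using power_power_fixed[OF mn(2), of n] power_power_fixed[OF mn(4), of m]
    by (simp_all add: power_mult) (simp add: power_mult[symmetric] mult.commute)
  then show ?thesis using mn unfolding periodic_def
    by (intro exI[of _ "m * n"]) (auto simp: frob2_funpow prod_eq_iff)
qed

section \<open>Clearing denominators\<close>

lemma exists_clear_denominator:
  fixes b :: "'a::idom fract poly"
  obtains c b' where "c \<noteq> 0" "Polynomial.smult (to_fract c) b = map_poly to_fract b'"
proof (induction b arbitrary: thesis)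
  case 0
  show ?case by (rule 0[of 1 0]) auto
next
  case (pCons a b)
  obtain c b' where c: "c \<noteq> 0" "Polynomial.smult (to_fract c) b = map_poly to_fract b'"
    by (rule pCons.IH)
  obtain x y where a: "a = to_fract x / to_fract y" "y \<noteq> 0"
    by (cases a) (auto simp: Fract_conv_to_fract)
  show ?case
  proof (rule pCons.prems[of "c * y" "pCons (c * x) (Polynomial.smult y b')"])
    show "Polynomial.smult (to_fract (c * y)) (pCons a b) =
        map_poly to_fract (pCons (c * x) (Polynomial.smult y b'))"
      using a by (simp add: hom_distribs c(2)[symmetric] mult.commute)
  qed (use c a in auto)
qed

lemma bezout_over_fract:
  fixes f a :: "'a::idom poly"
  assumes "Factorial_Ring.irreducible (map_poly to_fract f)" "\<not> map_poly to_fract f dvd map_poly to_fract a"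
  obtains u v c where "c \<noteq> 0" "u * f + v * a = [:c:]"
proof -
  obtain \<alpha> \<beta> where ab: "\<alpha> * map_poly to_fract f + \<beta> * map_poly to_fract a = 1"
    using irreducible_bezout[OF assms] .
  obtain c1 u where u: "c1 \<noteq> 0" "Polynomial.smult (to_fract c1) \<alpha> = map_poly to_fract u"
    by (rule exists_clear_denominator)
  obtain c2 v where v: "c2 \<noteq> 0" "Polynomial.smult (to_fract c2) \<beta> = map_poly to_fract v"
    by (rule exists_clear_denominator)
  have "map_poly to_fract ([:c2:] * u * f + [:c1:] * v * a)
      = [:to_fract c2:] * Polynomial.smult (to_fract c1) \<alpha> * map_poly to_fract f
        + [:to_fract c1:] * Polynomial.smult (to_fract c2) \<beta> * map_poly to_fract a"
    by (simp add: hom_distribs u v)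
  also have "\<dots> = Polynomial.smult (to_fract (c1 * c2)) (\<alpha> * map_poly to_fract f + \<beta> * map_poly to_fract a)"
    by (simp add: hom_distribs smult_add_right mult.commute)
  also have "\<dots> = map_poly to_fract [:c1 * c2:]" by (simp add: ab hom_distribs)
  finally have "[:c2:] * u * f + [:c1:] * v * a = [:c1 * c2:]"
    by (rule to_fract.injectivity)
  then show ?thesis using u(1) v(1) by (intro that[of "c1 * c2" "[:c2:] * u" "[:c1:] * v"]) auto
qed

section \<open>Places of an affine curve\<close>

context affine_curve
begin

text \<open>These are the closed points of the curve away from \<Delta> = 0; the cardinality of an
  orbit is the degree of its residue field over F_q.\<close>

definition orbits :: "('k alg_closure \<times> 'k alg_closure) set set"
  where "orbits = orb frob2 ` points"

lemma points_iff: "P \<in> points \<longleftrightarrow> tev (fst P) \<Delta> \<noteq> 0 \<and> pev (fst P) (snd P) f = 0"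
  by (cases P) (simp add: points_def fibre_def good_def)

lemma points_frobenius: "P \<in> points \<Longrightarrow> (frob2 ^^ i) P \<in> points"
  unfolding points_iff frob2_funpow by (simp add: tev_frobenius pev_frobenius)

lemma orbitsD:
  assumes "O' \<in> orbits" "P \<in> O'"
  shows "P \<in> points" "O' = orb frob2 P"
proof -
  obtain P' where P': "P' \<in> points" "O' = orb frob2 P'" using assms(1) by (auto simp: orbits_def)
  have "P \<in> orb frob2 P'" using P' assms(2) by simp
  then show "O' = orb frob2 P" unfolding P'(2) by (rule orb_eq_of_mem(2)[OF periodic_frob2, symmetric])
  obtain i where "P = (frob2 ^^ i) P'" using assms(2) P'(2) by (auto simp: orb_def)
  then show "P \<in> points" using points_frobenius[OF P'(1)] by simp
qed

lemma finite_orbit [simp]: "O' \<in> orbits \<Longrightarrow> finite O'"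
  by (auto simp: orbits_def finite_orb periodic_frob2)

lemma orbit_nonempty: "O' \<in> orbits \<Longrightarrow> O' \<noteq> {}"
proof -
  assume "O' \<in> orbits"
  then obtain P where "O' = orb frob2 P" by (auto simp: orbits_def)
  then show ?thesis using self_in_orb[of P frob2] by blast
qed

lemma card_orbit_pos: "O' \<in> orbits \<Longrightarrow> 0 < card O'"
  by (auto simp: orbits_def card_orb_pos periodic_frob2)

lemma orbits_disjoint:
  assumes "O1 \<in> orbits" "O2 \<in> orbits" "O1 \<noteq> O2" shows "O1 \<inter> O2 = {}"
proof (rule ccontr)
  assume "O1 \<inter> O2 \<noteq> {}"
  then obtain P where "P \<in> O1" "P \<in> O2" by blast
  then have "O1 = orb frob2 P" "O2 = orb frob2 P" using orbitsD(2) assms by blast+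
  then show False using assms by simp
qed

lemma vanish_orbit:
  assumes "O' \<in> orbits" "P \<in> O'" "P' \<in> O'" "pev (fst P) (snd P) a = 0"
  shows "pev (fst P') (snd P') a = 0"
proof -
  have "P' \<in> orb frob2 P" using orbitsD(2)[OF assms(1,2)] assms(3) by simp
  then obtain i where "P' = (frob2 ^^ i) P" by (auto simp: orb_def)
  then show ?thesis using assms(4) by (simp add: frob2_funpow pev_frobenius)
qed

lemma orbit_coordinates:
  assumes "O' \<in> orbits" "P \<in> O'"
  shows "fst P ^ CARD('k) ^ card O' = fst P" "snd P ^ CARD('k) ^ card O' = snd P"
proof -
  have "(frob2 ^^ card O') P = P"
    using funpow_eq_iff_card_orb_dvd[OF periodic_frob2, of "card O'" P] orbitsD(2)[OF assms, symmetric]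
    by simp
  then show "fst P ^ CARD('k) ^ card O' = fst P" "snd P ^ CARD('k) ^ card O' = snd P"
    by (auto simp: frob2_funpow prod_eq_iff)
qed

lemma card_power_gt_1: "0 < n \<Longrightarrow> 1 < CARD('k) ^ n"
  by (rule one_less_power[OF finite_field_card_gt_1])

lemma finite_orbits_card_le: "finite {O' \<in> orbits. card O' \<le> n}"
proof -
  let ?X = "\<Union>e\<in>{1..n}. {x :: 'k alg_closure. x ^ CARD('k) ^ e = x}"
  have "P \<in> ?X \<times> ?X" if O': "O' \<in> orbits" "card O' \<le> n" "P \<in> O'" for O' P
  proof -
    have "card O' \<in> {1..n}" using O' card_orbit_pos[OF O'(1)] by auto
    then have "fst P \<in> ?X" "snd P \<in> ?X"
      by (rule UN_I, simp only: mem_Collect_eq orbit_coordinates[OF O'(1,3)])+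
    then show ?thesis by (cases P) simp
  qed
  then have "{O' \<in> orbits. card O' \<le> n} \<subseteq> Pow (?X \<times> ?X)" by blast
  moreover have fin: "finite ?X"
    by (intro finite_UN_I card_power_fixed_le(1) card_power_gt_1) auto
  ultimately show ?thesis
    using finite_subset finite_Pow_iff[THEN iffD2, OF finite_cartesian_product[OF fin fin]] by blast
qed

section \<open>Zeros of functions, and the upper bound for sets of places\<close>

definition wt :: "('k alg_closure \<times> 'k alg_closure) set set \<Rightarrow> nat"
  where "wt E = (\<Sum>O'\<in>E. card O')"

text \<open>The multiplicity of a at a place. Taking the minimum makes it a function of the orbit
  without a proof that \<open>val a\<close> is constant on the orbit.\<close>

definition mult :: "'k poly poly \<Rightarrow> ('k alg_closure \<times> 'k alg_closure) set \<Rightarrow> nat"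
  where "mult a O' = Min (val a ` O')"

lemma mult_le: "O' \<in> orbits \<Longrightarrow> P \<in> O' \<Longrightarrow> mult a O' \<le> val a P"
  by (simp add: mult_def)

lemma mult_attained:
  assumes "O' \<in> orbits" obtains P where "P \<in> O'" "val a P = mult a O'"
proof -
  have "Min (val a ` O') \<in> val a ` O'"
    using assms orbit_nonempty by (intro Min_in) auto
  then show ?thesis using that by (auto simp: mult_def)
qed

lemma sum_mult_le:
  assumes "a \<noteq> 0" "reduced a" "height_le m a" "finite E" "E \<subseteq> orbits"
  shows "(\<Sum>O'\<in>E. card O' * mult a O') \<le> (m + height_defect) * d"
proof -
  have "(\<Sum>O'\<in>E. card O' * mult a O') \<le> (\<Sum>O'\<in>E. \<Sum>P\<in>O'. val a P)"
  proof (rule sum_mono)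
    fix O' assume "O' \<in> E"
    then have "O' \<in> orbits" using assms(5) by auto
    then show "card O' * mult a O' \<le> (\<Sum>P\<in>O'. val a P)"
      using sum_bounded_below[of O' "mult a O'" "val a"] mult_le by simp
  qed
  also have "\<dots> = (\<Sum>P\<in>\<Union>E. val a P)"
  proof -
    have "sum (val a) (\<Union>E) = (sum \<circ> sum) (val a) E"
      using assms(5) orbits_disjoint by (intro sum.Union_disjoint) auto
    then show ?thesis by simp
  qed
  also have "\<dots> \<le> (m + height_defect) * d"
    using assms(4,5) orbitsD(1) by (intro sum_val_le assms(1-3) finite_Union) auto
  finally show ?thesis .
qed

definition zeros :: "'k poly poly \<Rightarrow> ('k alg_closure \<times> 'k alg_closure) set set"
  where "zeros a = {O' \<in> orbits. \<forall>P\<in>O'. pev (fst P) (snd P) a = 0}"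

lemma wt_zeros_le:
  assumes "a \<noteq> 0" "reduced a" "height_le m a"
  shows "finite (zeros a)" "wt (zeros a) \<le> (m + height_defect) * d"
proof -
  have nd: "\<not> f dvd a" using assms(1,2) reduced_dvd_eq_0 by blast
  have le: "wt E \<le> (m + height_defect) * d" if E: "finite E" "E \<subseteq> zeros a" for E
  proof -
    have "wt E \<le> (\<Sum>O'\<in>E. card O' * mult a O')"
      unfolding wt_def
    proof (rule sum_mono)
      fix O' assume "O' \<in> E"
      then have O': "O' \<in> orbits" "\<forall>P\<in>O'. pev (fst P) (snd P) a = 0" using E by (auto simp: zeros_def)
      obtain P where P: "P \<in> O'" "val a P = mult a O'" using mult_attained[OF O'(1)] .
      have "0 < mult a O'" using val_pos_iff[OF orbitsD(1)[OF O'(1) P(1)] nd] O' P by auto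
      then show "card O' \<le> card O' * mult a O'" by simp
    qed
    also have "\<dots> \<le> (m + height_defect) * d"
      using E by (intro sum_mult_le assms) (auto simp: zeros_def)
    finally show ?thesis .
  qed
  have card_le: "card E \<le> wt E" if "finite E" "E \<subseteq> zeros a" for E
  proof -
    have "(\<Sum>O'\<in>E. 1) \<le> (\<Sum>O'\<in>E. card O')"
      using that card_orbit_pos by (intro sum_mono) (auto simp: zeros_def Suc_le_eq)
    then show ?thesis by (simp add: wt_def)
  qed
  show "finite (zeros a)"
  proof (rule ccontr)
    assume "infinite (zeros a)"
    then obtain E where "E \<subseteq> zeros a" "finite E" "card E = Suc ((m + height_defect) * d)"
      using infinite_arbitrarily_large by blast
    then show False using le[of E] card_le[of E] by simp
  qed
  then show "wt (zeros a) \<le> (m + height_defect) * d" using le by simp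
qed

text \<open>The boxes take the part of Riemann-Roch spaces of multiples of the poles at infinity;
  their size is explicit.\<close>

definition box :: "nat \<Rightarrow> 'k poly poly set"
  where "box m = {a. reduced a \<and> height_le m a}"

lemma card_box: "finite (box m)" "card (box m) = CARD('k) ^ (Suc m * d)"
proof -
  let ?B = "{c :: 'k poly. \<forall>i\<ge>Suc m. coeff c i = 0}"
  have deg: "degree c \<le> m \<longleftrightarrow> c \<in> ?B" for c :: "'k poly"
  proof
    assume *: "c \<in> ?B"
    show "degree c \<le> m"
      by (rule degree_le) (use * in auto)
  qed (auto simp: coeff_eq_0)
  have "box m = {p. (\<forall>i\<ge>d. coeff p i = 0) \<and> (\<forall>i. coeff p i \<in> ?B)}"
    unfolding box_def reduced_def height_le_def deg ..
  then show "finite (box m)" "card (box m) = CARD('k) ^ (Suc m * d)"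
    using card_polys_coeffs_in[of ?B d] card_polys_degree_less[of "Suc m", where 'a='k]
    by (auto simp: power_mult simp del: power_Suc mult_Suc)
qed

text \<open>The value of a function at a representative of an orbit O' lies in a set of at most
  q^(card O') elements. Hence a box with more than q^(wt E) elements contains two functions that
  agree on all of E; their difference is the required one.\<close>

lemma exists_vanishing:
  assumes "finite E" "E \<subseteq> orbits" "wt E < Suc m * d"
  shows "\<exists>a\<in>box m. a \<noteq> 0 \<and> E \<subseteq> zeros a"
proof -
  define rep where "rep O' = (SOME P. P \<in> O')" for O' :: "('k alg_closure \<times> 'k alg_closure) set"
  have rep: "rep O' \<in> O'" if "O' \<in> E" for O'
  proof -
    have "\<exists>P. P \<in> O'" using that assms(2) orbit_nonempty by blast
    then show ?thesis unfolding rep_def by (rule someI_ex)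
  qed
  let ?X = "\<lambda>O'. {c :: 'k alg_closure. c ^ CARD('k) ^ card O' = c}"
  define ev where "ev a = (\<lambda>O'\<in>E. pev (fst (rep O')) (snd (rep O')) a)" for a
  have finX: "finite (?X O')" "card (?X O') \<le> CARD('k) ^ card O'" if "O' \<in> E" for O'
    using card_power_fixed_le[OF card_power_gt_1] that card_orbit_pos assms(2) by blast+
  have sub: "ev ` box m \<subseteq> PiE E ?X"
  proof clarify
    fix a
    show "ev a \<in> PiE E ?X"
      unfolding ev_def
    proof (rule restrict_PiE_iff[THEN iffD2], clarify)
      fix O' assume O': "O' \<in> E"
      have "O' \<in> orbits" using O' assms(2) by auto
      note c = orbit_coordinates[OF this rep[OF O']]
      show "pev (fst (rep O')) (snd (rep O')) a ^ CARD('k) ^ card O' = pev (fst (rep O')) (snd (rep O')) a"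
        using pev_frobenius[of "fst (rep O')" "card O'" "snd (rep O')" a] unfolding c by simp
    qed
  qed
  have "card (ev ` box m) \<le> card (PiE E ?X)"
    using sub finX assms(1) by (intro card_mono finite_PiE) auto
  also have "\<dots> = (\<Prod>O'\<in>E. card (?X O'))" using assms(1) by (rule card_PiE)
  also have "\<dots> \<le> (\<Prod>O'\<in>E. CARD('k) ^ card O')" using finX by (intro prod_mono) auto
  also have "\<dots> = CARD('k) ^ wt E" by (simp add: wt_def power_sum)
  also have "\<dots> < CARD('k) ^ (Suc m * d)"
    using assms(3) finite_field_card_gt_1 by (rule power_strict_increasing)
  finally have "card (ev ` box m) < card (box m)" by (simp add: card_box)
  then have "\<not> inj_on ev (box m)" by (metis card_image less_irrefl)
  then obtain a b where ab: "a \<in> box m" "b \<in> box m" "a \<noteq> b" "ev a = ev b" by (auto simp: inj_on_def)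
  have "a - b \<in> box m" using ab by (auto simp: box_def height_le_diff)
  moreover have "E \<subseteq> zeros (a - b)"
  proof
    fix O' assume O': "O' \<in> E"
    have "pev (fst (rep O')) (snd (rep O')) a = pev (fst (rep O')) (snd (rep O')) b"
      using fun_cong[OF ab(4), of O'] O' by (simp add: ev_def)
    then have "pev (fst (rep O')) (snd (rep O')) (a - b) = 0" by (simp add: hom_distribs)
    then show "O' \<in> zeros (a - b)"
      using vanish_orbit[OF _ rep[OF O']] assms(2) O' by (auto simp: zeros_def)
  qed
  ultimately show ?thesis using ab(3) by (intro bexI[of _ "a - b"]) auto
qed

lemma finite_wt_le: "finite {E. finite E \<and> E \<subseteq> orbits \<and> wt E \<le> w}"
proof -
  have "{E. finite E \<and> E \<subseteq> orbits \<and> wt E \<le> w} \<subseteq> Pow {O' \<in> orbits. card O' \<le> w}"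
  proof clarify
    fix E O' assume E: "finite E" "E \<subseteq> orbits" "wt E \<le> w" "O' \<in> E"
    then have "card O' \<le> wt E" unfolding wt_def by (intro member_le_sum) auto
    then show "O' \<in> orbits \<and> card O' \<le> w" using E by auto
  qed
  then show ?thesis by (rule finite_subset) (simp add: finite_orbits_card_le)
qed

text \<open>E is determined by a function A E vanishing on it together with the other zeros of that
  function. These other zeros have bounded total weight, so they contribute only a constant factor
  to the count of functions.\<close>

theorem card_orbit_sets_le:
  "\<exists>K. \<forall>n. card {E. finite E \<and> E \<subseteq> orbits \<and> wt E = n} \<le> K * CARD('k) ^ n"
proof (rule exI, rule allI)
  fix n
  let ?F = "{E. finite E \<and> E \<subseteq> orbits \<and> wt E = n}"
  let ?G = "{E. finite E \<and> E \<subseteq> orbits \<and> wt E \<le> height_defect * d}"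
  \<comment> \<open>The smallest height at which a vanishing function is guaranteed. Then m d and n
    differ by less than d, which keeps both the number of functions and the weight of the surplus
    zeros under control.\<close>
  define m where "m = n div d"
  have md: "m * d \<le> n" "n < Suc m * d"
    using degree_pos by (auto simp: m_def dividend_less_div_times add.commute)
  define A where "A E = (SOME a. a \<in> box m \<and> a \<noteq> 0 \<and> E \<subseteq> zeros a)" for E
  have A: "A E \<in> box m \<and> A E \<noteq> 0 \<and> E \<subseteq> zeros (A E)" if "E \<in> ?F" for E
  proof -
    have "\<exists>a. a \<in> box m \<and> a \<noteq> 0 \<and> E \<subseteq> zeros a"
      using exists_vanishing[of E m] that md by blast
    then show ?thesis unfolding A_def by (rule someI_ex)
  qed
  have "(\<lambda>E. (A E, zeros (A E) - E)) ` ?F \<subseteq> box m \<times> ?G"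
  proof (rule image_subsetI)
    fix E assume E: "E \<in> ?F"
    note a = A[OF E]
    have red: "reduced (A E)" "height_le m (A E)" using a by (auto simp: box_def)
    note z = wt_zeros_le[OF _ red]
    have fin: "finite (zeros (A E))" using z a by auto
    have "wt (zeros (A E)) = wt (zeros (A E) - E) + wt E"
      unfolding wt_def using fin a by (intro sum.subset_diff) auto
    moreover have "wt (zeros (A E)) \<le> (m + height_defect) * d" using z a by auto
    ultimately have "wt (zeros (A E) - E) \<le> height_defect * d"
      using E md by (simp add: algebra_simps)
    then show "(A E, zeros (A E) - E) \<in> box m \<times> ?G"
      using a fin by (auto simp: zeros_def)
  qed
  moreover have "inj_on (\<lambda>E. (A E, zeros (A E) - E)) ?F"
  proof (rule inj_onI)
    fix E E' assume *: "E \<in> ?F" "E' \<in> ?F" "(A E, zeros (A E) - E) = (A E', zeros (A E') - E')"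
    then have AE: "A E = A E'" and "zeros (A E) - E = zeros (A E') - E'" by blast+
    then have "zeros (A E) - E = zeros (A E) - E'" by simp
    moreover have "E \<subseteq> zeros (A E)" "E' \<subseteq> zeros (A E)" using A[OF *(1)] A[OF *(2)] AE by auto
    ultimately show "E = E'" by blast
  qed
  moreover have "finite (box m \<times> ?G)" using card_box finite_wt_le by blast
  ultimately have "card ?F \<le> card (box m \<times> ?G)"
    using card_inj_on_le[of _ ?F "box m \<times> ?G"] by blast
  also have "\<dots> = CARD('k) ^ (Suc m * d) * card ?G" by (simp add: card_cartesian_product card_box)
  also have "\<dots> \<le> CARD('k) ^ (n + d) * card ?G"
    using md finite_field_card_gt_1[where 'k='k] by (intro mult_right_mono power_increasing) auto
  finally show "card ?F \<le> (CARD('k) ^ d * card ?G) * CARD('k) ^ n"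
    by (simp add: power_add mult_ac)
qed

end

section \<open>The lower bound for the number of effective divisors\<close>

context affine_curve
begin

lemma reduced_const [simp]: "reduced [:c:]"
  using degree_pos by (auto simp: reduced_def coeff_pCons split: nat.splits)

lemma map_tev_reduced_eq_0:
  assumes "reduced a" "map_poly (tev t) f dvd map_poly (tev t) a"
  shows "map_poly (tev t) a = 0"
proof (rule ccontr)
  assume "map_poly (tev t) a \<noteq> 0"
  then have "d \<le> degree (map_poly (tev t) a)"
    using dvd_imp_degree_le[OF assms(2)] degree_map_tev by simp
  then show False using assms(1) degree_map_poly_le[of "tev t" a] by (simp add: reduced_iff)
qed

text \<open>A good fibre has d distinct points, more than the degree in Y of a reduced element
  allows as roots.\<close>

lemma map_tev_eq_0_of_vanish:
  assumes "reduced a" "good t" "\<And>y. y \<in> fibre t \<Longrightarrow> pev t y a = 0"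
  shows "map_poly (tev t) a = 0"
proof (rule ccontr)
  assume nz: "map_poly (tev t) a \<noteq> 0"
  have "d = card (fibre t)" using card_fibre[OF assms(2)] by simp
  also have "\<dots> \<le> card {y. poly (map_poly (tev t) a) y = 0}"
    using assms(3) poly_roots_finite[OF nz] by (intro card_mono) (auto simp: pev_def)
  also have "\<dots> \<le> degree (map_poly (tev t) a)" by (rule card_poly_roots_bound[OF nz])
  also have "\<dots> < d"
    using assms(1) degree_map_poly_le[of "tev t" a] by (auto simp: reduced_iff intro: le_less_trans)
  finally show False by simp
qed

lemma dvd_coeffs_obtain:
  fixes p :: "'k poly"
  assumes "\<And>i. p dvd coeff a i"
  obtains b where "a = Polynomial.smult p b" "\<And>i. coeff a i = p * coeff b i"
proof -
  have "[:p:] dvd a" using assms by (simp add: const_poly_dvd_iff)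
  then obtain b where "a = [:p:] * b" by (elim dvdE)
  then show ?thesis using that[of b] by simp
qed

text \<open>An element that is \<open>1\<close> modulo \<open>\<Delta>\<close> divides every element with the same multiplicities: a prime \<open>p\<close> in
  a minimal denominator of the quotient cannot divide \<open>\<Delta>\<close>, and if \<open>p\<close> does not divide \<open>\<Delta>\<close>, the numerator
  vanishes at all points above \<open>p\<close> and is divisible by \<open>p\<close>.\<close>

lemma dvd_of_mult_eq:
  assumes a: "a = 1 + Polynomial.smult \<Delta> a1" "reduced a" "a \<noteq> 0"
    and a': "reduced a'" "a' \<noteq> 0"
    and eq: "\<And>O'. O' \<in> orbits \<Longrightarrow> mult a O' = mult a' O'"
  shows "\<exists>w. reduced w \<and> f dvd a * w - a'"
proof -
  have nd: "\<not> f dvd a" "\<not> f dvd a'" using a a' reduced_dvd_eq_0 by blast+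
  let ?Q = "\<lambda>(h, w). h \<noteq> 0 \<and> reduced w \<and> f dvd a * w - Polynomial.smult h a'"
  have "\<exists>hw. ?Q hw"
  proof -
    have "\<not> map_poly to_fract f dvd map_poly to_fract a" using nd map_fract_dvd_iff by blast
    then obtain u' b h where h: "h \<noteq> 0" "u' * f + b * a = [:h:]"
      using bezout_over_fract[OF irreducible_fract] by metis
    define w where "w = red (a' * b)"
    have "a * w - Polynomial.smult h a' = a * (w - a' * b) - a' * ([:h:] - b * a)"
      by (simp add: algebra_simps)
    also have "[:h:] - b * a = u' * f" using h by (simp add: algebra_simps)
    finally have "a * w - Polynomial.smult h a' = - (a * (a' * b - w)) - f * (a' * u')"
      by (simp add: algebra_simps)
    moreover have "f dvd a * (a' * b - w)" using red(1) unfolding w_def by (rule dvd_mult)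
    ultimately have "f dvd a * w - Polynomial.smult h a'" by (simp add: dvd_diff)
    then show ?thesis using h red(2) by (intro exI[of _ "(h, w)"]) (auto simp: w_def)
  qed
  then obtain h w where hw: "?Q (h, w)" and least: "\<And>h' w'. ?Q (h', w') \<Longrightarrow> degree h \<le> degree h'"
    using ex_has_least_nat[of ?Q _ "\<lambda>hw. degree (fst hw)"] by (metis (no_types, lifting) fst_conv surj_pair)
  have hw': "h \<noteq> 0" "reduced w" "f dvd a * w - Polynomial.smult h a'" using hw by auto
  have "degree h = 0"
  proof (rule ccontr)
    assume "degree h \<noteq> 0"
    then obtain p where p: "p \<in> prime_polys" "p dvd h"
      using exists_prime_poly_dvd[of h] hw' by auto
    then have irr: "Factorial_Ring.irreducible p" by (simp add: prime_polys_def)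
    obtain h' where h': "h = p * h'" using p by (elim dvdE)
    obtain t where t: "tev t p = 0"
      using alg_closed_imp_poly_has_root[of "map_poly to_ac p"] irreducible_field_polyD[OF irr]
      by (auto simp: tev_def)
    have ht: "tev t h = 0" using t by (simp add: h' hom_distribs)
    obtain c where c: "a * w - Polynomial.smult h a' = f * c" using hw'(3) by (elim dvdE)
    have "map_poly (tev t) w = 0"
    proof (cases "good t")
      case False
      then have "map_poly (tev t) a = 1" by (simp add: a(1) hom_distribs good_def)
      moreover have "map_poly (tev t) (a * w - Polynomial.smult h a') = map_poly (tev t) f * map_poly (tev t) c"
        by (simp add: c hom_distribs)
      ultimately have "map_poly (tev t) w = map_poly (tev t) f * map_poly (tev t) c"
        by (simp add: hom_distribs ht)
      then show ?thesis using hw'(2) by (intro map_tev_reduced_eq_0) auto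
    next
      case True
      show ?thesis
      proof (rule map_tev_eq_0_of_vanish[OF _ True])
        fix y assume y: "y \<in> fibre t"
        define O' where "O' = orb frob2 (t, y)"
        have O': "O' \<in> orbits" "(t, y) \<in> O'" using True y by (auto simp: O'_def orbits_def points_def)
        \<comment> \<open>The comparison is made at the point where \<open>val a\<close> is minimal:
          there val a P = mult a O' = mult a' O', which is at most val a' P. The conclusion is
          carried back to (t, y) along the Frobenius orbit.\<close>
        obtain P where P: "P \<in> O'" "val a P = mult a O'" using mult_attained[OF O'(1)] .
        have le: "val a P \<le> val a' P" using P eq[OF O'(1)] mult_le[OF O'(1) P(1)] by simp
        have "tev (fst P) h = 0"
        proof -
          have "P \<in> orb frob2 (t, y)" using P(1) by (simp add: O'_def)
          then obtain i where "P = (frob2 ^^ i) (t, y)" by (auto simp: orb_def)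
          then show ?thesis by (simp add: frob2_funpow tev_frobenius ht)
        qed
        have pt: "good (fst P)" "snd P \<in> fibre (fst P)"
          using orbitsD(1)[OF O'(1) P(1)] by (auto simp: points_def)
        let ?e = "fev (fst P) (lift (fst P) (snd P))"
        have "?e (a * w) = ?e (Polynomial.smult h a')"
          using hw'(3) by (rule fev_lift_cong[OF pt])
        moreover have "Polynomial.smult h a' = [:h:] * a'" by simp
        ultimately have e: "?e a * ?e w = tser (fst P) h * ?e a'"
          by (simp add: hom_distribs del: mult_pCons_left)
        have "pev (fst P) (snd P) w = 0"
        proof (cases "?e w = 0")
          case True
          then show ?thesis using fev_nth_0[of "fst P" "lift (fst P) (snd P)" w] lift(2)[OF pt] by simp
        next
          case False
          have nz: "?e a \<noteq> 0" "?e a' \<noteq> 0" using fev_lift_nz[OF pt] nd by auto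
          have hnz: "tser (fst P) h \<noteq> 0" using hw'(1) by simp
          have "subdegree (?e a) + subdegree (?e w) = subdegree (tser (fst P) h) + subdegree (?e a')"
            using arg_cong[OF e, of subdegree] nz hnz False by (simp add: subdegree_mult)
          moreover have "0 < subdegree (tser (fst P) h)"
            using hnz \<open>tev (fst P) h = 0\<close> by (simp add: subdegree_eq_0_iff flip: neq0_conv)
          ultimately have "0 < subdegree (?e w)" using le by (simp add: val_def)
          then have "fps_nth (?e w) 0 = 0" by (rule nth_less_subdegree_zero)
          then show ?thesis using lift(2)[OF pt] by simp
        qed
        then show "pev t y w = 0" using vanish_orbit[OF O'(1) P(1) O'(2)] by simp
      qed (use hw' in auto)
    qed
    then have "tev t (coeff w i) = 0" for i by (metis coeff_0 coeff_map_poly tev.base.hom_zero)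
    then have "p dvd coeff w i" for i using tev_eq_0_iff_dvd[OF irr t] by simp
    then obtain w' where w': "w = Polynomial.smult p w'" "\<And>i. coeff w i = p * coeff w' i"
      using dvd_coeffs_obtain[of p w] by blast
    have pnz: "p \<noteq> 0" using irreducible_field_polyD(1)[OF irr] .
    have "reduced w'" using hw'(2) w'(2) pnz by (auto simp: reduced_def)
    have "a * w - Polynomial.smult h a' = [:p:] * (a * w' - Polynomial.smult h' a')"
      by (simp add: w'(1) h' algebra_simps smult_diff_right)
    then have "f dvd [:p:] * (a * w' - Polynomial.smult h' a')" using hw'(3) by simp
    then have "f dvd [:p:] \<or> f dvd a * w' - Polynomial.smult h' a'" by (rule prime_f)
    moreover have "\<not> f dvd [:p:]"
      using reduced_dvd_eq_0[OF reduced_const, of p] pnz by auto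
    ultimately have "?Q (h', w')" using hw \<open>reduced w'\<close> by (auto simp: h')
    then have "degree h \<le> degree h'" by (rule least)
    moreover have "degree h = degree p + degree h'" using hw'(1) by (subst h') (auto simp: degree_mult_eq h')
    ultimately show False using irreducible_field_polyD(2)[OF irr] by simp
  qed
  then obtain c where c: "h = [:c:]" "c \<noteq> 0" using hw'(1) by (metis degree_eq_zeroE pCons_0_0)
  have "a * Polynomial.smult [:inverse c:] w - a' = [:[:inverse c:]:] * (a * w - Polynomial.smult h a')"
    using c by (simp add: smult_diff_right flip: one_pCons)
  then have "f dvd a * Polynomial.smult [:inverse c:] w - a'" using hw'(3) by (metis dvd_mult)
  then show ?thesis using hw'(2) by (intro exI[of _ "Polynomial.smult [:inverse c:] w"]) auto
qed

text \<open>If c exceeds the height of e by more than the reduction defect, the summand c w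
  dominates the product (e + c) w, which then has height deg c plus that of w. The bound on a'
  leaves only height 0 for w.\<close>

lemma height_of_mult_monom:
  assumes w: "reduced w" "w \<noteq> 0" and e: "reduced e" "height_le n e"
    and c: "c \<noteq> 0" "n + height_defect < degree c"
    and dvd: "f dvd (e + [:c:]) * w - a'" and a': "reduced a'" "height_le (degree c) a'"
  shows "height_le 0 w"
proof -
  define j where "j = Max ((\<lambda>i. degree (coeff w i)) ` {..degree w})"
  have fin: "finite ((\<lambda>i. degree (coeff w i)) ` {..degree w})" "(\<lambda>i. degree (coeff w i)) ` {..degree w} \<noteq> {}"
    by auto
  have hj: "height_le j w"
  proof -
    have "degree (coeff w i) \<le> j" for i
    proof (cases "i \<le> degree w")
      case True
      then show ?thesis unfolding j_def by (intro Max_ge) auto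
    qed (simp add: coeff_eq_0)
    then show ?thesis by (simp add: height_le_def)
  qed
  obtain i where i: "degree (coeff w i) = j" "coeff w i \<noteq> 0"
  proof -
    have "j \<in> (\<lambda>i. degree (coeff w i)) ` {..degree w}" unfolding j_def by (rule Max_in[OF fin])
    then obtain i where i: "j = degree (coeff w i)" by auto
    show ?thesis
    proof (cases "coeff w i = 0")
      case True
      then have "degree (coeff w (degree w)) = j" using i hj by (simp add: height_le_def)
      then show ?thesis using that w(2) by simp
    qed (use that i in auto)
  qed
  have "f dvd e * w - (a' - Polynomial.smult c w)" using dvd by (simp add: algebra_simps)
  then have ew: "red (e * w) = a' - Polynomial.smult c w" using a' w by (intro red_eqI) auto
  have "degree (e * w) \<le> 2 * d"
    using e(1) w(1) degree_mult_le[of e w] by (simp add: reduced_iff)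
  then have "height_le (n + j + height_defect) (red (e * w))"
    by (intro height_le_red height_le_mult e hj)
  then have le: "degree (coeff a' i - c * coeff w i) \<le> n + j + height_defect"
    by (simp add: ew height_le_def)
  have deg: "degree (c * coeff w i) = degree c + j" using c(1) i by (simp add: degree_mult_eq)
  show ?thesis
  proof (rule ccontr)
    assume "\<not> height_le 0 w"
    then have "j \<noteq> 0" using hj by metis
    then have "degree (coeff a' i) < degree (c * coeff w i)"
      using a'(2) deg by (auto simp: height_le_def intro: le_less_trans)
    then have "degree (coeff a' i - c * coeff w i) = degree c + j"
      using degree_add_eq_right[of "coeff a' i" "- (c * coeff w i)"] deg by simp
    then show False using le c(2) by simp
  qed
qed

text \<open>Being 1 modulo \<Delta> makes \<open>dvd_of_mult_eq\<close> applicable, and the dominant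
  term \<Delta> T^m makes \<open>height_of_mult_monom\<close> applicable to the quotient of two such
  elements.\<close>

definition special :: "nat \<Rightarrow> 'k poly poly \<Rightarrow> 'k poly poly"
  where "special m e = 1 + Polynomial.smult \<Delta> ([:monom 1 m:] + e)"

lemma special_split: "special m e = (1 + Polynomial.smult \<Delta> e) + [:\<Delta> * monom 1 m:]"
  by (simp add: special_def smult_add_right)

lemma
  assumes "e \<in> box n" "n + height_defect < m"
  shows reduced_special: "reduced (special m e)"
    and height_special: "height_le (degree \<Delta> + m) (special m e)"
    and special_nz: "special m e \<noteq> 0"
proof -
  have 1: "reduced 1" "height_le k 1" for k
    using reduced_const[of 1] by (auto simp: height_le_def one_pCons coeff_pCons split: nat.splits)
  have e: "reduced e" "height_le n e" using assms by (auto simp: box_def)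
  show "reduced (special m e)" unfolding special_split by (intro reduced_add reduced_smult 1 e reduced_const)
  have c: "height_le (degree \<Delta> + m) [:\<Delta> * monom 1 m:]"
    using degree_mult_le[of \<Delta> "monom 1 m"]
    by (auto simp: height_le_def coeff_pCons degree_monom_eq split: nat.splits)
  have "height_le (degree \<Delta> + n) (Polynomial.smult \<Delta> e)" by (intro height_le_smult e) simp
  then have "height_le (degree \<Delta> + m) (Polynomial.smult \<Delta> e)"
    using assms(2) by (elim height_le_mono) simp
  then show "height_le (degree \<Delta> + m) (special m e)"
    unfolding special_split by (intro height_le_add 1 c)
  show "special m e \<noteq> 0"
  proof
    assume 0: "special m e = 0"
    have "degree (coeff (1 + Polynomial.smult \<Delta> e) 0) \<le> degree \<Delta> + n"
      using height_le_add[OF 1(2) \<open>height_le (degree \<Delta> + n) (Polynomial.smult \<Delta> e)\<close>]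
      unfolding height_le_def by (rule spec)
    moreover have "coeff (1 + Polynomial.smult \<Delta> e) 0 = - (\<Delta> * monom 1 m)"
      using arg_cong[OF 0[unfolded special_split], of "\<lambda>p. coeff p 0"] by (simp add: eq_neg_iff_add_eq_0)
    moreover have "degree (- (\<Delta> * monom 1 m)) = degree \<Delta> + m"
      using discriminant_nz by (simp add: degree_mult_eq degree_monom_eq)
    ultimately show False using assms(2) by simp
  qed
qed

text \<open>The functions D are effective divisors. All e in a box give such a divisor, and two e
  with the same divisor differ by a reduced quotient of height 0, of which there are q^d. The q^(d
  (n + 1)) choices of e thus yield at least q^(d n) divisors.\<close>

theorem card_orbit_multisets_ge:
  fixes m :: nat
  defines "r \<equiv> Suc height_defect"
  assumes "r \<le> m"
  shows "\<exists>\<D>. finite \<D> \<and> CARD('k) ^ (d * (m - r)) \<le> card \<D> \<and>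
    (\<forall>D\<in>\<D>. finite {O'. D O' \<noteq> 0} \<and> {O'. D O' \<noteq> (0::nat)} \<subseteq> orbits \<and>
      (\<Sum>O' | D O' \<noteq> 0. card O' * D O') \<le> (m + (degree \<Delta> + height_defect)) * d)"
proof -
  \<comment> \<open>With r one more than the reduction defect, this is the largest box for which the
    term T^m still dominates.\<close>
  define n where "n = m - r"
  have n: "n + height_defect < m" using assms by (simp add: n_def)
  define D where "D e O' = (if O' \<in> orbits then mult (special m e) O' else 0)" for e O'
  note sp = reduced_special[OF _ n] height_special[OF _ n] special_nz[OF _ n]
  have D: "finite {O'. D e O' \<noteq> 0}" "{O'. D e O' \<noteq> 0} \<subseteq> orbits"
      "(\<Sum>O' | D e O' \<noteq> 0. card O' * D e O') \<le> (m + (degree \<Delta> + height_defect)) * d"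
    if e: "e \<in> box n" for e
  proof -
    note s = sp[OF e]
    have nd: "\<not> f dvd special m e" using s reduced_dvd_eq_0 by blast
    have sub: "{O'. D e O' \<noteq> 0} \<subseteq> zeros (special m e)"
    proof
      fix O' assume "O' \<in> {O'. D e O' \<noteq> 0}"
      then have O': "O' \<in> orbits" "mult (special m e) O' \<noteq> 0" by (auto simp: D_def split: if_splits)
      have "pev (fst P) (snd P) (special m e) = 0" if "P \<in> O'" for P
        using mult_le[OF O'(1) that, of "special m e"] O'(2) val_pos_iff[OF orbitsD(1)[OF O'(1) that] nd]
        by simp
      then show "O' \<in> zeros (special m e)" using O' by (simp add: zeros_def)
    qed
    show fin: "finite {O'. D e O' \<noteq> 0}" using sub wt_zeros_le(1)[OF s(3,1,2)] by (rule finite_subset)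
    show orb: "{O'. D e O' \<noteq> 0} \<subseteq> orbits" using sub by (auto simp: zeros_def)
    have "(\<Sum>O' | D e O' \<noteq> 0. card O' * D e O') = (\<Sum>O' | D e O' \<noteq> 0. card O' * mult (special m e) O')"
      using orb by (intro sum.cong) (auto simp: D_def)
    also have "\<dots> \<le> (degree \<Delta> + m + height_defect) * d" using fin orb by (intro sum_mult_le s)
    finally show "(\<Sum>O' | D e O' \<noteq> 0. card O' * D e O') \<le> (m + (degree \<Delta> + height_defect)) * d"
      by (simp add: ac_simps)
  qed
  have fibre: "card {e \<in> box n. D e = D e0} \<le> CARD('k) ^ d" if e0: "e0 \<in> box n" for e0
  proof -
    \<comment> \<open>The quotient of \<open>special m e\<close> by \<open>special m e0\<close> in
      the coordinate ring; it determines e and lies in \<open>box 0\<close>.\<close>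
    define W where "W e = (SOME w. reduced w \<and> f dvd special m e0 * w - special m e)" for e
    have W: "reduced (W e)" "f dvd special m e0 * W e - special m e" "height_le 0 (W e)"
      if e: "e \<in> {e \<in> box n. D e = D e0}" for e
    proof -
      have "\<exists>w. reduced w \<and> f dvd special m e0 * w - special m e"
      proof (rule dvd_of_mult_eq[OF special_def])
        show "mult (special m e0) O' = mult (special m e) O'" if "O' \<in> orbits" for O'
          using e that by (auto simp: D_def fun_eq_iff dest: spec[of _ O'])
      qed (use sp e e0 in auto)
      then have "reduced (W e) \<and> f dvd special m e0 * W e - special m e"
        unfolding W_def by (rule someI_ex)
      then show W: "reduced (W e)" "f dvd special m e0 * W e - special m e" by auto
      have e0': "reduced e0" "height_le n e0" using e0 by (auto simp: box_def)
      have deg: "degree (\<Delta> * monom 1 m) = degree \<Delta> + m"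
        using discriminant_nz by (simp add: degree_mult_eq degree_monom_eq)
      have "W e \<noteq> 0"
        using W(2) sp(1,3)[of e] e reduced_dvd_eq_0[of "special m e"] by auto
      then show "height_le 0 (W e)"
      proof (rule height_of_mult_monom[OF W(1)])
        show "f dvd (1 + Polynomial.smult \<Delta> e0 + [:\<Delta> * monom 1 m:]) * W e - special m e"
          using W(2) by (simp only: special_split)
        show "reduced (1 + Polynomial.smult \<Delta> e0)"
          using reduced_const[of 1] e0' by (intro reduced_add reduced_smult) (simp_all add: one_pCons)
        show "height_le (degree \<Delta> + n) (1 + Polynomial.smult \<Delta> e0)"
          using height_le_smult[of \<Delta> "degree \<Delta>" n e0] e0'
          by (intro height_le_add) (auto simp: height_le_def one_pCons coeff_pCons split: nat.splits)
        show "\<Delta> * monom 1 m \<noteq> 0" using discriminant_nz by simp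
        show "degree \<Delta> + n + height_defect < degree (\<Delta> * monom 1 m)" using n deg by simp
        show "height_le (degree (\<Delta> * monom 1 m)) (special m e)" using sp(2)[of e] e deg by simp
      qed (use sp e in auto)
    qed
    have "inj_on W {e \<in> box n. D e = D e0}"
    proof (rule inj_onI)
      fix e e' assume *: "e \<in> {e \<in> box n. D e = D e0}" "e' \<in> {e \<in> box n. D e = D e0}" "W e = W e'"
      have "f dvd (special m e0 * W e - special m e) - (special m e0 * W e' - special m e')"
        using W(2)[OF *(1)] W(2)[OF *(2)] by (rule dvd_diff)
      then have "f dvd special m e' - special m e" by (simp add: *(3))
      moreover have "reduced (special m e' - special m e)" using sp(1) * by auto
      ultimately have "special m e' - special m e = 0" using reduced_dvd_eq_0 by blast
      then have "Polynomial.smult \<Delta> (e' - e) = 0" by (simp add: special_def smult_add_right smult_diff_right)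
      then show "e = e'" using discriminant_nz by simp
    qed
    moreover have "W ` {e \<in> box n. D e = D e0} \<subseteq> box 0" using W by (auto simp: box_def)
    ultimately have "card {e \<in> box n. D e = D e0} \<le> card (box 0)"
      using card_inj_on_le card_box(1) by blast
    then show ?thesis by (simp add: card_box)
  qed
  have "box n = (\<Union>\<delta>\<in>D ` box n. {e \<in> box n. D e = \<delta>})" by auto
  then have "card (box n) \<le> (\<Sum>\<delta>\<in>D ` box n. card {e \<in> box n. D e = \<delta>})"
    using card_UN_le[of "D ` box n" "\<lambda>\<delta>. {e \<in> box n. D e = \<delta>}"] card_box(1) by simp
  also have "\<dots> \<le> (\<Sum>\<delta>\<in>D ` box n. CARD('k) ^ d)" using fibre by (intro sum_mono) auto
  finally have "CARD('k) ^ (d * n) * CARD('k) ^ d \<le> card (D ` box n) * CARD('k) ^ d"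
    by (simp add: card_box power_add[symmetric] algebra_simps)
  then have "CARD('k) ^ (d * n) \<le> card (D ` box n)"
    using finite_field_card_gt_1[where 'k='k] by simp
  then show ?thesis
    using D card_box(1) by (intro exI[of _ "D ` box n"]) (auto simp: n_def)
qed

end

section \<open>Logarithmic asymptotics\<close>

lemma sum_power_le_geometric:
  fixes x :: real
  assumes "finite N" "0 \<le> x" "x < 1"
  shows "(\<Sum>n\<in>N. x ^ n) \<le> 1 / (1 - x)"
proof -
  have "(\<Sum>n\<in>N. x ^ n) \<le> (\<Sum>n. x ^ n)"
    using assms by (intro sum_le_suminf summable_geometric) auto
  then show ?thesis using assms by (simp add: suminf_geometric)
qed

lemma sum_power_weight_le:
  fixes q y K :: real
  assumes "finite F" "0 \<le> y" "0 \<le> q" "q * y < 1" "0 \<le> K"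
    and "\<And>n. real (card {x \<in> F. w x = n}) \<le> K * q ^ n"
  shows "(\<Sum>x\<in>F. y ^ w x) \<le> K / (1 - q * y)"
proof -
  have "(\<Sum>x\<in>F. y ^ w x) = (\<Sum>n\<in>w ` F. \<Sum>x\<in>{x \<in> F. w x = n}. y ^ w x)"
    by (rule sum.image_gen[OF assms(1)])
  also have "\<dots> = (\<Sum>n\<in>w ` F. real (card {x \<in> F. w x = n}) * y ^ n)" by simp
  also have "\<dots> \<le> (\<Sum>n\<in>w ` F. K * (q * y) ^ n)"
  proof (rule sum_mono)
    fix n
    have "real (card {x \<in> F. w x = n}) * y ^ n \<le> (K * q ^ n) * y ^ n"
      using assms(2,6) by (intro mult_right_mono) auto
    then show "real (card {x \<in> F. w x = n}) * y ^ n \<le> K * (q * y) ^ n"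
      by (simp add: power_mult_distrib mult.assoc)
  qed
  also have "\<dots> = K * (\<Sum>n\<in>w ` F. (q * y) ^ n)" by (simp add: sum_distrib_left)
  also have "\<dots> \<le> K * (1 / (1 - q * y))"
    using assms by (intro mult_left_mono sum_power_le_geometric) auto
  finally show ?thesis by simp
qed

text \<open>Expansion of an Euler product: the given divisors D account for distinct terms with
  nonnegative values. Truncation at exponent N keeps the expansion finite.\<close>

lemma prod_geometric_ge:
  fixes z :: real
  assumes "finite F" "\<And>x. x \<in> F \<Longrightarrow> 0 < w x" "0 < z" "z < 1"
    and "finite \<U>" "\<And>D. D \<in> \<U> \<Longrightarrow> {x. D x \<noteq> (0::nat)} \<subseteq> F"
  shows "(\<Sum>D\<in>\<U>. z ^ (\<Sum>x\<in>F. w x * D x)) \<le> (\<Prod>x\<in>F. 1 / (1 - z ^ w x))"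
proof -
  define N where "N = Max (insert 0 (\<Union>D\<in>\<U>. D ` F))"
  have N: "D x \<le> N" if "D \<in> \<U>" "x \<in> F" for D x
    unfolding N_def using that assms(1,5) by (intro Max_ge) auto
  have "(\<Sum>D\<in>\<U>. z ^ (\<Sum>x\<in>F. w x * D x)) = (\<Sum>D\<in>\<U>. \<Prod>x\<in>F. (z ^ w x) ^ (restrict D F x))"
    by (simp add: power_sum power_mult)
  also have "\<dots> = (\<Sum>D\<in>(\<lambda>D. restrict D F) ` \<U>. \<Prod>x\<in>F. (z ^ w x) ^ D x)"
  proof (rule sum.reindex_cong[symmetric, of "\<lambda>D. restrict D F"])
    show "inj_on (\<lambda>D. restrict D F) \<U>"
    proof (rule inj_onI, rule ext)
      fix D D' x assume *: "D \<in> \<U>" "D' \<in> \<U>" "restrict D F = restrict D' F"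
      show "D x = D' x"
      proof (cases "x \<in> F")
        case True
        then show ?thesis using fun_cong[OF *(3), of x] by simp
      next
        case False
        then have "D x = 0" "D' x = 0" using assms(6)[OF *(1)] assms(6)[OF *(2)] by auto
        then show ?thesis by simp
      qed
    qed
  qed auto
  also have "\<dots> \<le> (\<Sum>D\<in>PiE F (\<lambda>_. {..N}). \<Prod>x\<in>F. (z ^ w x) ^ D x)"
    using assms N by (intro sum_mono2 finite_PiE prod_nonneg) auto
  also have "\<dots> = (\<Prod>x\<in>F. \<Sum>k\<le>N. (z ^ w x) ^ k)"
    using assms(1) by (subst prod_sum_PiE) auto
  also have "\<dots> \<le> (\<Prod>x\<in>F. 1 / (1 - z ^ w x))"
  proof (intro prod_mono conjI sum_nonneg sum_power_le_geometric)
    fix x assume "x \<in> F"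
    then show "z ^ w x < 1" using assms by (simp add: power_less_one_iff)
  qed (use assms in auto)
  finally show ?thesis .
qed

lemma neg_ln_one_minus_le:
  fixes y :: real
  assumes "0 \<le> y" "y \<le> 1 / 2"
  shows "- ln (1 - y) \<le> y + 2 * y\<^sup>2"
proof -
  have "- ln (1 - y) = ln (1 + y / (1 - y))"
    using assms by (simp add: ln_div[symmetric] field_simps ln_inverse[symmetric])
  also have "\<dots> \<le> y / (1 - y)" using assms by (intro ln_add_one_self_le_self) auto
  also have "\<dots> \<le> y + 2 * y\<^sup>2"
  proof -
    have "y \<le> (y + 2 * y\<^sup>2) * (1 - y)"
    proof -
      have "(y + 2 * y\<^sup>2) * (1 - y) - y = y\<^sup>2 * (1 - 2 * y)"
        by (simp add: algebra_simps power2_eq_square)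
      moreover have "0 \<le> y\<^sup>2 * (1 - 2 * y)" using assms by (intro mult_nonneg_nonneg) auto
      ultimately show ?thesis by linarith
    qed
    then show ?thesis using assms by (simp add: divide_le_eq)
  qed
  finally show ?thesis .
qed

text \<open>The places of a curve with their degrees, abstractly; finite subsets are squarefree
  effective divisors.\<close>

locale weighted_primes =
  fixes S :: "'x set" and w :: "'x \<Rightarrow> nat" and q K :: real
  assumes q: "2 \<le> q" and K: "1 \<le> K"
    and w_pos: "\<And>x. x \<in> S \<Longrightarrow> 0 < w x"
    and fin_sets: "\<And>n. finite {E. finite E \<and> E \<subseteq> S \<and> sum w E = n}"
    and sets_le: "\<And>n. real (card {E. finite E \<and> E \<subseteq> S \<and> sum w E = n}) \<le> K * q ^ n"
begin

lemma card_weight_eq: "finite {x \<in> S. w x = n}" "real (card {x \<in> S. w x = n}) \<le> K * q ^ n"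
proof -
  let ?G = "{E. finite E \<and> E \<subseteq> S \<and> sum w E = n}"
  have inj: "inj_on (\<lambda>x. {x}) {x \<in> S. w x = n}" by (auto simp: inj_on_def)
  have sub: "(\<lambda>x. {x}) ` {x \<in> S. w x = n} \<subseteq> ?G" by auto
  show "finite {x \<in> S. w x = n}" using inj sub fin_sets by (rule inj_on_finite)
  have "card {x \<in> S. w x = n} \<le> card ?G" by (rule card_inj_on_le[OF inj sub fin_sets])
  then show "real (card {x \<in> S. w x = n}) \<le> K * q ^ n" using sets_le[of n] by linarith
qed

text \<open>The second order terms of the logarithms stay bounded up to q z = 1, since there are at
  most K q^n primes of weight n and q z^2 is at most 1/2.\<close>

lemma sum_squares_le:
  assumes "finite F" "F \<subseteq> S" "0 < z" "z < 1 / q"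
  shows "(\<Sum>x\<in>F. (z ^ w x)\<^sup>2) \<le> 2 * K"
proof -
  have qz: "q * z\<^sup>2 \<le> 1 / 2"
  proof -
    have "q * z \<le> 1" using assms q by (simp add: field_simps)
    moreover have "z \<le> 1 / 2" using assms q by (smt (verit) frac_le)
    ultimately have "(q * z) * z \<le> 1 * (1 / 2)" using assms q by (intro mult_mono) auto
    then show ?thesis by (simp add: power2_eq_square mult.assoc)
  qed
  have "(\<Sum>x\<in>F. (z ^ w x)\<^sup>2) = (\<Sum>x\<in>F. (z\<^sup>2) ^ w x)" by (simp add: power_mult[symmetric] mult.commute)
  also have "\<dots> \<le> K / (1 - q * z\<^sup>2)"
  proof (rule sum_power_weight_le)
    fix n
    have "card {x \<in> F. w x = n} \<le> card {x \<in> S. w x = n}"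
      using assms card_weight_eq by (intro card_mono) auto
    then show "real (card {x \<in> F. w x = n}) \<le> K * q ^ n" using card_weight_eq(2)[of n] by linarith
  qed (use assms qz q K in auto)
  also have "\<dots> \<le> K / (1 / 2)" using qz K by (intro divide_left_mono) auto
  finally show ?thesis by simp
qed

text \<open>The product of all 1 + z^w is the generating function of the squarefree divisors, hence
  at most K / (1 - q z). Taking logarithms moves K into the error.\<close>

lemma sum_weight_upper:
  assumes "finite F" "F \<subseteq> S" "0 < z" "z < 1 / q"
  shows "(\<Sum>x\<in>F. z ^ w x) \<le> - ln (1 - q * z) + ln K + 2 * K"
proof -
  have qz: "q * z < 1" using assms q by (simp add: field_simps)
  have z1: "z < 1" using assms q by (smt (verit) divide_le_eq_1)
  have le1: "z ^ w x \<le> 1" for x using assms z1 by (intro power_le_one) auto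
  have "(\<Prod>x\<in>F. 1 + z ^ w x) = (\<Sum>E\<in>Pow F. \<Prod>x\<in>E. z ^ w x)"
    using assms(1) prod_add[OF assms(1), of "\<lambda>x. z ^ w x" "\<lambda>_. 1"] by (simp add: add.commute)
  also have "\<dots> = (\<Sum>E\<in>Pow F. z ^ sum w E)" by (simp add: power_sum)
  also have "\<dots> \<le> K / (1 - q * z)"
  proof (rule sum_power_weight_le)
    fix n
    have "card {E \<in> Pow F. sum w E = n} \<le> card {E. finite E \<and> E \<subseteq> S \<and> sum w E = n}"
      using assms fin_sets by (intro card_mono) (auto intro: finite_subset)
    then show "real (card {E \<in> Pow F. sum w E = n}) \<le> K * q ^ n" using sets_le[of n] by linarith
  qed (use assms qz q K in auto)
  finally have "ln (\<Prod>x\<in>F. 1 + z ^ w x) \<le> ln (K / (1 - q * z))"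
    using assms K qz by (subst ln_le_cancel_iff) (auto intro!: prod_pos add_pos_nonneg)
  also have "\<dots> = ln K - ln (1 - q * z)" using K qz by (simp add: ln_div)
  also have "ln (\<Prod>x\<in>F. 1 + z ^ w x) = (\<Sum>x\<in>F. ln (1 + z ^ w x))"
  proof (rule ln_prod[OF assms(1)])
    show "1 + z ^ w x \<noteq> 0" for x using zero_less_power[OF assms(3), of "w x"] by linarith
  qed
  finally have "(\<Sum>x\<in>F. ln (1 + z ^ w x)) \<le> ln K - ln (1 - q * z)" .
  moreover have "(\<Sum>x\<in>F. z ^ w x - (z ^ w x)\<^sup>2) \<le> (\<Sum>x\<in>F. ln (1 + z ^ w x))"
    using le1 assms by (intro sum_mono ln_one_plus_pos_lower_bound) auto
  ultimately show ?thesis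
    using sum_squares_le[OF assms] by (simp add: sum_subtractf)
qed

lemma summable_weight:
  assumes "0 < z" "z < 1 / q"
  shows "(\<lambda>x. z ^ w x) summable_on S"
proof (rule nonneg_bdd_above_summable_on)
  show "bdd_above (sum (\<lambda>x. z ^ w x) ` {F. F \<subseteq> S \<and> finite F})"
    using sum_weight_upper assms by (auto simp: bdd_above_def)
qed (use assms in auto)

lemma infsum_weight_upper:
  assumes "0 < z" "z < 1 / q"
  shows "(\<Sum>\<^sub>\<infinity>x\<in>S. z ^ w x) \<le> - ln (1 - q * z) + ln K + 2 * K"
  using sum_weight_upper assms by (intro infsum_le_finite_sums summable_weight) auto

text \<open>The Euler product of the factors 1 / (1 - z^w) is at least the sum over the given
  divisors; its logarithm differs from the sum of the z^w by the bounded second order terms.\<close>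

lemma infsum_weight_lower_of_multisets:
  assumes z: "0 < z" "z < 1 / q"
    and \<U>: "finite \<U>" "\<And>D. D \<in> \<U> \<Longrightarrow> finite {x. D x \<noteq> (0::nat)} \<and> {x. D x \<noteq> 0} \<subseteq> S" "\<U> \<noteq> {}"
  shows "ln (\<Sum>D\<in>\<U>. z ^ (\<Sum>x | D x \<noteq> 0. w x * D x)) - 4 * K \<le> (\<Sum>\<^sub>\<infinity>x\<in>S. z ^ w x)"
proof -
  have z1: "z \<le> 1 / 2" using z q by (smt (verit) frac_le)
  define F where "F = (\<Union>D\<in>\<U>. {x. D x \<noteq> 0})"
  have F: "finite F" "F \<subseteq> S" using \<U> by (auto simp: F_def)
  have half: "z ^ w x \<le> 1 / 2" if "x \<in> F" for x
  proof -
    have "w x = Suc (w x - 1)" using w_pos that F by (simp add: subset_iff)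
    then have "z ^ w x = z * z ^ (w x - 1)" by (metis power_Suc)
    also have "\<dots> \<le> 1 / 2 * 1" using z z1 by (intro mult_mono power_le_one) auto
    finally show ?thesis by simp
  qed
  have "(\<Sum>D\<in>\<U>. z ^ (\<Sum>x | D x \<noteq> 0. w x * D x)) = (\<Sum>D\<in>\<U>. z ^ (\<Sum>x\<in>F. w x * D x))"
    using F(1) by (intro sum.cong refl arg_cong[of _ _ "\<lambda>n. z ^ n"] sum.mono_neutral_left) (auto simp: F_def)
  also have "\<dots> \<le> (\<Prod>x\<in>F. 1 / (1 - z ^ w x))"
  proof (rule prod_geometric_ge[OF F(1) _ z(1) _ \<U>(1)])
    show "0 < w x" if "x \<in> F" for x using that F(2) w_pos by blast
    show "{x. D x \<noteq> 0} \<subseteq> F" if "D \<in> \<U>" for D using that by (auto simp: F_def)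
  qed (use z1 in simp)
  finally have "ln (\<Sum>D\<in>\<U>. z ^ (\<Sum>x | D x \<noteq> 0. w x * D x)) \<le> ln (\<Prod>x\<in>F. 1 / (1 - z ^ w x))"
    using \<U> z by (intro ln_mono sum_pos) auto
  also have "\<dots> = (\<Sum>x\<in>F. ln (1 / (1 - z ^ w x)))"
    using half F by (intro ln_prod) (force simp: field_simps)+
  also have "\<dots> \<le> (\<Sum>x\<in>F. z ^ w x + 2 * (z ^ w x)\<^sup>2)"
  proof (rule sum_mono)
    fix x assume "x \<in> F"
    then show "ln (1 / (1 - z ^ w x)) \<le> z ^ w x + 2 * (z ^ w x)\<^sup>2"
      using neg_ln_one_minus_le[of "z ^ w x"] half[of x] z by (simp add: ln_div)
  qed
  also have "\<dots> = (\<Sum>x\<in>F. z ^ w x) + 2 * (\<Sum>x\<in>F. (z ^ w x)\<^sup>2)"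
    by (simp add: sum.distrib sum_distrib_left)
  also have "\<dots> \<le> (\<Sum>x\<in>F. z ^ w x) + 4 * K" using sum_squares_le[OF F z] by simp
  also have "(\<Sum>x\<in>F. z ^ w x) \<le> (\<Sum>\<^sub>\<infinity>x\<in>S. z ^ w x)"
    using F z summable_weight[OF z] by (intro finite_sum_le_infsum) auto
  finally show ?thesis by simp
qed

text \<open>Divisors are counted only up to weight d m + C and only in steps of d. Abel summation
  turns such a cumulative count into the lower bound c' / (1 - q z) for a sum over divisors, with c'
  independent of z.\<close>

lemma infsum_weight_lower:
  fixes d r C :: nat and c :: real
  assumes c: "0 < c" and d: "0 < d"
    and many: "\<And>m. r \<le> m \<Longrightarrow> \<exists>\<D>. finite \<D> \<and> c * q ^ (d * m) \<le> card \<D> \<and>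
      (\<forall>D\<in>\<D>. finite {x. D x \<noteq> 0} \<and> {x. D x \<noteq> (0::nat)} \<subseteq> S \<and>
        (\<Sum>x | D x \<noteq> 0. w x * D x) \<le> d * m + C)"
  shows "\<exists>B. \<forall>z. 1 / q\<^sup>2 \<le> z \<longrightarrow> z < 1 / q \<longrightarrow> - ln (1 - q * z) - B \<le> (\<Sum>\<^sub>\<infinity>x\<in>S. z ^ w x)"
proof -
  define R where "R m \<D> \<longleftrightarrow> finite \<D> \<and> c * q ^ (d * m) \<le> card \<D> \<and>
      (\<forall>D\<in>\<D>. finite {x. D x \<noteq> 0} \<and> {x. D x \<noteq> (0::nat)} \<subseteq> S \<and>
        (\<Sum>x | D x \<noteq> 0. w x * D x) \<le> d * m + C)" for m \<D>
  define \<D> where "\<D> m = (SOME \<D>. R m \<D>)" for m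
  have \<D>: "R m (\<D> m)" if "r \<le> m" for m
    unfolding \<D>_def using many[OF that] unfolding R_def[symmetric] by (rule someI_ex)
  \<comment> \<open>The factors are the worst cases of 1 - z, z^C and (q z)^(d r) on the given range
    of z. The 2 pays for truncating a geometric series, and d for replacing 1 - (q z)^d by 1 - q
    z.\<close>
  define c' where "c' = (1 - 1 / q) * (1 / q\<^sup>2) ^ C * c * (1 / q) ^ (d * r) / (2 * d)"
  have c': "0 < c'" using c d q by (simp add: c'_def)
  have "- ln (1 - q * z) - (4 * K - ln c') \<le> (\<Sum>\<^sub>\<infinity>x\<in>S. z ^ w x)" if z: "1 / q\<^sup>2 \<le> z" "z < 1 / q" for z
  proof -
    have z0: "0 < z" using z(1) q by (smt (verit) zero_less_divide_iff zero_less_power)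
    have z1: "z < 1" using z q by (smt (verit) divide_le_eq_1)
    define \<rho> where "\<rho> = q * z"
    have \<rho>: "1 / q \<le> \<rho>" "\<rho> < 1" "0 < \<rho>"
    proof -
      have "q * (1 / q\<^sup>2) \<le> q * z" using z(1) q by (intro mult_left_mono) auto
      then show "1 / q \<le> \<rho>" using q by (simp add: \<rho>_def power2_eq_square)
      then show "0 < \<rho>" using q by (smt (verit) zero_less_divide_iff)
      show "\<rho> < 1" using z(2) q by (simp add: \<rho>_def field_simps)
    qed
    define x where "x = \<rho> ^ d"
    have x: "0 < x" "x < 1" using \<rho> d by (auto simp: x_def power_less_one_iff)
    \<comment> \<open>M0 depends on z, but the truncation loses at most half of the geometric series
      uniformly in z.\<close>
    obtain M0 where "x ^ M0 < 1 / 2" using real_arch_pow_inv[of "1/2" x] x by auto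
    define M where "M = r + M0"
    have M: "x ^ Suc M \<le> x ^ r / 2"
    proof -
      have "x ^ Suc M = x ^ r * (x ^ M0 * x)" by (simp add: M_def power_add)
      also have "\<dots> \<le> x ^ r * (1 / 2 * 1)"
        using \<open>x ^ M0 < 1 / 2\<close> x by (intro mult_left_mono mult_mono) auto
      finally show ?thesis by simp
    qed
    define \<U> where "\<U> = (\<Union>m\<in>{r..M}. \<D> m)"
    define t where "t D = (\<Sum>x | D x \<noteq> 0. w x * D x)" for D :: "'x \<Rightarrow> nat"
    have \<U>: "finite \<U>" "\<And>D. D \<in> \<U> \<Longrightarrow> finite {x. D x \<noteq> (0::nat)} \<and> {x. D x \<noteq> 0} \<subseteq> S"
    proof -
      show "finite \<U>" using \<D> by (auto simp: \<U>_def R_def)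
      fix D assume "D \<in> \<U>"
      then obtain m where "r \<le> m" "D \<in> \<D> m" by (auto simp: \<U>_def)
      then show "finite {x. D x \<noteq> 0} \<and> {x. D x \<noteq> 0} \<subseteq> S" using \<D>[of m] unfolding R_def by blast
    qed
    have Dr: "\<D> r \<noteq> {}"
    proof -
      have "0 < c * q ^ (d * r)" using c q by simp
      then have "0 < real (card (\<D> r))" using \<D>[of r] unfolding R_def by linarith
      then show ?thesis by auto
    qed
    then have ne: "\<U> \<noteq> {}" by (auto simp: \<U>_def M_def)
    define N where "N = d * M + C"
    \<comment> \<open>Spreading the weight of D over all n from t D to N is what makes the
      cumulative counts appear after exchanging the sums.\<close>
    have tele: "(1 - z) * (\<Sum>n\<in>{t D..N}. z ^ n) \<le> z ^ t D" for D
    proof (cases "t D \<le> N")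
      case True
      have "(1 - z) * (\<Sum>n\<in>{t D..N}. z ^ n) = z ^ t D - z ^ Suc N"
        using sum_gp_multiplied[OF True, of z] by simp
      then show ?thesis using z0 by simp
    qed (use z0 in auto)
    have "c' / (1 - \<rho>) \<le> (1 - z) * z ^ C * c * (x ^ r / 2) / (1 - x)"
    proof -
      have A: "(1 - 1 / q) * (1 / q\<^sup>2) ^ C * c * (1 / q) ^ (d * r) \<le> (1 - z) * z ^ C * c * x ^ r"
        unfolding x_def power_mult[symmetric]
        using z \<rho> q c z0 by (intro mult_mono power_mono mult_nonneg_nonneg) auto
      have B: "1 - x \<le> d * (1 - \<rho>)"
      proof -
        have "1 + real d * (\<rho> - 1) \<le> (1 + (\<rho> - 1)) ^ d" using \<rho> by (intro Bernoulli_inequality) auto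
        then show ?thesis by (simp add: x_def algebra_simps)
      qed
      have "c' / (1 - \<rho>) = ((1 - 1 / q) * (1 / q\<^sup>2) ^ C * c * (1 / q) ^ (d * r)) / (2 * (d * (1 - \<rho>)))"
        by (simp add: c'_def)
      also have "\<dots> \<le> ((1 - z) * z ^ C * c * x ^ r) / (2 * (1 - x))"
        using A B x z0 z1 c by (intro frac_le mult_nonneg_nonneg) auto
      finally show ?thesis by simp
    qed
    also have "\<dots> \<le> (1 - z) * z ^ C * c * ((x ^ r - x ^ Suc M) / (1 - x))"
    proof -
      have "(1 - z) * z ^ C * c * (x ^ r / 2) \<le> (1 - z) * z ^ C * c * (x ^ r - x ^ Suc M)"
        using M z0 z1 c by (intro mult_left_mono mult_nonneg_nonneg) auto
      then have "(1 - z) * z ^ C * c * (x ^ r / 2) / (1 - x)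
          \<le> (1 - z) * z ^ C * c * (x ^ r - x ^ Suc M) / (1 - x)"
        using x by (intro divide_right_mono) auto
      then show ?thesis by (simp only: times_divide_eq_right)
    qed
    also have "(x ^ r - x ^ Suc M) / (1 - x) = (\<Sum>m=r..M. x ^ m)"
      using sum_gp_multiplied[of r M x] x by (simp add: M_def field_simps)
    also have "(1 - z) * z ^ C * c * (\<Sum>m=r..M. x ^ m) = (1 - z) * (\<Sum>m=r..M. c * q ^ (d * m) * z ^ (d * m + C))"
    proof -
      have "x ^ m = q ^ (d * m) * z ^ (d * m)" for m
        by (simp add: x_def \<rho>_def power_mult power_mult_distrib)
      then show ?thesis by (simp add: sum_distrib_left power_add mult_ac)
    qed
    also have "\<dots> \<le> (1 - z) * (\<Sum>m=r..M. real (card {D \<in> \<U>. t D \<le> d * m + C}) * z ^ (d * m + C))"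
    proof (intro mult_left_mono sum_mono mult_right_mono)
      fix m assume m: "m \<in> {r..M}"
      have "\<D> m \<subseteq> {D \<in> \<U>. t D \<le> d * m + C}" using m \<D>[of m] by (auto simp: \<U>_def t_def R_def)
      then have "card (\<D> m) \<le> card {D \<in> \<U>. t D \<le> d * m + C}" using \<U>(1) by (intro card_mono) auto
      then show "c * q ^ (d * m) \<le> real (card {D \<in> \<U>. t D \<le> d * m + C})" using \<D>[of m] m by (auto simp: R_def)
    qed (use z0 z1 in auto)
    also have "(\<Sum>m=r..M. real (card {D \<in> \<U>. t D \<le> d * m + C}) * z ^ (d * m + C))
        = (\<Sum>n\<in>(\<lambda>m. d * m + C) ` {r..M}. real (card {D \<in> \<U>. t D \<le> n}) * z ^ n)"
      using d by (subst sum.reindex) (auto simp: inj_on_def)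
    also have "\<dots> \<le> (\<Sum>n\<le>N. real (card {D \<in> \<U>. t D \<le> n}) * z ^ n)"
      using z0 by (intro sum_mono2) (auto simp: N_def)
    also have "\<dots> = (\<Sum>n\<le>N. \<Sum>D\<in>\<U>. if t D \<le> n then z ^ n else 0)"
      using \<U>(1) by (simp add: sum.If_cases Int_def)
    also have "\<dots> = (\<Sum>D\<in>\<U>. \<Sum>n\<le>N. if t D \<le> n then z ^ n else 0)" by (rule sum.swap)
    also have "\<dots> = (\<Sum>D\<in>\<U>. \<Sum>n\<in>{t D..N}. z ^ n)"
    proof (rule sum.cong[OF refl])
      show "(\<Sum>n\<le>N. if t D \<le> n then z ^ n else 0) = (\<Sum>n\<in>{t D..N}. z ^ n)" for D
        by (rule sum.mono_neutral_cong_right) auto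
    qed
    also have "(1 - z) * \<dots> = (\<Sum>D\<in>\<U>. (1 - z) * (\<Sum>n\<in>{t D..N}. z ^ n))" by (rule sum_distrib_left)
    also have "\<dots> \<le> (\<Sum>D\<in>\<U>. z ^ t D)" using tele by (rule sum_mono)
    finally have "c' / (1 - \<rho>) \<le> (\<Sum>D\<in>\<U>. z ^ t D)" using z1 by (simp add: mult_left_mono)
    then have "ln (c' / (1 - \<rho>)) \<le> ln (\<Sum>D\<in>\<U>. z ^ t D)" using c' \<rho> by (intro ln_mono) auto
    also have "\<dots> - 4 * K \<le> (\<Sum>\<^sub>\<infinity>x\<in>S. z ^ w x)"
      unfolding t_def using infsum_weight_lower_of_multisets[OF z0 z(2) \<U> ne] by simp
    finally show ?thesis using c' \<rho> by (simp add: ln_div \<rho>_def)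
  qed
  then show ?thesis by blast
qed

end

section \<open>Degree one places\<close>

definition prime_root :: "'k::field poly \<Rightarrow> 'k alg_closure"
  where "prime_root p = (SOME t. tev t p = 0)"

lemma tev_prime_root:
  assumes "(p :: 'k::field poly) \<in> prime_polys" shows "tev (prime_root p) p = 0"
proof -
  have "0 < degree (map_poly (to_ac :: 'k \<Rightarrow> _) p)"
    using assms irreducible_field_polyD(2) by (auto simp: prime_polys_def)
  then have "\<exists>t. tev t p = 0" unfolding tev_def by (rule alg_closed_imp_poly_has_root)
  then show ?thesis unfolding prime_root_def by (rule someI_ex)
qed

lemma prime_poly_degree_pos: "p \<in> prime_polys \<Longrightarrow> 0 < degree (p :: 'k::field poly)"
  using irreducible_field_polyD(2) by (auto simp: prime_polys_def)

lemma prime_poly_irreducible: "p \<in> prime_polys \<Longrightarrow> Factorial_Ring.irreducible (p :: 'k::field poly)"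
  by (simp add: prime_polys_def)

lemma inj_on_frobenius_orbit:
  assumes "p \<in> prime_polys" "tev (t :: 'k::{field,finite} alg_closure) p = 0"
  shows "inj_on (\<lambda>i. t ^ CARD('k) ^ i) {..<degree p}"
proof (rule linorder_inj_onI')
  fix i j assume ij: "i \<in> {..<degree p}" "j \<in> {..<degree p}" "i < j"
  show "t ^ CARD('k) ^ i \<noteq> t ^ CARD('k) ^ j"
  proof
    assume "t ^ CARD('k) ^ i = t ^ CARD('k) ^ j"
    also have "CARD('k) ^ j = CARD('k) ^ (j - i) * CARD('k) ^ i"
      using ij by (simp add: power_add[symmetric])
    finally have "t ^ CARD('k) ^ i = (t ^ CARD('k) ^ (j - i)) ^ CARD('k) ^ i" by (simp add: power_mult)
    then have "t ^ CARD('k) ^ (j - i) = t" using frobenius_inj by metis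
    then have "degree p \<le> j - i" using ij by (intro degree_le_of_frobenius_fixes[OF assms]) auto
    then show False using ij by auto
  qed
qed

text \<open>The Frobenius powers of t already provide as many distinct roots as the degree of
  p.\<close>

lemma roots_are_conjugate:
  assumes "p \<in> prime_polys" "tev (t :: 'k::{field,finite} alg_closure) p = 0" "tev t' p = 0"
  obtains i where "t' = t ^ CARD('k) ^ i"
proof -
  let ?R = "{x. poly (map_poly to_ac p) x = 0}" and ?C = "(\<lambda>i. t ^ CARD('k) ^ i) ` {..<degree p}"
  have nz: "map_poly to_ac p \<noteq> 0" using prime_poly_degree_pos[OF assms(1)] by auto
  have "?C \<subseteq> ?R" using tev_frobenius[of t _ p] assms(2) by (auto simp: tev_def)
  moreover have "card ?R \<le> card ?C"
    using card_poly_roots_bound[OF nz] card_image[OF inj_on_frobenius_orbit[OF assms(1,2)]] by simp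
  ultimately have "?C = ?R" using poly_roots_finite[OF nz] by (intro card_seteq) auto
  moreover have "t' \<in> ?R" using assms(3) by (simp add: tev_def)
  ultimately show ?thesis using that by blast
qed

context affine_curve
begin

lemma weighted_orbits: "\<exists>K. weighted_primes orbits card (real CARD('k)) K"
proof -
  obtain K where K: "\<And>n. card {E. finite E \<and> E \<subseteq> orbits \<and> wt E = n} \<le> K * CARD('k) ^ n"
    using card_orbit_sets_le by blast
  have "weighted_primes orbits card (real CARD('k)) (real (Suc K))"
  proof
    show "2 \<le> real CARD('k)" using finite_field_card_gt_1[where 'k='k] by simp
    fix n
    have "{E. finite E \<and> E \<subseteq> orbits \<and> sum card E = n} \<subseteq> {E. finite E \<and> E \<subseteq> orbits \<and> wt E \<le> n}"
      by (auto simp: wt_def)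
    then show "finite {E. finite E \<and> E \<subseteq> orbits \<and> sum card E = n}"
      using finite_wt_le by (rule finite_subset)
    have "card {E. finite E \<and> E \<subseteq> orbits \<and> sum card E = n} \<le> Suc K * CARD('k) ^ n"
      using K[of n] by (simp add: wt_def)
    then show "real (card {E. finite E \<and> E \<subseteq> orbits \<and> sum card E = n}) \<le> real (Suc K) * real CARD('k) ^ n"
      by (simp only: of_nat_le_iff flip: of_nat_mult of_nat_power)
  qed (use card_orbit_pos in auto)
  then show ?thesis by blast
qed

lemma q_ge_2: "2 \<le> real CARD('k)" using finite_field_card_gt_1[where 'k='k] by simp

text \<open>With z = q^(-s) the range of z is 1 < s \<le> 2 and 1 - q z is comparable to s - 1. This
  is the logarithm of a simple pole of the zeta function of the curve, up to a bounded
  error.\<close>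

lemma orbit_sum_asymptotics:
  "\<exists>B. \<forall>z. 1 / (real CARD('k))\<^sup>2 \<le> z \<longrightarrow> z < 1 / (real CARD('k)) \<longrightarrow> (\<lambda>O'. z ^ card O') summable_on orbits \<and>
     \<bar>(\<Sum>\<^sub>\<infinity>O'\<in>orbits. z ^ card O') + ln (1 - (real CARD('k)) * z)\<bar> \<le> B"
proof -
  obtain K where "weighted_primes orbits card (real CARD('k)) K" using weighted_orbits by blast
  then interpret weighted_primes orbits card "real CARD('k)" K .
  define r where "r = Suc height_defect"
  have "\<exists>B. \<forall>z. 1 / (real CARD('k))\<^sup>2 \<le> z \<longrightarrow> z < 1 / (real CARD('k)) \<longrightarrow> - ln (1 - (real CARD('k)) * z) - B \<le> (\<Sum>\<^sub>\<infinity>x\<in>orbits. z ^ card x)"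
  proof (rule infsum_weight_lower)
    show "0 < 1 / (real CARD('k)) ^ (d * r)" using q_ge_2 by simp
    show "0 < d" by (rule degree_pos)
    fix m assume m: "r \<le> m"
    obtain \<D> where \<D>: "finite \<D>" "CARD('k) ^ (d * (m - r)) \<le> card \<D>"
      "\<forall>D\<in>\<D>. finite {O'. D O' \<noteq> 0} \<and> {O'. D O' \<noteq> (0::nat)} \<subseteq> orbits \<and>
      (\<Sum>O' | D O' \<noteq> 0. card O' * D O') \<le> (m + (degree \<Delta> + height_defect)) * d"
      using card_orbit_multisets_ge[of m] m unfolding r_def by blast
    have "1 / (real CARD('k)) ^ (d * r) * (real CARD('k)) ^ (d * m) = (real CARD('k)) ^ (d * (m - r))"
      using m q_ge_2 by (simp add: diff_mult_distrib2 power_diff)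
    also have "\<dots> \<le> card \<D>" using \<D>(2) by (simp only: of_nat_le_iff flip: of_nat_power)
    finally show "\<exists>\<D>. finite \<D> \<and> 1 / (real CARD('k)) ^ (d * r) * (real CARD('k)) ^ (d * m) \<le> card \<D> \<and>
      (\<forall>D\<in>\<D>. finite {x. D x \<noteq> 0} \<and> {x. D x \<noteq> (0::nat)} \<subseteq> orbits \<and>
        (\<Sum>x | D x \<noteq> 0. card x * D x) \<le> d * m + (degree \<Delta> + height_defect) * d)"
      using \<D>(1,3) by (intro exI[of _ \<D>]) (simp add: algebra_simps)
  qed
  then obtain B where B: "\<And>z. 1 / (real CARD('k))\<^sup>2 \<le> z \<Longrightarrow> z < 1 / (real CARD('k)) \<Longrightarrow>
      - ln (1 - (real CARD('k)) * z) - B \<le> (\<Sum>\<^sub>\<infinity>x\<in>orbits. z ^ card x)" by blast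
  show ?thesis
  proof (intro exI allI impI conjI)
    fix z assume z: "1 / (real CARD('k))\<^sup>2 \<le> z" "z < 1 / (real CARD('k))"
    have z0: "0 < z" using z(1) q_ge_2 by (smt (verit) zero_less_divide_iff zero_less_power)
    show "(\<lambda>O'. z ^ card O') summable_on orbits" by (rule summable_weight[OF z0 z(2)])
    show "\<bar>(\<Sum>\<^sub>\<infinity>O'\<in>orbits. z ^ card O') + ln (1 - (real CARD('k)) * z)\<bar> \<le> max B (ln K + 2 * K)"
      using B[OF z] infsum_weight_upper[OF z0 z(2)] by linarith
  qed
qed

definition good_primes :: "'k poly set"
  where "good_primes = {p \<in> prime_polys. \<not> p dvd \<Delta>}"

text \<open>The points above one root of p whose second coordinate lies in the residue field of p;
  they represent the degree one places above p.\<close>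

definition fixed_roots :: "'k poly \<Rightarrow> 'k alg_closure set"
  where "fixed_roots p = {y \<in> fibre (prime_root p). y ^ CARD('k) ^ degree p = y}"

text \<open>The places of residue degree one over the prime of F_q[T] below them.\<close>

definition split_orbits :: "('k alg_closure \<times> 'k alg_closure) set set"
  where "split_orbits = {O' \<in> orbits. \<exists>P\<in>O'. \<exists>p\<in>prime_polys. tev (fst P) p = 0 \<and> degree p = card O'}"

lemma good_prime_root: "p \<in> good_primes \<Longrightarrow> good (prime_root p)"
  using tev_prime_root tev_eq_0_iff_dvd[OF prime_poly_irreducible] by (auto simp: good_primes_def good_def)

lemma finite_fixed_roots: "finite (fixed_roots p)"
  using finite_fibre by (simp add: fixed_roots_def)

text \<open>An orbit projects onto the roots of the prime p below it. If its size equals the degree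
  of p, exactly one of its points lies above the chosen root.\<close>

lemma bij_betw_split_orbits:
  "bij_betw (\<lambda>(p, y). orb frob2 (prime_root p, y)) (Sigma good_primes fixed_roots) split_orbits"
    and card_split_orbit: "(p, y) \<in> Sigma good_primes fixed_roots \<Longrightarrow> card (orb frob2 (prime_root p, y)) = degree p"
proof -
  have point: "(prime_root p, y) \<in> points" if "p \<in> good_primes" "y \<in> fixed_roots p" for p y
    using that good_prime_root by (auto simp: points_def fixed_roots_def)
  have card: "card (orb frob2 (prime_root p, y)) = degree p" if py: "p \<in> good_primes" "y \<in> fixed_roots p" for p y
  proof (rule antisym)
    let ?P = "(prime_root p, y)"
    have p: "p \<in> prime_polys" using py by (simp add: good_primes_def)
    note root = tev_prime_root[OF p]
    have "(frob2 ^^ degree p) ?P = ?P"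
      using py frobenius_fixes_root[OF p root] by (simp add: frob2_funpow fixed_roots_def)
    then have "card (orb frob2 ?P) dvd degree p" using funpow_eq_iff_card_orb_dvd[OF periodic_frob2] by blast
    then show "card (orb frob2 ?P) \<le> degree p" using prime_poly_degree_pos[OF p] by (rule dvd_imp_le)
    have "orb frob2 ?P \<in> orbits" using point[OF py] by (simp add: orbits_def)
    then show "degree p \<le> card (orb frob2 ?P)"
      using orbit_coordinates(1)[of "orb frob2 ?P" ?P] card_orbit_pos
      by (intro degree_le_of_frobenius_fixes[OF p root]) auto
  qed
  then show "(p, y) \<in> Sigma good_primes fixed_roots \<Longrightarrow> card (orb frob2 (prime_root p, y)) = degree p"
    by auto
  have inj: "inj_on (\<lambda>(p, y). orb frob2 (prime_root p, y)) (Sigma good_primes fixed_roots)"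
  proof (rule inj_onI, clarify)
    fix p y p' y'
    assume py: "p \<in> good_primes" "y \<in> fixed_roots p" "p' \<in> good_primes" "y' \<in> fixed_roots p'"
      and eq: "orb frob2 (prime_root p, y) = orb frob2 (prime_root p', y')"
    have p: "p \<in> prime_polys" "p' \<in> prime_polys" using py by (auto simp: good_primes_def)
    have "(prime_root p', y') \<in> orb frob2 (prime_root p, y)" using eq by simp
    then obtain i where "i < card (orb frob2 (prime_root p, y))" "(prime_root p', y') = (frob2 ^^ i) (prime_root p, y)"
      using bij_betw_imp_surj_on[OF bij_betw_funpow_orb[OF periodic_frob2, of "(prime_root p, y)"]] by auto
    then have i: "i < degree p" "prime_root p' = prime_root p ^ CARD('k) ^ i" "y' = y ^ CARD('k) ^ i"
      using card py by (auto simp: frob2_funpow)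
    have "tev (prime_root p') p = 0" unfolding i(2) using tev_prime_root[OF p(1)] by (simp add: tev_frobenius)
    then have pp: "p = p'" using minimal_poly_unique[OF p] tev_prime_root[OF p(2)] by blast
    have "prime_root p ^ CARD('k) ^ i = prime_root p'" by (rule i(2)[symmetric])
    also have "\<dots> = prime_root p ^ CARD('k) ^ 0" by (simp add: pp)
    finally have "i = 0"
      by (rule inj_onD[OF inj_on_frobenius_orbit[OF p(1) tev_prime_root[OF p(1)]]]) (use i(1) in auto)
    then show "p = p' \<and> y = y'" using i(3) pp by simp
  qed
  have "(\<lambda>(p, y). orb frob2 (prime_root p, y)) ` Sigma good_primes fixed_roots = split_orbits"
  proof (intro equalityI subsetI)
    fix O' assume "O' \<in> (\<lambda>(p, y). orb frob2 (prime_root p, y)) ` Sigma good_primes fixed_roots"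
    then obtain p y where py: "p \<in> good_primes" "y \<in> fixed_roots p" "O' = orb frob2 (prime_root p, y)" by auto
    have "(prime_root p, y) \<in> O'" "O' \<in> orbits" "card O' = degree p"
      using py point[OF py(1,2)] card[OF py(1,2)] by (auto simp: orbits_def)
    moreover have "p \<in> prime_polys" "tev (prime_root p) p = 0"
      using py(1) tev_prime_root by (auto simp: good_primes_def)
    ultimately show "O' \<in> split_orbits" unfolding split_orbits_def by force
  next
    fix O' assume "O' \<in> split_orbits"
    then obtain P p where P: "O' \<in> orbits" "P \<in> O'" "p \<in> prime_polys" "tev (fst P) p = 0" "degree p = card O'"
      by (auto simp: split_orbits_def)
    obtain i where i: "prime_root p = fst P ^ CARD('k) ^ i"
      using roots_are_conjugate[OF P(3,4) tev_prime_root[OF P(3)]] .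
    define P' where "P' = (frob2 ^^ i) P"
    have P': "P' \<in> O'" using orbitsD(2)[OF P(1,2)] orb_funpow[of i frob2 P] by (simp add: P'_def)
    define y where "y = snd P'"
    have P'_eq: "P' = (prime_root p, y)" by (simp add: P'_def y_def frob2_funpow i)
    have "P' \<in> points" by (rule orbitsD(1)[OF P(1) P'])
    then have gy: "good (prime_root p)" "y \<in> fibre (prime_root p)" by (auto simp: P'_eq points_def)
    have "p \<in> good_primes"
      using gy(1) P(3) tev_eq_0_iff_dvd[OF prime_poly_irreducible tev_prime_root] by (auto simp: good_primes_def good_def)
    moreover have "y \<in> fixed_roots p"
      using gy(2) orbit_coordinates(2)[OF P(1) P'] P(5) by (simp add: fixed_roots_def y_def)
    moreover have "O' = orb frob2 (prime_root p, y)" using orbitsD(2)[OF P(1) P'] by (simp add: P'_eq)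
    ultimately show "O' \<in> (\<lambda>(p, y). orb frob2 (prime_root p, y)) ` Sigma good_primes fixed_roots"
      by (intro image_eqI[of _ _ "(p, y)"]) auto
  qed
  with inj show "bij_betw (\<lambda>(p, y). orb frob2 (prime_root p, y)) (Sigma good_primes fixed_roots) split_orbits"
    by (simp add: bij_betw_def)
qed

text \<open>For such an orbit of size e the prime below has as degree a proper divisor of e, hence
  at most e / 2. There are at most 2 q^(e / 2) elements t of that kind, each with d points above
  it.\<close>

lemma card_nonsplit_orbits_le:
  "finite {O' \<in> orbits - split_orbits. card O' = e}"
  "real (card {O' \<in> orbits - split_orbits. card O' = e}) \<le> 2 * d * sqrt (real CARD('k)) ^ e"
proof -
  let ?N = "{O' \<in> orbits - split_orbits. card O' = e}"
  show fin: "finite ?N" using finite_orbits_card_le[of e] by (rule finite_subset[rotated]) auto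
  define T where "T = (\<Union>m\<in>{1..e div 2}. {t :: 'k alg_closure. t ^ CARD('k) ^ m = t})"
  have fixq: "finite {t :: 'k alg_closure. t ^ CARD('k) ^ m = t}" "card {t :: 'k alg_closure. t ^ CARD('k) ^ m = t} \<le> CARD('k) ^ m"
    if "m \<in> {1..e div 2}" for m
    by (rule card_power_fixed_le, rule card_power_gt_1, use that in simp)+
  have finT: "finite T" unfolding T_def by (rule finite_UN_I[OF _ fixq(1)]) auto
  have geo: "(\<Sum>m\<in>{1..k}. CARD('k) ^ m) \<le> 2 * CARD('k) ^ k" for k
  proof (induction k)
    case (Suc k)
    have "2 * CARD('k) ^ k \<le> CARD('k) ^ Suc k"
      using finite_field_card_gt_1[where 'k='k] by simp
    moreover have "(\<Sum>m\<in>{1..Suc k}. CARD('k) ^ m) = (\<Sum>m\<in>{1..k}. CARD('k) ^ m) + CARD('k) ^ Suc k"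
      by simp
    ultimately show ?case using Suc by linarith
  qed simp
  have cardT: "card T \<le> 2 * CARD('k) ^ (e div 2)"
  proof -
    have "card T \<le> (\<Sum>m\<in>{1..e div 2}. card {t :: 'k alg_closure. t ^ CARD('k) ^ m = t})"
      unfolding T_def by (rule card_UN_le) simp
    also have "\<dots> \<le> (\<Sum>m\<in>{1..e div 2}. CARD('k) ^ m)" using fixq(2) by (rule sum_mono)
    also have "\<dots> \<le> 2 * CARD('k) ^ (e div 2)" by (rule geo)
    finally show ?thesis .
  qed
  define rep where "rep O' = (SOME P. P \<in> O')" for O' :: "('k alg_closure \<times> 'k alg_closure) set"
  have rep: "rep O' \<in> O'" if "O' \<in> ?N" for O'
  proof -
    have "\<exists>P. P \<in> O'" using that orbit_nonempty by blast
    then show ?thesis unfolding rep_def by (rule someI_ex)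
  qed
  have "rep ` ?N \<subseteq> Sigma {t \<in> T. good t} fibre"
  proof (rule image_subsetI)
    fix O' assume O': "O' \<in> ?N"
    then have orb: "O' \<in> orbits" and e: "card O' = e" by auto
    note coord = orbit_coordinates(1)[OF orb rep[OF O']]
    have pt: "rep O' \<in> points" by (rule orbitsD(1)[OF orb rep[OF O']])
    obtain p where p: "Factorial_Ring.irreducible p" "lead_coeff p = 1" "tev (fst (rep O')) p = 0"
      by (rule exists_minimal_poly)
    then have pp: "p \<in> prime_polys" by (simp add: prime_polys_def)
    let ?t = "fst (rep O')" and ?F = "\<lambda>x :: 'k alg_closure. x ^ CARD('k)"
    have iter: "(?F ^^ i) t = t ^ CARD('k) ^ i" for i t
      by (induction i) (auto simp: power_mult[symmetric] mult.commute)
    have fixt: "?t ^ CARD('k) ^ degree p = ?t" by (rule frobenius_fixes_root[OF pp p(3)])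
    have per: "periodic ?F ?t" unfolding periodic_def iter using fixt prime_poly_degree_pos[OF pp] by blast
    have "card (orb ?F ?t) dvd degree p" using funpow_eq_iff_card_orb_dvd[OF per] fixt by (simp add: iter)
    moreover have "degree p \<le> card (orb ?F ?t)"
      using funpow_eq_iff_card_orb_dvd[OF per, of "card (orb ?F ?t)"] card_orb_pos[OF per]
      by (intro degree_le_of_frobenius_fixes[OF pp p(3)]) (auto simp: iter)
    ultimately have "card (orb ?F ?t) = degree p"
      using prime_poly_degree_pos[OF pp] by (metis dvd_imp_le le_antisym)
    then have dvd: "degree p dvd e" using funpow_eq_iff_card_orb_dvd[OF per, of e] coord e by (simp add: iter)
    have "degree p \<noteq> e" using O' rep[OF O'] pp p(3) e by (auto simp: split_orbits_def)
    have "0 < e" using card_orbit_pos[OF orb] e by simp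
    obtain k where k: "e = degree p * k" using dvd by (elim dvdE)
    have "k \<noteq> 0" "k \<noteq> 1" using k \<open>0 < e\<close> \<open>degree p \<noteq> e\<close> by auto
    then have "2 \<le> k" by simp
    then have "degree p * 2 \<le> e" unfolding k by (rule mult_left_mono) simp
    then have "degree p \<in> {1..e div 2}" using prime_poly_degree_pos[OF pp] by auto
    then have "?t \<in> T" unfolding T_def by (rule UN_I) (simp only: mem_Collect_eq fixt)
    then show "rep O' \<in> Sigma {t \<in> T. good t} fibre"
      using pt by (cases "rep O'") (auto simp: points_def)
  qed
  moreover have "inj_on rep ?N"
  proof (rule inj_onI)
    fix A B assume *: "A \<in> ?N" "B \<in> ?N" "rep A = rep B"
    then have "rep A \<in> A \<inter> B" using rep[of A] rep[of B] by simp
    then show "A = B" using orbits_disjoint[of A B] * by auto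
  qed
  moreover have "finite (Sigma {t \<in> T. good t} fibre)" using finT finite_fibre by auto
  ultimately have "card ?N \<le> card (Sigma {t \<in> T. good t} fibre)" using card_inj_on_le by blast
  also have "\<dots> = (\<Sum>t\<in>{t \<in> T. good t}. card (fibre t))" using finT finite_fibre by (intro card_SigmaI) auto
  also have "\<dots> = card {t \<in> T. good t} * d" using card_fibre by simp
  also have "\<dots> \<le> card T * d" using finT by (intro mult_right_mono card_mono) auto
  also have "\<dots> \<le> 2 * CARD('k) ^ (e div 2) * d" using cardT by (rule mult_right_mono) simp
  finally have "real (card ?N) \<le> real (2 * CARD('k) ^ (e div 2) * d)" by (simp only: of_nat_le_iff)
  also have "\<dots> = 2 * d * sqrt (real CARD('k)) ^ (2 * (e div 2))" by (simp add: power_mult mult_ac)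
  also have "\<dots> \<le> 2 * d * sqrt (real CARD('k)) ^ e"
    using q_ge_2 by (intro mult_left_mono power_increasing) auto
  finally show "real (card ?N) \<le> 2 * d * sqrt (real CARD('k)) ^ e" .
qed

text \<open>Places of higher residue degree are so rare that discarding them changes the sum over
  all places by a bounded amount.\<close>

theorem fixed_roots_asymptotics:
  "\<exists>B. \<forall>z. 1 / (real CARD('k))\<^sup>2 \<le> z \<longrightarrow> z < 1 / (real CARD('k)) \<longrightarrow>
     (\<lambda>p. real (card (fixed_roots p)) * z ^ degree p) summable_on good_primes \<and>
     \<bar>(\<Sum>\<^sub>\<infinity>p\<in>good_primes. real (card (fixed_roots p)) * z ^ degree p) + ln (1 - (real CARD('k)) * z)\<bar> \<le> B"
proof -
  obtain B where B: "\<And>z. 1 / (real CARD('k))\<^sup>2 \<le> z \<Longrightarrow> z < 1 / (real CARD('k)) \<Longrightarrow> (\<lambda>O'. z ^ card O') summable_on orbits \<and>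
     \<bar>(\<Sum>\<^sub>\<infinity>O'\<in>orbits. z ^ card O') + ln (1 - (real CARD('k)) * z)\<bar> \<le> B"
    using orbit_sum_asymptotics by blast
  \<comment> \<open>For z < 1 / q the discarded orbits are dominated by a geometric series with
    ratio sqrt q z, which is below 1 / sqrt q.\<close>
  define B' where "B' = 2 * d / (1 - 1 / sqrt (real CARD('k)))"
  show ?thesis
  proof (intro exI allI impI)
    fix z assume z: "1 / (real CARD('k))\<^sup>2 \<le> z" "z < 1 / (real CARD('k))"
    have z0: "0 < z" using z(1) q_ge_2 by (smt (verit) zero_less_divide_iff zero_less_power)
    have summ: "(\<lambda>O'. z ^ card O') summable_on orbits" using B[OF z] by blast
    have summ': "(\<lambda>O'. z ^ card O') summable_on A" if "A \<subseteq> orbits" for A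
      using summ that by (rule summable_on_subset_banach)
    have sub: "split_orbits \<subseteq> orbits" by (auto simp: split_orbits_def)
    have split: "(\<Sum>\<^sub>\<infinity>O'\<in>orbits. z ^ card O')
        = (\<Sum>\<^sub>\<infinity>O'\<in>split_orbits. z ^ card O') + (\<Sum>\<^sub>\<infinity>O'\<in>orbits - split_orbits. z ^ card O')"
      using infsum_Un_disjoint[OF summ' summ', of split_orbits "orbits - split_orbits"] sub
      by (simp add: Un_absorb1)
    have rest: "(\<Sum>\<^sub>\<infinity>O'\<in>orbits - split_orbits. z ^ card O') \<le> B'"
    proof (rule infsum_le_finite_sums[OF summ'])
      fix F assume F: "finite F" "F \<subseteq> orbits - split_orbits"
      have sq: "sqrt (real CARD('k)) * z \<le> 1 / sqrt (real CARD('k))"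
      proof -
        have "sqrt (real CARD('k)) * z \<le> sqrt (real CARD('k)) * (1 / (real CARD('k)))" using z q_ge_2 by (intro mult_left_mono) auto
        also have "\<dots> = 1 / sqrt (real CARD('k))" using q_ge_2 by (simp add: field_simps)
        finally show ?thesis .
      qed
      have lt1: "1 / sqrt (real CARD('k)) < 1" using q_ge_2 by (simp add: field_simps)
      have "(\<Sum>O'\<in>F. z ^ card O') \<le> (2 * d) / (1 - sqrt (real CARD('k)) * z)"
      proof (rule sum_power_weight_le)
        fix n
        have "card {x \<in> F. card x = n} \<le> card {O' \<in> orbits - split_orbits. card O' = n}"
          using F card_nonsplit_orbits_le(1)[of n] by (intro card_mono) auto
        then show "real (card {x \<in> F. card x = n}) \<le> (2 * d) * sqrt (real CARD('k)) ^ n"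
          using card_nonsplit_orbits_le(2)[of n] by simp
        show "sqrt (real CARD('k)) * z < 1" by (rule le_less_trans[OF sq lt1])
      qed (use F z0 in auto)
      also have "\<dots> \<le> B'" unfolding B'_def 
      proof (rule divide_left_mono)
        show "0 < (1 - sqrt (real CARD('k)) * z) * (1 - 1 / sqrt (real CARD('k)))"
          using le_less_trans[OF sq lt1] lt1 by (intro mult_pos_pos) linarith+
      qed (use sq in simp_all)
      finally show "(\<Sum>O'\<in>F. z ^ card O') \<le> B'" .
    qed auto
    have rest0: "0 \<le> (\<Sum>\<^sub>\<infinity>O'\<in>orbits - split_orbits. z ^ card O')" using z0 by (intro infsum_nonneg) auto
    let ?g = "\<lambda>(p, y). z ^ card (orb frob2 (prime_root p, y))"
    have g: "?g summable_on Sigma good_primes fixed_roots"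
      "infsum ?g (Sigma good_primes fixed_roots) = (\<Sum>\<^sub>\<infinity>O'\<in>split_orbits. z ^ card O')"
      using summable_on_reindex_bij_betw[OF bij_betw_split_orbits, of "\<lambda>O'. z ^ card O'"]
        infsum_reindex_bij_betw[OF bij_betw_split_orbits, of "\<lambda>O'. z ^ card O'"] summ'[OF sub]
      by (simp_all add: case_prod_unfold)
    let ?h = "\<lambda>(p, y). z ^ degree p"
    have gh: "?g P = ?h P" if "P \<in> Sigma good_primes fixed_roots" for P
      using that card_split_orbit by (cases P) auto
    have h: "?h summable_on Sigma good_primes fixed_roots"
      "infsum ?h (Sigma good_primes fixed_roots) = (\<Sum>\<^sub>\<infinity>O'\<in>split_orbits. z ^ card O')"
      using g summable_on_cong[OF gh, of "Sigma good_primes fixed_roots" "\<lambda>x. x"]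
        infsum_cong[OF gh, of "Sigma good_primes fixed_roots" "\<lambda>x. x"] by simp_all
    have inner: "(\<Sum>\<^sub>\<infinity>y\<in>fixed_roots p. z ^ degree p) = real (card (fixed_roots p)) * z ^ degree p" for p
      using finite_fixed_roots by simp
    have sm: "(\<lambda>p. real (card (fixed_roots p)) * z ^ degree p) summable_on good_primes"
      using summable_on_Sigma[OF isUCont_plus h(1)] finite_fixed_roots by (simp add: inner)
    have "(\<Sum>\<^sub>\<infinity>p\<in>good_primes. real (card (fixed_roots p)) * z ^ degree p) = (\<Sum>\<^sub>\<infinity>O'\<in>split_orbits. z ^ card O')"
      using infsum_Sigma_banach[OF h(1)] h(2) by (simp add: inner)
    then have "\<bar>(\<Sum>\<^sub>\<infinity>p\<in>good_primes. real (card (fixed_roots p)) * z ^ degree p) + ln (1 - (real CARD('k)) * z)\<bar> \<le> B + B'"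
      using B[OF z] rest rest0 split by linarith
    with sm show "(\<lambda>p. real (card (fixed_roots p)) * z ^ degree p) summable_on good_primes \<and>
     \<bar>(\<Sum>\<^sub>\<infinity>p\<in>good_primes. real (card (fixed_roots p)) * z ^ degree p) + ln (1 - (real CARD('k)) * z)\<bar> \<le> B + B'" by blast
  qed
qed

end

text \<open>The curve Y = 0 has exactly one point above every t, and \<Delta> = 1 makes every prime
  good.\<close>

theorem prime_sum_asymptotics:
  "\<exists>B. \<forall>z. 1 / (real CARD('k))\<^sup>2 \<le> z \<longrightarrow> z < 1 / real CARD('k) \<longrightarrow>
     (\<lambda>p. z ^ degree p) summable_on (prime_polys :: 'k::{field,finite} poly set) \<and>
     \<bar>(\<Sum>\<^sub>\<infinity>p\<in>(prime_polys :: 'k poly set). z ^ degree p) + ln (1 - real CARD('k) * z)\<bar> \<le> B"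
proof -
  interpret affine_curve "[:0, 1:] :: 'k poly poly" 1 0 1
  proof
    show "Factorial_Ring.irreducible (map_poly to_fract ([:0, 1:] :: 'k poly poly))"
      by (simp add: hom_distribs irreducible_linear_field_poly)
  qed (auto simp: pderiv_pCons one_pCons)
  have gp: "good_primes = prime_polys"
    using prime_poly_degree_pos by (fastforce simp: good_primes_def is_unit_iff_degree)
  have "fixed_roots p = {0}" for p by (auto simp: fixed_roots_def fibre_def power_0_left)
  then show ?thesis using fixed_roots_asymptotics by (simp add: gp)
qed

section \<open>Subfields of the algebraic closure\<close>

lemma ambient_simps [simp]:
  "carrier (ambient :: 'a::field alg_closure ring) = UNIV" "x \<otimes>\<^bsub>ambient\<^esub> y = x * y" "x \<oplus>\<^bsub>ambient\<^esub> y = x + y"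
  "\<one>\<^bsub>ambient\<^esub> = 1" "\<zero>\<^bsub>ambient\<^esub> = 0"
  by (simp_all add: ring_of_type_algebra_def)

interpretation ambient: cring "ambient :: 'a::field alg_closure ring"
  by (rule cring_from_type_algebra)

lemma ambient_minus [simp]: "\<ominus>\<^bsub>ambient\<^esub> x = - x"
  by (rule ambient.minus_equality) auto

lemma ambient_inv [simp]: "x \<noteq> 0 \<Longrightarrow> inv\<^bsub>ambient\<^esub> x = inverse x"
  by (rule ambient.comm_inv_char) auto

lemma subfield_ambientD:
  assumes "subfield S ambient"
  shows "0 \<in> S" "1 \<in> S" "x \<in> S \<Longrightarrow> y \<in> S \<Longrightarrow> x + y \<in> S" "x \<in> S \<Longrightarrow> y \<in> S \<Longrightarrow> x * y \<in> S"
    "x \<in> S \<Longrightarrow> - x \<in> S" "x \<in> S \<Longrightarrow> y \<in> S \<Longrightarrow> x - y \<in> S" "x \<in> S \<Longrightarrow> inverse x \<in> S"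
proof -
  note sub = subringE[OF subfieldE(1)[OF assms]]
  show "0 \<in> S" "1 \<in> S" "x \<in> S \<Longrightarrow> y \<in> S \<Longrightarrow> x + y \<in> S" "x \<in> S \<Longrightarrow> y \<in> S \<Longrightarrow> x * y \<in> S" "x \<in> S \<Longrightarrow> - x \<in> S"
    using sub(2,3,5,6,7)[simplified] by auto
  then show "x \<in> S \<Longrightarrow> y \<in> S \<Longrightarrow> x - y \<in> S" using sub(5,7)[simplified] by (metis diff_conv_add_uminus)
  show "x \<in> S \<Longrightarrow> inverse x \<in> S"
    using ambient.subfield_m_inv(1)[OF assms, of x] \<open>0 \<in> S\<close> by (cases "x = 0") auto
qed

lemma subfield_ambientI:
  assumes "1 \<in> S" "\<And>x y. x \<in> S \<Longrightarrow> y \<in> S \<Longrightarrow> x + y \<in> S" "\<And>x y. x \<in> S \<Longrightarrow> y \<in> S \<Longrightarrow> x * y \<in> S"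
    "\<And>x. x \<in> S \<Longrightarrow> - x \<in> S" "\<And>x. x \<in> S \<Longrightarrow> x \<noteq> 0 \<Longrightarrow> inverse x \<in> S"
  shows "subfield S ambient"
proof (rule field.subfieldI'[OF field_from_type_algebra])
  show "subring S ambient" using assms by (intro ambient.subringI) auto
qed (use assms in auto)

lemma subfield_base_field: "subfield (base_field :: 'a::field alg_closure set) ambient"
proof (rule subfield_ambientI)
  show "1 \<in> (base_field :: 'a alg_closure set)" by (rule range_eqI[of _ _ 1]) simp
qed (auto simp flip: to_ac_add to_ac_mult to_ac_minus to_ac_inverse)

text \<open>Since x is algebraic, the polynomials in x already form the field generated by
  x.\<close>

definition adj :: "'a::field alg_closure \<Rightarrow> 'a alg_closure set"
  where "adj x = range (tev x)"

lemma base_subset_adj: "base_field \<subseteq> adj x"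
proof clarify
  fix c show "to_ac c \<in> adj x" unfolding adj_def by (rule range_eqI[of _ _ "[:c:]"]) simp
qed

lemma tev_X [simp]: "tev x [:0, 1:] = x"
  by simp

lemma self_in_adj: "x \<in> adj x"
  unfolding adj_def by (rule range_eqI[of _ _ "[:0, 1:]"]) simp

lemma subfield_adj: "subfield (adj x) ambient"
proof (rule subfield_ambientI)
  show "1 \<in> adj x" using base_subset_adj[of x] by (metis rangeI subsetD to_ac_1)
  show "y + z \<in> adj x" if "y \<in> adj x" "z \<in> adj x" for y z
    using that by (auto simp: adj_def simp flip: tev.base.hom_add)
  show "y * z \<in> adj x" if "y \<in> adj x" "z \<in> adj x" for y z
    using that by (auto simp: adj_def simp flip: tev.base.hom_mult)
  show "- y \<in> adj x" if "y \<in> adj x" for y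
    using that by (auto simp: adj_def simp flip: tev.base.hom_uminus)
  show "inverse y \<in> adj x" if y: "y \<in> adj x" "y \<noteq> 0" for y
  proof -
    obtain P where P: "y = tev x P" using y(1) by (auto simp: adj_def)
    obtain p where p: "Factorial_Ring.irreducible p" "lead_coeff p = 1" "tev x p = 0"
      by (rule exists_minimal_poly)
    have "\<not> p dvd P" using y(2) tev_eq_0_iff_dvd[OF p(1,3)] P by simp
    then obtain a b where "a * p + b * P = 1" using irreducible_bezout[OF p(1)] by blast
    then have "tev x (a * p + b * P) = 1" by simp
    then have "tev x b * y = 1" using p(3) by (simp add: hom_distribs P)
    then have "inverse y = tev x b" by (metis inverse_unique mult.commute)
    then show ?thesis by (simp add: adj_def)
  qed
qed

lemma tev_in_subfield:
  assumes "subfield S ambient" "base_field \<subseteq> S" "x \<in> S"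
  shows "tev x P \<in> S"
proof (induction P)
  case 0 then show ?case using subfield_ambientD(1)[OF assms(1)] by simp
next
  case (pCons c P)
  have "to_ac c \<in> S" using assms(2) by blast
  then show ?case using subfield_ambientD(3,4)[OF assms(1)] assms(3) pCons by simp
qed

lemma adj_subset: "subfield S ambient \<Longrightarrow> base_field \<subseteq> S \<Longrightarrow> x \<in> S \<Longrightarrow> adj x \<subseteq> S"
  using tev_in_subfield unfolding adj_def by blast

lemma adj_mono: "x \<in> adj y \<Longrightarrow> adj x \<subseteq> adj y"
  by (intro adj_subset subfield_adj base_subset_adj)

lemma finite_dimension_adj: "ring.finite_dimension ambient base_field (adj x)"
proof -
  obtain p where p: "Factorial_Ring.irreducible p" "lead_coeff p = 1" "tev x p = 0"
    by (rule exists_minimal_poly)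
  define Us where "Us = map (\<lambda>i. x ^ i) [0..<degree p]"
  note Span = ambient.Span_subgroup_props[OF subfield_base_field, of Us]
    ambient.Span_smult_closed[OF subfield_base_field, of Us]
    ambient.Span_base_incl[OF subfield_base_field, of Us]
  have pow: "x ^ i \<in> ambient.Span base_field Us" if "i < degree p" for i
    using Span(6) that by (auto simp: Us_def)
  have "adj x \<subseteq> ambient.Span base_field Us"
  proof
    fix y assume "y \<in> adj x"
    then obtain P where P: "y = tev x P" by (auto simp: adj_def)
    obtain Q where Q: "tev x Q = tev x P" "degree Q < degree p"
      by (rule tev_eq_exists_degree_less[OF p(1,3)])
    have "y = (\<Sum>i<degree p. to_ac (coeff Q i) * x ^ i)"
      using poly_eq_sum_less[of "map_poly to_ac Q" "degree p" x] Q by (simp add: P tev_def)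
    also have "\<dots> \<in> ambient.Span base_field Us"
    proof -
      have "(\<Sum>i\<in>I. to_ac (coeff Q i) * x ^ i) \<in> ambient.Span base_field Us" if "finite I" "I \<subseteq> {..<degree p}" for I
        using that
      proof (induction I rule: finite_induct)
        case empty then show ?case using Span(2) by simp
      next
        case (insert i I)
        have "to_ac (coeff Q i) * x ^ i \<in> ambient.Span base_field Us"
          using Span(5)[of "to_ac (coeff Q i)" "x ^ i"] pow insert by simp
        then show ?case using Span(3) insert by simp
      qed
      then show ?thesis by simp
    qed
    finally show "y \<in> ambient.Span base_field Us" .
  qed
  moreover have "ambient.finite_dimension base_field (ambient.Span base_field Us)"
    by (rule ambient.Span_finite_dimension[OF subfield_base_field]) simp
  moreover have "subalgebra base_field (adj x) ambient"
  proof (intro subalgebra.intro subalgebra_axioms.intro)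
    show "subgroup (adj x) (add_monoid ambient)"
      using subringE(1)[OF subfieldE(1)[OF subfield_adj]] subfieldE(1)[OF subfield_adj]
      by (intro subring.axioms(1)) auto
    show "k \<otimes>\<^bsub>ambient\<^esub> v \<in> adj x" if "k \<in> base_field" "v \<in> adj x" for k v
      using subfield_ambientD(4)[OF subfield_adj, of k x v] base_subset_adj[of x] that by auto
  qed
  ultimately show ?thesis
    using ambient.subalbegra_incl_imp_finite_dimension[OF subfield_base_field] by blast
qed

section \<open>Primitive elements\<close>

lemma poly_division_in_subfield:
  fixes g :: "'a::field alg_closure poly"
  assumes S: "subfield S ambient" and g: "lead_coeff g = 1" "0 < degree g" "\<And>i. coeff g i \<in> S"
  shows "(\<And>i. coeff P i \<in> S) \<Longrightarrow> \<exists>r. g dvd P - r \<and> degree r < degree g \<and> (\<forall>i. coeff r i \<in> S)"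
proof (induction "degree P" arbitrary: P rule: less_induct)
  case less
  note cl = subfield_ambientD[OF S]
  show ?case
  proof (cases "degree P < degree g")
    case True
    then show ?thesis using less.prems by (intro exI[of _ P]) auto
  next
    case False
    define M where "M = monom (lead_coeff P) (degree P - degree g) * g"
    have M: "degree M = degree P" "lead_coeff M = lead_coeff P"
    proof -
      have "P \<noteq> 0" using False g(2) by auto
      then have nz: "monom (lead_coeff P) (degree P - degree g) \<noteq> 0" "g \<noteq> 0" using g by auto
      show "degree M = degree P"
        using False nz \<open>P \<noteq> 0\<close> by (simp add: M_def degree_mult_eq degree_monom_eq)
      show "lead_coeff M = lead_coeff P" using g(1) \<open>P \<noteq> 0\<close> by (simp add: M_def lead_coeff_mult degree_monom_eq)
    qed
    have cM: "coeff M i \<in> S" for i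
      using less.prems g(3) cl(1,4) by (auto simp: M_def coeff_monom_mult)
    have "degree (P - M) < degree P"
    proof -
      have "degree P \<noteq> 0" using False g(2) by simp
      moreover have "degree (P - M) \<le> degree P" using M by (intro degree_diff_le) auto
      moreover have "coeff (P - M) (degree P) = 0" using M by simp
      ultimately show ?thesis
        by (metis degree_0 gr0I leading_coeff_0_iff le_neq_implies_less)
    qed
    moreover have "coeff (P - M) i \<in> S" for i using cM less.prems cl(6) by simp
    ultimately obtain r where r: "g dvd (P - M) - r" "degree r < degree g" "\<forall>i. coeff r i \<in> S"
      using less.hyps by blast
    have "P - r = ((P - M) - r) + monom (lead_coeff P) (degree P - degree g) * g" by (simp add: M_def)
    then have "g dvd P - r" using r(1) by (metis dvd_add dvd_triv_right)
    then show ?thesis using r by blast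
  qed
qed

lemma rsquarefree_dvd:
  fixes p :: "'a::field poly"
  assumes "rsquarefree p" "q dvd p" shows "rsquarefree q"
proof -
  obtain k where k: "p = q * k" using assms(2) by (elim dvdE)
  have nz: "q * k \<noteq> 0" using assms(1) by (simp add: k rsquarefree_def)
  have "order a q = 0 \<or> order a q = 1" for a
  proof -
    have "order a p = 0 \<or> order a p = 1" using assms(1) by (simp add: rsquarefree_def)
    moreover have "order a p = order a q + order a k" unfolding k using nz by (rule order_mult)
    ultimately show ?thesis by linarith
  qed
  then show ?thesis using nz by (auto simp: rsquarefree_def)
qed

lemma separable_elementE:
  assumes "separable_element x"
  obtains p where "Factorial_Ring.irreducible p" "lead_coeff p = 1" "tev x p = 0" "rsquarefree (map_poly to_ac p)"
proof -
  obtain p0 where p0: "Factorial_Ring.irreducible p0" "tev x p0 = 0" "rsquarefree (map_poly to_ac p0)"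
    using assms by (auto simp: separable_element_def tev_def)
  obtain p where p: "Factorial_Ring.irreducible p" "lead_coeff p = 1" "tev x p = 0" by (rule exists_minimal_poly)
  have "p dvd p0" using tev_eq_0_iff_dvd p p0 by blast
  then have "map_poly to_ac p dvd map_poly to_ac p0" by (rule to_ac.hom_dvd)
  then have "rsquarefree (map_poly to_ac p)" by (rule rsquarefree_dvd[OF p0(3)])
  then show ?thesis using that p by blast
qed

text \<open>The classical argument: for \<theta> = a + c b and all but finitely many c, the
  polynomials g(X) and f(\<theta> - c X) over the field of \<theta> have b as their only common
  root. As g is separable, the minimal polynomial of b over that field is linear.\<close>

lemma two_generators:
  assumes inf: "infinite (UNIV :: 'a::field set)" and b: "separable_element (b :: 'a alg_closure)"
  shows "\<exists>c. a \<in> adj (a + to_ac c * b) \<and> b \<in> adj (a + to_ac c * b)"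
proof -
  obtain g where g: "Factorial_Ring.irreducible g" "lead_coeff g = 1" "tev b g = 0" "rsquarefree (map_poly to_ac g)"
    using separable_elementE[OF b] .
  obtain f where f: "Factorial_Ring.irreducible f" "lead_coeff f = 1" "tev a f = 0" by (rule exists_minimal_poly)
  have fin: "finite {x. tev x f = 0}" "finite {x. tev x g = 0}"
    unfolding tev_def using irreducible_field_polyD(1)[OF f(1)] irreducible_field_polyD(1)[OF g(1)]
    by (auto intro!: poly_roots_finite)
  \<comment> \<open>The values of c that would create a second common root. Pairs with b' = b give
    the default quotient 0 and only exclude c = 0.\<close>
  let ?bad = "(\<lambda>(a', b'). of_ac ((a' - a) / (b - b'))) ` ({x. tev x f = 0} \<times> {x. tev x g = 0})"
  have "finite ?bad" using fin by blast
  then obtain c where c: "c \<notin> ?bad" using inf by (metis ex_new_if_finite)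
  define \<theta> where "\<theta> = a + to_ac c * b"
  let ?S = "adj \<theta>"
  note cl = subfield_ambientD[OF subfield_adj[of \<theta>]]
  have common: "x = b" if "tev (\<theta> - to_ac c * x) f = 0" "tev x g = 0" for x
  proof (rule ccontr)
    assume "x \<noteq> b"
    define a' where "a' = \<theta> - to_ac c * x"
    have "a' - a = to_ac c * (b - x)" by (simp add: a'_def \<theta>_def algebra_simps)
    then have "(a' - a) / (b - x) = to_ac c" using \<open>x \<noteq> b\<close> by (simp add: field_simps)
    then have "c = of_ac ((a' - a) / (b - x))" by simp
    moreover have "(a', x) \<in> {x. tev x f = 0} \<times> {x. tev x g = 0}" using that by (simp add: a'_def)
    ultimately show False using c by (metis (mono_tags, lifting) case_prod_conv image_eqI)
  qed
  let ?Q = "\<lambda>q. lead_coeff q = 1 \<and> poly q b = 0 \<and> (\<forall>i. coeff q i \<in> ?S)"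
  let ?G = "map_poly to_ac g" and ?F = "pcompose (map_poly to_ac f) [:\<theta>, - to_ac c:]"
  have baseS: "to_ac x \<in> ?S" for x using base_subset_adj by auto
  have G: "?Q ?G" using g baseS by (auto simp: tev_def)
  \<comment> \<open>The minimal polynomial of b over the field generated by \<theta>.\<close>
  define q where "q = arg_min degree ?Q"
  have q: "?Q q" unfolding q_def by (rule arg_min_natI) (rule G)
  have least: "degree q \<le> degree r" if "?Q r" for r unfolding q_def using that by (rule arg_min_nat_le)
  have degq: "0 < degree q"
  proof (rule ccontr)
    assume "\<not> 0 < degree q"
    then obtain x where "q = [:x:]" by (metis degree_eq_zeroE neq0_conv)
    then show False using q by auto
  qed
  have dvd: "q dvd P" if P: "poly P b = 0" "\<And>i. coeff P i \<in> ?S" for P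
  proof -
    obtain r where r: "q dvd P - r" "degree r < degree q" "\<forall>i. coeff r i \<in> ?S"
      using poly_division_in_subfield[OF subfield_adj _ degq _ P(2)] q by blast
    obtain k where k: "P - r = q * k" using r(1) by (elim dvdE)
    have "poly (P - r) b = 0" unfolding k using q by simp
    then have rb: "poly r b = 0" using P(1) by simp
    have "r = 0"
    proof (rule ccontr)
      assume nz: "r \<noteq> 0"
      have "?Q (Polynomial.smult (inverse (lead_coeff r)) r)"
        using nz rb r(3) cl(4,7) by simp
      then have "degree q \<le> degree r" using least nz by fastforce
      then show False using r(2) by simp
    qed
    then show ?thesis using r(1) by simp
  qed
  have "q dvd ?G" using G by (intro dvd) auto
  have "q dvd ?F"
  proof (rule dvd)
    show "poly ?F b = 0" using f(3) by (simp add: poly_pcompose \<theta>_def tev_def)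
    fix i
    have "\<forall>i. coeff (pcompose (map_poly to_ac P) [:\<theta>, - to_ac c:]) i \<in> ?S" for P
    proof (induction P)
      case (pCons x P)
      have "pcompose (map_poly to_ac (pCons x P)) [:\<theta>, - to_ac c:]
          = [:to_ac x:] + Polynomial.smult \<theta> (pcompose (map_poly to_ac P) [:\<theta>, - to_ac c:])
            + pCons 0 (Polynomial.smult (- to_ac c) (pcompose (map_poly to_ac P) [:\<theta>, - to_ac c:]))"
      proof -
        have "map_poly to_ac (pCons x P) = pCons (to_ac x) (map_poly to_ac P)"
          by (rule to_ac.base.map_poly_pCons_hom)
        then show ?thesis by (simp add: pcompose_pCons)
      qed
      moreover have "coeff [:to_ac x:] i \<in> ?S" for i
        using baseS cl(1) by (cases i) auto
      moreover have "coeff (pCons 0 (Polynomial.smult (- to_ac c) (pcompose (map_poly to_ac P) [:\<theta>, - to_ac c:]))) i \<in> ?S" for i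
        using pCons.IH cl(1) cl(4)[OF cl(5)[OF baseS]] by (cases i) auto
      ultimately show ?case
        using pCons.IH cl(3) cl(4)[OF self_in_adj] by (simp only: coeff_add coeff_smult) blast
    qed (use cl in simp)
    then show "coeff ?F i \<in> ?S" by blast
  qed
  have "degree q = 1"
  proof -
    have "rsquarefree q" using g(4) \<open>q dvd ?G\<close> by (rule rsquarefree_dvd)
    then have "card {x. poly q x = 0} = degree q" by (rule rsquarefree_split(2))
    moreover have "{x. poly q x = 0} = {b}"
    proof (intro equalityI subsetI)
      fix x assume "x \<in> {x. poly q x = 0}"
      then have "poly ?G x = 0" "poly ?F x = 0"
        using \<open>q dvd ?G\<close> \<open>q dvd ?F\<close> by (auto elim!: dvdE)
      then show "x \<in> {b}" using common[of x] by (simp add: tev_def poly_pcompose mult.commute)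
    qed (use q in auto)
    ultimately show ?thesis by simp
  qed
  then have "poly q b = coeff q 0 + b" using q by (simp add: poly_altdef)
  then have "coeff q 0 = - b" using q by (simp add: eq_neg_iff_add_eq_0)
  moreover have "coeff q 0 \<in> ?S" using q by blast
  ultimately have "- b \<in> ?S" by simp
  then have bS: "b \<in> ?S" using cl(5)[of "- b"] by simp
  have "a = \<theta> - to_ac c * b" by (simp add: \<theta>_def)
  then have "a \<in> ?S" using cl(6)[OF self_in_adj cl(4)[OF baseS bS], of c] by simp
  with bS show ?thesis unfolding \<theta>_def by blast
qed

text \<open>The explicit linear combination is kept because the separability and normality of the
  Galois closure are derived from it.\<close>

lemma generated_by_separable_list:
  assumes inf: "infinite (UNIV :: 'a::field set)"
    and sep: "\<And>r. r \<in> set rs \<Longrightarrow> separable_element (r :: 'a alg_closure)"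
  shows "\<exists>\<gamma> c. \<gamma> = (\<Sum>i<length rs. to_ac (c i) * rs ! i) \<and> set rs \<subseteq> adj \<gamma>"
  using sep
proof (induction rs rule: rev_induct)
  case (snoc r rs)
  then obtain \<gamma> c where \<gamma>: "\<gamma> = (\<Sum>i<length rs. to_ac (c i) * rs ! i)" "set rs \<subseteq> adj \<gamma>" by auto
  obtain c' where c': "\<gamma> \<in> adj (\<gamma> + to_ac c' * r)" "r \<in> adj (\<gamma> + to_ac c' * r)"
    using two_generators[OF inf, of r \<gamma>] snoc.prems by auto
  let ?c = "c(length rs := c')"
  have "\<gamma> + to_ac c' * r = (\<Sum>i<length (rs @ [r]). to_ac (?c i) * (rs @ [r]) ! i)"
    by (simp add: \<gamma>(1) nth_append)
  moreover have "set (rs @ [r]) \<subseteq> adj (\<gamma> + to_ac c' * r)"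
    using \<gamma>(2) adj_mono[OF c'(1)] c'(2) by auto
  ultimately show ?case by blast
qed auto

lemma primitive_element:
  assumes inf: "infinite (UNIV :: 'a::field set)" and K: "finite_separable_extension (K :: 'a alg_closure set)"
  obtains \<alpha> where "K = adj \<alpha>" "\<alpha> \<in> K" "separable_element \<alpha>"
proof -
  have K': "subfield K ambient" "base_field \<subseteq> K" "ring.finite_dimension ambient base_field K"
    "\<And>x. x \<in> K \<Longrightarrow> separable_element x"
    using K by (auto simp: finite_separable_extension_def)
  obtain n where "ambient.dimension n base_field K" using K'(3) by (auto elim: ambient.finite_dimensionE')
  then obtain Us where Us: "set Us \<subseteq> carrier ambient" "ambient.Span base_field Us = K"
    using ambient.exists_base[OF subfield_base_field] by blast
  have UsK: "set Us \<subseteq> K" using ambient.Span_base_incl[OF subfield_base_field Us(1)] Us(2) by simp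
  obtain \<alpha> c where \<alpha>: "\<alpha> = (\<Sum>i<length Us. to_ac (c i) * Us ! i)" "set Us \<subseteq> adj \<alpha>"
    using generated_by_separable_list[OF inf, of Us] UsK K'(4) by blast
  have sumK: "sum g I \<in> K" if "finite I" "\<And>i. i \<in> I \<Longrightarrow> g i \<in> K" for g and I :: "nat set"
    using that subfield_ambientD(1,3)[OF K'(1)] by (induction I rule: finite_induct) auto
  have "\<alpha> \<in> K" unfolding \<alpha>(1)
  proof (rule sumK)
    fix i assume "i \<in> {..<length Us}"
    then have "Us ! i \<in> K" using UsK by auto
    moreover have "to_ac (c i) \<in> K" using K'(2) by blast
    ultimately show "to_ac (c i) * Us ! i \<in> K" using subfield_ambientD(4)[OF K'(1)] by blast
  qed simp
  moreover have "K \<subseteq> adj \<alpha>"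
  proof -
    have "subalgebra base_field (adj \<alpha>) ambient"
      by (rule ambient.finite_dimension_imp_subalgebra[OF subfield_base_field finite_dimension_adj])
    then have "ambient.Span base_field Us \<subseteq> adj \<alpha>"
      using ambient.subalgebra_Span_incl[OF subfield_base_field] \<alpha>(2) by blast
    then show ?thesis using Us(2) by simp
  qed
  moreover have "adj \<alpha> \<subseteq> K" using \<open>\<alpha> \<in> K\<close> K' by (intro adj_subset)
  ultimately show ?thesis using that K'(4) by blast
qed

section \<open>Galois groups through a primitive element\<close>

locale galois_generator =
  fixes \<gamma> :: "'a::field alg_closure" and h :: "'a poly"
  assumes irreducible_h: "Factorial_Ring.irreducible h"
    and root_h: "tev \<gamma> h = 0"
    and separable_h: "rsquarefree (map_poly to_ac h)"
    and split_h: "\<And>z. tev z h = 0 \<Longrightarrow> z \<in> adj \<gamma>"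
begin

definition conjugates :: "'a alg_closure set"
  where "conjugates = {z. tev z h = 0}"

lemma h_nz: "map_poly to_ac h \<noteq> 0" "h \<noteq> 0" "0 < degree h"
  using irreducible_field_polyD[OF irreducible_h] by auto

lemma card_conjugates: "card conjugates = degree h" "finite conjugates"
  using rsquarefree_split(2)[OF separable_h] poly_roots_finite[OF h_nz(1)]
  by (simp_all add: conjugates_def tev_def)

lemma gen_conjugate [simp]: "\<gamma> \<in> conjugates" by (simp add: conjugates_def root_h)

text \<open>Reduced modulo h, the polynomial w has degree below that of h but takes the value c at
  all conjugates, which are as many as the degree of h. So it is constant. This is the fixed field
  statement of Galois theory.\<close>

lemma fixed_value_in_base:
  assumes "\<And>z. z \<in> conjugates \<Longrightarrow> tev z w = c"
  shows "c \<in> base_field"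
proof -
  define r where "r = w mod h"
  have "w = w div h * h + r" by (simp add: r_def)
  then have r: "tev z r = c" if "z \<in> conjugates" for z
    using assms[OF that] that by (simp add: conjugates_def hom_distribs)
      (metis add_0 mult_zero_right tev.base.hom_add tev.base.hom_mult)
  define P where "P = map_poly to_ac r - [:c:]"
  have "P = 0"
  proof (rule ccontr)
    assume nz: "P \<noteq> 0"
    have "conjugates \<subseteq> {z. poly P z = 0}" using r by (auto simp: P_def tev_def)
    then have "degree h \<le> card {z. poly P z = 0}"
      unfolding card_conjugates(1)[symmetric] by (intro card_mono poly_roots_finite nz)
    also have "\<dots> \<le> degree P" by (rule card_poly_roots_bound[OF nz])
    also have "\<dots> < degree h"
    proof -
      have "degree r < degree h"
        unfolding r_def using degree_mod_less'[OF h_nz(2), of w] h_nz(3) by (cases "w mod h = 0") auto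
      then show ?thesis unfolding P_def by (intro degree_diff_less) (use h_nz in auto)
    qed
    finally show False by simp
  qed
  then have "map_poly to_ac r = [:c:]" by (simp add: P_def)
  then have "to_ac (coeff r 0) = c" by (metis coeff_map_poly coeff_pCons_0 to_ac_0)
  then show ?thesis by blast
qed

lemma tev_conjugate_cong:
  assumes "z \<in> conjugates" "tev \<gamma> P = tev \<gamma> Q" shows "tev z P = tev z Q"
proof -
  have "tev \<gamma> (P - Q) = 0" using assms(2) by (simp add: hom_distribs)
  then have "h dvd P - Q" using tev_eq_0_iff_dvd[OF irreducible_h root_h] by simp
  then have "tev z (P - Q) = 0"
    using tev_eq_0_iff_dvd[OF irreducible_h, of z] assms(1) by (simp add: conjugates_def)
  then show ?thesis by (simp add: hom_distribs)
qed

text \<open>The automorphism sending \<gamma> to z, with the choice of P justified by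
  \<open>tev_conjugate_cong\<close>. The restriction makes it extensional, as the elements of
  \<open>galois_group\<close> are.\<close>

definition aut :: "'a alg_closure \<Rightarrow> 'a alg_closure \<Rightarrow> 'a alg_closure"
  where "aut z = (\<lambda>y\<in>adj \<gamma>. tev z (SOME P. tev \<gamma> P = y))"

lemma aut_tev: "z \<in> conjugates \<Longrightarrow> aut z (tev \<gamma> P) = tev z P"
proof -
  assume z: "z \<in> conjugates"
  have "tev \<gamma> (SOME Q. tev \<gamma> Q = tev \<gamma> P) = tev \<gamma> P" by (rule someI) (rule refl)
  then have "tev z (SOME Q. tev \<gamma> Q = tev \<gamma> P) = tev z P" by (rule tev_conjugate_cong[OF z])
  then show ?thesis by (simp add: aut_def adj_def)
qed

lemma aut_gen: "z \<in> conjugates \<Longrightarrow> aut z \<gamma> = z"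
  using aut_tev[of z "[:0, 1:]"] by simp

lemma adjE: assumes "y \<in> adj \<gamma>" obtains P where "y = tev \<gamma> P"
  using assms by (auto simp: adj_def)

lemma aut_add: "z \<in> conjugates \<Longrightarrow> x \<in> adj \<gamma> \<Longrightarrow> y \<in> adj \<gamma> \<Longrightarrow> aut z (x + y) = aut z x + aut z y"
  by (elim adjE) (simp add: aut_tev flip: tev.base.hom_add)

lemma aut_mult: "z \<in> conjugates \<Longrightarrow> x \<in> adj \<gamma> \<Longrightarrow> y \<in> adj \<gamma> \<Longrightarrow> aut z (x * y) = aut z x * aut z y"
  by (elim adjE) (simp add: aut_tev flip: tev.base.hom_mult)

lemma aut_base: "z \<in> conjugates \<Longrightarrow> aut z (to_ac c) = to_ac c"
  using aut_tev[of z "[:c:]"] by simp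

lemma aut_mem: "z \<in> conjugates \<Longrightarrow> x \<in> adj \<gamma> \<Longrightarrow> aut z x \<in> adj \<gamma>"
  by (elim adjE) (simp add: aut_tev tev_in_subfield[OF subfield_adj base_subset_adj split_h] conjugates_def)

lemma aut_inj: "z \<in> conjugates \<Longrightarrow> inj_on (aut z) (adj \<gamma>)"
proof (rule inj_onI, elim adjE)
  fix x y P Q assume *: "z \<in> conjugates" "aut z x = aut z y" "x = tev \<gamma> P" "y = tev \<gamma> Q"
  then have "tev z (P - Q) = 0" by (simp add: aut_tev hom_distribs)
  then have "h dvd P - Q" using tev_eq_0_iff_dvd[OF irreducible_h] *(1) by (simp add: conjugates_def)
  then have "tev \<gamma> (P - Q) = 0" using tev_eq_0_iff_dvd[OF irreducible_h root_h] by simp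
  then show "x = y" using * by (simp add: hom_distribs)
qed

lemma aut_tev_mem: "z \<in> conjugates \<Longrightarrow> x \<in> adj \<gamma> \<Longrightarrow> aut z (tev x P) = tev (aut z x) P"
proof (induction P)
  case 0
  then show ?case using aut_base[of z 0] by simp
next
  case (pCons c P)
  have "tev x P \<in> adj \<gamma>" "to_ac c \<in> adj \<gamma>"
    using pCons tev_in_subfield[OF subfield_adj base_subset_adj] base_subset_adj by blast+
  moreover have "x * tev x P \<in> adj \<gamma>" using calculation pCons subfield_ambientD(4)[OF subfield_adj] by blast
  ultimately show ?case using pCons by (simp add: aut_add aut_mult aut_base)
qed

lemma aut_conjugates: "z \<in> conjugates \<Longrightarrow> aut z ` conjugates = conjugates"
proof (rule card_subset_eq)
  assume z: "z \<in> conjugates"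
  have mem: "x \<in> adj \<gamma>" if "x \<in> conjugates" for x using that split_h by (simp add: conjugates_def)
  show "aut z ` conjugates \<subseteq> conjugates"
  proof clarify
    fix x assume x: "x \<in> conjugates"
    then show "aut z x \<in> conjugates"
      using aut_tev_mem[OF z mem[OF x], of h] aut_base[OF z, of 0] by (simp add: conjugates_def)
  qed
  have "inj_on (aut z) conjugates" using aut_inj[OF z] mem by (meson inj_on_subset subsetI)
  then show "card (aut z ` conjugates) = card conjugates" by (rule card_image)
qed (simp add: card_conjugates)

lemma aut_bij: "z \<in> conjugates \<Longrightarrow> aut z \<in> Bij (adj \<gamma>)"
proof -
  assume z: "z \<in> conjugates"
  have "aut z ` adj \<gamma> = adj \<gamma>"
  proof (intro equalityI subsetI)
    fix y assume "y \<in> adj \<gamma>"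
    then obtain P where P: "y = tev \<gamma> P" by (rule adjE)
    obtain x where x: "x \<in> conjugates" "\<gamma> = aut z x" using aut_conjugates[OF z] gen_conjugate by blast
    then have "x \<in> adj \<gamma>" using split_h by (simp add: conjugates_def)
    then have "y = aut z (tev x P)" using aut_tev_mem[OF z, of x P] x P by simp
    then show "y \<in> aut z ` adj \<gamma>"
      using tev_in_subfield[OF subfield_adj base_subset_adj \<open>x \<in> adj \<gamma>\<close>] by blast
  qed (use aut_mem[OF z] in auto)
  then show ?thesis using aut_inj[OF z] by (auto simp: Bij_def bij_betw_def aut_def)
qed

abbreviation gal :: "('a alg_closure \<Rightarrow> 'a alg_closure) monoid"
  where "gal \<equiv> galois_group (adj \<gamma>) base_field"

lemma carrier_galois_group:
  "carrier (galois_group S K) = {\<sigma> \<in> Bij S. (\<forall>x\<in>S. \<forall>y\<in>S. \<sigma> (x * y) = \<sigma> x * \<sigma> y \<and> \<sigma> (x + y) = \<sigma> x + \<sigma> y) \<and>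
     \<sigma> 1 = 1 \<and> (\<forall>x\<in>K. \<sigma> x = x)}"
  by (auto simp: galois_group_def Ring.ring_hom_def ring_of_type_algebra_def Bij_def bij_betw_def)

lemma carrier_gal: "carrier gal = aut ` conjugates"
proof (intro equalityI subsetI)
  fix \<sigma> assume "\<sigma> \<in> aut ` conjugates"
  then show "\<sigma> \<in> carrier gal"
    unfolding carrier_galois_group
    using aut_bij aut_mult aut_add aut_base aut_base[of _ 1] by auto
next
  fix \<sigma> assume \<sigma>: "\<sigma> \<in> carrier gal"
  then have \<sigma>': "\<sigma> \<in> Bij (adj \<gamma>)" "\<And>x y. x \<in> adj \<gamma> \<Longrightarrow> y \<in> adj \<gamma> \<Longrightarrow> \<sigma> (x * y) = \<sigma> x * \<sigma> y"
    "\<And>x y. x \<in> adj \<gamma> \<Longrightarrow> y \<in> adj \<gamma> \<Longrightarrow> \<sigma> (x + y) = \<sigma> x + \<sigma> y" "\<And>c. \<sigma> (to_ac c) = to_ac c"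
    unfolding carrier_galois_group by auto
  have \<sigma>tev: "\<sigma> (tev \<gamma> P) = tev (\<sigma> \<gamma>) P" for P
  proof (induction P)
    case 0
    then show ?case using \<sigma>'(4)[of 0] by simp
  next
    case (pCons c P)
    have "tev \<gamma> P \<in> adj \<gamma>" by (simp add: adj_def)
    moreover have "to_ac c \<in> adj \<gamma>" using base_subset_adj by blast
    moreover have "\<gamma> * tev \<gamma> P \<in> adj \<gamma>"
      using calculation self_in_adj subfield_ambientD(4)[OF subfield_adj] by blast
    ultimately show ?case
      using pCons.IH \<sigma>'(2)[OF self_in_adj, of "tev \<gamma> P"] \<sigma>'(3)[of "to_ac c" "\<gamma> * tev \<gamma> P"] \<sigma>'(4)
      by simp
  qed
  have z: "\<sigma> \<gamma> \<in> conjugates" using \<sigma>tev[of h] \<sigma>'(4)[of 0] root_h by (simp add: conjugates_def)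
  have "\<sigma> = aut (\<sigma> \<gamma>)"
  proof (rule extensionalityI[of _ "adj \<gamma>"])
    show "\<sigma> \<in> extensional (adj \<gamma>)" using \<sigma>'(1) by (simp add: Bij_def)
    show "aut (\<sigma> \<gamma>) \<in> extensional (adj \<gamma>)" by (simp add: aut_def)
    fix x assume "x \<in> adj \<gamma>"
    then show "\<sigma> x = aut (\<sigma> \<gamma>) x" by (elim adjE) (simp add: \<sigma>tev aut_tev[OF z])
  qed
  then show "\<sigma> \<in> aut ` conjugates" using z by blast
qed

lemma gal_mult: "\<sigma> \<in> carrier gal \<Longrightarrow> \<tau> \<in> carrier gal \<Longrightarrow> \<sigma> \<otimes>\<^bsub>gal\<^esub> \<tau> = compose (adj \<gamma>) \<sigma> \<tau>"
  by (simp add: galois_group_def BijGroup_def)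

lemma gal_one: "\<one>\<^bsub>gal\<^esub> = (\<lambda>x\<in>adj \<gamma>. x)"
  by (simp add: galois_group_def BijGroup_def)

lemma gal_eqI:
  assumes "\<sigma> \<in> carrier gal" "\<tau> \<in> carrier gal" "\<sigma> \<gamma> = \<tau> \<gamma>" shows "\<sigma> = \<tau>"
  using assms by (auto simp: carrier_gal aut_gen)

lemma gal_mem: "\<sigma> \<in> carrier gal \<Longrightarrow> x \<in> adj \<gamma> \<Longrightarrow> \<sigma> x \<in> adj \<gamma>"
  by (auto simp: carrier_gal aut_mem)

lemma gal_tev: "\<sigma> \<in> carrier gal \<Longrightarrow> x \<in> adj \<gamma> \<Longrightarrow> \<sigma> (tev x P) = tev (\<sigma> x) P"
  by (auto simp: carrier_gal aut_tev_mem)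

lemma finite_gal: "finite (carrier gal)"
  by (simp add: carrier_gal card_conjugates)

lemma group_gal: "group gal"
proof (rule groupI)
  have comp: "compose (adj \<gamma>) \<sigma> \<tau> \<in> carrier gal" if *: "\<sigma> \<in> carrier gal" "\<tau> \<in> carrier gal" for \<sigma> \<tau>
  proof -
    have m: "\<And>x. x \<in> adj \<gamma> \<Longrightarrow> \<tau> x \<in> adj \<gamma>" using * gal_mem by blast
    have cl: "x * y \<in> adj \<gamma>" "x + y \<in> adj \<gamma>" "1 \<in> adj \<gamma>" if "x \<in> adj \<gamma>" "y \<in> adj \<gamma>" for x y
      using that subfield_ambientD[OF subfield_adj] by blast+
    have b: "to_ac c \<in> adj \<gamma>" for c using base_subset_adj by blast
    show ?thesis
      using * m cl b[of 1] b unfolding carrier_galois_group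
      by (auto simp: compose_Bij compose_eq self_in_adj)
  qed
  show "\<sigma> \<otimes>\<^bsub>gal\<^esub> \<tau> \<in> carrier gal" if "\<sigma> \<in> carrier gal" "\<tau> \<in> carrier gal" for \<sigma> \<tau>
    using comp that by (simp add: gal_mult)
  have "aut \<gamma> = (\<lambda>x\<in>adj \<gamma>. x)"
    by (rule extensionalityI[of _ "adj \<gamma>"]) (auto simp: aut_def elim!: adjE intro: someI2)
  then show one: "\<one>\<^bsub>gal\<^esub> \<in> carrier gal" unfolding gal_one carrier_gal using gen_conjugate by (metis imageI)
  show "\<sigma> \<otimes>\<^bsub>gal\<^esub> \<tau> \<otimes>\<^bsub>gal\<^esub> \<rho> = \<sigma> \<otimes>\<^bsub>gal\<^esub> (\<tau> \<otimes>\<^bsub>gal\<^esub> \<rho>)"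
    if "\<sigma> \<in> carrier gal" "\<tau> \<in> carrier gal" "\<rho> \<in> carrier gal" for \<sigma> \<tau> \<rho>
  proof -
    have "\<rho> \<in> adj \<gamma> \<rightarrow> adj \<gamma>" using that gal_mem by auto
    then show ?thesis using that comp by (simp add: gal_mult compose_assoc)
  qed
  show "\<one>\<^bsub>gal\<^esub> \<otimes>\<^bsub>gal\<^esub> \<sigma> = \<sigma>" if "\<sigma> \<in> carrier gal" for \<sigma>
    using that one gal_mem[OF that] unfolding gal_mult[OF one that]
    by (auto simp: gal_one carrier_galois_group Bij_def intro!: Id_compose)
  show "\<exists>\<tau>\<in>carrier gal. \<tau> \<otimes>\<^bsub>gal\<^esub> \<sigma> = \<one>\<^bsub>gal\<^esub>" if \<sigma>: "\<sigma> \<in> carrier gal" for \<sigma>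
  proof -
    obtain z where z: "z \<in> conjugates" "\<sigma> = aut z" using \<sigma> carrier_gal by blast
    have "z \<in> adj \<gamma>" using z split_h by (simp add: conjugates_def)
    obtain P where P: "z = tev \<gamma> P" using \<open>z \<in> adj \<gamma>\<close> by (rule adjE)
    have "\<gamma> \<in> aut z ` conjugates" unfolding aut_conjugates[OF z(1)] by simp
    then obtain x where "\<gamma> = aut z x" "x \<in> conjugates" by (rule imageE)
    then have x: "x \<in> conjugates" "aut z x = \<gamma>" by simp_all
    have xm: "x \<in> adj \<gamma>" using x split_h by (simp add: conjugates_def)
    have "aut x z = tev x P" unfolding P by (rule aut_tev[OF x(1)])
    then have "aut z (aut x z) = tev (aut z x) P" using aut_tev_mem[OF z(1) xm] by simp
    also have "\<dots> = z" unfolding x(2) by (rule P[symmetric])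
    also have "\<dots> = aut z \<gamma>" by (rule aut_gen[OF z(1), symmetric])
    finally have "aut x z = \<gamma>"
      by (rule inj_onD[OF aut_inj[OF z(1)] _ aut_mem[OF x(1) \<open>z \<in> adj \<gamma>\<close>] self_in_adj])
    then have "compose (adj \<gamma>) (aut x) \<sigma> \<gamma> = (\<lambda>x\<in>adj \<gamma>. x) \<gamma>"
      by (simp add: compose_eq self_in_adj z aut_gen)
    moreover have "aut x \<in> carrier gal" using x carrier_gal by blast
    ultimately show ?thesis
      using gal_eqI[OF comp[OF _ \<sigma>] one] by (intro bexI[of _ "aut x"]) (auto simp: gal_mult \<sigma> gal_one)
  qed
qed

text \<open>The coefficients of the product are invariant under all automorphisms. To apply
  \<open>fixed_value_in_base\<close>, they are written as polynomials in \<gamma>, collected in W;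
  evaluating W at a conjugate z applies the automorphism \<open>aut z\<close>, which permutes the
  orbit.\<close>

lemma orbit_poly:
  assumes "\<alpha> \<in> adj \<gamma>"
  shows "\<exists>m. map_poly to_ac m = (\<Prod>x\<in>(\<lambda>\<sigma>. \<sigma> \<alpha>) ` carrier gal. [:- x, 1:])"
proof -
  let ?O = "(\<lambda>\<sigma>. \<sigma> \<alpha>) ` carrier gal" and ?M = "\<Prod>x\<in>(\<lambda>\<sigma>. \<sigma> \<alpha>) ` carrier gal. [:- x, 1:]"
  interpret group gal by (rule group_gal)
  have OA: "?O \<subseteq> adj \<gamma>" using gal_mem assms by blast
  define rep where "rep y = (SOME P. tev \<gamma> P = y)" for y
  have rep: "tev \<gamma> (rep y) = y" if "y \<in> adj \<gamma>" for y
  proof -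
    have "\<exists>P. tev \<gamma> P = y" using that by (auto simp: adj_def)
    then show ?thesis unfolding rep_def by (rule someI_ex)
  qed
  define W where "W = (\<Prod>y\<in>?O. [:- rep y, 1:])"
  have W: "map_poly (tev z) W = ?M" if z: "z \<in> conjugates" for z
  proof -
    have az: "aut z \<in> carrier gal" using z carrier_gal by blast
    have "map_poly (tev z) W = (\<Prod>y\<in>?O. [:- tev z (rep y), 1:])"
      by (simp add: W_def hom_distribs)
    also have "\<dots> = (\<Prod>y\<in>?O. [:- aut z y, 1:])"
    proof (rule prod.cong[OF refl])
      fix y assume "y \<in> ?O"
      then have "y \<in> adj \<gamma>" using OA by blast
      then have "aut z y = tev z (rep y)" using aut_tev[OF z, of "rep y"] rep by simp
      then show "[:- tev z (rep y), 1:] = [:- aut z y, 1:]" by simp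
    qed
    also have "\<dots> = (\<Prod>y\<in>aut z ` ?O. [:- y, 1:])"
      using aut_inj[OF z] OA by (subst prod.reindex) (auto intro: inj_on_subset)
    also have "aut z ` ?O = ?O"
    proof (rule card_subset_eq)
      show "finite ?O" using finite_gal by simp
      show "aut z ` ?O \<subseteq> ?O"
      proof clarify
        fix \<sigma> assume \<sigma>: "\<sigma> \<in> carrier gal"
        then have "aut z (\<sigma> \<alpha>) = (aut z \<otimes>\<^bsub>gal\<^esub> \<sigma>) \<alpha>" using az assms by (simp add: gal_mult compose_eq)
        then show "aut z (\<sigma> \<alpha>) \<in> ?O" using az \<sigma> by (metis image_eqI m_closed)
      qed
      show "card (aut z ` ?O) = card ?O"
        using aut_inj[OF z] OA by (intro card_image) (auto intro: inj_on_subset)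
    qed
    finally show ?thesis .
  qed
  have "coeff ?M i \<in> base_field" for i
  proof (rule fixed_value_in_base)
    fix z assume "z \<in> conjugates"
    then show "tev z (coeff W i) = coeff ?M i" using W by (metis coeff_map_poly tev.base.hom_zero)
  qed
  then have "to_ac (of_ac (coeff ?M i)) = coeff ?M i" for i by (rule to_ac_of_ac)
  then have "map_poly to_ac (map_poly of_ac ?M) = ?M"
    by (intro poly_eqI) (simp add: coeff_map_poly)
  then show ?thesis by blast
qed

lemma orbit_prod_properties:
  fixes A :: "'a alg_closure set"
  assumes "finite A"
  shows "poly (\<Prod>x\<in>A. [:- x, 1:]) y = 0 \<longleftrightarrow> y \<in> A" "rsquarefree (\<Prod>x\<in>A. [:- x, 1:])"
proof -
  show roots: "poly (\<Prod>x\<in>A. [:- x, 1:]) y = 0 \<longleftrightarrow> y \<in> A" for y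
    using assms by (auto simp: poly_prod prod_zero_iff)
  have nz: "(\<Prod>x\<in>A. [:- x, 1:]) \<noteq> 0" using assms by (auto simp: prod_zero_iff)
  have "order y (\<Prod>x\<in>A. [:- x, 1:]) \<le> 1" for y
    using assms
  proof (induction A rule: finite_induct)
    case (insert x A)
    have "(\<Prod>x\<in>A. [:- x, 1:]) \<noteq> 0" using insert(1) by (auto simp: prod_zero_iff)
    then have nz: "[:- x, 1:] * (\<Prod>x\<in>A. [:- x, 1:]) \<noteq> 0" by (intro no_zero_divisors) simp_all
    have "order y [:- x, 1:] = (if x = y then 1 else 0)"
      using order_power_n_n[of x 1] by (auto simp: order_0I)
    moreover have "order x (\<Prod>x\<in>A. [:- x, 1:]) = 0"
      using insert(1,2) by (intro order_0I) (auto simp: poly_prod prod_zero_iff)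
    moreover have "order y (\<Prod>x\<in>insert x A. [:- x, 1:]) = order y [:- x, 1:] + order y (\<Prod>x\<in>A. [:- x, 1:])"
      unfolding prod.insert[OF insert(1,2)] by (rule order_mult[OF nz])
    ultimately show ?case using insert.IH by (auto split: if_splits)
  qed simp
  then have "order y (\<Prod>x\<in>A. [:- x, 1:]) = 0 \<or> order y (\<Prod>x\<in>A. [:- x, 1:]) = 1" for y
    by (metis le_0_eq le_SucE One_nat_def)
  then show "rsquarefree (\<Prod>x\<in>A. [:- x, 1:])" using nz by (simp add: rsquarefree_def)
qed

text \<open>The orbit polynomial has coefficients in the base field and \<alpha> as a root, so f
  divides it; hence f has only simple roots, all in the orbit.\<close>

lemma roots_eq_orbit:
  assumes "\<alpha> \<in> adj \<gamma>" "Factorial_Ring.irreducible f" "tev \<alpha> f = 0"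
  shows "{x. tev x f = 0} = (\<lambda>\<sigma>. \<sigma> \<alpha>) ` carrier gal" "rsquarefree (map_poly to_ac f)"
proof -
  let ?O = "(\<lambda>\<sigma>. \<sigma> \<alpha>) ` carrier gal"
  interpret group gal by (rule group_gal)
  have fin: "finite ?O" using finite_gal by simp
  obtain m where m: "map_poly to_ac m = (\<Prod>x\<in>?O. [:- x, 1:])" using orbit_poly[OF assms(1)] by blast
  have "\<alpha> \<in> ?O"
  proof (rule image_eqI)
    show "\<alpha> = \<one>\<^bsub>gal\<^esub> \<alpha>" using assms(1) by (simp add: gal_one)
  qed simp
  then have "tev \<alpha> m = 0" unfolding tev_def m using orbit_prod_properties(1)[OF fin] by simp
  then have dvd: "f dvd m" using tev_eq_0_iff_dvd[OF assms(2,3)] by simp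
  then have dvd': "map_poly to_ac f dvd (\<Prod>x\<in>?O. [:- x, 1:])" unfolding m[symmetric] by (rule to_ac.hom_dvd)
  show "rsquarefree (map_poly to_ac f)" by (rule rsquarefree_dvd[OF orbit_prod_properties(2)[OF fin] dvd'])
  show "{x. tev x f = 0} = ?O"
  proof (intro equalityI subsetI)
    fix x assume "x \<in> {x. tev x f = 0}"
    then have "poly (\<Prod>x\<in>?O. [:- x, 1:]) x = 0" using dvd' by (auto simp: tev_def elim!: dvdE)
    then show "x \<in> ?O" using orbit_prod_properties(1)[OF fin] by simp
  next
    fix x assume "x \<in> ?O"
    then obtain \<sigma> where \<sigma>: "\<sigma> \<in> carrier gal" "x = \<sigma> \<alpha>" by blast
    have "\<sigma> 0 = 0" using gal_tev[OF \<sigma>(1) assms(1), of 0] by simp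
    then show "x \<in> {x. tev x f = 0}" using gal_tev[OF \<sigma>(1) assms(1), of f] assms(3) \<sigma>(2) by simp
  qed
qed

lemma galois_extension: "finite_galois_extension (adj \<gamma>)"
  unfolding finite_galois_extension_def finite_separable_extension_def
proof (intro conjI ballI)
  show "separable_element x" if "x \<in> adj \<gamma>" for x
  proof -
    obtain f where f: "Factorial_Ring.irreducible f" "lead_coeff f = 1" "tev x f = 0" by (rule exists_minimal_poly)
    then show ?thesis using roots_eq_orbit(2)[OF that f(1,3)] unfolding separable_element_def tev_def by blast
  qed
  show "normal_extension (adj \<gamma>)"
    unfolding normal_extension_def tev_def[symmetric]
  proof (intro allI impI)
    fix p assume p: "Factorial_Ring.irreducible p" "\<exists>x\<in>adj \<gamma>. tev x p = 0"
    then obtain x where x: "x \<in> adj \<gamma>" "tev x p = 0" by blast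
    show "{x. tev x p = 0} \<subseteq> adj \<gamma>" unfolding roots_eq_orbit(1)[OF x(1) p(1) x(2)] using gal_mem x(1) by blast
  qed
qed (simp_all add: subfield_adj base_subset_adj finite_dimension_adj)

end

lemma galois_generator_of_extension:
  assumes inf: "infinite (UNIV :: 'a::field set)" and N: "finite_galois_extension (N :: 'a alg_closure set)"
  obtains \<gamma> h where "galois_generator \<gamma> h" "N = adj \<gamma>"
proof -
  have N': "finite_separable_extension N" "normal_extension N" using N by (auto simp: finite_galois_extension_def)
  obtain \<gamma> where \<gamma>: "N = adj \<gamma>" "\<gamma> \<in> N" "separable_element \<gamma>" using primitive_element[OF inf N'(1)] .
  obtain h where h: "Factorial_Ring.irreducible h" "lead_coeff h = 1" "tev \<gamma> h = 0" "rsquarefree (map_poly to_ac h)"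
    using separable_elementE[OF \<gamma>(3)] .
  have "galois_generator \<gamma> h"
  proof
    fix z assume "tev z h = 0"
    then show "z \<in> adj \<gamma>"
      using N'(2) h(1,3) \<gamma>(1,2) unfolding normal_extension_def tev_def by blast
  qed (use h in auto)
  then show ?thesis using that \<gamma>(1) by blast
qed

text \<open>If the minimal polynomial \<open>h\<close> of \<open>\<gamma>\<close> had derivative zero, \<open>P(\<gamma>) \<mapsto> P'(\<gamma>)\<close> would be a
  well-defined derivation; it vanishes on the separable generators, hence on \<open>\<gamma>\<close>, where it has value \<open>1\<close>.\<close>

lemma separable_of_separable_generators:
  fixes \<gamma> :: "'a::field alg_closure"
  assumes h: "Factorial_Ring.irreducible h" "tev \<gamma> h = 0"
    and \<gamma>: "\<gamma> = (\<Sum>i\<in>I. to_ac (c i) * r i)" and sep: "\<And>i. i \<in> I \<Longrightarrow> separable_element (r i)"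
    and mem: "\<And>i. i \<in> I \<Longrightarrow> r i \<in> adj \<gamma>"
  shows "rsquarefree (map_poly to_ac h)"
proof (rule ccontr)
  assume nsf: "\<not> rsquarefree (map_poly to_ac h)"
  have hnz: "h \<noteq> 0" "0 < degree h" using irreducible_field_polyD[OF h(1)] by auto
  have "map_poly to_ac h \<noteq> 0" using hnz by simp
  then obtain a where a: "tev a h = 0" "tev a (pderiv h) = 0"
    using nsf rsquarefree_iff_simple_roots[of "map_poly to_ac h"] by (auto simp: tev_def hom_distribs)
  then have "h dvd pderiv h" using tev_eq_0_iff_dvd[OF h(1)] by blast
  then have ph: "pderiv h = 0"
  proof (rule contrapos_pp)
    assume "pderiv h \<noteq> 0"
    moreover have "degree (pderiv h) < degree h" using hnz degree_pderiv_le[of h] by linarith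
    ultimately show "\<not> h dvd pderiv h" by (meson dvd_imp_degree_le leD)
  qed
  have D0: "tev \<gamma> (pderiv P) = 0" if P: "tev \<gamma> P = 0" for P
  proof -
    have "h dvd P" using P tev_eq_0_iff_dvd[OF h] by simp
    then obtain k where "P = h * k" by (elim dvdE)
    then show ?thesis using h(2) by (simp add: pderiv_mult ph hom_distribs)
  qed
  define R where "R i = (SOME P. tev \<gamma> P = r i)" for i
  have R: "tev \<gamma> (R i) = r i" if "i \<in> I" for i
  proof -
    have "\<exists>P. tev \<gamma> P = r i" using mem[OF that] by (auto simp: adj_def)
    then show ?thesis unfolding R_def by (rule someI_ex)
  qed
  have DR: "tev \<gamma> (pderiv (R i)) = 0" if i: "i \<in> I" for i
  proof -
    obtain f where f: "Factorial_Ring.irreducible f" "lead_coeff f = 1" "tev (r i) f = 0" "rsquarefree (map_poly to_ac f)"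
      using separable_elementE[OF sep[OF i]] .
    have comp: "tev \<gamma> (pcompose g (R i)) = tev (r i) g" for g
      by (simp add: tev_def hom_distribs poly_pcompose R[OF i, unfolded tev_def])
    have "tev \<gamma> (pderiv (pcompose f (R i))) = 0" using D0 comp f(3) by simp
    then have "tev (r i) (pderiv f) * tev \<gamma> (pderiv (R i)) = 0"
      by (simp add: pderiv_pcompose hom_distribs comp)
    moreover have "tev (r i) (pderiv f) \<noteq> 0"
    proof -
      have "map_poly to_ac f \<noteq> 0" using irreducible_field_polyD(1)[OF f(1)] by simp
      then show ?thesis
        using f(3,4) rsquarefree_iff_simple_roots[of "map_poly to_ac f"] by (auto simp: tev_def hom_distribs)
    qed
    ultimately show ?thesis by simp
  qed
  define Q where "Q = [:0, 1:] - (\<Sum>i\<in>I. Polynomial.smult (c i) (R i))"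
  have sm: "tev \<gamma> (Polynomial.smult x P) = to_ac x * tev \<gamma> P" for x P
    by (simp add: tev_def hom_distribs)
  have "tev \<gamma> Q = 0"
    using R \<gamma>[symmetric] by (simp add: Q_def hom_distribs sm del: tev_pCons)
  then have "tev \<gamma> (pderiv Q) = 0" by (rule D0)
  moreover have "tev \<gamma> (pderiv Q) = 1"
    using DR by (simp add: Q_def pderiv_diff pderiv_sum pderiv_smult pderiv_pCons hom_distribs sm)
  ultimately show False by simp
qed

text \<open>Take \<gamma> generating the field of all roots of f g. A conjugate of \<gamma> is the
  same linear combination of conjugates of these roots, which are again roots of f g and so lie in
  the field of \<gamma>.\<close>

lemma exists_galois_closure:
  assumes inf: "infinite (UNIV :: 'a::field set)"
    and K: "finite_separable_extension (K :: 'a alg_closure set)" and L: "finite_separable_extension L"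
  obtains \<gamma> h where "galois_generator \<gamma> h" "K \<subseteq> adj \<gamma>" "L \<subseteq> adj \<gamma>"
proof -
  obtain \<alpha> where \<alpha>: "K = adj \<alpha>" "separable_element \<alpha>" using primitive_element[OF inf K] .
  obtain \<beta> where \<beta>: "L = adj \<beta>" "separable_element \<beta>" using primitive_element[OF inf L] .
  obtain f where f: "Factorial_Ring.irreducible f" "lead_coeff f = 1" "tev \<alpha> f = 0" "rsquarefree (map_poly to_ac f)"
    using separable_elementE[OF \<alpha>(2)] .
  obtain g where g: "Factorial_Ring.irreducible g" "lead_coeff g = 1" "tev \<beta> g = 0" "rsquarefree (map_poly to_ac g)"
    using separable_elementE[OF \<beta>(2)] .
  let ?R = "{x. tev x (f * g) = 0}"
  have "f * g \<noteq> 0" using f g irreducible_field_polyD(1) by auto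
  then have "finite ?R" unfolding tev_def by (intro poly_roots_finite) simp
  then obtain rs where rs: "set rs = ?R" using finite_list by blast
  have sep: "separable_element r" if "r \<in> ?R" for r
  proof -
    have "tev r f = 0 \<or> tev r g = 0" using that by (simp add: hom_distribs)
    then show ?thesis using f g unfolding separable_element_def tev_def by blast
  qed
  obtain \<gamma> c where \<gamma>: "\<gamma> = (\<Sum>i<length rs. to_ac (c i) * rs ! i)" "set rs \<subseteq> adj \<gamma>"
    using generated_by_separable_list[OF inf, of rs] sep rs by blast
  obtain h where h: "Factorial_Ring.irreducible h" "lead_coeff h = 1" "tev \<gamma> h = 0" by (rule exists_minimal_poly)
  have mem: "rs ! i \<in> ?R" "rs ! i \<in> adj \<gamma>" if "i < length rs" for i
    using that rs \<gamma>(2) nth_mem by blast+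
  have "galois_generator \<gamma> h"
  proof
    show "Factorial_Ring.irreducible h" "tev \<gamma> h = 0" using h by auto
    show "rsquarefree (map_poly to_ac h)"
      by (rule separable_of_separable_generators[OF h(1,3) \<gamma>(1)]) (use mem sep in auto)
    fix z assume z: "tev z h = 0"
    define R where "R i = (SOME P. tev \<gamma> P = rs ! i)" for i
    have R: "tev \<gamma> (R i) = rs ! i" if "i < length rs" for i
    proof -
      have "\<exists>P. tev \<gamma> P = rs ! i" using mem(2)[OF that] by (auto simp: adj_def)
      then show ?thesis unfolding R_def by (rule someI_ex)
    qed
    have transfer: "tev z P = 0" if "tev \<gamma> P = 0" for P
      using that tev_eq_0_iff_dvd[OF h(1,3)] tev_eq_0_iff_dvd[OF h(1) z] by simp
    have Rz: "tev z (R i) \<in> adj \<gamma>" if i: "i < length rs" for i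
    proof -
      have comp: "tev y (pcompose (f * g) (R i)) = tev (tev y (R i)) (f * g)" for y
        by (simp add: tev_def hom_distribs poly_pcompose)
      have "tev z (pcompose (f * g) (R i)) = 0" using comp[of \<gamma>] R[OF i] mem(1)[OF i] by (intro transfer) simp
      then have "tev z (R i) \<in> ?R" using comp[of z] by simp
      then show ?thesis using \<gamma>(2) rs by blast
    qed
    have sm: "tev y (Polynomial.smult x P) = to_ac x * tev y P" for x y P
      by (simp add: tev_def hom_distribs)
    have "tev \<gamma> ([:0, 1:] - (\<Sum>i<length rs. Polynomial.smult (c i) (R i))) = 0"
      using R \<gamma>(1) by (simp add: hom_distribs sm del: tev_pCons)
    then have "tev z ([:0, 1:] - (\<Sum>i<length rs. Polynomial.smult (c i) (R i))) = 0" by (rule transfer)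
    then have zeq: "z = (\<Sum>i<length rs. to_ac (c i) * tev z (R i))"
      by (simp add: hom_distribs sm del: tev_pCons)
    have base: "to_ac x \<in> adj \<gamma>" for x using base_subset_adj by blast
    have "(\<Sum>i\<in>I. to_ac (c i) * tev z (R i)) \<in> adj \<gamma>" if "finite I" "I \<subseteq> {..<length rs}" for I
      using that
    proof (induction I rule: finite_induct)
      case empty then show ?case using subfield_ambientD(1)[OF subfield_adj] by simp
    next
      case (insert i I)
      have "to_ac (c i) * tev z (R i) \<in> adj \<gamma>"
        using insert.prems by (intro subfield_ambientD(4)[OF subfield_adj] base Rz) auto
      moreover have "(\<Sum>i\<in>I. to_ac (c i) * tev z (R i)) \<in> adj \<gamma>" using insert by simp
      ultimately show ?case
        using insert(1,2) subfield_ambientD(3)[OF subfield_adj] by (simp add: sum.insert)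
    qed
    then show "z \<in> adj \<gamma>" by (subst zeq) simp
  qed
  moreover have "\<alpha> \<in> adj \<gamma>" "\<beta> \<in> adj \<gamma>" using f g rs \<gamma>(2) by (auto simp: hom_distribs)
  ultimately show ?thesis using that adj_mono \<alpha>(1) \<beta>(1) by blast
qed

section \<open>Integral elements\<close>

text \<open>Evaluation at Y = x with T kept as a variable, in contrast to
  \<open>pev\<close>.\<close>

definition aev :: "'k::field poly fract alg_closure \<Rightarrow> 'k poly poly \<Rightarrow> 'k poly fract alg_closure"
  where "aev x a = poly (map_poly poly_embed a) x"

definition integral_element :: "'k::field poly fract alg_closure \<Rightarrow> bool"
  where "integral_element x \<longleftrightarrow> (\<exists>g :: 'k poly poly. lead_coeff g = 1 \<and> aev x g = 0)"

interpretation poly_embed: map_poly_inj_idom_hom "poly_embed :: 'k::field poly \<Rightarrow> _"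
  by unfold_locales auto

interpretation aev: idom_hom "aev x" for x
  by unfold_locales (auto simp: aev_def poly_embed.hom_add poly_embed.hom_mult)

lemma aev_pCons [simp]: "aev x (pCons c p) = poly_embed c + x * aev x p"
  by (simp add: aev_def poly_embed.base.map_poly_pCons_hom)

lemma aev_eq_tev: "aev x a = tev x (map_poly to_fract a)"
  by (simp add: aev_def tev_def map_poly_map_poly o_def)

lemma poly_embed_in_base: "poly_embed c \<in> base_field"
  by blast

definition espan :: "'i set \<Rightarrow> ('i \<Rightarrow> 'k::field poly fract alg_closure) \<Rightarrow> 'k poly fract alg_closure set"
  where "espan I v = range (\<lambda>c. \<Sum>i\<in>I. poly_embed (c i) * v i)"

lemma espan_add: assumes "x \<in> espan I v" "y \<in> espan I v" shows "x + y \<in> espan I v"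
proof -
  obtain a b where "x = (\<Sum>i\<in>I. poly_embed (a i) * v i)" "y = (\<Sum>i\<in>I. poly_embed (b i) * v i)"
    using assms by (auto simp: espan_def)
  then have "x + y = (\<Sum>i\<in>I. poly_embed (a i + b i) * v i)" by (simp add: sum.distrib algebra_simps)
  then show ?thesis unfolding espan_def by (rule range_eqI[where x="\<lambda>i. a i + b i"])
qed

lemma espan_scale: assumes "x \<in> espan I v" shows "poly_embed c * x \<in> espan I v"
proof -
  obtain a where "x = (\<Sum>i\<in>I. poly_embed (a i) * v i)" using assms by (auto simp: espan_def)
  then have "poly_embed c * x = (\<Sum>i\<in>I. poly_embed (c * a i) * v i)" by (simp add: sum_distrib_left mult.assoc)
  then show ?thesis unfolding espan_def by (rule range_eqI[where x="\<lambda>i. c * a i"])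
qed

lemma espan_0: "0 \<in> espan I v"
  unfolding espan_def by (rule range_eqI[of _ _ "\<lambda>_. 0"]) simp

lemma espan_sum: "(\<And>j. j \<in> J \<Longrightarrow> g j \<in> espan I v) \<Longrightarrow> sum g J \<in> espan I v"
  by (induction J rule: infinite_finite_induct) (auto intro: espan_add espan_0)

lemma espan_base: assumes "finite I" "i \<in> I" shows "v i \<in> espan I v"
proof -
  have "v i = (\<Sum>j\<in>I. poly_embed (if j = i then 1 else 0) * v j)"
    using assms by (simp add: if_distrib[of poly_embed] if_distrib[of "\<lambda>x. x * _"] sum.delta cong: if_cong)
  then show ?thesis unfolding espan_def by (rule range_eqI[where x="\<lambda>j. if j = i then 1 else 0"])
qed

lemma espan_stable: assumes "\<And>i. i \<in> I \<Longrightarrow> z * v i \<in> espan I v" "x \<in> espan I v" shows "z * x \<in> espan I v"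
proof -
  obtain a where a: "x = (\<Sum>i\<in>I. poly_embed (a i) * v i)" using assms(2) by (auto simp: espan_def)
  have "z * x = (\<Sum>i\<in>I. poly_embed (a i) * (z * v i))" by (simp add: a sum_distrib_left mult_ac)
  then show ?thesis using assms(1) by (simp add: espan_sum espan_scale)
qed

text \<open>The determinant trick: z is an eigenvalue of a matrix over the polynomials in T, hence a
  root of its monic characteristic polynomial.\<close>

lemma integral_of_stable:
  fixes z :: "'k::field poly fract alg_closure"
  assumes I: "finite I" "i0 \<in> I" "v i0 \<noteq> 0" and stable: "\<And>i. i \<in> I \<Longrightarrow> z * v i \<in> espan I v"
  shows "integral_element z"
proof -
  obtain h where h: "bij_betw h {..<card I} I"
    using ex_bij_betw_nat_finite[OF I(1)] by (auto simp: lessThan_atLeast0)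
  let ?n = "card I"
  define C where "C i = (SOME c. z * v i = (\<Sum>j\<in>I. poly_embed (c j) * v j))" for i
  have C: "z * v i = (\<Sum>j\<in>I. poly_embed (C i j) * v j)" if "i \<in> I" for i
  proof -
    have "\<exists>c. z * v i = (\<Sum>j\<in>I. poly_embed (c j) * v j)" using stable[OF that] by (auto simp: espan_def)
    then show ?thesis unfolding C_def by (rule someI_ex)
  qed
  define A where "A = mat ?n ?n (\<lambda>(i, j). C (h i) (h j))"
  define A' where "A' = map_mat poly_embed A"
  have A: "A \<in> carrier_mat ?n ?n" "A' \<in> carrier_mat ?n ?n" by (simp_all add: A_def A'_def)
  define w where "w = vec ?n (\<lambda>i. v (h i))"
  have hI: "h i \<in> I" if "i < ?n" for i using h that by (auto simp: bij_betw_def)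
  have "A' *\<^sub>v w = z \<cdot>\<^sub>v w"
  proof (rule eq_vecI)
    fix i assume "i < dim_vec (z \<cdot>\<^sub>v w)"
    then have i: "i < ?n" by (simp add: w_def)
    have "(A' *\<^sub>v w) $ i = (\<Sum>j<?n. poly_embed (C (h i) (h j)) * v (h j))"
      using i by (simp add: A'_def A_def w_def scalar_prod_def lessThan_atLeast0)
    also have "\<dots> = (\<Sum>j\<in>I. poly_embed (C (h i) j) * v j)"
      using sum.reindex_bij_betw[OF h, of "\<lambda>j. poly_embed (C (h i) j) * v j"] .
    also have "\<dots> = z * v (h i)" using C[OF hI[OF i]] by simp
    finally show "(A' *\<^sub>v w) $ i = (z \<cdot>\<^sub>v w) $ i" using i by (simp add: w_def)
  qed (simp add: A'_def A_def w_def)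
  moreover have "w \<noteq> 0\<^sub>v ?n"
  proof
    assume w0: "w = 0\<^sub>v ?n"
    have "i0 \<in> h ` {..<?n}" using I(2) bij_betw_imp_surj_on[OF h] by simp
    then obtain i where i: "i < ?n" "h i = i0" by auto
    have "w $ i = v i0" using i by (simp add: w_def)
    then show False using w0 i I(3) by simp
  qed
  ultimately have "eigenvalue A' z"
    unfolding eigenvalue_def eigenvector_def using A by (intro exI[of _ w]) (auto simp: w_def A'_def A_def)
  then have "poly (char_poly A') z = 0" using eigenvalue_root_char_poly[OF A(2)] by simp
  also have "char_poly A' = map_poly poly_embed (char_poly A)"
    unfolding A'_def by (rule poly_embed.base.char_poly_hom[OF A(1)])
  finally show ?thesis
    using degree_monic_char_poly[OF A(1)] unfolding integral_element_def aev_def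
    by (intro exI[of _ "char_poly A"]) simp
qed

lemma monic_root_degree_pos: "lead_coeff g = 1 \<Longrightarrow> aev x g = 0 \<Longrightarrow> 0 < degree g"
proof (rule ccontr)
  assume *: "lead_coeff g = 1" "aev x g = 0" "\<not> 0 < degree g"
  then have "g = 1" by (metis coeff_pCons_0 degree_eq_zeroE neq0_conv one_pCons)
  then show False using * by simp
qed

lemma power_degree_eq:
  assumes "lead_coeff g = 1" "aev x g = 0"
  shows "x ^ degree g = (\<Sum>i<degree g. poly_embed (- coeff g i) * x ^ i)"
proof -
  have "0 = (\<Sum>i\<le>degree g. poly_embed (coeff g i) * x ^ i)"
    using assms(2) by (simp add: aev_def poly_altdef)
  also have "\<dots> = (\<Sum>i<degree g. poly_embed (coeff g i) * x ^ i) + x ^ degree g"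
    using assms(1) by (simp add: lessThan_Suc_atMost[symmetric])
  finally show ?thesis by (simp add: sum_negf eq_neg_iff_add_eq_0 add.commute)
qed

text \<open>One finite module, spanned by the monomials a^i b^j, stable under both elements; it is
  then stable under their sum and product.\<close>

lemma integral_common_module:
  assumes "integral_element a" "integral_element b"
  obtains I :: "(nat \<times> nat) set" and v where "finite I" "(0, 0) \<in> I" "v (0, 0) \<noteq> 0"
    "\<And>i. i \<in> I \<Longrightarrow> a * v i \<in> espan I v" "\<And>i. i \<in> I \<Longrightarrow> b * v i \<in> espan I v"
proof -
  obtain f where f: "lead_coeff f = 1" "aev a f = 0" using assms(1) by (auto simp: integral_element_def)
  obtain g where g: "lead_coeff g = 1" "aev b g = 0" using assms(2) by (auto simp: integral_element_def)
  define I where "I = {..<degree f} \<times> {..<degree g}"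
  define v where "v = (\<lambda>(i, j). a ^ i * b ^ j)"
  have fin: "finite I" by (simp add: I_def)
  have base: "a ^ i * b ^ j \<in> espan I v" if "i < degree f" "j < degree g" for i j
    using espan_base[OF fin, of "(i, j)" v] that by (simp add: I_def v_def)
  show ?thesis
  proof (rule that[OF fin])
    show "(0, 0) \<in> I" using monic_root_degree_pos[OF f] monic_root_degree_pos[OF g] by (simp add: I_def)
    show "v (0, 0) \<noteq> 0" by (simp add: v_def)
    show "a * v x \<in> espan I v" if xI: "x \<in> I" for x
    proof -
      obtain i j where x: "x = (i, j)" "i < degree f" "j < degree g" using xI by (auto simp: I_def)
      show ?thesis
      proof (cases "Suc i < degree f")
        case True
        then show ?thesis using base[of "Suc i" j] x by (simp add: v_def mult_ac)
      next
        case False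
        then have "a * v x = a ^ degree f * b ^ j" using x
          by (simp add: v_def mult.assoc[symmetric] Suc_leI flip: power_Suc) (metis Suc_leI le_antisym not_less)
        also have "\<dots> = (\<Sum>l<degree f. poly_embed (- coeff f l) * (a ^ l * b ^ j))"
          by (simp add: power_degree_eq[OF f] sum_distrib_right mult.assoc)
        also have "\<dots> \<in> espan I v" using base x by (intro espan_sum espan_scale) auto
        finally show ?thesis .
      qed
    qed
    show "b * v x \<in> espan I v" if xI: "x \<in> I" for x
    proof -
      obtain i j where x: "x = (i, j)" "i < degree f" "j < degree g" using xI by (auto simp: I_def)
      show ?thesis
      proof (cases "Suc j < degree g")
        case True
        then show ?thesis using base[of i "Suc j"] x by (simp add: v_def mult_ac)
      next
        case False
        then have "degree g = Suc j" using x by simp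
        then have "b * v x = a ^ i * b ^ degree g" using x by (simp add: v_def mult_ac)
        also have "\<dots> = (\<Sum>l<degree g. poly_embed (- coeff g l) * (a ^ i * b ^ l))"
          by (simp add: power_degree_eq[OF g] sum_distrib_left mult_ac)
        also have "\<dots> \<in> espan I v" using base x by (intro espan_sum espan_scale) auto
        finally show ?thesis .
      qed
    qed
  qed
qed

lemma integral_add: assumes "integral_element a" "integral_element b" shows "integral_element (a + b)"
proof -
  obtain I :: "(nat \<times> nat) set" and v where I: "finite I" "(0, 0) \<in> I" "v (0, 0) \<noteq> 0"
    "\<And>i. i \<in> I \<Longrightarrow> a * v i \<in> espan I v" "\<And>i. i \<in> I \<Longrightarrow> b * v i \<in> espan I v"
    using integral_common_module[OF assms] by blast
  show ?thesis by (rule integral_of_stable[of I "(0, 0)" v, OF I(1-3)]) (simp add: distrib_right espan_add I)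
qed

lemma integral_mult: assumes "integral_element a" "integral_element b" shows "integral_element (a * b)"
proof -
  obtain I :: "(nat \<times> nat) set" and v where I: "finite I" "(0, 0) \<in> I" "v (0, 0) \<noteq> 0"
    "\<And>i. i \<in> I \<Longrightarrow> a * v i \<in> espan I v" "\<And>i. i \<in> I \<Longrightarrow> b * v i \<in> espan I v"
    using integral_common_module[OF assms] by blast
  show ?thesis
    by (rule integral_of_stable[of I "(0, 0)" v, OF I(1-3)]) (simp add: mult.assoc espan_stable[OF I(4) I(5)])
qed

lemma integral_embed: "integral_element (poly_embed c)"
  unfolding integral_element_def by (rule exI[of _ "[:- c, 1:]"]) simp

lemma integral_0: "integral_element 0" and integral_1: "integral_element 1"
  using integral_embed[of 0] integral_embed[of 1] by simp_all

lemma integral_uminus: "integral_element a \<Longrightarrow> integral_element (- a)"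
  using integral_mult[OF integral_embed[of "-1"], of a] by simp

text \<open>The polynomial ring is integrally closed. Lowest terms are expressed by a denominator b
  of least degree: a prime divisor of b would also divide the numerator, by the integral equation
  multiplied by b^n.\<close>

lemma integral_base_imp_polynomial:
  fixes c :: "'k::field poly fract"
  assumes "integral_element (to_ac c)"
  shows "c \<in> range to_fract"
proof -
  obtain g :: "'k poly poly" where g: "lead_coeff g = 1" "aev (to_ac c) g = 0"
    using assms by (auto simp: integral_element_def)
  let ?n = "degree g"
  let ?Q = "\<lambda>(a, b). b \<noteq> 0 \<and> c * to_fract b = to_fract a"
  have "\<exists>ab. ?Q ab"
  proof -
    obtain x y where "c = to_fract x / to_fract y" "y \<noteq> 0" by (cases c) (auto simp: Fract_conv_to_fract)
    then show ?thesis by (intro exI[of _ "(x, y)"]) simp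
  qed
  then obtain ab where ab: "?Q ab" "\<And>ab'. ?Q ab' \<Longrightarrow> degree (snd ab) \<le> degree (snd ab')"
    using ex_has_least_nat[of ?Q _ "\<lambda>ab. degree (snd ab)"] by blast
  obtain a b where ab_eq: "ab = (a, b)" by (cases ab)
  have b: "b \<noteq> 0" "c * to_fract b = to_fract a" using ab(1) ab_eq by auto
  have sum0: "(\<Sum>i\<le>?n. coeff g i * (a ^ i * b ^ (?n - i))) = 0"
  proof -
    have "poly_embed (\<Sum>i\<le>?n. coeff g i * (a ^ i * b ^ (?n - i)))
        = (\<Sum>i\<le>?n. poly_embed (coeff g i) * (to_ac c ^ i * poly_embed b ^ ?n))"
    proof -
      have "poly_embed (a ^ i * b ^ (?n - i)) = to_ac c ^ i * poly_embed b ^ ?n" if "i \<le> ?n" for i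
      proof -
        have "poly_embed a = to_ac c * poly_embed b" using b(2) by (simp flip: to_ac_mult)
        then have "poly_embed (a ^ i * b ^ (?n - i)) = to_ac c ^ i * (poly_embed b ^ i * poly_embed b ^ (?n - i))"
          by (simp only: poly_embed.base.hom_mult poly_embed.base.hom_power power_mult_distrib mult.assoc)
        then show ?thesis using that by (simp flip: power_add)
      qed
      then show ?thesis by (simp add: to_ac_sum)
    qed
    also have "\<dots> = poly_embed b ^ ?n * aev (to_ac c) g"
      by (simp add: aev_def poly_altdef sum_distrib_left mult_ac)
    finally have "poly_embed (\<Sum>i\<le>?n. coeff g i * (a ^ i * b ^ (?n - i))) = poly_embed 0" using g(2) by simp
    then show ?thesis by (rule poly_embed.base.injectivity)
  qed
  have "degree b = 0"
  proof (rule ccontr)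
    assume "degree b \<noteq> 0"
    then obtain p where p: "p \<in> prime_polys" "p dvd b" using exists_prime_poly_dvd[OF b(1)] by blast
    note t = tev_prime_root[OF p(1)]
    let ?t = "prime_root p"
    have tb: "tev ?t b = 0" using p t tev_eq_0_iff_dvd[OF prime_poly_irreducible] by blast
    have "0 = tev ?t (\<Sum>i\<le>?n. coeff g i * (a ^ i * b ^ (?n - i)))" by (simp add: sum0)
    also have "\<dots> = (\<Sum>i\<le>?n. tev ?t (coeff g i) * (tev ?t a ^ i * tev ?t b ^ (?n - i)))"
      by (simp add: tev.base.hom_sum tev.base.hom_mult tev.base.hom_power)
    also have "\<dots> = (\<Sum>i\<in>{?n}. tev ?t (coeff g i) * (tev ?t a ^ i * tev ?t b ^ (?n - i)))"
      using tb by (intro sum.mono_neutral_right) (auto simp: power_0_left)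
    also have "\<dots> = tev ?t a ^ ?n" using g(1) by simp
    finally have "tev ?t a = 0" by simp
    then have "p dvd a" using tev_eq_0_iff_dvd[OF prime_poly_irreducible[OF p(1)] t] by simp
    then obtain a' where a': "a = p * a'" by (elim dvdE)
    obtain b' where b': "b = p * b'" using p(2) by (elim dvdE)
    have pnz: "p \<noteq> 0" "b' \<noteq> 0" using b(1) b' by auto
    have "c * to_fract b' = to_fract a'" using b(2) pnz by (simp add: a' b')
    then have "?Q (a', b')" using pnz by simp
    then have "degree b \<le> degree b'" using ab(2)[of "(a', b')"] ab_eq by simp
    moreover have "degree b = degree p + degree b'" using pnz by (simp add: b' degree_mult_eq)
    ultimately show False using prime_poly_degree_pos[OF p(1)] by simp
  qed
  then obtain e where e: "b = [:e:]" "e \<noteq> 0" using b(1) by (metis degree_eq_zeroE pCons_0_0)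
  have "c = to_fract ([:inverse e:] * a)"
  proof -
    have "to_fract ([:inverse e:] * a) = to_fract [:inverse e:] * (c * to_fract b)" by (simp only: b(2) to_fract_mult)
    also have "\<dots> = c * to_fract ([:inverse e:] * b)" by (simp only: to_fract_mult mult_ac)
    also have "[:inverse e:] * b = 1" using e by (simp add: one_pCons)
    finally show ?thesis by simp
  qed
  then show ?thesis by (rule range_eqI)
qed

text \<open>All roots of the minimal polynomial satisfy the same monic equation as x. Its
  coefficients are sums and products of these roots, hence integral elements of the base field,
  hence polynomials.\<close>

lemma integral_minimal_poly:
  fixes x :: "'k::field poly fract alg_closure"
  assumes "integral_element x"
  obtains f :: "'k poly poly" where "lead_coeff f = 1" "Factorial_Ring.irreducible (map_poly to_fract f)" "aev x f = 0"
proof -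
  obtain g :: "'k poly poly" where g: "lead_coeff g = 1" "aev x g = 0" using assms by (auto simp: integral_element_def)
  obtain p where p: "Factorial_Ring.irreducible p" "lead_coeff p = 1" "tev x p = 0" by (rule exists_minimal_poly)
  have "p dvd map_poly to_fract g" using g(2) tev_eq_0_iff_dvd[OF p(1,3)] by (simp add: aev_eq_tev)
  then obtain k where k: "map_poly to_fract g = p * k" by (elim dvdE)
  have root: "integral_element y" if "tev y p = 0" for y
    using that g(1) unfolding integral_element_def aev_eq_tev
    by (intro exI[of _ g]) (simp add: k tev.base.hom_mult)
  have nz: "map_poly to_ac p \<noteq> 0" using irreducible_field_polyD[OF p(1)] by simp
  obtain A where A: "size A = degree (map_poly to_ac p)"
      "map_poly to_ac p = Polynomial.smult (lead_coeff (map_poly to_ac p)) (\<Prod>y\<in>#A. [:- y, 1:])"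
    using alg_closed_imp_factorization[OF nz] by blast
  then have A: "map_poly to_ac p = (\<Prod>y\<in>#A. [:- y, 1:])" using p(2) by simp
  have "integral_element y" if "y \<in># A" for y
  proof (rule root)
    show "tev y p = 0" unfolding tev_def A using that by (auto simp: poly_prod_mset prod_mset_zero_iff)
  qed
  then have "integral_element (coeff (\<Prod>y\<in>#A. [:- y, 1:]) i)" for i
  proof (induction A arbitrary: i)
    case empty
    then show ?case using integral_0 integral_1 by (cases i) (simp_all add: one_pCons)
  next
    case (add y A)
    then have IH: "integral_element (coeff (\<Prod>y\<in>#A. [:- y, 1:]) i)" "integral_element y" for i by auto
    have "(\<Prod>y\<in>#add_mset y A. [:- y, 1:])
        = Polynomial.smult (- y) (\<Prod>y\<in>#A. [:- y, 1:]) + pCons 0 (\<Prod>y\<in>#A. [:- y, 1:])" by simp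
    then show ?case
      using integral_add[OF integral_mult[OF integral_uminus[OF IH(2)] IH(1)]] IH(1) integral_0
      by (cases i) (simp_all only: coeff_add coeff_smult coeff_pCons_0 coeff_pCons_Suc)
  qed
  then have "integral_element (to_ac (coeff p i))" for i unfolding A[symmetric] by simp
  then have ci: "coeff p i \<in> range to_fract" for i by (rule integral_base_imp_polynomial)
  define f where "f = map_poly (inv_into UNIV to_fract) p"
  have inj: "inj (to_fract :: 'k poly \<Rightarrow> _)" by (auto simp: inj_def)
  have "inv_into UNIV to_fract (0 :: 'k poly fract) = 0" using inv_f_f[OF inj, of 0] by simp
  then have cf: "to_fract (coeff f i) = coeff p i" for i
    using ci[of i] by (simp add: f_def coeff_map_poly f_inv_into_f)
  then have map: "map_poly to_fract f = p" by (intro poly_eqI) (simp add: coeff_map_poly)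
  have "degree f = degree p" using map by (metis to_fract.base.degree_map_poly_hom)
  then have "to_fract (lead_coeff f) = to_fract 1" using cf[of "degree p"] p(2) by simp
  then have "lead_coeff f = 1" by (simp only: to_fract_eq_iff)
  then show ?thesis using that p map by (simp add: aev_eq_tev)
qed

lemma exists_integral_multiple:
  fixes x :: "'k::field poly fract alg_closure"
  obtains c where "c \<noteq> 0" "integral_element (poly_embed c * x)"
proof -
  obtain p where p: "Factorial_Ring.irreducible p" "lead_coeff p = 1" "tev x p = 0" by (rule exists_minimal_poly)
  obtain c P where c: "c \<noteq> 0" "Polynomial.smult (to_fract c) p = map_poly to_fract P"
    by (rule exists_clear_denominator)
  let ?n = "degree p"
  have n: "0 < ?n" using irreducible_field_polyD[OF p(1)] by simp
  have cP: "to_fract (coeff P i) = to_fract c * coeff p i" for i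
    using arg_cong[OF c(2), of "\<lambda>q. coeff q i"] by simp
  have lcP: "coeff P ?n = c"
  proof -
    have "to_fract (coeff P ?n) = to_fract c" using cP[of ?n] p(2) by simp
    then show ?thesis by (simp only: to_fract_eq_iff)
  qed
  \<comment> \<open>This is c^(n - 1) P(X / c), which is monic because c is the leading coefficient
    of P.\<close>
  define g where "g = monom 1 ?n + (\<Sum>i<?n. monom (coeff P i * c ^ (?n - 1 - i)) i)"
  have lc: "lead_coeff g = 1"
  proof -
    have "degree (\<Sum>i<?n. monom (coeff P i * c ^ (?n - 1 - i)) i) < ?n"
      using n by (intro degree_sum_less) (auto intro: le_less_trans[OF degree_monom_le])
    then have "degree g = ?n" "coeff (\<Sum>i<?n. monom (coeff P i * c ^ (?n - 1 - i)) i) ?n = 0"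
      unfolding g_def by (subst degree_add_eq_left, simp_all add: degree_monom_eq) (rule coeff_eq_0)
    then show ?thesis by (simp add: g_def)
  qed
  have "poly_embed c ^ (?n - 1) * (\<Sum>i\<le>?n. poly_embed (coeff P i) * x ^ i) = 0"
  proof -
    have "(\<Sum>i\<le>?n. poly_embed (coeff P i) * x ^ i) = poly_embed c * (\<Sum>i\<le>?n. to_ac (coeff p i) * x ^ i)"
      by (simp add: cP sum_distrib_left mult.assoc)
    also have "(\<Sum>i\<le>?n. to_ac (coeff p i) * x ^ i) = tev x p" by (simp add: tev_def poly_altdef)
    finally show ?thesis using p(3) by simp
  qed
  moreover have "poly_embed c ^ (?n - 1) * (\<Sum>i\<le>?n. poly_embed (coeff P i) * x ^ i) = aev (poly_embed c * x) g"
  proof -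
    have pw: "poly_embed c ^ (?n - 1) = poly_embed c ^ (?n - 1 - i) * poly_embed c ^ i" if "i < ?n" for i
      using that by (simp flip: power_add)
    have "poly_embed c ^ (?n - 1) * (\<Sum>i\<le>?n. poly_embed (coeff P i) * x ^ i)
        = poly_embed c ^ (?n - 1) * poly_embed c * x ^ ?n
          + (\<Sum>i<?n. poly_embed c ^ (?n - 1) * (poly_embed (coeff P i) * x ^ i))"
      by (simp add: lessThan_Suc_atMost[symmetric] lcP distrib_left sum_distrib_left)
    also have "poly_embed c ^ (?n - 1) * poly_embed c * x ^ ?n = (poly_embed c * x) ^ ?n"
      by (simp only: power_mult_distrib power_minus_mult[OF n])
    also have "(\<Sum>i<?n. poly_embed c ^ (?n - 1) * (poly_embed (coeff P i) * x ^ i))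
        = (\<Sum>i<?n. poly_embed (coeff P i * c ^ (?n - 1 - i)) * (poly_embed c * x) ^ i)"
    proof (rule sum.cong[OF refl])
      fix i assume "i \<in> {..<?n}"
      then have "i < ?n" by simp
      then show "poly_embed c ^ (?n - 1) * (poly_embed (coeff P i) * x ^ i)
          = poly_embed (coeff P i * c ^ (?n - 1 - i)) * (poly_embed c * x) ^ i"
        by (subst pw) (simp_all only: poly_embed.base.hom_mult poly_embed.base.hom_power power_mult_distrib mult_ac)
    qed
    also have "(poly_embed c * x) ^ ?n + \<dots> = aev (poly_embed c * x) g"
      by (simp add: g_def aev.hom_add aev.hom_sum) (simp add: aev_def map_poly_monom poly_monom)
    finally show ?thesis .
  qed
  ultimately have "aev (poly_embed c * x) g = 0" by (simp only:)
  then show ?thesis using that c(1) lc unfolding integral_element_def by blast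
qed

section \<open>Places of the ring of integers\<close>

lemma
  assumes "\<And>x y. x \<in> A \<Longrightarrow> y \<in> A \<Longrightarrow> g x = g y \<longleftrightarrow> h x = h y"
  shows bij_betw_of_same_fibres: "bij_betw (\<lambda>c. h (inv_into A g c)) (g ` A) (h ` A)"
    and same_fibres_inv: "x \<in> A \<Longrightarrow> h (inv_into A g (g x)) = h x"
proof -
  have inv: "inv_into A g c \<in> A" "g (inv_into A g c) = c" if "c \<in> g ` A" for c
    using inv_into_into[OF that] f_inv_into_f[OF that] by auto
  show eq: "h (inv_into A g (g x)) = h x" if "x \<in> A" for x
    using assms[of "inv_into A g (g x)" x] inv[of "g x"] that by blast
  show "bij_betw (\<lambda>c. h (inv_into A g c)) (g ` A) (h ` A)"
  proof (rule bij_betw_imageI)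
    show "inj_on (\<lambda>c. h (inv_into A g c)) (g ` A)"
      by (rule inj_onI) (metis assms inv)
    show "(\<lambda>c. h (inv_into A g c)) ` g ` A = h ` A"
      using eq unfolding image_image by (rule image_cong[OF refl])
  qed
qed

lemma card_image_eq_of_iff:
  assumes "\<And>x y. x \<in> A \<Longrightarrow> y \<in> A \<Longrightarrow> g x = g y \<longleftrightarrow> h x = h y"
  shows "card (g ` A) = card (h ` A)"
  using bij_betw_of_same_fibres[of A g h, OF assms] by (rule bij_betw_same_card)

text \<open>Two maps that identify the same elements have matching images. Prime ideals, residues
  and orbits are compared in this way.\<close>

lemma image_mset_eq_of_iff:
  assumes "\<And>x y. x \<in> A \<Longrightarrow> y \<in> A \<Longrightarrow> g x = g y \<longleftrightarrow> h x = h y" "\<And>x. x \<in> A \<Longrightarrow> u (g x) = w (h x)" "finite A"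
  shows "image_mset u (mset_set (g ` A)) = image_mset w (mset_set (h ` A))"
proof -
  note bij = bij_betw_of_same_fibres[of A g h, OF assms(1)]
  have "mset_set (h ` A) = image_mset (\<lambda>c. h (inv_into A g c)) (mset_set (g ` A))"
    using image_mset_mset_set[OF bij_betw_imp_inj_on[OF bij]] bij_betw_imp_surj_on[OF bij] by simp
  then have "image_mset w (mset_set (h ` A)) = image_mset (\<lambda>c. w (h (inv_into A g c))) (mset_set (g ` A))"
    by (simp add: multiset.map_comp comp_def)
  also have "\<dots> = image_mset u (mset_set (g ` A))"
  proof (rule image_mset_cong)
    fix c assume "c \<in># mset_set (g ` A)"
    then obtain x where x: "x \<in> A" "c = g x" using assms(3) by auto
    show "w (h (inv_into A g c)) = u c"
      using same_fibres_inv[of A g h, OF assms(1) x(1)] assms(2)[OF x(1)] x(2) by simp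
  qed
  finally show ?thesis by (rule sym)
qed

lemma range_tev_inverse:
  assumes "p \<in> prime_polys" "tev (t :: 'k::{field,finite} alg_closure) p = 0" "c \<in> range (tev t)"
  shows "inverse c \<in> range (tev t)"
proof -
  have "c ^ CARD('k) ^ degree p = c" using assms(3) range_tev_eq[OF assms(1,2)] by simp
  then have "inverse c ^ CARD('k) ^ degree p = inverse c" by (simp only: power_inverse)
  then show ?thesis using range_tev_eq[OF assms(1,2)] by simp
qed

definition frob :: "nat \<Rightarrow> 'k::{field,finite} alg_closure \<Rightarrow> 'k alg_closure"
  where "frob n y = y ^ CARD('k) ^ n"

lemma frob_funpow: "(frob n ^^ i) y = (y :: 'k::{field,finite} alg_closure) ^ CARD('k) ^ (n * i)"
  by (induction i) (simp_all add: frob_def power_mult[symmetric] power_add[symmetric] add.commute)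

lemma periodic_frob: "0 < n \<Longrightarrow> periodic (frob n) y"
proof -
  obtain m where m: "0 < m" "y ^ CARD('a) ^ m = y" using exists_frobenius_period[of y] by blast
  have "y ^ CARD('a) ^ (n * m) = y"
    using power_power_fixed[OF m(2), of n] by (simp only: power_mult[symmetric] mult.commute)
  then show ?thesis unfolding periodic_def frob_funpow using m(1) by blast
qed

section \<open>Reduction of integral elements at a good point\<close>

locale integral_generator = affine_curve f \<Delta> u v
  for f :: "'k::{field,finite} poly poly" and \<Delta> u v +
  fixes \<alpha> :: "'k poly fract alg_closure"
  assumes root_f: "aev \<alpha> f = 0"
begin

lemma aev_eq_0_iff: "aev \<alpha> a = 0 \<longleftrightarrow> f dvd a"
  using tev_eq_0_iff_dvd[OF irreducible_fract, of \<alpha> "map_poly to_fract a"] root_f map_fract_dvd_iff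
  by (simp add: aev_eq_tev)

text \<open>A presentation x = P(\<alpha>) / h with denominator invertible at t. The powers of
  \<alpha> need not span the ring of integers, so denominators cannot be avoided globally.\<close>

definition loc :: "'k alg_closure \<Rightarrow> 'k poly fract alg_closure \<Rightarrow> 'k poly poly \<Rightarrow> 'k poly \<Rightarrow> bool"
  where "loc t x P h \<longleftrightarrow> tev t h \<noteq> 0 \<and> poly_embed h * x = aev \<alpha> P"

text \<open>The reduction map of the ring of integers at the point (t, y); by
  \<open>place_eq\<close> it does not depend on the presentation.\<close>

definition place :: "'k alg_closure \<Rightarrow> 'k alg_closure \<Rightarrow> 'k poly fract alg_closure \<Rightarrow> 'k alg_closure"
  where "place t y x = (SOME c. \<exists>P h. loc t x P h \<and> c = pev t y P / tev t h)"

abbreviation OK :: "'k poly fract alg_closure set"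
  where "OK \<equiv> integral_closure (adj \<alpha>)"

lemma OK_iff: "x \<in> OK \<longleftrightarrow> x \<in> adj \<alpha> \<and> integral_element x"
  by (simp add: integral_closure_def integral_element_def aev_def)

lemma pev_const [simp]: "pev t y [:h:] = tev t h"
  by simp

lemma aev_const: "aev x [:h:] = poly_embed h"
  by simp

lemma place_eq:
  assumes y: "y \<in> fibre t" and l: "loc t x P h"
  shows "place t y x = pev t y P / tev t h"
  unfolding place_def
proof (rule some_equality)
  show "\<exists>P' h'. loc t x P' h' \<and> pev t y P / tev t h = pev t y P' / tev t h'" using l by blast
  fix c assume "\<exists>P h. loc t x P h \<and> c = pev t y P / tev t h"
  then obtain P' h' where l': "loc t x P' h'" "c = pev t y P' / tev t h'" by blast
  have "aev \<alpha> ([:h:] * P' - [:h':] * P) = poly_embed h * (poly_embed h' * x) - poly_embed h' * (poly_embed h * x)"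
    using l l'(1) by (simp only: aev.hom_minus aev.hom_mult aev_const loc_def)
  then have "aev \<alpha> ([:h:] * P' - [:h':] * P) = 0" by simp
  then have "f dvd [:h:] * P' - [:h':] * P" by (simp only: aev_eq_0_iff)
  then have "pev t y ([:h:] * P') = pev t y ([:h':] * P)" by (rule pev_cong[OF y])
  then have "tev t h * pev t y P' = tev t h' * pev t y P" by (simp only: pev.hom_mult pev_const)
  then show "c = pev t y P / tev t h" using l l'(1) unfolding l'(2) loc_def by (auto simp: frac_eq_eq mult.commute)
qed

lemma loc_embed: "loc t (poly_embed c) [:c:] 1"
  by (simp add: loc_def)

lemma loc_aev: "loc t (aev \<alpha> P) P 1"
  by (simp add: loc_def)

lemma loc_add: "loc t x P h \<Longrightarrow> loc t x' P' h' \<Longrightarrow> loc t (x + x') ([:h':] * P + [:h:] * P') (h * h')"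
proof -
  assume l: "loc t x P h" "loc t x' P' h'"
  have "poly_embed (h * h') * (x + x') = poly_embed h' * (poly_embed h * x) + poly_embed h * (poly_embed h' * x')"
    by (simp only: poly_embed.base.hom_mult algebra_simps)
  also have "\<dots> = aev \<alpha> ([:h':] * P + [:h:] * P')"
    using l by (simp only: aev.hom_add aev.hom_mult aev_const loc_def)
  finally show ?thesis using l by (simp only: loc_def tev.base.hom_mult mult_eq_0_iff) simp
qed

lemma loc_mult: "loc t x P h \<Longrightarrow> loc t x' P' h' \<Longrightarrow> loc t (x * x') (P * P') (h * h')"
proof -
  assume l: "loc t x P h" "loc t x' P' h'"
  have "poly_embed (h * h') * (x * x') = (poly_embed h * x) * (poly_embed h' * x')"
    by (simp only: poly_embed.base.hom_mult mult_ac)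
  also have "\<dots> = aev \<alpha> (P * P')" using l by (simp only: aev.hom_mult loc_def)
  finally show ?thesis using l by (simp only: loc_def tev.base.hom_mult mult_eq_0_iff) simp
qed

text \<open>Away from \<Delta> the powers of \<alpha> span the ring of integers locally. In a
  presentation with denominator h of least degree, a zero of h at t would force P to vanish on the
  whole fibre of t, and the minimal polynomial of t could be cancelled.\<close>

lemma integral_loc:
  assumes "x \<in> OK" "good t"
  obtains P h where "loc t x P h"
proof -
  have x: "x \<in> adj \<alpha>" "integral_element x" using assms(1) by (auto simp: OK_iff)
  obtain S where S: "x = tev \<alpha> S" using x(1) by (auto simp: adj_def)
  obtain g :: "'k poly poly" where g: "lead_coeff g = 1" "aev x g = 0" using x(2) by (auto simp: integral_element_def)
  let ?n = "degree g"
  let ?Q = "\<lambda>(h, P). h \<noteq> 0 \<and> reduced P \<and> poly_embed h * x = aev \<alpha> P"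
  have "\<exists>hP. ?Q hP"
  proof -
    obtain c S' where S': "c \<noteq> 0" "Polynomial.smult (to_fract c) S = map_poly to_fract S'"
      by (rule exists_clear_denominator)
    have "poly_embed c * x = aev \<alpha> S'"
      unfolding aev_eq_tev S'(2)[symmetric] S by (simp add: tev_def hom_distribs)
    also have "\<dots> = aev \<alpha> (red S')"
    proof -
      have "aev \<alpha> (S' - red S') = 0" using red(1) by (simp only: aev_eq_0_iff)
      then show ?thesis by (simp add: aev.hom_minus)
    qed
    finally show ?thesis using S'(1) red(2) by (intro exI[of _ "(c, red S')"]) simp
  qed
  then obtain hP where hP: "?Q hP" "\<And>hP'. ?Q hP' \<Longrightarrow> degree (fst hP) \<le> degree (fst hP')"
    using ex_has_least_nat[of ?Q _ "\<lambda>hP. degree (fst hP)"] by blast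
  obtain h P where hP_eq: "hP = (h, P)" by (cases hP)
  have h: "h \<noteq> 0" "reduced P" "poly_embed h * x = aev \<alpha> P" using hP(1) hP_eq by auto
  have "tev t h \<noteq> 0"
  proof
    assume th: "tev t h = 0"
    obtain p where p: "Factorial_Ring.irreducible p" "lead_coeff p = 1" "tev t p = 0" by (rule exists_minimal_poly)
    \<comment> \<open>The integral equation of x = P / h multiplied by h^n. Where h vanishes, only
      the term P^n survives.\<close>
    define W where "W = (\<Sum>i\<le>?n. [:coeff g i:] * (P ^ i * [:h:] ^ (?n - i)))"
    have "aev \<alpha> W = (\<Sum>i\<le>?n. poly_embed (coeff g i) * (x ^ i * poly_embed h ^ ?n))"
    proof -
      have "aev \<alpha> (P ^ i * [:h:] ^ (?n - i)) = x ^ i * poly_embed h ^ ?n" if "i \<le> ?n" for i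
      proof -
        have "aev \<alpha> (P ^ i * [:h:] ^ (?n - i)) = x ^ i * (poly_embed h ^ i * poly_embed h ^ (?n - i))"
          by (simp only: aev.hom_mult aev.hom_power aev_const h(3)[symmetric] power_mult_distrib mult_ac)
        then show ?thesis using that by (simp flip: power_add)
      qed
      then have "poly_embed (coeff g i) * (aev \<alpha> (P ^ i * [:h:] ^ (?n - i))) = poly_embed (coeff g i) * (x ^ i * poly_embed h ^ ?n)"
        if "i \<in> {..?n}" for i using that by simp
      then show ?thesis unfolding W_def aev.hom_sum by (intro sum.cong refl) (simp only: aev.hom_mult aev_const)
    qed
    also have "\<dots> = poly_embed h ^ ?n * aev x g"
      by (simp add: aev_def poly_altdef sum_distrib_left mult_ac)
    finally have "f dvd W" using g(2) by (simp add: aev_eq_0_iff)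
    have "map_poly (tev t) P = 0"
    proof (rule map_tev_eq_0_of_vanish[OF h(2) assms(2)])
      fix y assume y: "y \<in> fibre t"
      have "0 = pev t y W" using pev_cong[OF y, of W 0] \<open>f dvd W\<close> by simp
      also have "\<dots> = (\<Sum>i\<le>?n. tev t (coeff g i) * (pev t y P ^ i * tev t h ^ (?n - i)))"
        unfolding W_def by (simp only: pev.hom_sum pev.hom_mult pev.hom_power pev_const)
      also have "\<dots> = (\<Sum>i\<in>{?n}. tev t (coeff g i) * (pev t y P ^ i * tev t h ^ (?n - i)))"
        using th by (intro sum.mono_neutral_right) (auto simp: power_0_left)
      also have "\<dots> = pev t y P ^ ?n" using g(1) by simp
      finally show "pev t y P = 0" by simp
    qed
    then have "tev t (coeff P i) = 0" for i by (metis coeff_0 coeff_map_poly tev.base.hom_zero)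
    then have "p dvd coeff P i" for i using tev_eq_0_iff_dvd[OF p(1,3)] by simp
    then obtain P' where P': "P = Polynomial.smult p P'" "\<And>i. coeff P i = p * coeff P' i"
      using dvd_coeffs_obtain[of p P] by blast
    have "p dvd h" using th tev_eq_0_iff_dvd[OF p(1,3)] by simp
    then obtain h' where h': "h = p * h'" by (elim dvdE)
    have nz: "p \<noteq> 0" "h' \<noteq> 0" using h(1) h' by auto
    have "poly_embed p * (poly_embed h' * x) = poly_embed p * aev \<alpha> P'"
    proof -
      have "P = [:p:] * P'" using P'(1) by simp
      then have "aev \<alpha> P = poly_embed p * aev \<alpha> P'" by (simp only: aev.hom_mult aev_const)
      then show ?thesis using h(3) by (simp only: h' poly_embed.base.hom_mult mult.assoc)
    qed
    then have "poly_embed h' * x = aev \<alpha> P'" using nz by simp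
    moreover have "reduced P'" using h(2) P'(2) nz by (auto simp: reduced_def)
    ultimately have "?Q (h', P')" using nz by simp
    then have "degree h \<le> degree h'" using hP(2)[of "(h', P')"] hP_eq by simp
    moreover have "degree h = degree p + degree h'" using nz by (simp add: h' degree_mult_eq)
    ultimately show False using irreducible_field_polyD(2)[OF p(1)] by simp
  qed
  then show ?thesis using that h(3) unfolding loc_def by blast
qed

lemma OK_add: "x \<in> OK \<Longrightarrow> y \<in> OK \<Longrightarrow> x + y \<in> OK"
  unfolding OK_iff using subfield_ambientD(3)[OF subfield_adj, of x \<alpha> y] integral_add[of x y] by blast

lemma OK_mult: "x \<in> OK \<Longrightarrow> y \<in> OK \<Longrightarrow> x * y \<in> OK"
  unfolding OK_iff using subfield_ambientD(4)[OF subfield_adj, of x \<alpha> y] integral_mult[of x y] by blast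

lemma OK_uminus: "x \<in> OK \<Longrightarrow> - x \<in> OK"
  unfolding OK_iff using subfield_ambientD(5)[OF subfield_adj, of x \<alpha>] integral_uminus[of x] by blast

lemma OK_embed: "poly_embed c \<in> OK"
  using base_subset_adj integral_embed by (auto simp: OK_iff)

lemma OK_0: "0 \<in> OK" and OK_1: "1 \<in> OK"
  using OK_embed[of 0] OK_embed[of 1] by simp_all

lemma OK_diff: "x \<in> OK \<Longrightarrow> y \<in> OK \<Longrightarrow> x - y \<in> OK"
  using OK_add[of x "- y"] OK_uminus by simp

lemma OK_power: "x \<in> OK \<Longrightarrow> x ^ n \<in> OK"
  by (induction n) (auto intro: OK_mult OK_1)

lemma OK_gen: "\<alpha> \<in> OK"
  using self_in_adj root_f monic by (auto simp: OK_iff integral_element_def)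

lemma OK_aev: "aev \<alpha> P \<in> OK"
proof (induction P)
  case (pCons c P)
  then show ?case using OK_add[OF OK_embed OK_mult[OF OK_gen], of "aev \<alpha> P" c] by simp
qed (simp add: OK_0)

lemma
  assumes "good t" "y \<in> fibre t"
  shows place_add: "x \<in> OK \<Longrightarrow> x' \<in> OK \<Longrightarrow> place t y (x + x') = place t y x + place t y x'"
    and place_mult: "x \<in> OK \<Longrightarrow> x' \<in> OK \<Longrightarrow> place t y (x * x') = place t y x * place t y x'"
    and place_aev: "place t y (aev \<alpha> P) = pev t y P"
    and place_embed: "place t y (poly_embed c) = tev t c"
proof -
  show "place t y (aev \<alpha> P) = pev t y P" using place_eq[OF assms(2) loc_aev] by simp
  show "place t y (poly_embed c) = tev t c" using place_eq[OF assms(2) loc_embed] by simp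
  assume "x \<in> OK" "x' \<in> OK"
  then obtain P h P' h' where l: "loc t x P h" "loc t x' P' h'" using integral_loc assms(1) by metis
  then have nz: "tev t h \<noteq> 0" "tev t h' \<noteq> 0" by (auto simp: loc_def)
  show "place t y (x + x') = place t y x + place t y x'"
    by (simp only: place_eq[OF assms(2) l(1)] place_eq[OF assms(2) l(2)] place_eq[OF assms(2) loc_add[OF l]]
      pev.hom_add pev.hom_mult pev_const tev.base.hom_mult add_frac_eq[OF nz] mult.commute)
  show "place t y (x * x') = place t y x * place t y x'"
    by (simp only: place_eq[OF assms(2) l(1)] place_eq[OF assms(2) l(2)] place_eq[OF assms(2) loc_mult[OF l]]
      pev.hom_mult tev.base.hom_mult times_divide_times_eq)
qed

lemma
  assumes "good t" "y \<in> fibre t"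
  shows place_0: "place t y 0 = 0" and place_1: "place t y 1 = 1"
    and place_uminus: "x \<in> OK \<Longrightarrow> place t y (- x) = - place t y x"
    and place_diff: "x \<in> OK \<Longrightarrow> x' \<in> OK \<Longrightarrow> place t y (x - x') = place t y x - place t y x'"
    and place_power: "x \<in> OK \<Longrightarrow> place t y (x ^ n) = place t y x ^ n"
proof -
  show p0: "place t y 0 = 0" using place_embed[OF assms, of 0] by simp
  show p1: "place t y 1 = 1" using place_embed[OF assms, of 1] by simp
  show um: "place t y (- x) = - place t y x" if "x \<in> OK" for x
    using place_add[OF assms that OK_uminus[OF that]] p0 by (simp add: eq_neg_iff_add_eq_0 add.commute)
  show "place t y (x - x') = place t y x - place t y x'" if "x \<in> OK" "x' \<in> OK"
    using place_add[OF assms that(1) OK_uminus[OF that(2)]] um[OF that(2)] by simp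
  show "place t y (x ^ n) = place t y x ^ n" if "x \<in> OK"
    by (induction n) (simp_all add: p1 place_mult[OF assms that OK_power[OF that]])
qed

lemma place_frobenius:
  assumes "good t" "y \<in> fibre t" "x \<in> OK" "t ^ CARD('k) ^ i = t"
  shows "y ^ CARD('k) ^ i \<in> fibre t" "place t (y ^ CARD('k) ^ i) x = place t y x ^ CARD('k) ^ i"
proof -
  have ev: "pev t (y ^ CARD('k) ^ i) P = pev t y P ^ CARD('k) ^ i" for P
    using pev_frobenius[of t i y P] assms(4) by simp
  show fib: "y ^ CARD('k) ^ i \<in> fibre t" using assms(2) by (simp add: fibre_def ev)
  obtain P h where l: "loc t x P h" using integral_loc[OF assms(3,1)] .
  have "tev t h ^ CARD('k) ^ i = tev t h" using tev_frobenius[of t i h] assms(4) by simp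
  then have "(pev t y P / tev t h) ^ CARD('k) ^ i = pev t y P ^ CARD('k) ^ i / tev t h"
    by (simp only: power_divide)
  then show "place t (y ^ CARD('k) ^ i) x = place t y x ^ CARD('k) ^ i"
    unfolding place_eq[OF fib l] place_eq[OF assms(2) l] ev by simp
qed

definition ker :: "'k alg_closure \<Rightarrow> 'k alg_closure \<Rightarrow> 'k poly fract alg_closure set"
  where "ker t y = {x \<in> OK. place t y x = 0}"

end

text \<open>A good prime \<open>p\<close> with a root \<open>t\<close>; \<open>\<phi>\<close> generates the decomposition groups above \<open>p\<close>.\<close>

locale good_prime = integral_generator f \<Delta> u v \<alpha>
  for f :: "'k::{field,finite} poly poly" and \<Delta> u v \<alpha> +
  fixes p :: "'k poly" and t :: "'k alg_closure"
  assumes prime_p: "p \<in> prime_polys" and root_p: "tev t p = 0" and good_t: "good t"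
begin

abbreviation n where "n \<equiv> degree p"
abbreviation \<phi> :: "'k alg_closure \<Rightarrow> 'k alg_closure" where "\<phi> \<equiv> frob (degree p)"

lemma n_pos: "0 < n" by (rule prime_poly_degree_pos[OF prime_p])

lemma periodic_\<phi>: "periodic \<phi> y" by (rule periodic_frob[OF n_pos])

lemma t_fixed: "t ^ CARD('k) ^ (n * i) = t"
  using power_power_fixed[OF frobenius_fixes_root[OF prime_p root_p], of i] by (simp only: power_mult)

lemma tev_eq_0: "tev t c = 0 \<longleftrightarrow> p dvd c"
  by (rule tev_eq_0_iff_dvd[OF prime_poly_irreducible[OF prime_p] root_p])

lemma orb_\<phi>: "orb \<phi> y = {y ^ CARD('k) ^ (n * i) | i. True}"
  unfolding orb_def frob_funpow by blast

lemma place_orb: "y \<in> fibre t \<Longrightarrow> y' \<in> orb \<phi> y \<Longrightarrow> x \<in> OK \<Longrightarrow> place t y x = 0 \<Longrightarrow> place t y' x = 0"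
proof -
  assume *: "y \<in> fibre t" "y' \<in> orb \<phi> y" "x \<in> OK" "place t y x = 0"
  then obtain i where "y' = y ^ CARD('k) ^ (n * i)" unfolding orb_\<phi> by blast
  then show ?thesis using place_frobenius(2)[OF good_t *(1,3) t_fixed] *(4) by simp
qed

text \<open>The orbit is stable under \<phi>, so the coefficients of its polynomial are fixed by
  \<phi> and lie in the residue field of p; they are lifted to polynomials in T.\<close>

lemma exists_orbit_poly:
  obtains g where "lead_coeff g = 1" "degree g = card (orb \<phi> y)"
    "map_poly (tev t) g = (\<Prod>y'\<in>orb \<phi> y. [:- y', 1:])"
proof -
  let ?M = "\<Prod>y'\<in>orb \<phi> y. [:- y', 1:]"
  have fin: "finite (orb \<phi> y)" by (rule finite_orb[OF periodic_\<phi>])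
  interpret F: map_poly_comm_ring_hom "\<lambda>x :: 'k alg_closure. x ^ CARD('k) ^ n"
    using frobenius_comm_ring_hom[where 'k='k] by (rule map_poly_comm_ring_hom.intro)
  have inj: "inj_on \<phi> (orb \<phi> y)" using frobenius_inj by (auto simp: inj_on_def frob_def)
  have img: "\<phi> ` orb \<phi> y = orb \<phi> y"
  proof (rule card_subset_eq[OF fin])
    show "\<phi> ` orb \<phi> y \<subseteq> orb \<phi> y"
      unfolding orb_def by (auto intro: range_eqI[of _ _ "Suc _"])
  qed (rule card_image[OF inj])
  have "map_poly (\<lambda>x. x ^ CARD('k) ^ n) ?M = (\<Prod>y'\<in>orb \<phi> y. [:- \<phi> y', 1:])"
    by (simp add: F.hom_prod F.base.map_poly_pCons_hom frobenius_minus frob_def)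
  also have "\<dots> = (\<Prod>y'\<in>\<phi> ` orb \<phi> y. [:- y', 1:])"
    using inj by (subst prod.reindex) auto
  finally have "map_poly (\<lambda>x. x ^ CARD('k) ^ n) ?M = ?M" by (simp only: img)
  then have "coeff ?M i ^ CARD('k) ^ n = coeff ?M i" for i
    by (metis F.base.coeff_map_poly_hom)
  then have range: "coeff ?M i \<in> range (tev t)" for i
    unfolding range_tev_eq[OF prime_p root_p] by simp
  \<comment> \<open>The values at 0 and 1 are prescribed so that the lifted polynomial stays monic
    of the same degree.\<close>
  define l where "l c = (if c = 1 then 1 else if c = 0 then 0 else SOME a. tev t a = c)" for c
  have l: "tev t (l c) = c" if "c \<in> range (tev t)" for c
  proof -
    have "\<exists>a. tev t a = c" using that by blast
    then have "tev t (SOME a. tev t a = c) = c" by (rule someI_ex)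
    then show ?thesis by (simp add: l_def)
  qed
  define g where "g = map_poly l ?M"
  have cg: "coeff g i = l (coeff ?M i)" for i by (simp add: g_def coeff_map_poly l_def)
  have map: "map_poly (tev t) g = ?M"
    using l[OF range] by (intro poly_eqI) (simp add: coeff_map_poly cg)
  have lcM: "lead_coeff ?M = 1" by (simp add: lead_coeff_prod)
  have degM: "degree ?M = card (orb \<phi> y)" by (subst degree_prod_eq_sum_degree) auto
  have "degree g = degree ?M"
  proof (rule antisym)
    show "degree g \<le> degree ?M" unfolding g_def by (rule degree_map_poly_le)
    have "coeff g (degree ?M) = 1" using lcM by (simp add: cg l_def)
    then show "degree ?M \<le> degree g" by (intro le_degree) simp
  qed
  moreover then have "lead_coeff g = 1" using lcM by (simp add: cg l_def)
  ultimately show ?thesis using that map degM by metis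
qed

lemma orbit_poly_root:
  assumes "map_poly (tev t) g = (\<Prod>y'\<in>orb \<phi> y. [:- y', 1:])"
  shows "pev t z g = 0 \<longleftrightarrow> z \<in> orb \<phi> y"
  unfolding pev_def assms using finite_orb[OF periodic_\<phi>, of y] by (auto simp: poly_prod prod_zero_iff)

lemma orbit_division:
  assumes g: "lead_coeff g = 1" "degree g = card (orb \<phi> y)"
    and map: "map_poly (tev t) g = (\<Prod>y'\<in>orb \<phi> y. [:- y', 1:])"
  obtains w r where "S = g * w + r" "degree r < card (orb \<phi> y)" "pev t y S = pev t y r"
proof -
  have pos: "0 < degree g" using g(2) card_orb_pos[OF periodic_\<phi>] by simp
  obtain r where r: "g dvd S - r" "\<forall>i\<ge>degree g. coeff r i = 0" using monic_division[OF g(1) pos] .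
  obtain w where w: "S - r = g * w" using r(1) by (elim dvdE)
  have S: "S = g * w + r" using w by (simp add: algebra_simps)
  have "degree r < degree g" using r(2) pos by (metis degree_0 leading_coeff_0_iff linorder_not_less)
  moreover have "pev t y S = pev t y r"
    using orbit_poly_root[OF map, of y] unfolding S by (simp add: pev.hom_add pev.hom_mult)
  ultimately show ?thesis using that S g(2) by metis
qed

text \<open>By division by the orbit polynomial, the residue field of the place is the bijective
  image of the polynomials of degree below the orbit size with coefficients in the residue field of
  p.\<close>

lemma card_range_pev: "card (range (pev t y)) = (CARD('k) ^ n) ^ card (orb \<phi> y)"
proof -
  let ?e = "card (orb \<phi> y)" and ?B = "range (tev t)"
  let ?S = "{r. (\<forall>i\<ge>?e. coeff r i = 0) \<and> (\<forall>i. coeff r i \<in> ?B)}"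
  obtain g where g: "lead_coeff g = 1" "degree g = ?e" "map_poly (tev t) g = (\<Prod>y'\<in>orb \<phi> y. [:- y', 1:])"
    by (rule exists_orbit_poly)
  have pevp: "pev t y r = poly (map_poly (tev t) r) y" for r by (simp add: pev_def)
  have frob_poly: "poly r (y ^ CARD('k) ^ (n * i)) = poly r y ^ CARD('k) ^ (n * i)" if "r \<in> ?S" for r i
  proof -
    define l where "l c = (if c = 0 then 0 else SOME a. tev t a = c)" for c
    have l: "tev t (l c) = c" if "c \<in> ?B" for c
    proof -
      have "\<exists>a. tev t a = c" using that by blast
      then have "tev t (SOME a. tev t a = c) = c" by (rule someI_ex)
      then show ?thesis by (simp add: l_def)
    qed
    have "r = map_poly (tev t) (map_poly l r)"
      using that l by (intro poly_eqI) (simp add: coeff_map_poly l_def)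
    then obtain r' where r': "r = map_poly (tev t) r'" by blast
    show ?thesis unfolding r' pev_def[symmetric] using pev_frobenius[of t "n * i" y r'] t_fixed[of i] by simp
  qed
  have "range (pev t y) = (\<lambda>r. poly r y) ` ?S"
  proof (intro equalityI subsetI)
    fix c assume "c \<in> range (pev t y)"
    then obtain S where S: "c = pev t y S" by blast
    obtain w r where r: "S = g * w + r" "degree r < ?e" "pev t y S = pev t y r" by (rule orbit_division[OF g])
    have "map_poly (tev t) r \<in> ?S" using r(2) by (auto simp: coeff_map_poly coeff_eq_0)
    moreover have "c = poly (map_poly (tev t) r) y" using S r(3) pevp by (simp only:)
    ultimately show "c \<in> (\<lambda>r. poly r y) ` ?S" by (intro image_eqI)
  next
    fix c assume "c \<in> (\<lambda>r. poly r y) ` ?S"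
    then obtain r where r: "r \<in> ?S" "c = poly r y" by (elim imageE)
    define l where "l c = (if c = 0 then 0 else SOME a. tev t a = c)" for c
    have l: "tev t (l c) = c" if "c \<in> ?B" for c
    proof -
      have "\<exists>a. tev t a = c" using that by blast
      then have "tev t (SOME a. tev t a = c) = c" by (rule someI_ex)
      then show ?thesis by (simp add: l_def)
    qed
    have "r = map_poly (tev t) (map_poly l r)"
      using r(1) l by (intro poly_eqI) (simp add: coeff_map_poly l_def)
    then have "c = pev t y (map_poly l r)" using r(2) pevp by metis
    then show "c \<in> range (pev t y)" by (rule range_eqI)
  qed
  moreover have "inj_on (\<lambda>r. poly r y) ?S"
  proof (rule inj_onI)
    fix r s assume rs: "r \<in> ?S" "s \<in> ?S" "poly r y = poly s y"
    have "poly (r - s) y' = 0" if "y' \<in> orb \<phi> y" for y'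
    proof -
      obtain i where "y' = y ^ CARD('k) ^ (n * i)" using \<open>y' \<in> orb \<phi> y\<close> unfolding orb_\<phi> by blast
      then show ?thesis using frob_poly[OF rs(1)] frob_poly[OF rs(2)] rs(3) by simp
    qed
    then have sub: "orb \<phi> y \<subseteq> {x. poly (r - s) x = 0}" by blast
    show "r = s"
    proof (rule ccontr)
      assume "r \<noteq> s"
      then have nz: "r - s \<noteq> 0" by simp
      have "?e \<le> card {x. poly (r - s) x = 0}" using sub by (intro card_mono poly_roots_finite nz)
      also have "\<dots> \<le> degree (r - s)" by (rule card_poly_roots_bound[OF nz])
      finally have "coeff (r - s) (degree (r - s)) = 0" using rs by simp
      then show False using nz by (simp only: leading_coeff_0_iff)
    qed
  qed
  ultimately have "card (range (pev t y)) = card ?S" by (simp only: card_image)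
  also have "\<dots> = card ?B ^ ?e"
  proof -
    have "0 \<in> ?B" by (rule range_eqI[of _ _ 0]) simp
    then show ?thesis using card_polys_coeffs_in[of ?B ?e] card_range_tev(2)[OF prime_p root_p] by blast
  qed
  finally show ?thesis by (simp only: card_range_tev(1)[OF prime_p root_p])
qed

lemma place_image: assumes "y \<in> fibre t" shows "place t y ` OK = range (pev t y)"
proof (intro equalityI subsetI)
  fix c assume "c \<in> place t y ` OK"
  then obtain x where x: "x \<in> OK" "c = place t y x" by blast
  obtain P h where l: "loc t x P h" using integral_loc[OF x(1) good_t] .
  have "inverse (tev t h) \<in> range (tev t)" by (rule range_tev_inverse[OF prime_p root_p]) simp
  then obtain h' where h': "tev t h' = inverse (tev t h)" by (metis rangeE)
  have "c = pev t y (P * [:h':])"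
    unfolding x(2) place_eq[OF assms l] pev.hom_mult pev_const h' by (simp add: divide_inverse)
  then show "c \<in> range (pev t y)" by blast
next
  fix c assume "c \<in> range (pev t y)"
  then obtain P where "c = place t y (aev \<alpha> P)" using place_aev[OF good_t assms] by auto
  then show "c \<in> place t y ` OK" using OK_aev by blast
qed

text \<open>Nonzero residues are roots of unity. This replaces inverses in the maximality and
  comaximality arguments.\<close>

lemma place_power_eq_1:
  assumes "y \<in> fibre t" "x \<in> OK" "place t y x \<noteq> 0"
  shows "\<exists>m>0. place t y x ^ m = 1"
proof -
  obtain m where m: "0 < m" "place t y x ^ CARD('k) ^ m = place t y x"
    using exists_frobenius_period[of "place t y x"] by blast
  have Q: "1 < CARD('k) ^ m" by (rule card_power_gt_1[OF m(1)])
  then have "CARD('k) ^ m = Suc (CARD('k) ^ m - 1)" by simp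
  then have "place t y x * place t y x ^ (CARD('k) ^ m - 1) = place t y x * 1"
    using m(2) by (metis mult.right_neutral power_Suc)
  then have "place t y x ^ (CARD('k) ^ m - 1) = 1" using assms(3) by simp
  then show ?thesis using Q by (intro exI[of _ "CARD('k) ^ m - 1"]) simp
qed

text \<open>The lifted orbit polynomial separates orbits: its value at \<alpha> reduces to 0 exactly
  at the points of the orbit of y.\<close>

lemma ker_eq_iff:
  assumes "y \<in> fibre t" "y' \<in> fibre t"
  shows "ker t y = ker t y' \<longleftrightarrow> y' \<in> orb \<phi> y"
proof
  assume "y' \<in> orb \<phi> y"
  then have y: "orb \<phi> y' = orb \<phi> y" by (rule orb_eq_of_mem(2)[OF periodic_\<phi>])
  then have "y \<in> orb \<phi> y'" by simp
  then show "ker t y = ker t y'"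
    unfolding ker_def using place_orb[OF assms(1) \<open>y' \<in> orb \<phi> y\<close>] place_orb[OF assms(2)] by blast
next
  assume eq: "ker t y = ker t y'"
  obtain g where g: "lead_coeff g = 1" "degree g = card (orb \<phi> y)" "map_poly (tev t) g = (\<Prod>y'\<in>orb \<phi> y. [:- y', 1:])"
    by (rule exists_orbit_poly)
  have "pev t y g = 0" using orbit_poly_root[OF g(3)] by simp
  then have "aev \<alpha> g \<in> ker t y" using OK_aev place_aev[OF good_t assms(1)] by (simp add: ker_def)
  then have "aev \<alpha> g \<in> ker t y'" using eq by simp
  then have "pev t y' g = 0" using place_aev[OF good_t assms(2)] by (simp add: ker_def)
  then show "y' \<in> orb \<phi> y" using orbit_poly_root[OF g(3)] by simp
qed

end

section \<open>Prime ideals and splitting types\<close>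

text \<open>Adjoining a vector outside a subspace is a direct sum and multiplies the cardinality by
  that of the field.\<close>

lemma (in ring) card_dimension:
  assumes "dimension n K V" "subfield K R" "finite K"
  shows "finite V \<and> card V = card K ^ n"
  using assms
proof (induction rule: dimension.induct)
  case (Suc_dim v E n K)
  note K = subfield.axioms(1)[OF Suc_dim.prems(1)] subringE[OF subfieldE(1)[OF Suc_dim.prems(1)]]
  obtain Us where Us: "set Us \<subseteq> carrier R" "Span K Us = E"
    using exists_base[OF Suc_dim.prems(1) Suc_dim.hyps(3)] by blast
  note E = Span_subgroup_props[OF Suc_dim.prems(1) Us(1), unfolded Us(2)]
    Span_smult_closed[OF Suc_dim.prems(1) Us(1), unfolded Us(2)]
  have IH: "finite E" "card E = card K ^ n" using Suc_dim.IH Suc_dim.prems by auto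
  define F where "F = (\<lambda>(k, w). k \<otimes> v \<oplus> w)"
  have img: "line_extension K v E = F ` (K \<times> E)"
    unfolding set_eq_iff line_extension_mem_iff F_def image_iff by (simp add: Bex_def)
  have inj: "inj_on F (K \<times> E)"
  proof (rule inj_onI, clarify)
    fix k w k' w' assume in_KE: "k \<in> K" "w \<in> E" "k' \<in> K" "w' \<in> E" and eq: "F (k, w) = F (k', w')"
    have carr: "k \<in> carrier R" "k' \<in> carrier R" "w \<in> carrier R" "w' \<in> carrier R"
      using in_KE K(2) E(1) by auto
    have eq': "k \<otimes> v \<oplus> w = k' \<otimes> v \<oplus> w'" using eq by (simp add: F_def)
    have kv: "k \<otimes> v \<in> carrier R" "k' \<otimes> v \<in> carrier R" using carr Suc_dim.hyps(1) by auto
    have diff: "(k \<oplus> \<ominus> k') \<otimes> v = w' \<oplus> \<ominus> w"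
    proof -
      have "(k \<oplus> \<ominus> k') \<otimes> v = k \<otimes> v \<oplus> \<ominus> (k' \<otimes> v)"
        using carr Suc_dim.hyps(1) by (simp add: l_distr l_minus)
      also have "\<dots> = (k \<otimes> v \<oplus> w) \<oplus> \<ominus> w \<oplus> \<ominus> (k' \<otimes> v)"
        using kv carr by (simp add: a_assoc r_neg)
      also have "\<dots> = (k' \<otimes> v \<oplus> w') \<oplus> \<ominus> w \<oplus> \<ominus> (k' \<otimes> v)" by (simp only: eq')
      also have "\<dots> = w' \<oplus> \<ominus> w \<oplus> (k' \<otimes> v \<oplus> \<ominus> (k' \<otimes> v))"
        using kv carr by (simp add: a_ac)
      also have "\<dots> = w' \<oplus> \<ominus> w" using kv carr by (simp add: r_neg)
      finally show ?thesis .
    qed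
    have E': "w' \<oplus> \<ominus> w \<in> E" using E(3,4) in_KE by blast
    have "k \<oplus> \<ominus> k' = \<zero>"
    proof (rule ccontr)
      assume nz: "k \<oplus> \<ominus> k' \<noteq> \<zero>"
      have "k \<oplus> \<ominus> k' \<in> K" using K(6,8) in_KE by blast
      then have k: "k \<oplus> \<ominus> k' \<in> K - {\<zero>}" using nz by blast
      note i = subfield_m_inv[OF Suc_dim.prems(1) k]
      have "inv (k \<oplus> \<ominus> k') \<otimes> ((k \<oplus> \<ominus> k') \<otimes> v) \<in> E" unfolding diff using E(5)[OF _ E'] i(1) by blast
      moreover have "inv (k \<oplus> \<ominus> k') \<otimes> ((k \<oplus> \<ominus> k') \<otimes> v) = v"
        using i k K(2) Suc_dim.hyps(1) carr by (subst m_assoc[symmetric]) auto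
      ultimately show False using Suc_dim.hyps(2) by simp
    qed
    then have "k = k'" using carr by (metis add.inv_solve_right l_zero zero_closed add.inv_closed)
    then have "w = w'" using eq' kv carr by simp
    then show "k = k' \<and> w = w'" using \<open>k = k'\<close> by simp
  qed
  have "card (F ` (K \<times> E)) = card K * card E" using inj by (simp add: card_image card_cartesian_product)
  then show ?case using IH Suc_dim.prems(2) unfolding img by simp
qed simp

lemma (in ring) finite_dimension_finite_carrier:
  assumes "subfield K R" "finite (carrier R)"
  shows "finite_dimension K (carrier R)"
proof -
  obtain Us where Us: "set Us = carrier R" using finite_list[OF assms(2)] by blast
  have "Span K Us = carrier R"
    using Span_base_incl[OF assms(1), of Us] Span_subgroup_props(1)[OF assms(1), of Us] Us by blast
  then show ?thesis using Span_finite_dimension[OF assms(1), of Us] Us by simp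
qed

text \<open>Reads the dimension off cardinalities, which reduces inertia degrees to
  counting.\<close>

lemma (in ring) dim_eqI:
  assumes "subfield K R" "finite (carrier R)" "card (carrier R) = card K ^ n"
  shows "ring.dim R K (carrier R) = n"
proof -
  have sub: "K \<subseteq> carrier R" by (rule subfieldE(3)[OF assms(1)])
  have fin: "finite K" using sub assms(2) by (rule finite_subset)
  have "{\<zero>, \<one>} \<subseteq> K" "\<one> \<noteq> \<zero>" using subringE(2,3)[OF subfieldE(1)[OF assms(1)]] subfieldE(6)[OF assms(1)] by auto
  then have K: "2 \<le> card K" using card_mono[OF fin, of "{\<zero>, \<one>}"] by auto
  note dim = finite_dimensionE[OF assms(1) finite_dimension_finite_carrier[OF assms(1,2)]]
  have "card K ^ n = card K ^ dim K (carrier R)" using card_dimension[OF dim assms(1) fin] assms(3) by (simp add: over_def)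
  then show ?thesis using K by (subst (asm) power_inject_exp) auto
qed

section \<open>Ideals of the ring of integers above a good prime\<close>

context good_prime
begin

abbreviation R where "R \<equiv> ring_of_integers (adj \<alpha>)"

lemma R_simps [simp]:
  "carrier R = OK" "x \<otimes>\<^bsub>R\<^esub> y = x * y" "x \<oplus>\<^bsub>R\<^esub> y = x + y" "\<one>\<^bsub>R\<^esub> = 1" "\<zero>\<^bsub>R\<^esub> = 0"
  by (simp_all add: ring_of_integers_def)

lemma cring_R: "cring R"
  unfolding ring_of_integers_def
proof (subst ambient.subcring_iff[symmetric])
  show "subcring OK ambient"
    by (intro ambient.subcringI' ambient.subringI) (auto intro: OK_1 OK_uminus OK_mult OK_add)
qed simp

sublocale R: cring R by (rule cring_R)

lemma R_minus [simp]: "x \<in> OK \<Longrightarrow> \<ominus>\<^bsub>R\<^esub> x = - x"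
  by (rule R.minus_equality) (auto intro: OK_uminus)

lemma R_diff [simp]: "x \<in> OK \<Longrightarrow> y \<in> OK \<Longrightarrow> x \<ominus>\<^bsub>R\<^esub> y = x - y"
  by (simp add: a_minus_def)

lemma ideal_closed:
  assumes "ideal I R"
  shows "I \<subseteq> OK" "0 \<in> I" "x \<in> I \<Longrightarrow> y \<in> I \<Longrightarrow> x + y \<in> I" "x \<in> I \<Longrightarrow> y \<in> OK \<Longrightarrow> y * x \<in> I" "x \<in> I \<Longrightarrow> - x \<in> I"
proof -
  interpret I: ideal I R by (rule assms)
  show sub: "I \<subseteq> OK" using I.a_subset by simp
  show "0 \<in> I" using I.zero_closed by simp
  show "x \<in> I \<Longrightarrow> y \<in> I \<Longrightarrow> x + y \<in> I" using I.a_closed[of x y] by simp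
  show "x \<in> I \<Longrightarrow> y \<in> OK \<Longrightarrow> y * x \<in> I" using I.I_l_closed[of x y] by simp
  show "x \<in> I \<Longrightarrow> - x \<in> I" using I.a_inv_closed[of x] R_minus[of x] subsetD[OF sub, of x] by simp
qed

lemma prime_prod_mem:
  assumes "primeideal P R" "finite Y" "\<And>y. y \<in> Y \<Longrightarrow> g y \<in> OK" "prod g Y \<in> P"
  shows "\<exists>y\<in>Y. g y \<in> P"
proof -
  interpret P: primeideal P R by (rule assms(1))
  have one: "1 \<notin> P"
    using P.I_notcarr P.one_imp_carrier by auto
  have cl: "prod g Z \<in> OK" if "Z \<subseteq> Y" for Z
    using finite_subset[OF that assms(2)] that
    by (induction Z rule: finite_induct) (auto intro: OK_1 OK_mult assms(3))
  have "\<exists>y\<in>Z. g y \<in> P" if "Z \<subseteq> Y" "prod g Z \<in> P" for Z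
    using finite_subset[OF that(1) assms(2)] that
  proof (induction Z rule: finite_induct)
    case (insert y Z)
    then have "g y \<in> P \<or> prod g Z \<in> P" using P.I_prime[of "g y" "prod g Z"] assms(3)[of y] cl[of Z] by simp
    then show ?case using insert by blast
  qed (simp add: one)
  then show ?thesis using assms(4) by blast
qed

lemma primeideal_ker:
  assumes y: "y \<in> fibre t"
  shows "primeideal (ker t y) R"
proof (rule primeidealI)
  note pl = place_add[OF good_t y] place_mult[OF good_t y] place_0[OF good_t y] place_uminus[OF good_t y]
    place_1[OF good_t y]
  have cl: "0 \<in> ker t y" "\<And>a b. a \<in> ker t y \<Longrightarrow> b \<in> ker t y \<Longrightarrow> a + b \<in> ker t y"
    "\<And>a. a \<in> ker t y \<Longrightarrow> - a \<in> ker t y"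
    by (auto simp: ker_def pl OK_0 intro: OK_add OK_uminus)
  show "ideal (ker t y) R"
  proof (rule idealI)
    show "subgroup (ker t y) (add_monoid R)"
    proof (rule R.add.subgroupI)
      fix a assume "a \<in> ker t y"
      then show "\<ominus>\<^bsub>R\<^esub> a \<in> ker t y" using cl(3)[of a] by (simp add: ker_def)
    qed (use cl in \<open>auto simp: ker_def\<close>)
  qed (auto simp: ker_def pl OK_mult R.ring_axioms)
  have "1 \<notin> ker t y" using pl(5) by (simp add: ker_def)
  then show "carrier R \<noteq> ker t y" using OK_1 R_simps(1) by metis
  show "a \<in> ker t y \<or> b \<in> ker t y" if "a \<in> carrier R" "b \<in> carrier R" "a \<otimes>\<^bsub>R\<^esub> b \<in> ker t y" for a b
    using that pl(2)[of a b] by (simp add: ker_def)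
qed (rule cring_R)

lemma place_eq_power_1:
  assumes "y \<in> fibre t" "x \<in> OK" "place t y x \<noteq> 0"
  shows "\<exists>m>0. x ^ m - 1 \<in> ker t y"
proof -
  obtain m where m: "0 < m" "place t y x ^ m = 1" using place_power_eq_1[OF assms] by blast
  have "place t y (x ^ m - 1) = 0"
    using place_diff[OF good_t assms(1) OK_power[OF assms(2)] OK_1] m(2)
    by (simp add: place_power[OF good_t assms(1,2)] place_1[OF good_t assms(1)])
  then have "x ^ m - 1 \<in> ker t y" using OK_diff[OF OK_power[OF assms(2)] OK_1] by (simp add: ker_def)
  then show ?thesis using m(1) by blast
qed

text \<open>An element x of P outside the kernel has a power x^m with x^m - 1 in the kernel; then
  both lie in P, and so does 1.\<close>

lemma ker_maximal:
  assumes y: "y \<in> fibre t" and P: "primeideal P R" and sub: "ker t y \<subseteq> P"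
  shows "P = ker t y"
proof (intro equalityI sub subsetI)
  interpret P: primeideal P R by (rule P)
  fix x assume x: "x \<in> P"
  have xO: "x \<in> OK" using x P.a_subset by auto
  show "x \<in> ker t y"
  proof (rule ccontr)
    assume "x \<notin> ker t y"
    then have "place t y x \<noteq> 0" using xO by (simp add: ker_def)
    then obtain m where m: "0 < m" "x ^ m - 1 \<in> ker t y" using place_eq_power_1[OF y xO] by blast
    have "x ^ (m - 1) * x \<in> P" using ideal_closed(4)[OF P.is_ideal x OK_power[OF xO]] .
    then have "x ^ m \<in> P" using power_minus_mult[OF m(1), of x] by simp
    moreover have "- (x ^ m - 1) \<in> P" using ideal_closed(5)[OF P.is_ideal] m(2) sub by blast
    ultimately have "x ^ m + - (x ^ m - 1) \<in> P" by (rule ideal_closed(3)[OF P.is_ideal])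
    then have "\<one>\<^bsub>R\<^esub> \<in> P" by simp
    then show False using P.one_imp_carrier P.I_notcarr by simp
  qed
qed

text \<open>This expresses that p is unramified: in a presentation of x the numerator vanishes on
  the full fibre and is divisible by p, while the denominator is invertible modulo p.\<close>

lemma vanish_everywhere:
  assumes x: "x \<in> OK" "\<And>y. y \<in> fibre t \<Longrightarrow> place t y x = 0"
  shows "\<exists>x'\<in>OK. x = poly_embed p * x'"
proof -
  obtain P h where l: "loc t x P h" using integral_loc[OF x(1) good_t] .
  have h: "tev t h \<noteq> 0" "poly_embed h * x = aev \<alpha> P" using l by (auto simp: loc_def)
  have "aev \<alpha> (P - red P) = 0" using red(1) by (simp only: aev_eq_0_iff)
  then have hx: "poly_embed h * x = aev \<alpha> (red P)" using h(2) by (simp add: aev.hom_minus)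
  have "map_poly (tev t) (red P) = 0"
  proof (rule map_tev_eq_0_of_vanish[OF red(2) good_t])
    fix y assume y: "y \<in> fibre t"
    have "loc t x (red P) h" using h(1) hx by (simp add: loc_def)
    then have "pev t y (red P) / tev t h = 0" using place_eq[OF y] x(2)[OF y] by metis
    then show "pev t y (red P) = 0" using h(1) by simp
  qed
  then have "coeff (map_poly (tev t) (red P)) i = 0" for i by simp
  then have "tev t (coeff (red P) i) = 0" for i by (simp add: coeff_map_poly)
  then have "p dvd coeff (red P) i" for i by (simp only: tev_eq_0)
  then obtain P' where P': "red P = Polynomial.smult p P'" using dvd_coeffs_obtain[of p "red P"] by blast
  have "red P = [:p:] * P'" using P' by simp
  then have hx': "poly_embed h * x = poly_embed p * aev \<alpha> P'" unfolding hx by (simp only: aev.hom_mult aev_const)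
  have "\<not> p dvd h" using h(1) tev_eq_0[of h] by blast
  then obtain a b where ab: "a * p + b * h = 1" by (rule irreducible_bezout[OF prime_poly_irreducible[OF prime_p]])
  have "poly_embed (a * p + b * h) * x = poly_embed p * (poly_embed a * x) + poly_embed b * (poly_embed h * x)"
    by (simp only: poly_embed.base.hom_add poly_embed.base.hom_mult algebra_simps)
  also have "\<dots> = poly_embed p * (poly_embed a * x + poly_embed b * aev \<alpha> P')"
    unfolding hx' by (simp only: algebra_simps)
  finally have "x = poly_embed p * (poly_embed a * x + poly_embed b * aev \<alpha> P')" unfolding ab by simp
  moreover have "poly_embed a * x + poly_embed b * aev \<alpha> P' \<in> OK"
    using x(1) by (intro OK_add OK_mult OK_embed OK_aev)
  ultimately show ?thesis by blast
qed

text \<open>If no kernel were contained in P, choose in each kernel an element outside P. Their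
  product reduces to 0 at every point above t, so it is divisible by p and lies in P, against
  primality.\<close>

lemma prime_containing_p:
  assumes P: "primeideal P R" "poly_embed p \<in> P"
  obtains y where "y \<in> fibre t" "P = ker t y"
proof -
  interpret P: primeideal P R by (rule P)
  have "\<exists>y\<in>fibre t. ker t y \<subseteq> P"
  proof (rule ccontr)
    assume "\<not> ?thesis"
    then have "\<exists>x. x \<in> ker t y \<and> x \<notin> P" if "y \<in> fibre t" for y using that by blast
    then have "\<exists>g. \<forall>y\<in>fibre t. g y \<in> ker t y \<and> g y \<notin> P" by (intro bchoice) blast
    then obtain g where g: "\<And>y. y \<in> fibre t \<Longrightarrow> g y \<in> ker t y" "\<And>y. y \<in> fibre t \<Longrightarrow> g y \<notin> P" by blast
    have gO: "g y \<in> OK" if "y \<in> fibre t" for y using g(1)[OF that] by (simp add: ker_def)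
    have cl: "prod g Z \<in> OK" if "Z \<subseteq> fibre t" for Z
      using finite_subset[OF that finite_fibre] that
      by (induction Z rule: finite_induct) (auto intro: OK_1 OK_mult gO)
    have "place t y (prod g (fibre t)) = 0" if y: "y \<in> fibre t" for y
    proof -
      have "prod g (fibre t) = g y * prod g (fibre t - {y})" using y finite_fibre by (simp add: prod.remove)
      then show ?thesis using place_mult[OF good_t y gO[OF y] cl[of "fibre t - {y}"]] g(1)[OF y] by (simp add: ker_def)
    qed
    then obtain x' where x': "x' \<in> OK" "prod g (fibre t) = poly_embed p * x'"
      using vanish_everywhere[OF cl[OF order_refl]] by blast
    have "x' * poly_embed p \<in> P" by (rule ideal_closed(4)[OF P.is_ideal P(2) x'(1)])
    then have "prod g (fibre t) \<in> P" by (simp add: x'(2) mult.commute)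
    then show False using prime_prod_mem[OF P(1) finite_fibre, where g=g] gO g(2) by blast
  qed
  then show ?thesis using that ker_maximal P(1) by blast
qed

lemma embed_mem_ker_iff: "y \<in> fibre t \<Longrightarrow> poly_embed c \<in> ker t y \<longleftrightarrow> p dvd c"
  using place_embed[OF good_t] tev_eq_0 OK_embed by (simp add: ker_def)

lemma primes_above_eq: "primes_above (adj \<alpha>) p = ker t ` fibre t"
proof (intro equalityI subsetI)
  fix P assume "P \<in> primes_above (adj \<alpha>) p"
  then have P: "primeideal P R" "P \<inter> range poly_embed = poly_embed ` {f. p dvd f}" by (auto simp: primes_above_def)
  have "poly_embed p \<in> poly_embed ` {f. p dvd f}" by (rule imageI) simp
  then have "poly_embed p \<in> P" unfolding P(2)[symmetric] by blast
  then show "P \<in> ker t ` fibre t" using prime_containing_p[OF P(1)] by blast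
next
  fix P assume "P \<in> ker t ` fibre t"
  then obtain y where y: "y \<in> fibre t" "P = ker t y" by blast
  have "ker t y \<inter> range poly_embed = poly_embed ` {f. p dvd f}"
  proof (intro equalityI subsetI)
    fix x assume "x \<in> ker t y \<inter> range poly_embed"
    then obtain c where "x = poly_embed c" "poly_embed c \<in> ker t y" by blast
    then show "x \<in> poly_embed ` {f. p dvd f}" using embed_mem_ker_iff[OF y(1)] by blast
  next
    fix x assume "x \<in> poly_embed ` {f. p dvd f}"
    then obtain c where "x = poly_embed c" "p dvd c" by blast
    then show "x \<in> ker t y \<inter> range poly_embed" using embed_mem_ker_iff[OF y(1)] by blast
  qed
  then show "P \<in> primes_above (adj \<alpha>) p" using primeideal_ker[OF y(1)] y(2) by (simp add: primes_above_def)
qed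

lemma fibre_nonempty: "fibre t \<noteq> {}"
  using card_fibre[OF good_t] degree_pos by auto

text \<open>Both residue fields are counted: the quotient by the kernel matches
  \<open>range (pev t y)\<close> and the cosets of polynomials match
  \<open>range (tev t)\<close>.\<close>

lemma inertia_degree_ker:
  assumes y: "y \<in> fibre t"
  shows "inertia_degree (adj \<alpha>) (ker t y) = card (orb \<phi> y)"
proof -
  interpret P: primeideal "ker t y" R by (rule primeideal_ker[OF y])
  let ?P = "ker t y" and ?\<kappa> = "R Quot ker t y"
  interpret \<kappa>: cring ?\<kappa> by (rule P.quotient_is_cring[OF cring_R])
  interpret h: ring_hom_ring R ?\<kappa> "(+>\<^bsub>R\<^esub>) ?P" by (rule P.rcos_ring_hom_ring)
  let ?c = "\<lambda>x. ?P +>\<^bsub>R\<^esub> x" and ?E = "range (\<lambda>f. ?P +>\<^bsub>R\<^esub> poly_embed f)"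
  have eq_iff: "?c x = ?c x' \<longleftrightarrow> place t y x = place t y x'" if "x \<in> OK" "x' \<in> OK" for x x'
    using R.quotient_eq_iff_same_a_r_cos[OF P.is_ideal, of x x'] that
      place_diff[OF good_t y that] OK_diff[OF that] by (simp add: ker_def)
  have carr: "carrier ?\<kappa> = ?c ` OK" by (auto simp: FactRing_def A_RCOSETS_def')
  have card_\<kappa>: "card (carrier ?\<kappa>) = (CARD('k) ^ n) ^ card (orb \<phi> y)"
  proof -
    have "card (?c ` OK) = card (place t y ` OK)" by (rule card_image_eq_of_iff) (rule eq_iff)
    then show ?thesis by (simp only: carr place_image[OF y] card_range_pev)
  qed
  have card_E: "card ?E = CARD('k) ^ n"
  proof -
    have "card ?E = card (range (tev t))"
      by (rule card_image_eq_of_iff) (simp add: eq_iff OK_embed place_embed[OF good_t y])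
    then show ?thesis using card_range_tev(1)[OF prime_p root_p] by simp
  qed
  have hE: "?c (poly_embed a) \<oplus>\<^bsub>?\<kappa>\<^esub> ?c (poly_embed b) = ?c (poly_embed (a + b))"
    "?c (poly_embed a) \<otimes>\<^bsub>?\<kappa>\<^esub> ?c (poly_embed b) = ?c (poly_embed (a * b))"
    "\<one>\<^bsub>?\<kappa>\<^esub> = ?c (poly_embed 1)" "\<zero>\<^bsub>?\<kappa>\<^esub> = ?c (poly_embed 0)" for a b
    using h.hom_add[of "poly_embed a" "poly_embed b"] h.hom_mult[of "poly_embed a" "poly_embed b"] h.hom_one h.hom_zero
    by (simp_all add: OK_embed)
  have E_carr: "?E \<subseteq> carrier ?\<kappa>" unfolding carr using OK_embed by blast
  have minus: "\<ominus>\<^bsub>?\<kappa>\<^esub> ?c (poly_embed a) = ?c (poly_embed (- a))" for a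
  proof (rule \<kappa>.minus_equality)
    show "?c (poly_embed (- a)) \<oplus>\<^bsub>?\<kappa>\<^esub> ?c (poly_embed a) = \<zero>\<^bsub>?\<kappa>\<^esub>"
      unfolding hE(1,4) by simp
  qed (use E_carr in blast)+
  have subring: "subring ?E ?\<kappa>"
  proof (intro \<kappa>.subringI E_carr)
    show "\<one>\<^bsub>?\<kappa>\<^esub> \<in> ?E" unfolding hE(3) by (rule rangeI)
    fix h1 h2 assume "h1 \<in> ?E" "h2 \<in> ?E"
    then obtain a b where ab: "h1 = ?c (poly_embed a)" "h2 = ?c (poly_embed b)" by blast
    show "h1 \<otimes>\<^bsub>?\<kappa>\<^esub> h2 \<in> ?E" "h1 \<oplus>\<^bsub>?\<kappa>\<^esub> h2 \<in> ?E" unfolding ab hE by (rule rangeI)+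
  next
    fix h assume "h \<in> ?E"
    then obtain a where a: "h = ?c (poly_embed a)" by blast
    show "\<ominus>\<^bsub>?\<kappa>\<^esub> h \<in> ?E" unfolding a minus by (rule rangeI)
  qed
  have unit: "\<exists>b. ?c (poly_embed (b * a)) = ?c (poly_embed 1)" if "?c (poly_embed a) \<noteq> ?c (poly_embed 0)" for a
  proof -
    have "tev t a \<noteq> tev t 0" using that by (simp only: eq_iff[OF OK_embed OK_embed] place_embed[OF good_t y] not_False_eq_True)
    then have "\<not> p dvd a" using tev_eq_0[of a] by simp
    then obtain c b where cb: "c * p + b * a = 1" by (rule irreducible_bezout[OF prime_poly_irreducible[OF prime_p]])
    have "tev t (c * p + b * a) = tev t (b * a)" using root_p by (simp only: tev.base.hom_add tev.base.hom_mult) simp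
    then have "tev t (b * a) = tev t 1" by (simp only: cb)
    then have "?c (poly_embed (b * a)) = ?c (poly_embed 1)"
      using eq_iff[OF OK_embed OK_embed, of "b * a" 1] place_embed[OF good_t y] by (simp only:)
    then show ?thesis by blast
  qed
  have ne: "?c (poly_embed 1) \<noteq> ?c (poly_embed 0)"
    unfolding eq_iff[OF OK_embed OK_embed] place_embed[OF good_t y] by simp
  have U: "e \<in> Units (?\<kappa>\<lparr>carrier := E\<rparr>) \<longleftrightarrow>
      e \<in> E \<and> (\<exists>e'\<in>E. e' \<otimes>\<^bsub>?\<kappa>\<^esub> e = \<one>\<^bsub>?\<kappa>\<^esub> \<and> e \<otimes>\<^bsub>?\<kappa>\<^esub> e' = \<one>\<^bsub>?\<kappa>\<^esub>)" for e E
    by (simp add: Units_def)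
  have "Units (?\<kappa>\<lparr>carrier := ?E\<rparr>) = ?E - {\<zero>\<^bsub>?\<kappa>\<^esub>}"
  proof (intro equalityI subsetI)
    fix e assume "e \<in> Units (?\<kappa>\<lparr>carrier := ?E\<rparr>)"
    then obtain a b where ab: "e = ?c (poly_embed a)" "?c (poly_embed b) \<otimes>\<^bsub>?\<kappa>\<^esub> e = \<one>\<^bsub>?\<kappa>\<^esub>"
      unfolding U by blast
    have "e \<noteq> \<zero>\<^bsub>?\<kappa>\<^esub>"
    proof
      assume "e = \<zero>\<^bsub>?\<kappa>\<^esub>"
      then have "\<one>\<^bsub>?\<kappa>\<^esub> = \<zero>\<^bsub>?\<kappa>\<^esub>" 
        using ab(2) \<kappa>.r_null[OF subsetD[OF E_carr rangeI]] by (simp only:)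
      then show False using ne by (simp only: hE)
    qed
    then show "e \<in> ?E - {\<zero>\<^bsub>?\<kappa>\<^esub>}" using ab(1) by blast
  next
    fix e assume "e \<in> ?E - {\<zero>\<^bsub>?\<kappa>\<^esub>}"
    then obtain a where a: "e = ?c (poly_embed a)" "?c (poly_embed a) \<noteq> ?c (poly_embed 0)" by (simp only: hE(4)) blast
    obtain b where b: "?c (poly_embed (b * a)) = ?c (poly_embed 1)" using unit[OF a(2)] by blast
    have "?c (poly_embed b) \<otimes>\<^bsub>?\<kappa>\<^esub> e = \<one>\<^bsub>?\<kappa>\<^esub>" "e \<otimes>\<^bsub>?\<kappa>\<^esub> ?c (poly_embed b) = \<one>\<^bsub>?\<kappa>\<^esub>"
      by (simp_all only: a(1) hE b mult.commute[of a b])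
    then show "e \<in> Units (?\<kappa>\<lparr>carrier := ?E\<rparr>)" unfolding U a(1) by (intro conjI rangeI bexI[of _ "?c (poly_embed b)"])
  qed
  then have "subfield ?E ?\<kappa>" by (intro \<kappa>.subfieldI \<kappa>.subcringI' subring)
  moreover have "finite (carrier ?\<kappa>)"
  proof -
    have "0 < (CARD('k) ^ n) ^ card (orb \<phi> y)" by simp
    then show ?thesis using card_\<kappa> by (metis card_ge_0_finite)
  qed
  ultimately have "ring.dim ?\<kappa> ?E (carrier ?\<kappa>) = card (orb \<phi> y)"
    by (rule \<kappa>.dim_eqI) (simp add: card_\<kappa> card_E)
  then show ?thesis by (simp add: inertia_degree_def Let_def)
qed

lemma kers_comaximal:
  assumes y: "y \<in> fibre t" "y' \<in> fibre t" "ker t y \<noteq> ker t y'"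
  shows "ker t y <+>\<^bsub>R\<^esub> ker t y' = carrier R"
proof -
  have "\<not> ker t y' \<subseteq> ker t y" using ker_maximal[OF y(2) primeideal_ker[OF y(1)]] y(3) by blast
  then obtain x where x: "x \<in> ker t y'" "x \<notin> ker t y" by blast
  have xO: "x \<in> OK" using x by (simp add: ker_def)
  obtain m where m: "0 < m" "x ^ m - 1 \<in> ker t y" using place_eq_power_1[OF y(1) xO] x(2) xO by (auto simp: ker_def)
  note I = primeideal.axioms(1)[OF primeideal_ker[OF y(1)]] primeideal.axioms(1)[OF primeideal_ker[OF y(2)]]
  have "x ^ (m - 1) * x \<in> ker t y'" by (rule ideal_closed(4)[OF I(2) x(1) OK_power[OF xO]])
  then have xm: "x ^ m \<in> ker t y'" using power_minus_mult[OF m(1), of x] by simp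
  have "- (x ^ m - 1) \<in> ker t y" by (rule ideal_closed(5)[OF I(1) m(2)])
  moreover have "a + b \<in> ker t y <+>\<^bsub>R\<^esub> ker t y'" if "a \<in> ker t y" "b \<in> ker t y'" for a b
    using that unfolding set_add_def' by auto
  ultimately have "- (x ^ m - 1) + x ^ m \<in> ker t y <+>\<^bsub>R\<^esub> ker t y'" using xm by blast
  then have "\<one>\<^bsub>R\<^esub> \<in> ker t y <+>\<^bsub>R\<^esub> ker t y'" by simp
  then show ?thesis using ideal.one_imp_carrier[OF R.add_ideals[OF I]] by blast
qed

lemma principal_ideal: "Idl\<^bsub>R\<^esub> {poly_embed p} = (\<lambda>x. poly_embed p * x) ` OK"
  using R.cgenideal_eq_genideal[of "poly_embed p"] by (auto simp: cgenideal_def OK_embed mult.commute)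

lemma principal_ideal_eq_Inter: "Idl\<^bsub>R\<^esub> {poly_embed p} = (\<Inter>y\<in>fibre t. ker t y)"
proof (intro equalityI subsetI)
  fix x assume "x \<in> Idl\<^bsub>R\<^esub> {poly_embed p}"
  then obtain x' where x': "x = poly_embed p * x'" "x' \<in> OK" unfolding principal_ideal by blast
  have "x' * poly_embed p \<in> ker t y" if "y \<in> fibre t" for y
    using ideal_closed(4)[OF primeideal.axioms(1)[OF primeideal_ker[OF that]] _ x'(2)] embed_mem_ker_iff[OF that, of p]
    by simp
  then show "x \<in> (\<Inter>y\<in>fibre t. ker t y)" by (simp add: x'(1) mult.commute)
next
  fix x assume x: "x \<in> (\<Inter>y\<in>fibre t. ker t y)"
  then have "x \<in> OK" using fibre_nonempty by (auto simp: ker_def)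
  moreover have "place t y x = 0" if "y \<in> fibre t" for y using x that by (auto simp: ker_def)
  ultimately show "x \<in> Idl\<^bsub>R\<^esub> {poly_embed p}" unfolding principal_ideal using vanish_everywhere by blast
qed

text \<open>Each factor contains p, hence is a kernel by \<open>prime_containing_p\<close>;
  conversely a kernel contains the product and therefore some factor, with equality by maximality.
  The exponents stay open; the tuple of inertia degrees depends only on the set of factors.\<close>

lemma set_factors_eq:
  assumes Ps: "length es = length Ps" "\<forall>P\<in>set Ps. primeideal P R" "\<forall>e\<in>set es. 1 \<le> (e :: nat)"
    and prod: "Idl\<^bsub>R\<^esub> {poly_embed p} = (\<Otimes>\<^bsub>ideals_set R\<^esub> i\<in>{..<length Ps}. (Ps ! i) [^]\<^bsub>ideals_set R\<^esub> (es ! i))"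
  shows "set Ps = ker t ` fibre t"
proof -
  interpret M: comm_monoid "ideals_set R" by (rule R.ideals_set_is_comm_monoid)
  have carr: "J \<in> carrier (ideals_set R) \<longleftrightarrow> ideal J R" for J by (simp add: ideals_set_def)
  have mult: "J \<otimes>\<^bsub>ideals_set R\<^esub> J' = ideal_prod R J J'" for J J' by (simp add: ideals_set_def)
  have one: "\<one>\<^bsub>ideals_set R\<^esub> = carrier R" by (simp add: ideals_set_def)
  have idl: "ideal (Ps ! i) R" if "i < length Ps" for i using Ps(2) that by (simp add: primeideal.axioms(1))
  have pw_idl: "ideal ((Ps ! i) [^]\<^bsub>ideals_set R\<^esub> e) R" if "i < length Ps" for i and e :: nat
    using M.nat_pow_closed[of "Ps ! i" e] idl[OF that] by (simp only: carr)
  have pw_sub: "(Ps ! i) [^]\<^bsub>ideals_set R\<^esub> (es ! i) \<subseteq> Ps ! i" if i: "i < length Ps" for i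
  proof -
    obtain e where e: "es ! i = Suc e" using Ps(1,3) i by (metis Suc_le_D nth_mem One_nat_def)
    have "(Ps ! i) [^]\<^bsub>ideals_set R\<^esub> (es ! i) = ideal_prod R ((Ps ! i) [^]\<^bsub>ideals_set R\<^esub> e) (Ps ! i)"
      by (simp add: e mult)
    then show ?thesis using R.ideal_prod_inter[OF pw_idl[OF i] idl[OF i]] by blast
  qed
  let ?F = "\<lambda>i. (Ps ! i) [^]\<^bsub>ideals_set R\<^esub> (es ! i)"
  have Pi: "?F \<in> A \<rightarrow> carrier (ideals_set R)" if "A \<subseteq> {..<length Ps}" for A
    using pw_idl that by (auto simp: carr)
  have p_in: "poly_embed p \<in> finprod (ideals_set R) ?F {..<length Ps}"
    unfolding prod[symmetric] principal_ideal using OK_1 by (intro image_eqI[of _ _ 1]) auto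
  have p_mem: "poly_embed p \<in> Ps ! i" if i: "i < length Ps" for i
  proof -
    let ?rest = "finprod (ideals_set R) ?F ({..<length Ps} - {i})"
    have rest: "ideal ?rest R" using M.finprod_closed[OF Pi[of "{..<length Ps} - {i}"]] by (simp add: carr)
    have "finprod (ideals_set R) ?F (insert i ({..<length Ps} - {i})) = ?F i \<otimes>\<^bsub>ideals_set R\<^esub> ?rest"
      using Pi[of "{..<length Ps} - {i}"] pw_idl[OF i] by (intro M.finprod_insert) (auto simp: carr)
    moreover have "insert i ({..<length Ps} - {i}) = {..<length Ps}" using i by auto
    ultimately have "poly_embed p \<in> ideal_prod R (?F i) ?rest" using p_in by (simp only: mult)
    then show ?thesis using R.ideal_prod_inter[OF pw_idl[OF i] rest] pw_sub[OF i] by blast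
  qed
  show ?thesis
  proof (intro equalityI subsetI)
    fix P assume "P \<in> set Ps"
    then obtain i where i: "i < length Ps" "P = Ps ! i" by (metis in_set_conv_nth)
    then have "primeideal P R" "poly_embed p \<in> P" using Ps(2) p_mem by auto
    then show "P \<in> ker t ` fibre t" using prime_containing_p by blast
  next
    fix P assume "P \<in> ker t ` fibre t"
    then obtain y where y: "y \<in> fibre t" "P = ker t y" by blast
    have P: "primeideal P R" using primeideal_ker y by simp
    have not: "\<not> carrier R \<subseteq> P"
      using primeideal.I_notcarr[OF P] ideal_closed(1)[OF primeideal.axioms(1)[OF P]] by auto
    have pw_dvd: "Ps ! i \<subseteq> P" if "(Ps ! i) [^]\<^bsub>ideals_set R\<^esub> e \<subseteq> P" "i < length Ps" for i and e :: nat
      using that(1)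
    proof (induction e)
      case 0 then show ?case using not by (simp add: one)
    next
      case (Suc e)
      then have "ideal_prod R ((Ps ! i) [^]\<^bsub>ideals_set R\<^esub> e) (Ps ! i) \<subseteq> P" by (simp add: mult)
      then show ?case using R.primeideal_divides_ideal_prod[OF P pw_idl[OF that(2)] idl[OF that(2)]] Suc.IH by blast
    qed
    have fin_dvd: "\<exists>i\<in>A. ?F i \<subseteq> P" if "finite A" "A \<subseteq> {..<length Ps}" "finprod (ideals_set R) ?F A \<subseteq> P" for A
      using that
    proof (induction A rule: finite_induct)
      case empty then show ?case using not by (simp add: one)
    next
      case (insert i A)
      have i: "i < length Ps" using insert.prems by simp
      have A: "ideal (finprod (ideals_set R) ?F A) R"
        using M.finprod_closed[OF Pi[of A]] insert.prems by (simp add: carr)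
      have "finprod (ideals_set R) ?F (insert i A) = ?F i \<otimes>\<^bsub>ideals_set R\<^esub> finprod (ideals_set R) ?F A"
        using Pi[of A] pw_idl[OF i] insert by (intro M.finprod_insert) (auto simp: carr)
      then have "?F i \<subseteq> P \<or> finprod (ideals_set R) ?F A \<subseteq> P"
        using R.primeideal_divides_ideal_prod[OF P pw_idl[OF i] A] insert.prems(2) by (simp only: mult)
      then show ?case using insert by auto
    qed
    have "Idl\<^bsub>R\<^esub> {poly_embed p} \<subseteq> P" unfolding principal_ideal_eq_Inter y(2) using y(1) by blast
    then obtain i where i: "i < length Ps" "?F i \<subseteq> P" using fin_dvd[of "{..<length Ps}"] by (auto simp: prod)
    have sub: "Ps ! i \<subseteq> P" by (rule pw_dvd[OF i(2,1)])
    obtain z where z: "z \<in> fibre t" "Ps ! i = ker t z"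
      using prime_containing_p[of "Ps ! i"] Ps(2) i(1) p_mem by auto
    have "P = ker t z" using ker_maximal[OF z(1) P] sub z(2) by simp
    then show "P \<in> set Ps" using z(2) i(1) by (metis nth_mem)
  qed
qed

text \<open>For existence, all exponents are 1: the ideal of p is the intersection of the kernels,
  which are pairwise comaximal, hence their product. Uniqueness comes from
  \<open>set_factors_eq\<close> and sortedness.\<close>

lemma has_splitting_type_iff:
  "has_splitting_type (adj \<alpha>) p fs \<longleftrightarrow>
    fs = sorted_list_of_multiset (image_mset (inertia_degree (adj \<alpha>)) (mset_set (ker t ` fibre t)))"
  (is "_ \<longleftrightarrow> fs = ?fs")
proof
  assume "has_splitting_type (adj \<alpha>) p fs"
  then obtain Ps es where Ps: "distinct Ps" "length es = length Ps" "\<forall>P\<in>set Ps. primeideal P R" "\<forall>e\<in>set es. 1 \<le> e"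
    "Idl\<^bsub>R\<^esub> {poly_embed p} = (\<Otimes>\<^bsub>ideals_set R\<^esub> i\<in>{..<length Ps}. (Ps ! i) [^]\<^bsub>ideals_set R\<^esub> (es ! i :: nat))"
    "fs = map (inertia_degree (adj \<alpha>)) Ps" "sorted fs"
    unfolding has_splitting_type_def by blast
  have "mset Ps = mset_set (ker t ` fibre t)"
    using mset_set_set[OF Ps(1)] set_factors_eq[OF Ps(2-5)] by simp
  then have "mset fs = image_mset (inertia_degree (adj \<alpha>)) (mset_set (ker t ` fibre t))" by (simp add: Ps(6))
  then have "sorted_list_of_multiset (mset fs) = ?fs" by simp
  then show "fs = ?fs" using Ps(7) by (metis sorted_list_of_multiset_mset sorted_sort_id)
next
  assume fs: "fs = ?fs"
  obtain Ps0 where Ps0: "set Ps0 = ker t ` fibre t" "distinct Ps0"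
    using finite_distinct_list[of "ker t ` fibre t"] finite_fibre by blast
  define Ps where "Ps = sort_key (inertia_degree (adj \<alpha>)) Ps0"
  have Ps: "set Ps = ker t ` fibre t" "distinct Ps" using Ps0 by (simp_all add: Ps_def)
  have pr: "\<forall>P\<in>set Ps. primeideal P R" using primeideal_ker Ps(1) by auto
  have fs': "fs = map (inertia_degree (adj \<alpha>)) Ps"
  proof -
    have "mset_set (ker t ` fibre t) = mset Ps" using mset_set_set[OF Ps(2)] Ps(1) by simp
    then have "fs = sort (map (inertia_degree (adj \<alpha>)) Ps)" unfolding fs
      by (metis mset_map sorted_list_of_multiset_mset)
    then show ?thesis by (simp add: Ps_def sorted_sort_id)
  qed
  interpret M: comm_monoid "ideals_set R" by (rule R.ideals_set_is_comm_monoid)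
  obtain m where m: "length Ps = Suc m" using Ps(1) fibre_nonempty by (cases Ps) auto
  have idl: "ideal (Ps ! i) R" if "i < length Ps" for i using pr that by (simp add: primeideal.axioms(1))
  have "Idl\<^bsub>R\<^esub> {poly_embed p} = (\<Inter>P\<in>set Ps. P)" unfolding principal_ideal_eq_Inter Ps(1) by simp
  also have "\<dots> = (\<Inter>i\<in>{..m}. Ps ! i)" using m by (auto simp: set_conv_nth less_Suc_eq_le)
  also have "\<dots> = (\<Otimes>\<^bsub>ideals_set R\<^esub> i\<in>{..m}. Ps ! i)"
  proof (rule R.ideal_prod_eq_Inter[symmetric])
    show "(!) Ps \<in> {..m} \<rightarrow> {J. ideal J R}" using idl m by auto
    fix i j assume ij: "i \<in> {..m}" "j \<in> {..m}" "i \<noteq> j"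
    then have "Ps ! i \<in> ker t ` fibre t" "Ps ! j \<in> ker t ` fibre t" unfolding Ps(1)[symmetric] using m by auto
    then obtain y y' where y: "y \<in> fibre t" "y' \<in> fibre t" "Ps ! i = ker t y" "Ps ! j = ker t y'" by blast
    have "Ps ! i \<noteq> Ps ! j" using Ps(2) ij m by (simp add: nth_eq_iff_index_eq)
    then show "Ps ! i <+>\<^bsub>R\<^esub> Ps ! j = carrier R" using kers_comaximal[OF y(1,2)] y(3,4) by simp
  qed
  also have "\<dots> = (\<Otimes>\<^bsub>ideals_set R\<^esub> i\<in>{..<length Ps}. (Ps ! i) [^]\<^bsub>ideals_set R\<^esub> (replicate (length Ps) 1 ! i :: nat))"
  proof (rule M.finprod_cong')
    show "{..m} = {..<length Ps}" using m by auto
    have carr: "Ps ! i \<in> carrier (ideals_set R)" if "i < length Ps" for i using idl[OF that] by (simp add: ideals_set_def)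
    then show "(\<lambda>i. (Ps ! i) [^]\<^bsub>ideals_set R\<^esub> (replicate (length Ps) 1 ! i :: nat)) \<in> {..<length Ps} \<rightarrow> carrier (ideals_set R)"
      using M.nat_pow_closed by auto
    fix i assume "i \<in> {..<length Ps}"
    then show "Ps ! i = (Ps ! i) [^]\<^bsub>ideals_set R\<^esub> (replicate (length Ps) 1 ! i :: nat)"
      using carr by simp
  qed
  finally have prod: "Idl\<^bsub>R\<^esub> {poly_embed p} = \<dots>" .
  have "sorted fs" by (simp add: fs)
  then show "has_splitting_type (adj \<alpha>) p fs"
    unfolding has_splitting_type_def using Ps(2) pr prod fs'
    by (intro exI[of _ Ps] exI[of _ "replicate (length Ps) 1"] conjI) auto
qed

lemma orb_eq_iff:
  assumes "y \<in> fibre t" "y' \<in> fibre t"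
  shows "ker t y = ker t y' \<longleftrightarrow> orb \<phi> y = orb \<phi> y'"
proof
  assume "ker t y = ker t y'"
  then have "y' \<in> orb \<phi> y" by (simp only: ker_eq_iff[OF assms])
  then show "orb \<phi> y = orb \<phi> y'" using orb_eq_of_mem(2)[OF periodic_\<phi>] by blast
next
  assume "orb \<phi> y = orb \<phi> y'"
  then have "y' \<in> orb \<phi> y" using self_in_orb[of y' \<phi>] by simp
  then show "ker t y = ker t y'" by (simp only: ker_eq_iff[OF assms])
qed

lemma splitting_type_eq:
  "splitting_type (adj \<alpha>) p = sorted_list_of_multiset (image_mset card (mset_set (orb \<phi> ` fibre t)))"
proof -
  have "image_mset (inertia_degree (adj \<alpha>)) (mset_set (ker t ` fibre t)) = image_mset card (mset_set (orb \<phi> ` fibre t))"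
    by (rule image_mset_eq_of_iff) (use orb_eq_iff inertia_degree_ker finite_fibre in blast)+
  then show ?thesis unfolding splitting_type_def has_splitting_type_iff by simp
qed

lemma card_primes_above: "card (primes_above (adj \<alpha>) p) = card (orb \<phi> ` fibre t)"
  unfolding primes_above_eq by (rule card_image_eq_of_iff) (rule orb_eq_iff)

end

section \<open>Permutation actions of a finite group\<close>

lemma card_eq_mult_of_fibres:
  assumes "finite A" "\<And>y. y \<in> B \<Longrightarrow> card {x \<in> A. g x = y} = k" "g ` A \<subseteq> B" "finite B"
  shows "card A = card B * k"
proof -
  have "card A = card (\<Union>y\<in>B. {x \<in> A. g x = y})" using assms(3) by (intro arg_cong[of _ _ card]) auto
  also have "\<dots> = (\<Sum>y\<in>B. card {x \<in> A. g x = y})" using assms(1,4) by (intro card_UN_disjoint) auto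
  also have "\<dots> = card B * k" using assms(2) by simp
  finally show ?thesis .
qed

lemma card_fixed_funpow:
  assumes S: "finite S" "\<And>x. x \<in> S \<Longrightarrow> periodic F x" "\<And>x. x \<in> S \<Longrightarrow> orb F x \<subseteq> S"
  shows "card {x \<in> S. (F ^^ k) x = x} = (\<Sum>O'\<in>{O' \<in> orb F ` S. card O' dvd k}. card O')"
proof -
  have eq: "{x \<in> S. (F ^^ k) x = x} = \<Union>{O' \<in> orb F ` S. card O' dvd k}"
  proof (intro equalityI subsetI)
    fix x assume "x \<in> {x \<in> S. (F ^^ k) x = x}"
    then have x: "x \<in> S" "card (orb F x) dvd k" using funpow_eq_iff_card_orb_dvd[OF S(2)] by auto
    then show "x \<in> \<Union>{O' \<in> orb F ` S. card O' dvd k}" by (intro UnionI[of "orb F x"]) auto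
  next
    fix x assume "x \<in> \<Union>{O' \<in> orb F ` S. card O' dvd k}"
    then obtain y where y: "y \<in> S" "x \<in> orb F y" "card (orb F y) dvd k" by auto
    have "x \<in> S" using y S(3) by blast
    moreover have "card (orb F x) dvd k" using orb_eq_of_mem(2)[OF S(2)[OF y(1)] y(2)] y(3) by simp
    ultimately show "x \<in> {x \<in> S. (F ^^ k) x = x}" using funpow_eq_iff_card_orb_dvd[OF S(2)] by simp
  qed
  have disj: "O1 \<inter> O2 = {}" if O12: "O1 \<in> orb F ` S" "O2 \<in> orb F ` S" "O1 \<noteq> O2" for O1 O2
  proof (rule ccontr)
    assume "O1 \<inter> O2 \<noteq> {}"
    then obtain z where z: "z \<in> O1" "z \<in> O2" by blast
    obtain x y where xy: "x \<in> S" "y \<in> S" "O1 = orb F x" "O2 = orb F y" using O12 by blast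
    show False using orb_eq_of_mem(2)[OF S(2)[OF xy(1)], of z] orb_eq_of_mem(2)[OF S(2)[OF xy(2)], of z] xy z O12(3) by simp
  qed
  show "card {x \<in> S. (F ^^ k) x = x} = (\<Sum>O'\<in>{O' \<in> orb F ` S. card O' dvd k}. card O')"
    unfolding eq using disj finite_orb[OF S(2)] by (intro card_Union_disjoint) (auto simp: pairwise_def disjnt_def)
qed

text \<open>The number of fixed points of the k-th power is the sum of j times the number of
  j-cycles over the divisors j of k, so the numbers of cycles are recovered by induction on the
  length.\<close>

lemma cycle_type_eq_of_fixed:
  assumes S: "finite S" "\<And>x. x \<in> S \<Longrightarrow> periodic F x" "\<And>x. x \<in> S \<Longrightarrow> orb F x \<subseteq> S"
    and S': "finite S'" "\<And>x. x \<in> S' \<Longrightarrow> periodic F' x" "\<And>x. x \<in> S' \<Longrightarrow> orb F' x \<subseteq> S'"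
    and eq: "\<And>k. card {x \<in> S. (F ^^ k) x = x} = card {x \<in> S'. (F' ^^ k) x = x}"
  shows "image_mset card (mset_set (orb F ` S)) = image_mset card (mset_set (orb F' ` S'))"
proof -
  define m where "m A l = card {O' \<in> A. card O' = l}" for A :: "'b set set" and l
  have pos: "0 < card O'" if "O' \<in> orb F ` S" for O' using that card_orb_pos[OF S(2)] by auto
  have pos': "0 < card O'" if "O' \<in> orb F' ` S'" for O' using that card_orb_pos[OF S'(2)] by auto
  have split: "(\<Sum>O'\<in>{O' \<in> A. card O' dvd l}. card O') =
      (\<Sum>O'\<in>{O' \<in> A. card O' dvd l \<and> card O' < l}. card O') + card {O' \<in> A. card O' = l} * l"
    if "finite A" "0 < l" for A :: "'z set set" and l
  proof -
    have "{O' \<in> A. card O' dvd l} = {O' \<in> A. card O' dvd l \<and> card O' < l} \<union> {O' \<in> A. card O' = l}"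
      using that(2) by (auto dest: dvd_imp_le)
    then have "(\<Sum>O'\<in>{O' \<in> A. card O' dvd l}. card O') =
        (\<Sum>O'\<in>{O' \<in> A. card O' dvd l \<and> card O' < l}. card O') + (\<Sum>O'\<in>{O' \<in> A. card O' = l}. card O')"
      using that(1) by (simp only:) (intro sum.union_disjoint, auto)
    then show ?thesis by simp
  qed
  have small: "(\<Sum>O'\<in>{O' \<in> A. card O' dvd l \<and> card O' < l}. card O') =
      (\<Sum>j | j dvd l \<and> j < l. card {O' \<in> A. card O' = j} * j)"
    if "finite A" "0 < l" for A :: "'z set set" and l
  proof -
    have "(\<Sum>O'\<in>{O' \<in> A. card O' dvd l \<and> card O' < l}. card O') =
        (\<Sum>j\<in>{j. j dvd l \<and> j < l}. \<Sum>O'\<in>{O' \<in> {O' \<in> A. card O' dvd l \<and> card O' < l}. card O' = j}. card O')"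
      using that(1) by (intro sum.group[symmetric]) auto
    also have "\<dots> = (\<Sum>j | j dvd l \<and> j < l. card {O' \<in> A. card O' = j} * j)"
    proof (rule sum.cong[OF refl])
      fix j assume "j \<in> {j. j dvd l \<and> j < l}"
      then have "{O' \<in> {O' \<in> A. card O' dvd l \<and> card O' < l}. card O' = j} = {O' \<in> A. card O' = j}" by auto
      then show "(\<Sum>O'\<in>{O' \<in> {O' \<in> A. card O' dvd l \<and> card O' < l}. card O' = j}. card O') = card {O' \<in> A. card O' = j} * j"
        by simp
    qed
    finally show ?thesis .
  qed
  have fin: "finite (orb F ` S)" "finite (orb F' ` S')" using S(1) S'(1) by auto
  have main: "card {O' \<in> orb F ` S. card O' = l} = card {O' \<in> orb F' ` S'. card O' = l}" if "0 < l" for l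
    using that
  proof (induction l rule: less_induct)
    case (less l)
    have "(\<Sum>j | j dvd l \<and> j < l. card {O' \<in> orb F ` S. card O' = j} * j) = (\<Sum>j | j dvd l \<and> j < l. card {O' \<in> orb F' ` S'. card O' = j} * j)"
    proof (rule sum.cong[OF refl])
      fix j assume "j \<in> {j. j dvd l \<and> j < l}"
      then have "0 < j" "j < l" using less.prems by (auto intro: Nat.gr0I)
      then show "card {O' \<in> orb F ` S. card O' = j} * j = card {O' \<in> orb F' ` S'. card O' = j} * j"
        using less.IH by simp
    qed
    moreover have "(\<Sum>O'\<in>{O' \<in> orb F ` S. card O' dvd l}. card O') = (\<Sum>O'\<in>{O' \<in> orb F' ` S'. card O' dvd l}. card O')"
      using card_fixed_funpow[OF S, of l] card_fixed_funpow[OF S', of l] eq[of l] by simp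
    ultimately have "card {O' \<in> orb F ` S. card O' = l} * l = card {O' \<in> orb F' ` S'. card O' = l} * l"
      unfolding split[OF fin(1) less.prems] split[OF fin(2) less.prems] small[OF fin(1) less.prems] small[OF fin(2) less.prems]
      by simp
    then show ?case using less.prems by simp
  qed
  show ?thesis
  proof (rule multiset_eqI)
    fix l
    have count: "count (image_mset card (mset_set A)) l = card {O' \<in> A. card O' = l}" if "finite A" for A :: "'z set set"
      using that by (simp add: count_image_mset vimage_def Int_def conj_commute)
    show "count (image_mset card (mset_set (orb F ` S))) l = count (image_mset card (mset_set (orb F' ` S'))) l"
    proof (cases "l = 0")
      case True
      have "{O' \<in> orb F ` S. card O' = 0} = {}" "{O' \<in> orb F' ` S'. card O' = 0} = {}"
        using pos pos' by (metis (mono_tags, lifting) empty_Collect_eq less_irrefl)+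
      then show ?thesis by (simp only: count[OF fin(1)] count[OF fin(2)]) (simp only: True card.empty)
    qed (simp add: count fin main)
  qed
qed

text \<open>Burnside's formula for a cyclic group: an orbit of size l contributes l for each of the
  N / l multiples of l below N.\<close>

lemma card_orbits_mult:
  assumes S: "finite S" "\<And>x. x \<in> S \<Longrightarrow> orb F x \<subseteq> S" and N: "0 < N" "\<And>x. x \<in> S \<Longrightarrow> (F ^^ N) x = x"
  shows "card (orb F ` S) * N = (\<Sum>i<N. card {x \<in> S. (F ^^ i) x = x})"
proof -
  have per: "periodic F x" if "x \<in> S" for x using N that by (auto simp: periodic_def)
  have count: "card {i \<in> {..<N}. l dvd i} * l = N" if l: "l dvd N" "0 < l" for l
  proof -
    obtain k where k: "N = l * k" using l(1) by (elim dvdE)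
    have "{i \<in> {..<N}. l dvd i} = (\<lambda>j. l * j) ` {..<k}" using l(2) by (auto simp: k elim!: dvdE)
    then have "card {i \<in> {..<N}. l dvd i} = k" using l(2) by (simp add: card_image inj_on_def)
    then show ?thesis by (simp add: k)
  qed
  have "(\<Sum>i<N. card {x \<in> S. (F ^^ i) x = x}) = (\<Sum>i<N. \<Sum>O'\<in>{O' \<in> orb F ` S. card O' dvd i}. card O')"
    by (simp only: card_fixed_funpow[OF S(1) per S(2)])
  also have "\<dots> = (\<Sum>i<N. \<Sum>O'\<in>orb F ` S. if card O' dvd i then card O' else 0)"
    using S(1) by (simp add: sum.inter_filter)
  also have "\<dots> = (\<Sum>O'\<in>orb F ` S. \<Sum>i<N. if card O' dvd i then card O' else 0)" by (rule sum.swap)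
  also have "\<dots> = (\<Sum>O'\<in>orb F ` S. N)"
  proof (rule sum.cong[OF refl])
    fix O' assume "O' \<in> orb F ` S"
    then obtain x where x: "x \<in> S" "O' = orb F x" by blast
    have "card O' dvd N" using funpow_eq_iff_card_orb_dvd[OF per[OF x(1)], of N] N(2)[OF x(1)] x(2) by simp
    moreover have "0 < card O'" using card_orb_pos[OF per[OF x(1)]] x(2) by simp
    moreover have "(\<Sum>i<N. if card O' dvd i then card O' else 0) = (\<Sum>i\<in>{i \<in> {..<N}. card O' dvd i}. card O')"
      by (rule sum.inter_filter[symmetric]) simp
    ultimately show "(\<Sum>i<N. if card O' dvd i then card O' else 0) = N" using count[of "card O'"] by (simp only: sum_constant of_nat_id)
  qed
  finally show ?thesis by simp
qed

text \<open>The law is required only on the orbit of a, because the automorphisms to which this is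
  applied are meaningful only on the Galois extension.\<close>

locale transitive_action = group G for G (structure) +
  fixes act :: "'a \<Rightarrow> 'x \<Rightarrow> 'x" and a :: 'x
  assumes fin: "finite (carrier G)"
    and act_mult: "g \<in> carrier G \<Longrightarrow> h \<in> carrier G \<Longrightarrow> c \<in> carrier G \<Longrightarrow> act (g \<otimes> h) (act c a) = act g (act h (act c a))"
    and act_one: "act \<one> a = a"
begin

definition pts :: "'x set" where "pts = (\<lambda>g. act g a) ` carrier G"
definition stab :: "'a set" where "stab = {g \<in> carrier G. act g a = a}"
definition fixpts :: "'a \<Rightarrow> 'x set" where "fixpts g = {x \<in> pts. act g x = x}"

lemma act_mult_a: "g \<in> carrier G \<Longrightarrow> h \<in> carrier G \<Longrightarrow> act (g \<otimes> h) a = act g (act h a)"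
  using act_mult[of g h \<one>] act_one by simp

lemma ptsE: assumes "x \<in> pts" obtains c where "c \<in> carrier G" "x = act c a"
  using assms by (auto simp: pts_def)

lemma a_pts: "a \<in> pts" unfolding pts_def using act_one by (intro image_eqI[of _ _ \<one>]) auto

lemma act_pts: "g \<in> carrier G \<Longrightarrow> x \<in> pts \<Longrightarrow> act g x \<in> pts"
  by (elim ptsE) (auto simp: pts_def act_mult_a[symmetric])

lemma act_mult_pts: "g \<in> carrier G \<Longrightarrow> h \<in> carrier G \<Longrightarrow> x \<in> pts \<Longrightarrow> act (g \<otimes> h) x = act g (act h x)"
  by (elim ptsE) (simp add: act_mult)

lemma act_one_pts: "x \<in> pts \<Longrightarrow> act \<one> x = x"
  by (elim ptsE) (simp add: act_mult_a[symmetric])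

lemma finite_pts: "finite pts" using fin by (simp add: pts_def)

lemma act_pow: "g \<in> carrier G \<Longrightarrow> x \<in> pts \<Longrightarrow> act (g [^] (i :: nat)) x = (act g ^^ i) x"
proof (induction i arbitrary: x)
  case (Suc i)
  have "act (g [^] Suc i) x = act (g [^] i) (act g x)" using Suc.prems by (simp add: act_mult_pts)
  also have "\<dots> = (act g ^^ i) (act g x)" using Suc.IH[OF Suc.prems(1) act_pts[OF Suc.prems]] .
  also have "\<dots> = (act g ^^ Suc i) x" by (simp add: funpow_swap1)
  finally show ?case .
qed (simp add: act_one_pts)

lemma stab_subset: "stab \<subseteq> carrier G" by (auto simp: stab_def)

lemma one_stab: "\<one> \<in> stab" by (simp add: stab_def act_one)

lemma card_transporter: "x \<in> pts \<Longrightarrow> card {c \<in> carrier G. act c a = x} = card stab"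
proof (elim ptsE)
  fix b assume b: "b \<in> carrier G" "x = act b a"
  have "bij_betw (\<lambda>h. b \<otimes> h) stab {c \<in> carrier G. act c a = x}"
  proof (rule bij_betw_imageI)
    show "inj_on (\<lambda>h. b \<otimes> h) stab" using b(1) stab_subset by (intro inj_onI) (meson l_cancel subsetD)
    show "(\<lambda>h. b \<otimes> h) ` stab = {c \<in> carrier G. act c a = x}"
    proof (intro equalityI subsetI)
      fix c assume c: "c \<in> {c \<in> carrier G. act c a = x}"
      then have "act (inv b \<otimes> c) a = act (inv b) (act b a)" using b by (simp add: act_mult_a)
      also have "\<dots> = a" using b act_one by (simp flip: act_mult_a)
      finally have "inv b \<otimes> c \<in> stab" using b c by (simp add: stab_def)
      moreover have "c = b \<otimes> (inv b \<otimes> c)" using b c by (simp add: m_assoc[symmetric])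
      ultimately show "c \<in> (\<lambda>h. b \<otimes> h) ` stab" by (rule image_eqI[rotated])
    qed (use b in \<open>auto simp: stab_def act_mult_a\<close>)
  qed
  then show ?thesis by (simp add: bij_betw_same_card)
qed

lemma conj_stab_iff:
  assumes "g \<in> carrier G" "c \<in> carrier G"
  shows "inv c \<otimes> g \<otimes> c \<in> stab \<longleftrightarrow> act c a \<in> fixpts g"
proof -
  have "act (inv c \<otimes> g \<otimes> c) a = act (inv c) (act g (act c a))" using assms by (simp add: act_mult act_mult_a m_assoc)
  moreover have "act (inv c) (act g (act c a)) = a \<longleftrightarrow> act g (act c a) = act c a"
  proof
    assume "act (inv c) (act g (act c a)) = a"
    then have "act c (act (inv c) (act (g \<otimes> c) a)) = act c a" using assms by (simp add: act_mult_a)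
    then show "act g (act c a) = act c a" using assms by (simp add: act_mult_a[symmetric] m_assoc[symmetric])
  next
    assume "act g (act c a) = act c a"
    then show "act (inv c) (act g (act c a)) = a" using assms act_one by (simp add: act_mult_a[symmetric])
  qed
  ultimately show ?thesis using assms by (auto simp: stab_def fixpts_def pts_def)
qed

text \<open>An element c conjugates g into the stabilizer exactly when it moves a to a fixed point
  of g, and every point is reached by one coset of the stabilizer.\<close>

lemma card_conj_stab:
  assumes "g \<in> carrier G"
  shows "card {c \<in> carrier G. inv c \<otimes> g \<otimes> c \<in> stab} = card (fixpts g) * card stab"
proof (rule card_eq_mult_of_fibres[where g = "\<lambda>c. act c a"])
  show "card {x \<in> {c \<in> carrier G. inv c \<otimes> g \<otimes> c \<in> stab}. act x a = y} = card stab" if "y \<in> fixpts g" for y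
  proof -
    have "{x \<in> {c \<in> carrier G. inv c \<otimes> g \<otimes> c \<in> stab}. act x a = y} = {c \<in> carrier G. act c a = y}"
      using conj_stab_iff[OF assms] that by auto
    then show ?thesis using card_transporter that by (simp add: fixpts_def)
  qed
qed (use fin finite_pts conj_stab_iff[OF assms] in \<open>auto simp: fixpts_def\<close>)

text \<open>The elements c conjugating g into the stabilizer are counted a second time, by the
  resulting conjugate; each conjugate arises from one coset of the centralizer.\<close>

lemma card_class_stab:
  assumes g: "g \<in> carrier G"
  shows "card ({h \<otimes> g \<otimes> inv h | h. h \<in> carrier G} \<inter> stab) * card {z \<in> carrier G. z \<otimes> g = g \<otimes> z} =
    card (fixpts g) * card stab"
proof -
  let ?C = "{h \<otimes> g \<otimes> inv h | h. h \<in> carrier G}"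
  have "card {c \<in> carrier G. inv c \<otimes> g \<otimes> c \<in> stab} = card (?C \<inter> stab) * card {z \<in> carrier G. z \<otimes> g = g \<otimes> z}"
  proof (rule card_eq_mult_of_fibres[where g = "\<lambda>c. inv c \<otimes> g \<otimes> c"])
    fix y assume "y \<in> ?C \<inter> stab"
    then obtain h where h: "h \<in> carrier G" "y = h \<otimes> g \<otimes> inv h" "y \<in> stab" by blast
    have "bij_betw (\<lambda>z. z \<otimes> inv h) {z \<in> carrier G. z \<otimes> g = g \<otimes> z}
        {x \<in> {c \<in> carrier G. inv c \<otimes> g \<otimes> c \<in> stab}. inv x \<otimes> g \<otimes> x = y}"
    proof (rule bij_betw_imageI)
      show "inj_on (\<lambda>z. z \<otimes> inv h) {z \<in> carrier G. z \<otimes> g = g \<otimes> z}" using h(1) by (intro inj_onI) auto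
      have conj: "inv (z \<otimes> inv h) \<otimes> g \<otimes> (z \<otimes> inv h) = y" if z: "z \<in> carrier G" "z \<otimes> g = g \<otimes> z" for z
      proof -
        have "inv (z \<otimes> inv h) \<otimes> g \<otimes> (z \<otimes> inv h) = h \<otimes> (inv z \<otimes> (g \<otimes> z)) \<otimes> inv h"
          using z h g by (simp add: inv_mult_group m_assoc)
        also have "inv z \<otimes> (g \<otimes> z) = g" using z g by (simp flip: z(2) m_assoc)
        finally show ?thesis by (simp add: h(2))
      qed
      show "(\<lambda>z. z \<otimes> inv h) ` {z \<in> carrier G. z \<otimes> g = g \<otimes> z} = {x \<in> {c \<in> carrier G. inv c \<otimes> g \<otimes> c \<in> stab}. inv x \<otimes> g \<otimes> x = y}"
      proof (intro equalityI subsetI)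
        fix c assume "c \<in> {x \<in> {c \<in> carrier G. inv c \<otimes> g \<otimes> c \<in> stab}. inv x \<otimes> g \<otimes> x = y}"
        then have c: "c \<in> carrier G" "inv c \<otimes> g \<otimes> c = h \<otimes> g \<otimes> inv h" by (auto simp: h(2))
        have "c \<otimes> (inv c \<otimes> g \<otimes> c) \<otimes> h = g \<otimes> (c \<otimes> h)" using c(1) h(1) g by (simp add: m_assoc[symmetric])
        moreover have "c \<otimes> (h \<otimes> g \<otimes> inv h) \<otimes> h = c \<otimes> h \<otimes> g" using c(1) h(1) g by (simp add: m_assoc)
        ultimately have "c \<otimes> h \<otimes> g = g \<otimes> (c \<otimes> h)" using c(2) by simp
        then have "c \<otimes> h \<in> {z \<in> carrier G. z \<otimes> g = g \<otimes> z}" using c(1) h(1) by simp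
        moreover have "c = c \<otimes> h \<otimes> inv h" using c(1) h(1) by (simp add: m_assoc)
        ultimately show "c \<in> (\<lambda>z. z \<otimes> inv h) ` {z \<in> carrier G. z \<otimes> g = g \<otimes> z}" by (rule image_eqI[rotated])
      qed (use conj h in auto)
    qed
    then show "card {x \<in> {c \<in> carrier G. inv c \<otimes> g \<otimes> c \<in> stab}. inv x \<otimes> g \<otimes> x = y} = card {z \<in> carrier G. z \<otimes> g = g \<otimes> z}"
      by (simp add: bij_betw_same_card)
  next
    show "(\<lambda>c. inv c \<otimes> g \<otimes> c) ` {c \<in> carrier G. inv c \<otimes> g \<otimes> c \<in> stab} \<subseteq> ?C \<inter> stab"
    proof (rule image_subsetI)
      fix c assume "c \<in> {c \<in> carrier G. inv c \<otimes> g \<otimes> c \<in> stab}"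
      then have c: "c \<in> carrier G" "inv c \<otimes> g \<otimes> c \<in> stab" by auto
      have "inv c \<otimes> g \<otimes> c = inv c \<otimes> g \<otimes> inv (inv c)" using c(1) by simp
      then have "inv c \<otimes> g \<otimes> c \<in> ?C" using c(1) by blast
      then show "inv c \<otimes> g \<otimes> c \<in> ?C \<inter> stab" using c(2) by blast
    qed
    show "finite (?C \<inter> stab)" using finite_subset[OF stab_subset fin] by blast
  qed (use fin in simp)
  then show ?thesis using card_conj_stab[OF g] by simp
qed

lemma fixpts_one: "fixpts \<one> = pts" using act_one_pts by (auto simp: fixpts_def)

lemma card_stab_pos: "0 < card stab"
  using one_stab finite_subset[OF stab_subset fin] by (auto simp: card_gt_0_iff)

lemma card_pts_stab: "card pts * card stab = card (carrier G)"
proof -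
  have "{c \<in> carrier G. inv c \<otimes> \<one> \<otimes> c \<in> stab} = carrier G" using one_stab by auto
  then show ?thesis using card_conj_stab[of \<one>] by (simp add: fixpts_one)
qed

lemma sum_card_fixpts: "(\<Sum>g\<in>carrier G. card (fixpts g)) = card (carrier G)"
proof -
  have conj: "card {g \<in> carrier G. inv c \<otimes> g \<otimes> c \<in> stab} = card stab" if c: "c \<in> carrier G" for c
  proof -
    have "bij_betw (\<lambda>h. c \<otimes> h \<otimes> inv c) stab {g \<in> carrier G. inv c \<otimes> g \<otimes> c \<in> stab}"
    proof (rule bij_betw_byWitness[where f' = "\<lambda>g. inv c \<otimes> g \<otimes> c"])
      have 1: "inv c \<otimes> (c \<otimes> h \<otimes> inv c) \<otimes> c = h" if "h \<in> carrier G" for h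
        using c that by (simp add: m_assoc) (simp flip: m_assoc)
      have 2: "c \<otimes> (inv c \<otimes> h \<otimes> c) \<otimes> inv c = h" if "h \<in> carrier G" for h
        using c that by (simp add: m_assoc) (simp flip: m_assoc)
      show "\<forall>h\<in>stab. inv c \<otimes> (c \<otimes> h \<otimes> inv c) \<otimes> c = h" using 1 stab_subset by blast
      show "\<forall>g\<in>{g \<in> carrier G. inv c \<otimes> g \<otimes> c \<in> stab}. c \<otimes> (inv c \<otimes> g \<otimes> c) \<otimes> inv c = g" using 2 by blast
      have "inv c \<otimes> (c \<otimes> h \<otimes> inv c) \<otimes> c \<in> stab" if "h \<in> stab" for h using 1[of h] that stab_subset by auto
      then show "(\<lambda>h. c \<otimes> h \<otimes> inv c) ` stab \<subseteq> {g \<in> carrier G. inv c \<otimes> g \<otimes> c \<in> stab}" using c stab_subset by auto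
    qed auto
    then show ?thesis by (simp add: bij_betw_same_card)
  qed
  have "(\<Sum>g\<in>carrier G. card (fixpts g)) * card stab = (\<Sum>g\<in>carrier G. card {c \<in> carrier G. inv c \<otimes> g \<otimes> c \<in> stab})"
    by (simp add: sum_distrib_right card_conj_stab)
  also have "\<dots> = (\<Sum>c\<in>carrier G. card {g \<in> carrier G. inv c \<otimes> g \<otimes> c \<in> stab})"
    by (rule sum_multicount_gen) (use fin in auto)
  also have "\<dots> = card (carrier G) * card stab" by (simp add: conj)
  finally show ?thesis using card_stab_pos by simp
qed

lemma act_periodic:
  assumes "g \<in> carrier G" "x \<in> pts"
  shows "periodic (act g) x" "orb (act g) x \<subseteq> pts" "(act g ^^ ord g) x = x"
proof -
  have "act (g [^] ord g) x = x" using assms by (simp add: act_one_pts)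
  then show *: "(act g ^^ ord g) x = x" using act_pow[OF assms] by simp
  have "0 < ord g" using ord_ge_1[OF fin assms(1)] by simp
  then show "periodic (act g) x" using * by (auto simp: periodic_def)
  show "orb (act g) x \<subseteq> pts"
    unfolding orb_def using assms by (auto simp flip: act_pow intro: act_pts)
qed

lemma fixpts_pow: "g \<in> carrier G \<Longrightarrow> fixpts (g [^] (i :: nat)) = {x \<in> pts. (act g ^^ i) x = x}"
  by (auto simp: fixpts_def act_pow)

lemma fixpts_coprime_pow:
  assumes g: "g \<in> carrier G" and i: "coprime i (ord g)"
  shows "fixpts (g [^] i) = fixpts g"
proof -
  have "(act g ^^ i) x = x \<longleftrightarrow> act g x = x" if x: "x \<in> pts" for x
  proof
    assume "(act g ^^ i) x = x"
    then have "card (orb (act g) x) dvd i" by (simp add: funpow_eq_iff_card_orb_dvd[OF act_periodic(1)[OF g x]])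
    moreover have "card (orb (act g) x) dvd ord g"
      using act_periodic(3)[OF g x] by (simp add: funpow_eq_iff_card_orb_dvd[OF act_periodic(1)[OF g x]])
    ultimately have "card (orb (act g) x) dvd 1" using i by (metis coprime_common_divisor is_unit_gcd gcd_greatest)
    then have "(act g ^^ 1) x = x" by (simp only: funpow_eq_iff_card_orb_dvd[OF act_periodic(1)[OF g x]])
    then show "act g x = x" by simp
  next
    assume "act g x = x"
    then show "(act g ^^ i) x = x" by (induction i) auto
  qed
  then show ?thesis unfolding fixpts_pow[OF g] by (auto simp: fixpts_def)
qed

abbreviation num_orbits :: "'a \<Rightarrow> nat" where "num_orbits g \<equiv> card (orb (act g) ` pts)"

lemma orb_pow_coprime:
  assumes g: "g \<in> carrier G" and i: "coprime i (ord g)" and x: "x \<in> pts"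
  shows "orb (act (g [^] i)) x = orb (act g) x"
proof -
  have sub: "orb (act (h [^] j)) x \<subseteq> orb (act h) x" if "h \<in> carrier G" for h and j :: nat
    unfolding orb_def using that x by (auto simp flip: act_pow simp: nat_pow_pow)
  have "\<exists>j :: nat. (g [^] i) [^] j = g"
  proof (cases "i = 0")
    case True
    then have "g = \<one>" using i ord_eq_1[OF g] by simp
    then show ?thesis by simp
  next
    case False
    then obtain j k where jk: "i * j = ord g * k + gcd i (ord g)" using bezout_nat by blast
    have "(g [^] i) [^] j = g [^] (ord g * k + 1)" using g jk i by (simp add: nat_pow_pow)
    also have "\<dots> = g" using g pow_eq_id[OF g, of "ord g * k"] by simp
    finally show ?thesis by (rule exI)
  qed
  then obtain j :: nat where j: "(g [^] i) [^] j = g" by blast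
  then show ?thesis using sub[OF g, of i] sub[of "g [^] i" j] g by auto
qed

lemma num_orbits_coprime_pow:
  assumes "g \<in> carrier G" "coprime i (ord g)"
  shows "num_orbits (g [^] i) = num_orbits g"
  using orb_pow_coprime[OF assms] by (simp cong: image_cong)

lemma num_orbits_conj:
  assumes g: "g \<in> carrier G" and c: "c \<in> carrier G"
  shows "num_orbits (c \<otimes> g \<otimes> inv c) = num_orbits g"
proof -
  let ?b = "c \<otimes> g \<otimes> inv c"
  have pow: "?b [^] i \<otimes> c = c \<otimes> g [^] i" for i :: nat
  proof (induction i)
    case (Suc i)
    have "?b [^] Suc i \<otimes> c = ?b [^] i \<otimes> (?b \<otimes> c)" using g c by (simp add: m_assoc del: nat_pow_Suc add: nat_pow_Suc[of ?b])
    also have "?b \<otimes> c = c \<otimes> g" using g c by (simp add: m_assoc)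
    also have "?b [^] i \<otimes> (c \<otimes> g) = ?b [^] i \<otimes> c \<otimes> g" using g c by (intro m_assoc[symmetric]) auto
    also have "\<dots> = c \<otimes> g [^] i \<otimes> g" by (simp only: Suc)
    finally show ?case using g c by (simp add: m_assoc)
  qed (use c in simp)
  have orb: "orb (act ?b) (act c x) = act c ` orb (act g) x" if x: "x \<in> pts" for x
  proof -
    have "(act ?b ^^ i) (act c x) = act c ((act g ^^ i) x)" for i
      using g c x pow[of i] by (simp add: act_pow[symmetric] act_pts act_mult_pts[symmetric])
    then show ?thesis unfolding orb_def by auto
  qed
  have img: "act c ` pts = pts"
  proof (intro equalityI subsetI)
    fix x assume x: "x \<in> pts"
    then have "act c (act (inv c) x) = x" using c by (simp add: act_mult_pts[symmetric] act_one_pts)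
    then show "x \<in> act c ` pts" using act_pts[OF _ x, of "inv c"] c by (metis image_eqI inv_closed)
  qed (use c act_pts in auto)
  have inj: "inj_on (act c) pts" using eq_card_imp_inj_on[OF finite_pts, of "act c"] img by simp
  have "orb (act ?b) ` pts = (\<lambda>x. orb (act ?b) (act c x)) ` pts" using img by (metis image_image)
  also have "\<dots> = (`) (act c) ` (orb (act g) ` pts)" unfolding image_image using orb by (rule image_cong[OF refl])
  finally have "num_orbits ?b = card ((`) (act c) ` (orb (act g) ` pts))" by simp
  also have "\<dots> = num_orbits g"
    using act_periodic(2)[OF g] by (intro card_image inj_on_image[OF inj_on_subset[OF inj]]) auto
  finally show ?thesis .
qed

end

locale two_transitive_actions =
  A: transitive_action G act a + B: transitive_action G act' a'
  for G (structure) and act :: "'a \<Rightarrow> 'x \<Rightarrow> 'x" and a and act' :: "'a \<Rightarrow> 'y \<Rightarrow> 'y" and a'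
begin

text \<open>By \<open>card_class_stab\<close> the two conditions differ only by the orders of the
  stabilizers. These agree in one direction by summing over the group with Burnside's formula, in
  the other by taking the identity for g.\<close>

lemma gassmann_iff:
  "(\<forall>C\<in>conjugacy_classes G. card (C \<inter> A.stab) = card (C \<inter> B.stab)) \<longleftrightarrow>
    (\<forall>g\<in>carrier G. card (A.fixpts g) = card (B.fixpts g))"
proof
  assume L: "\<forall>C\<in>conjugacy_classes G. card (C \<inter> A.stab) = card (C \<inter> B.stab)"
  have eq: "card (A.fixpts g) * card A.stab = card (B.fixpts g) * card B.stab" if g: "g \<in> carrier G" for g
  proof -
    have "{h \<otimes> g \<otimes> inv h | h. h \<in> carrier G} \<in> conjugacy_classes G" using g by (auto simp: conjugacy_classes_def)
    then show ?thesis using L A.card_class_stab[OF g] B.card_class_stab[OF g] by simp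
  qed
  have "card (carrier G) * card A.stab = (\<Sum>g\<in>carrier G. card (A.fixpts g) * card A.stab)"
    by (simp only: A.sum_card_fixpts[symmetric] sum_distrib_right)
  also have "\<dots> = (\<Sum>g\<in>carrier G. card (B.fixpts g) * card B.stab)" using eq by (rule sum.cong[OF refl])
  also have "\<dots> = card (carrier G) * card B.stab"
    by (simp only: B.sum_card_fixpts[symmetric] sum_distrib_right)
  finally have "card A.stab = card B.stab"
    using A.fin A.one_closed by (auto simp: card_gt_0_iff)
  then show "\<forall>g\<in>carrier G. card (A.fixpts g) = card (B.fixpts g)" using eq A.card_stab_pos by auto
next
  assume R: "\<forall>g\<in>carrier G. card (A.fixpts g) = card (B.fixpts g)"
  have "card A.pts * card A.stab = card A.pts * card B.stab"
    using A.card_pts_stab B.card_pts_stab R[rule_format, OF A.one_closed] by (simp add: A.fixpts_one B.fixpts_one)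
  moreover have "0 < card A.pts" using A.a_pts A.finite_pts by (auto simp: card_gt_0_iff)
  ultimately have stab: "card A.stab = card B.stab" by simp
  show "\<forall>C\<in>conjugacy_classes G. card (C \<inter> A.stab) = card (C \<inter> B.stab)"
  proof
    fix C assume "C \<in> conjugacy_classes G"
    then obtain g where g: "g \<in> carrier G" "C = {h \<otimes> g \<otimes> inv h | h. h \<in> carrier G}" by (auto simp: conjugacy_classes_def)
    have "card (C \<inter> A.stab) * card {z \<in> carrier G. z \<otimes> g = g \<otimes> z} = card (C \<inter> B.stab) * card {z \<in> carrier G. z \<otimes> g = g \<otimes> z}"
      using A.card_class_stab[OF g(1)] B.card_class_stab[OF g(1)] R g(1) stab g(2) by simp
    moreover have "0 < card {z \<in> carrier G. z \<otimes> g = g \<otimes> z}"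
      using A.fin g(1) A.one_closed by (auto simp: card_gt_0_iff intro!: exI[of _ \<one>])
    ultimately show "card (C \<inter> A.stab) = card (C \<inter> B.stab)" by simp
  qed
qed

lemma cycle_types_eq:
  assumes R: "\<forall>g\<in>carrier G. card (A.fixpts g) = card (B.fixpts g)" and g: "g \<in> carrier G"
  shows "image_mset card (mset_set (orb (act g) ` A.pts)) = image_mset card (mset_set (orb (act' g) ` B.pts))"
proof (rule cycle_type_eq_of_fixed)
  fix k
  show "card {x \<in> A.pts. (act g ^^ k) x = x} = card {x \<in> B.pts. (act' g ^^ k) x = x}"
    using R[rule_format, of "g [^] k"] g by (simp add: A.fixpts_pow B.fixpts_pow)
qed (use A.finite_pts B.finite_pts A.act_periodic[OF g] B.act_periodic[OF g] in auto)

text \<open>Induction on the order of \<open>g\<close>: in Burnside's formula the powers of smaller order cancel, and the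
  remaining powers have the same fixed points as \<open>g\<close>.\<close>

lemma fixpts_eq_of_num_orbits:
  assumes R: "\<forall>g\<in>carrier G. A.num_orbits g = B.num_orbits g" and g: "g \<in> carrier G"
  shows "card (A.fixpts g) = card (B.fixpts g)"
  using g
proof (induction "A.ord g" arbitrary: g rule: less_induct)
  case less
  let ?n = "A.ord g" and ?I = "{i \<in> {..<A.ord g}. coprime i (A.ord g)}" and ?J = "{i \<in> {..<A.ord g}. \<not> coprime i (A.ord g)}"
  have n: "0 < ?n" using A.ord_ge_1[OF A.fin less.prems] by simp
  have burnside: "A.num_orbits g * ?n = (\<Sum>i<?n. card (A.fixpts (g [^] i)))"
    "B.num_orbits g * ?n = (\<Sum>i<?n. card (B.fixpts (g [^] i)))"
    unfolding A.fixpts_pow[OF less.prems] B.fixpts_pow[OF less.prems]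
    using A.act_periodic[OF less.prems] B.act_periodic[OF less.prems] A.finite_pts B.finite_pts n
    by (intro card_orbits_mult; blast)+
  have split: "(\<Sum>i<?n. f i) = sum f ?I + sum f ?J" for f :: "nat \<Rightarrow> nat"
    by (subst sum.union_disjoint[symmetric]) (auto intro!: sum.cong)
  have J: "card (A.fixpts (g [^] i)) = card (B.fixpts (g [^] i))" if "i \<in> ?J" for i
  proof (rule less.hyps)
    have "\<not> coprime i ?n" using that by simp
    then have gcd: "gcd ?n i \<noteq> 1" by (simp add: coprime_iff_gcd_eq_1 gcd.commute)
    have pos: "0 < gcd ?n i" using n by simp
    show "A.ord (g [^] i) < ?n"
    proof (cases "i = 0")
      case True
      then have "?n \<noteq> 1" using gcd by simp
      then show ?thesis using n True by simp
    next
      case False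
      have "1 < gcd ?n i" using gcd pos by linarith
      then show ?thesis using A.ord_pow_gen[OF less.prems, of i] n False div_less_dividend by simp
    qed
  qed (use less.prems in simp)
  have I: "(\<Sum>i\<in>?I. card (A.fixpts (g [^] i))) = card ?I * card (A.fixpts g)"
    "(\<Sum>i\<in>?I. card (B.fixpts (g [^] i))) = card ?I * card (B.fixpts g)"
    using A.fixpts_coprime_pow[OF less.prems] B.fixpts_coprime_pow[OF less.prems] by simp_all
  have "(\<Sum>i\<in>?J. card (A.fixpts (g [^] i))) = (\<Sum>i\<in>?J. card (B.fixpts (g [^] i)))" using J by (rule sum.cong[OF refl])
  moreover have "(\<Sum>i<?n. card (A.fixpts (g [^] i))) = (\<Sum>i<?n. card (B.fixpts (g [^] i)))"
    using burnside R[rule_format, OF less.prems] by simp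
  ultimately have "card ?I * card (A.fixpts g) = card ?I * card (B.fixpts g)"
    unfolding split I by linarith
  moreover have "?I \<noteq> {}"
  proof (cases "?n = 1")
    case True then have "0 \<in> ?I" by simp
    then show ?thesis by blast
  next
    case False then have "1 \<in> ?I" using n by simp
    then show ?thesis by blast
  qed
  then have "card ?I \<noteq> 0" by simp
  ultimately show ?case by (metis mult_cancel1)
qed

end

section \<open>Frobenius elements\<close>

lemma map_poly_embed_pderiv: "map_poly poly_embed (pderiv f) = pderiv (map_poly poly_embed f)"
  by (simp add: hom_distribs)

text \<open>Separability makes f and its derivative coprime over the fraction field; clearing
  denominators in a Bezout identity yields \<Delta>.\<close>

lemma exists_integral_generator:
  fixes \<alpha> :: "'k::{field,finite} poly fract alg_closure"
  assumes "integral_element \<alpha>" "separable_element \<alpha>"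
  obtains f \<Delta> u v where "integral_generator f \<Delta> u v \<alpha>"
proof -
  obtain f :: "'k poly poly" where f: "lead_coeff f = 1" "Factorial_Ring.irreducible (map_poly to_fract f)" "aev \<alpha> f = 0"
    using integral_minimal_poly[OF assms(1)] .
  obtain m where m: "Factorial_Ring.irreducible m" "tev \<alpha> m = 0" "rsquarefree (map_poly to_ac m)"
    using separable_elementE[OF assms(2)] by metis
  have "map_poly to_fract f dvd m" using tev_eq_0_iff_dvd[OF f(2), of \<alpha> m] f(3) m(2) by (simp add: aev_eq_tev)
  then have "map_poly to_ac (map_poly to_fract f) dvd map_poly to_ac m" by (rule to_ac.hom_dvd)
  then have "rsquarefree (map_poly to_ac (map_poly to_fract f))" by (rule rsquarefree_dvd[OF m(3)])
  then have sq: "rsquarefree (map_poly poly_embed f)" by (simp add: map_poly_map_poly o_def)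
  have "map_poly poly_embed f \<noteq> 0" using f(1) by auto
  then have "poly (pderiv (map_poly poly_embed f)) \<alpha> \<noteq> 0"
    using sq f(3) by (simp add: rsquarefree_iff_simple_roots aev_def)
  then have "aev \<alpha> (pderiv f) \<noteq> 0" unfolding aev_def map_poly_embed_pderiv .
  then have "\<not> map_poly to_fract f dvd map_poly to_fract (pderiv f)"
    using tev_eq_0_iff_dvd[OF f(2), of \<alpha>] f(3) by (simp add: aev_eq_tev)
  then obtain u v c where "c \<noteq> 0" "u * f + v * pderiv f = [:c:]" by (rule bezout_over_fract[OF f(2)])
  then have "integral_generator f c u v \<alpha>" using f by unfold_locales auto
  then show ?thesis by (rule that)
qed

lemma (in integral_generator) card_roots: "card {x. aev x f = 0} = d"
proof -
  have "map_poly poly_embed f \<noteq> 0" using f_nz by simp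
  moreover have "poly (pderiv (map_poly poly_embed f)) x \<noteq> 0" if "poly (map_poly poly_embed f) x = 0" for x
  proof
    assume "poly (pderiv (map_poly poly_embed f)) x = 0"
    then have "aev x (pderiv f) = 0" "aev x f = 0" using that unfolding aev_def map_poly_embed_pderiv by auto
    then have "aev x (u * f + v * pderiv f) = 0" by (simp only: aev.hom_add aev.hom_mult) simp
    then show False using discriminant_nz by (simp add: discriminant)
  qed
  ultimately have "rsquarefree (map_poly poly_embed f)" by (simp add: rsquarefree_iff_simple_roots)
  from rsquarefree_split(2)[OF this] show ?thesis by (simp add: aev_def)
qed

lemma (in integral_generator) aev_OK: "x \<in> OK \<Longrightarrow> aev x P \<in> OK"
proof (induction P)
  case (pCons c P)
  then show ?case using OK_add[OF OK_embed OK_mult[of x "aev x P"]] by simp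
qed (simp add: OK_0)

lemma (in integral_generator) place_aev_elem:
  assumes "good t" "y \<in> fibre t" "x \<in> OK"
  shows "place t y (aev x P) = pev t (place t y x) P"
proof (induction P)
  case (pCons c P)
  note P = aev_OK[OF assms(3), of P]
  show ?case
    using place_add[OF assms(1,2) OK_embed OK_mult[OF assms(3) P]] place_mult[OF assms P]
    by (simp add: place_embed[OF assms(1,2)] pCons)
qed (simp add: place_0[OF assms(1,2)])

text \<open>For two distinct roots \<open>a\<close>, \<open>b\<close> of \<open>P\<close> this says that their common residue is a double root of the
  reduction.\<close>

lemma (in integral_generator) divided_difference:
  assumes "good t" "y \<in> fibre t" "a \<in> OK" "b \<in> OK" "place t y a = place t y b"
  shows "\<exists>w\<in>OK. aev a P - aev b P = (a - b) * w \<and> place t y w = pev t (place t y a) (pderiv P)"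
proof (induction P)
  case 0 then show ?case by (intro bexI[of _ 0]) (simp_all add: place_0[OF assms(1,2)] OK_0)
next
  case (pCons c P)
  obtain w where w: "w \<in> OK" "aev a P - aev b P = (a - b) * w" "place t y w = pev t (place t y a) (pderiv P)"
    using pCons.IH by blast
  note ev = aev_OK[OF assms(3), of P] place_aev_elem[OF assms(1,2,3), of P]
  show ?case
  proof (intro bexI conjI)
    have "aev a (pCons c P) - aev b (pCons c P) = (a - b) * aev a P + b * (aev a P - aev b P)"
      by (simp add: algebra_simps)
    then show "aev a (pCons c P) - aev b (pCons c P) = (a - b) * (aev a P + b * w)"
      by (simp add: w(2) algebra_simps)
    show "aev a P + b * w \<in> OK" using ev(1) assms(4) w(1) by (intro OK_add OK_mult)
    have "place t y (aev a P + b * w) = place t y (aev a P) + place t y b * place t y w"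
      using place_add[OF assms(1,2) ev(1) OK_mult[OF assms(4) w(1)]] place_mult[OF assms(1,2,4) w(1)] by simp
    also have "\<dots> = pev t (place t y a) (P + pCons 0 (pderiv P))"
      by (simp add: ev(2) w(3) assms(5) pev.hom_add)
    finally show "place t y (aev a P + b * w) = pev t (place t y a) (pderiv (pCons c P))"
      by (simp add: pderiv_pCons)
  qed
qed

section \<open>Reduction of conjugates and the Frobenius of a good prime\<close>

locale galois_curve = N: integral_generator f \<Delta> u v \<gamma> + galois_generator \<gamma> "map_poly to_fract f"
  for f :: "'k::{field,finite} poly poly" and \<Delta> u v \<gamma>
begin

lemma gal_aev: "\<sigma> \<in> carrier gal \<Longrightarrow> x \<in> adj \<gamma> \<Longrightarrow> \<sigma> (aev x P) = aev (\<sigma> x) P"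
  by (simp add: aev_eq_tev gal_tev)

lemma gal_embed: "\<sigma> \<in> carrier gal \<Longrightarrow> \<sigma> (poly_embed c) = poly_embed c"
  using gal_aev[OF _ self_in_adj, of \<sigma> "[:c:]"] by simp

lemma gal_OK: "\<sigma> \<in> carrier gal \<Longrightarrow> x \<in> N.OK \<Longrightarrow> \<sigma> x \<in> N.OK"
proof -
  assume \<sigma>: "\<sigma> \<in> carrier gal" and x: "x \<in> N.OK"
  obtain g where g: "lead_coeff g = 1" "aev x g = 0" using x by (auto simp: N.OK_iff integral_element_def)
  have "aev (\<sigma> x) g = 0" using gal_aev[OF \<sigma>, of x g] x g(2) gal_embed[OF \<sigma>, of 0] by (simp add: N.OK_iff)
  then show ?thesis using gal_mem[OF \<sigma>] x g(1) by (auto simp: N.OK_iff integral_element_def)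
qed

lemma gal_times: "\<sigma> \<in> carrier gal \<Longrightarrow> x \<in> adj \<gamma> \<Longrightarrow> y \<in> adj \<gamma> \<Longrightarrow> \<sigma> (x * y) = \<sigma> x * \<sigma> y"
  unfolding carrier_galois_group by blast

lemma transitive_action_gal:
  assumes "\<alpha> \<in> adj \<gamma>" shows "transitive_action gal (\<lambda>\<sigma>. \<sigma>) \<alpha>"
proof -
  interpret group gal by (rule group_gal)
  show ?thesis
    by unfold_locales (use assms gal_mem in \<open>auto simp: finite_gal gal_mult gal_one compose_eq\<close>)
qed

text \<open>Another choice of the point above \<open>p\<close> conjugates the Frobenius element.\<close>

definition base_point :: "'k poly \<Rightarrow> 'k alg_closure"
  where "base_point p = (SOME y. y \<in> N.fibre (prime_root p))"

abbreviation residue :: "'k poly \<Rightarrow> 'k poly fract alg_closure \<Rightarrow> 'k alg_closure"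
  where "residue p \<equiv> N.place (prime_root p) (base_point p)"

definition Frob :: "'k poly \<Rightarrow> 'k poly fract alg_closure \<Rightarrow> 'k poly fract alg_closure"
  where "Frob p = (SOME \<sigma>. \<sigma> \<in> carrier gal \<and> (\<forall>x\<in>N.OK. residue p (\<sigma> x) = frob (degree p) (residue p x)))"

lemma base_point: "p \<in> N.good_primes \<Longrightarrow> base_point p \<in> N.fibre (prime_root p)"
proof -
  assume "p \<in> N.good_primes"
  then have "card (N.fibre (prime_root p)) > 0" using N.card_fibre N.good_prime_root N.degree_pos by simp
  then have "\<exists>y. y \<in> N.fibre (prime_root p)" by (auto simp: card_gt_0_iff)
  then show ?thesis unfolding base_point_def by (rule someI_ex)
qed

text \<open>Two conjugates with the same residue would produce a double root of the reduction of f',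
  which is excluded as p is good for f'; both sets have as many elements as the degree of
  f'.\<close>

lemma bij_betw_residue:
  assumes p: "p \<in> N.good_primes" and A: "integral_generator f' \<Delta>' u' v' \<alpha>" "\<alpha> \<in> adj \<gamma>"
    and p': "p \<in> affine_curve.good_primes \<Delta>'"
  shows "bij_betw (residue p) ((\<lambda>\<sigma>. \<sigma> \<alpha>) ` carrier gal) (affine_curve.fibre f' (prime_root p))"
proof -
  interpret A: integral_generator f' \<Delta>' u' v' \<alpha> by (rule A(1))
  let ?t = "prime_root p" and ?y = "base_point p"
  note N_good = N.good_prime_root[OF p] and A_good = A.good_prime_root[OF p']
  note y = base_point[OF p]
  have roots: "{x. aev x f' = 0} = (\<lambda>\<sigma>. \<sigma> \<alpha>) ` carrier gal"
    using roots_eq_orbit(1)[OF A(2) A.irreducible_fract] A.root_f by (simp add: aev_eq_tev)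
  have OK: "x \<in> N.OK" if "aev x f' = 0" for x
  proof -
    have "x \<in> (\<lambda>\<sigma>. \<sigma> \<alpha>) ` carrier gal" using that unfolding roots[symmetric] by simp
    then have "x \<in> adj \<gamma>" using gal_mem A(2) by blast
    then show ?thesis using that A.monic by (auto simp: N.OK_iff integral_element_def)
  qed
  have fib: "residue p x \<in> A.fibre ?t" if x: "aev x f' = 0" for x
    using N.place_aev_elem[OF N_good y OK[OF x], of f'] x by (simp add: A.fibre_def N.place_0[OF N_good y])
  have inj: "inj_on (residue p) {x. aev x f' = 0}"
  proof (rule inj_onI)
    fix a b assume ab: "a \<in> {x. aev x f' = 0}" "b \<in> {x. aev x f' = 0}" "residue p a = residue p b"
    have ab': "a \<in> N.OK" "b \<in> N.OK" "aev a f' = 0" "aev b f' = 0" using ab OK by auto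
    obtain w where w: "w \<in> N.OK" "aev a f' - aev b f' = (a - b) * w" "residue p w = pev ?t (residue p a) (pderiv f')"
      using N.divided_difference[OF N_good y ab'(1,2) ab(3), of f'] by blast
    have "w \<noteq> 0"
      using A.simple_root[OF A_good fib[OF ab'(3)]] w(3) N.place_0[OF N_good y] by auto
    then show "a = b" using w(2) ab' by simp
  qed
  have "card (residue p ` {x. aev x f' = 0}) = card (A.fibre ?t)"
    using card_image[OF inj] A.card_roots A.card_fibre[OF A_good] by simp
  moreover have "residue p ` {x. aev x f' = 0} \<subseteq> A.fibre ?t" using fib by blast
  ultimately have "residue p ` {x. aev x f' = 0} = A.fibre ?t" using A.finite_fibre by (intro card_subset_eq)
  then show ?thesis using inj unfolding roots by (simp add: bij_betw_def)
qed

text \<open>By the bijection for \<gamma> itself, some \<sigma> sends \<gamma> to a conjugate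
  reducing to the Frobenius of the base point. The congruence extends to all integral x by
  presenting x as P(\<gamma>) / h with h fixed by \<sigma>.\<close>

lemma Frob:
  assumes p: "p \<in> N.good_primes"
  shows "Frob p \<in> carrier gal" "x \<in> N.OK \<Longrightarrow> residue p (Frob p x) = frob (degree p) (residue p x)"
proof -
  let ?t = "prime_root p" and ?y = "base_point p"
  note good = N.good_prime_root[OF p] and y = base_point[OF p]
  have pp: "p \<in> prime_polys" using p by (simp add: N.good_primes_def)
  interpret P: good_prime f \<Delta> u v \<gamma> p ?t
    using good tev_prime_root[OF pp] pp by unfold_locales
  have t: "?t ^ CARD('k) ^ degree p = ?t" by (rule frobenius_fixes_root[OF pp tev_prime_root[OF pp]])
  have "residue p ` (\<lambda>\<sigma>. \<sigma> \<gamma>) ` carrier gal = N.fibre ?t"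
    using bij_betw_residue[OF p N.integral_generator_axioms self_in_adj p] by (simp add: bij_betw_def)
  moreover have "frob (degree p) ?y \<in> N.fibre ?t"
    using N.place_frobenius(1)[OF good y N.OK_1 t] by (simp add: frob_def)
  ultimately have "frob (degree p) ?y \<in> residue p ` (\<lambda>\<sigma>. \<sigma> \<gamma>) ` carrier gal" by (simp only:)
  then obtain \<sigma> where \<sigma>: "\<sigma> \<in> carrier gal" "residue p (\<sigma> \<gamma>) = frob (degree p) ?y" by (elim imageE) metis
  have "residue p (\<sigma> x) = frob (degree p) (residue p x)" if x: "x \<in> N.OK" for x
  proof -
    obtain P h where l: "N.loc ?t x P h" using N.integral_loc[OF x good] .
    then have h: "tev ?t h \<noteq> 0" "poly_embed h * x = aev \<gamma> P" by (auto simp: N.loc_def)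
    have xN: "x \<in> adj \<gamma>" using x by (simp add: N.OK_iff)
    have hN: "poly_embed h \<in> adj \<gamma>" using N.OK_embed by (simp add: N.OK_iff)
    have "poly_embed h * \<sigma> x = aev (\<sigma> \<gamma>) P"
      using arg_cong[OF h(2), of \<sigma>] by (simp add: gal_times[OF \<sigma>(1) hN xN] gal_embed[OF \<sigma>(1)] gal_aev[OF \<sigma>(1) self_in_adj])
    then have "tev ?t h * residue p (\<sigma> x) = pev ?t (frob (degree p) ?y) P"
      using N.place_mult[OF good y N.OK_embed gal_OK[OF \<sigma>(1) x], of h] N.place_embed[OF good y]
        N.place_aev_elem[OF good y gal_OK[OF \<sigma>(1) N.OK_gen], of P] \<sigma>(2) by simp
    also have "\<dots> = pev ?t ?y P ^ CARD('k) ^ degree p"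
      using pev_frobenius[of ?t "degree p" ?y P] t by (simp add: frob_def)
    also have "pev ?t ?y P = tev ?t h * residue p x"
      using N.place_mult[OF good y N.OK_embed x, of h] N.place_embed[OF good y] N.place_aev[OF good y, of P] h(2) by simp
    also have "(tev ?t h * residue p x) ^ CARD('k) ^ degree p = tev ?t h * frob (degree p) (residue p x)"
      using tev_frobenius[of ?t "degree p" h] t by (simp add: power_mult_distrib frob_def)
    finally show ?thesis using h(1) by simp
  qed
  then have "\<exists>\<sigma>. \<sigma> \<in> carrier gal \<and> (\<forall>x\<in>N.OK. residue p (\<sigma> x) = frob (degree p) (residue p x))" using \<sigma>(1) by blast
  from someI_ex[OF this] show "Frob p \<in> carrier gal"
    "x \<in> N.OK \<Longrightarrow> residue p (Frob p x) = frob (degree p) (residue p x)"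
    unfolding Frob_def by blast+
qed

end

lemma orb_image:
  assumes "\<And>y. y \<in> S \<Longrightarrow> F y \<in> S" "\<And>y. y \<in> S \<Longrightarrow> b (F y) = F' (b y)" "x \<in> S"
  shows "orb F' (b x) = b ` orb F x"
proof -
  have "(F ^^ i) x \<in> S \<and> b ((F ^^ i) x) = (F' ^^ i) (b x)" for i
    by (induction i) (use assms in auto)
  then have "(\<lambda>i. (F' ^^ i) (b x)) = (\<lambda>i. b ((F ^^ i) x))" by simp
  then show ?thesis unfolding orb_def image_image by (rule arg_cong)
qed

locale galois_subcurve = galois_curve f \<Delta> u v \<gamma> + A: integral_generator f' \<Delta>' u' v' \<alpha>
  for f :: "'k::{field,finite} poly poly" and \<Delta> u v \<gamma> and f' :: "'k poly poly" and \<Delta>' u' v' \<alpha> +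
  assumes subfield: "\<alpha> \<in> adj \<gamma>"
begin

sublocale act: transitive_action gal "\<lambda>\<sigma>. \<sigma>" \<alpha>
  by (rule transitive_action_gal[OF subfield])

lemma pts_OK: "x \<in> act.pts \<Longrightarrow> x \<in> N.OK"
proof -
  assume "x \<in> act.pts"
  then obtain \<sigma> where \<sigma>: "\<sigma> \<in> carrier gal" "x = \<sigma> \<alpha>" by (auto simp: act.pts_def)
  have "\<alpha> \<in> N.OK" using subfield A.root_f A.monic by (auto simp: N.OK_iff integral_element_def)
  then show ?thesis using gal_OK[OF \<sigma>(1)] \<sigma>(2) by simp
qed

lemma stab_eq: "act.stab = carrier (galois_group (adj \<gamma>) (adj \<alpha>))"
proof (intro equalityI subsetI)
  fix \<sigma> assume "\<sigma> \<in> act.stab"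
  then have \<sigma>: "\<sigma> \<in> carrier gal" "\<sigma> \<alpha> = \<alpha>" by (auto simp: act.stab_def)
  have "\<sigma> x = x" if x: "x \<in> adj \<alpha>" for x
  proof -
    obtain P where "x = tev \<alpha> P" using x by (auto simp: adj_def)
    then show ?thesis using gal_tev[OF \<sigma>(1) subfield, of P] \<sigma>(2) by simp
  qed
  then show "\<sigma> \<in> carrier (galois_group (adj \<gamma>) (adj \<alpha>))" using \<sigma>(1) unfolding carrier_galois_group by blast
next
  fix \<sigma> assume \<sigma>: "\<sigma> \<in> carrier (galois_group (adj \<gamma>) (adj \<alpha>))"
  then have "\<sigma> \<in> carrier gal" unfolding carrier_galois_group using base_subset_adj[of \<alpha>] by blast
  moreover have "\<sigma> \<alpha> = \<alpha>" using \<sigma> self_in_adj[of \<alpha>] unfolding carrier_galois_group by blast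
  ultimately show "\<sigma> \<in> act.stab" by (simp add: act.stab_def)
qed

context
  fixes p assumes p: "p \<in> N.good_primes" "p \<in> A.good_primes"
begin

lemma bij_residue: "bij_betw (residue p) act.pts (A.fibre (prime_root p))"
  using bij_betw_residue[OF p(1) A.integral_generator_axioms subfield p(2)] by (simp add: act.pts_def)

lemma residue_Frob: "x \<in> act.pts \<Longrightarrow> residue p (Frob p x) = frob (degree p) (residue p x)"
  by (rule Frob(2)[OF p(1) pts_OK])

lemma card_fixed_roots: "card (A.fixed_roots p) = card (act.fixpts (Frob p))"
proof -
  have "A.fixed_roots p = residue p ` act.fixpts (Frob p)"
  proof (intro equalityI subsetI)
    fix y assume "y \<in> A.fixed_roots p"
    then have y: "y \<in> A.fibre (prime_root p)" "frob (degree p) y = y" by (auto simp: A.fixed_roots_def frob_def)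
    then obtain x where x: "x \<in> act.pts" "y = residue p x" using bij_residue by (auto simp: bij_betw_def)
    have "residue p (Frob p x) = residue p x" using residue_Frob[OF x(1)] y(2) x(2) by simp
    then have "Frob p x = x"
      using bij_residue act.act_pts[OF Frob(1)[OF p(1)] x(1)] x(1) by (auto simp: bij_betw_def inj_on_def)
    then show "y \<in> residue p ` act.fixpts (Frob p)" using x by (auto simp: act.fixpts_def)
  next
    fix y assume "y \<in> residue p ` act.fixpts (Frob p)"
    then obtain x where x: "x \<in> act.pts" "Frob p x = x" "y = residue p x" by (auto simp: act.fixpts_def)
    then have "y \<in> A.fibre (prime_root p)" using bij_residue by (auto simp: bij_betw_def)
    moreover have "frob (degree p) y = y" using residue_Frob[OF x(1)] x(2,3) by simp
    ultimately show "y \<in> A.fixed_roots p" by (simp add: A.fixed_roots_def frob_def)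
  qed
  moreover have "inj_on (residue p) (act.fixpts (Frob p))"
    using bij_residue by (auto simp: bij_betw_def act.fixpts_def intro: inj_on_subset)
  ultimately show ?thesis by (simp add: card_image)
qed

lemma orb_residue: "x \<in> act.pts \<Longrightarrow> orb (frob (degree p)) (residue p x) = residue p ` orb (Frob p) x"
  using orb_image[of act.pts "Frob p" "residue p" "frob (degree p)" x] act.act_pts[OF Frob(1)[OF p(1)]] residue_Frob
  by blast

lemma residue_orb_iff:
  assumes "x \<in> act.pts" "x' \<in> act.pts"
  shows "orb (frob (degree p)) (residue p x) = orb (frob (degree p)) (residue p x') \<longleftrightarrow> orb (Frob p) x = orb (Frob p) x'"
proof -
  have "orb (Frob p) x \<subseteq> act.pts" "orb (Frob p) x' \<subseteq> act.pts"
    using act.act_periodic(2)[OF Frob(1)[OF p(1)]] assms by auto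
  then show ?thesis unfolding orb_residue[OF assms(1)] orb_residue[OF assms(2)]
    using bij_residue by (intro inj_on_image_eq_iff) (auto simp: bij_betw_def)
qed

lemma fibre_eq: "A.fibre (prime_root p) = residue p ` act.pts"
  using bij_residue by (simp add: bij_betw_def)

lemma good_prime: "good_prime f' \<Delta>' u' v' \<alpha> p (prime_root p)"
proof -
  have pp: "p \<in> prime_polys" using p(2) by (simp add: A.good_primes_def)
  show ?thesis using A.good_prime_root[OF p(2)] tev_prime_root[OF pp] pp by unfold_locales
qed

lemma splitting_type_eq_cycle_type:
  "splitting_type (adj \<alpha>) p = sorted_list_of_multiset (image_mset card (mset_set (orb (Frob p) ` act.pts)))"
proof -
  have "image_mset card (mset_set ((\<lambda>x. orb (frob (degree p)) (residue p x)) ` act.pts)) =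
      image_mset card (mset_set (orb (Frob p) ` act.pts))"
  proof (rule image_mset_eq_of_iff)
    fix x assume x: "x \<in> act.pts"
    have "inj_on (residue p) (orb (Frob p) x)"
      using bij_residue act.act_periodic(2)[OF Frob(1)[OF p(1)] x] by (auto simp: bij_betw_def intro: inj_on_subset)
    then show "card (orb (frob (degree p)) (residue p x)) = card (orb (Frob p) x)"
      by (simp add: orb_residue[OF x] card_image)
  qed (use residue_orb_iff act.finite_pts in auto)
  then show ?thesis unfolding good_prime.splitting_type_eq[OF good_prime] fibre_eq image_image by simp
qed

lemma card_primes_above_eq_num_orbits: "card (primes_above (adj \<alpha>) p) = act.num_orbits (Frob p)"
  unfolding good_prime.card_primes_above[OF good_prime] fibre_eq image_image
  by (rule card_image_eq_of_iff) (rule residue_orb_iff)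

end

end

section \<open>Logarithmic sums over primes\<close>

text \<open>With \<open>z = q powr (- s)\<close> the sum below is the Dirichlet series of \<open>f\<close>, and
  \<open>- ln (1 - q z)\<close> is \<open>log (1 / (s - 1)) + O(1)\<close>.\<close>

definition log_asymp :: "'k::{field,finite} poly set \<Rightarrow> ('k poly \<Rightarrow> real) \<Rightarrow> real \<Rightarrow> bool"
  where "log_asymp I f M \<longleftrightarrow> (\<exists>B. \<forall>z. 1 / (real CARD('k))\<^sup>2 \<le> z \<longrightarrow> z < 1 / real CARD('k) \<longrightarrow>
     (\<lambda>p. f p * z ^ degree p) summable_on I \<and> \<bar>(\<Sum>\<^sub>\<infinity>p\<in>I. f p * z ^ degree p) + M * ln (1 - real CARD('k) * z)\<bar> \<le> B)"

lemma log_asymp_0: "log_asymp I (\<lambda>_. 0) 0"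
  unfolding log_asymp_def by (intro exI[of _ 0]) simp

lemma log_asymp_add:
  fixes I :: "'k::{field,finite} poly set"
  assumes "log_asymp I f M" "log_asymp I g N"
  shows "log_asymp I (\<lambda>p. f p + g p) (M + N)"
proof -
  obtain B where B: "\<And>z. 1 / (real CARD('k))\<^sup>2 \<le> z \<Longrightarrow> z < 1 / real CARD('k) \<Longrightarrow>
     (\<lambda>p. f p * z ^ degree p) summable_on I \<and> \<bar>(\<Sum>\<^sub>\<infinity>p\<in>I. f p * z ^ degree p) + M * ln (1 - real CARD('k) * z)\<bar> \<le> B"
    using assms(1) unfolding log_asymp_def by blast
  obtain C where C: "\<And>z. 1 / (real CARD('k))\<^sup>2 \<le> z \<Longrightarrow> z < 1 / real CARD('k) \<Longrightarrow>
     (\<lambda>p. g p * z ^ degree p) summable_on I \<and> \<bar>(\<Sum>\<^sub>\<infinity>p\<in>I. g p * z ^ degree p) + N * ln (1 - real CARD('k) * z)\<bar> \<le> C"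
    using assms(2) unfolding log_asymp_def by blast
  show ?thesis unfolding log_asymp_def
  proof (intro exI[of _ "B + C"] allI impI conjI)
    fix z assume z: "1 / (real CARD('k))\<^sup>2 \<le> z" "z < 1 / real CARD('k)"
    note s = conjunct1[OF B[OF z]] conjunct1[OF C[OF z]] and b = conjunct2[OF B[OF z]] conjunct2[OF C[OF z]]
    show "(\<lambda>p. (f p + g p) * z ^ degree p) summable_on I"
      using summable_on_add[OF s] by (simp add: distrib_right)
    have "(\<Sum>\<^sub>\<infinity>p\<in>I. (f p + g p) * z ^ degree p) = (\<Sum>\<^sub>\<infinity>p\<in>I. f p * z ^ degree p) + (\<Sum>\<^sub>\<infinity>p\<in>I. g p * z ^ degree p)"
      using infsum_add[OF s] by (simp add: distrib_right)
    then show "\<bar>(\<Sum>\<^sub>\<infinity>p\<in>I. (f p + g p) * z ^ degree p) + (M + N) * ln (1 - real CARD('k) * z)\<bar> \<le> B + C"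
      using b by (simp add: distrib_right abs_le_iff)
  qed
qed

lemma log_asymp_cmult:
  fixes I :: "'k::{field,finite} poly set"
  assumes "log_asymp I f M"
  shows "log_asymp I (\<lambda>p. c * f p) (c * M)"
proof -
  obtain B where B: "\<And>z. 1 / (real CARD('k))\<^sup>2 \<le> z \<Longrightarrow> z < 1 / real CARD('k) \<Longrightarrow>
     (\<lambda>p. f p * z ^ degree p) summable_on I \<and> \<bar>(\<Sum>\<^sub>\<infinity>p\<in>I. f p * z ^ degree p) + M * ln (1 - real CARD('k) * z)\<bar> \<le> B"
    using assms(1) unfolding log_asymp_def by blast
  show ?thesis unfolding log_asymp_def
  proof (intro exI[of _ "\<bar>c\<bar> * B"] allI impI conjI)
    fix z assume z: "1 / (real CARD('k))\<^sup>2 \<le> z" "z < 1 / real CARD('k)"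
    note s = conjunct1[OF B[OF z]] and b = conjunct2[OF B[OF z]]
    show "(\<lambda>p. c * f p * z ^ degree p) summable_on I"
      using summable_on_cmult_right[OF s, of c] by (simp add: mult.assoc)
    have "(\<Sum>\<^sub>\<infinity>p\<in>I. c * f p * z ^ degree p) + c * M * ln (1 - real CARD('k) * z) =
        c * ((\<Sum>\<^sub>\<infinity>p\<in>I. f p * z ^ degree p) + M * ln (1 - real CARD('k) * z))"
      using infsum_cmult_right[OF s, of c] by (simp add: mult.assoc distrib_left)
    then show "\<bar>(\<Sum>\<^sub>\<infinity>p\<in>I. c * f p * z ^ degree p) + c * M * ln (1 - real CARD('k) * z)\<bar> \<le> \<bar>c\<bar> * B"
      using b by (simp add: abs_mult mult_left_mono)
  qed
qed

lemma log_asymp_diff: "log_asymp I f M \<Longrightarrow> log_asymp I g N \<Longrightarrow> log_asymp I (\<lambda>p. f p - g p) (M - N)"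
  using log_asymp_add[of I f M "\<lambda>p. - 1 * g p" "- 1 * N"] log_asymp_cmult[of I g N "- 1"] by simp

lemma log_asymp_sum:
  assumes "finite E" "\<And>e. e \<in> E \<Longrightarrow> log_asymp I (f e) (M e)"
  shows "log_asymp I (\<lambda>p. \<Sum>e\<in>E. f e p) (\<Sum>e\<in>E. M e)"
  using assms
proof (induction E rule: finite_induct)
  case (insert e E)
  then show ?case using log_asymp_add[of I "f e" "M e"] by simp
qed (simp add: log_asymp_0)

lemma log_asymp_change:
  fixes I J :: "'k::{field,finite} poly set"
  assumes "log_asymp I f M" and fin: "finite (I - J)" "finite (J - I)" and eq: "\<And>p. p \<in> I \<inter> J \<Longrightarrow> f p = g p"
  shows "log_asymp J g M"
proof -
  obtain B where B: "\<And>z. 1 / (real CARD('k))\<^sup>2 \<le> z \<Longrightarrow> z < 1 / real CARD('k) \<Longrightarrow>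
     (\<lambda>p. f p * z ^ degree p) summable_on I \<and> \<bar>(\<Sum>\<^sub>\<infinity>p\<in>I. f p * z ^ degree p) + M * ln (1 - real CARD('k) * z)\<bar> \<le> B"
    using assms(1) unfolding log_asymp_def by blast
  let ?C = "(\<Sum>p\<in>I - J. \<bar>f p\<bar>) + (\<Sum>p\<in>J - I. \<bar>g p\<bar>)"
  show ?thesis unfolding log_asymp_def
  proof (intro exI[of _ "B + ?C"] allI impI conjI)
    fix z assume z: "1 / (real CARD('k))\<^sup>2 \<le> z" "z < 1 / real CARD('k)"
    note s = conjunct1[OF B[OF z]] and b = conjunct2[OF B[OF z]]
    let ?F = "\<lambda>p. f p * z ^ degree p" and ?G = "\<lambda>p. g p * z ^ degree p"
    have "0 \<le> 1 / (real CARD('k))\<^sup>2" "1 / real CARD('k) \<le> 1" by auto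
    then have z01: "0 \<le> z" "z \<le> 1" using z by linarith+
    have small: "\<bar>c * z ^ n\<bar> \<le> \<bar>c\<bar>" for c n
      using z01 mult_left_mono[OF power_le_one[OF z01, of n], of "\<bar>c\<bar>"] by (simp add: abs_mult)
    have fsum: "\<bar>\<Sum>p\<in>A. c p * z ^ degree p\<bar> \<le> (\<Sum>p\<in>A. \<bar>c p\<bar>)" for A and c :: "'k poly \<Rightarrow> real"
      using order_trans[OF sum_abs sum_mono[of A "\<lambda>p. \<bar>c p * z ^ degree p\<bar>" "\<lambda>p. \<bar>c p\<bar>"]] small by blast
    have IJ: "?F summable_on (I \<inter> J)" by (rule summable_on_subset_banach[OF s]) blast
    have cong: "?G summable_on (I \<inter> J) \<longleftrightarrow> ?F summable_on (I \<inter> J)" "infsum ?G (I \<inter> J) = infsum ?F (I \<inter> J)"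
      using eq by (auto intro!: summable_on_cong infsum_cong)
    have I: "I = (I \<inter> J) \<union> (I - J)" and J: "J = (I \<inter> J) \<union> (J - I)" by blast+
    show "?G summable_on J"
      by (subst J, rule summable_on_Un_disjoint) (use cong IJ fin in auto)
    have "infsum ?F ((I \<inter> J) \<union> (I - J)) = infsum ?F (I \<inter> J) + infsum ?F (I - J)"
      by (rule infsum_Un_disjoint) (use IJ fin in auto)
    then have iF: "infsum ?F I = infsum ?F (I \<inter> J) + (\<Sum>p\<in>I - J. ?F p)"
      using fin(1) unfolding I[symmetric] by simp
    have "infsum ?G ((I \<inter> J) \<union> (J - I)) = infsum ?G (I \<inter> J) + infsum ?G (J - I)"
      by (rule infsum_Un_disjoint) (use cong IJ fin in auto)
    then have iG: "infsum ?G J = infsum ?F (I \<inter> J) + (\<Sum>p\<in>J - I. ?G p)"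
      using fin(2) unfolding J[symmetric] cong(2) by simp
    have "infsum ?G J - infsum ?F I = (\<Sum>p\<in>J - I. ?G p) - (\<Sum>p\<in>I - J. ?F p)" by (simp add: iF iG)
    moreover have "\<bar>\<Sum>p\<in>J - I. ?G p\<bar> \<le> (\<Sum>p\<in>J - I. \<bar>g p\<bar>)" "\<bar>\<Sum>p\<in>I - J. ?F p\<bar> \<le> (\<Sum>p\<in>I - J. \<bar>f p\<bar>)"
      by (rule fsum)+
    ultimately show "\<bar>infsum ?G J + M * ln (1 - real CARD('k) * z)\<bar> \<le> B + ?C"
      using b unfolding abs_le_iff by linarith
  qed
qed

lemma finite_dividing_polys:
  assumes "(c :: 'k::{field,finite} poly) \<noteq> 0" shows "finite {p. p dvd c}"
proof (rule finite_subset[OF _ card_polys_degree_less(1)])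
  show "{p. p dvd c} \<subseteq> {p. \<forall>i\<ge>Suc (degree c). coeff p i = 0}"
    using assms by (auto dest!: dvd_imp_degree_le intro!: coeff_eq_0)
qed

section \<open>Dirichlet density zero and logarithmic growth\<close>

lemma prime_sum_eq:
  fixes S :: "'k::{field,finite} poly set"
  shows "prime_sum S s = (\<Sum>\<^sub>\<infinity>p\<in>S. (real CARD('k) powr (- s)) ^ degree p)"
proof -
  have q: "0 < real CARD('k)" by simp
  have "real (CARD('k) ^ n) powr (- s) = (real CARD('k) powr (- s)) ^ n" for n
    using q by (simp add: powr_powr mult.commute flip: powr_realpow)
  then show ?thesis by (simp add: prime_sum_def)
qed

lemma powr_range:
  assumes "1 < s" "s \<le> 2"
  shows "1 / (real CARD('k::{field,finite}))\<^sup>2 \<le> real CARD('k) powr (- s)" "real CARD('k) powr (- s) < 1 / real CARD('k)"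
proof -
  have q: "1 < real CARD('k)" using finite_field_card_gt_1[where 'k='k] by linarith
  have "1 / (real CARD('k))\<^sup>2 = real CARD('k) powr (- 2)"
    using q by (simp add: powr_minus_divide powr_numeral)
  then show "1 / (real CARD('k))\<^sup>2 \<le> real CARD('k) powr (- s)" using q assms by simp
  have "real CARD('k) powr (- s) < real CARD('k) powr (- 1)" using q assms by (intro powr_less_mono) auto
  then show "real CARD('k) powr (- s) < 1 / real CARD('k)" using q by (simp add: powr_minus_divide)
qed

lemma eventually_ln_large:
  "eventually (\<lambda>s. - ln (1 - real CARD('k::{field,finite}) * real CARD('k) powr (- s)) > C) (at_right 1)"
proof -
  let ?q = "real CARD('k)"
  have q: "1 < ?q" using finite_field_card_gt_1[where 'k='k] by linarith
  have "((\<lambda>s. 1 - ?q * ?q powr (- s)) \<longlongrightarrow> 1 - ?q * ?q powr (- 1)) (at_right 1)"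
    by (intro tendsto_intros) (use q in auto)
  then have "((\<lambda>s. 1 - ?q * ?q powr (- s)) \<longlongrightarrow> 0) (at_right 1)" using q by (simp add: powr_minus_divide)
  then have "eventually (\<lambda>s. 1 - ?q * ?q powr (- s) < exp (- C)) (at_right 1)" by (rule order_tendstoD(2)) simp
  moreover have "eventually (\<lambda>s :: real. s \<in> {1<..<2}) (at_right 1)" by (rule eventually_at_right_real) simp
  ultimately show ?thesis
  proof eventually_elim
    case (elim s)
    have "?q powr (- s) < 1 / ?q" using powr_range(2)[of s] elim(2) by simp
    then have "0 < 1 - ?q * ?q powr (- s)" using q by (simp add: field_simps)
    then have "ln (1 - ?q * ?q powr (- s)) < ln (exp (- C))" using elim(1) by (simp only: ln_less_cancel_iff exp_gt_zero)
    then show ?case by simp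
  qed
qed

lemma summable_primes:
  assumes "1 < s" "s \<le> 2" "S \<subseteq> (prime_polys :: 'k::{field,finite} poly set)"
  shows "(\<lambda>p. (real CARD('k) powr (- s)) ^ degree p) summable_on S"
  using prime_sum_asymptotics powr_range[OF assms(1,2)] summable_on_subset_banach[OF _ assms(3)] by blast

lemma prime_sum_nonneg: "0 \<le> prime_sum S s"
  unfolding prime_sum_eq by (rule infsum_nonneg) simp

lemma prime_sum_mono:
  assumes "1 < s" "s \<le> 2" "S \<subseteq> S'" "S' \<subseteq> (prime_polys :: 'k::{field,finite} poly set)"
  shows "prime_sum S s \<le> prime_sum S' s"
  unfolding prime_sum_eq
proof (rule infsum_mono_neutral)
  show "(\<lambda>p. (real CARD('k) powr (- s)) ^ degree p) summable_on S"
    using assms(3,4) by (intro summable_primes assms(1,2)) auto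
  show "(\<lambda>p. (real CARD('k) powr (- s)) ^ degree p) summable_on S'" by (rule summable_primes[OF assms(1,2,4)])
qed (use assms(3) in auto)

lemma eventually_prime_sum_large:
  "eventually (\<lambda>s. prime_sum (prime_polys :: 'k::{field,finite} poly set) s > C) (at_right 1)"
proof -
  obtain B where B: "\<And>z. 1 / (real CARD('k))\<^sup>2 \<le> z \<Longrightarrow> z < 1 / real CARD('k) \<Longrightarrow>
     \<bar>(\<Sum>\<^sub>\<infinity>p\<in>(prime_polys :: 'k poly set). z ^ degree p) + ln (1 - real CARD('k) * z)\<bar> \<le> B"
    using prime_sum_asymptotics[where 'k='k] by blast
  have "eventually (\<lambda>s :: real. s \<in> {1<..<2}) (at_right 1)" by (rule eventually_at_right_real) simp
  with eventually_ln_large[of "C + B", where 'k='k] show ?thesis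
  proof eventually_elim
    case (elim s)
    then show ?case using B[OF powr_range[of s]] unfolding prime_sum_eq by (simp add: abs_le_iff)
  qed
qed

lemma density_zero_subset:
  assumes "has_dirichlet_density Z 0" "S \<subseteq> Z" "Z \<subseteq> (prime_polys :: 'k::{field,finite} poly set)"
  shows "has_dirichlet_density S 0"
  unfolding has_dirichlet_density_def
proof (rule tendsto_sandwich[OF _ _ tendsto_const assms(1)[unfolded has_dirichlet_density_def]])
  have ev: "eventually (\<lambda>s :: real. s \<in> {1<..<2}) (at_right 1)" by (rule eventually_at_right_real) simp
  show "eventually (\<lambda>s. 0 \<le> prime_sum S s / prime_sum (prime_polys :: 'k poly set) s) (at_right 1)"
    by (simp add: prime_sum_nonneg)
  show "eventually (\<lambda>s. prime_sum S s / prime_sum (prime_polys :: 'k poly set) s \<le>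
      prime_sum Z s / prime_sum (prime_polys :: 'k poly set) s) (at_right 1)"
    using ev by eventually_elim (use prime_sum_mono[OF _ _ assms(2,3)] in \<open>auto intro!: divide_right_mono prime_sum_nonneg\<close>)
qed

lemma density_zero_finite:
  assumes "finite (S :: 'k::{field,finite} poly set)"
  shows "has_dirichlet_density S 0"
  unfolding has_dirichlet_density_def
proof (rule tendstoI)
  fix e :: real assume e: "0 < e"
  have ev: "eventually (\<lambda>s :: real. s \<in> {1<..<2}) (at_right 1)" by (rule eventually_at_right_real) simp
  show "eventually (\<lambda>s. dist (prime_sum S s / prime_sum (prime_polys :: 'k poly set) s) 0 < e) (at_right 1)"
    using ev eventually_prime_sum_large[of 0, where 'k='k] eventually_prime_sum_large[of "real (card S) / e", where 'k='k]
  proof eventually_elim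
    case (elim s)
    have q: "1 \<le> real CARD('k)" by simp
    have "1 / real CARD('k) \<le> 1" using q by simp
    moreover have "real CARD('k) powr (- s) < 1 / real CARD('k)" using powr_range(2)[of s] elim(1) by simp
    ultimately have "real CARD('k) powr (- s) \<le> 1" by linarith
    then have "(\<Sum>p\<in>S. (real CARD('k) powr (- s)) ^ degree p) \<le> (\<Sum>p\<in>S. 1)"
      by (intro sum_mono power_le_one) auto
    then have "prime_sum S s \<le> real (card S)" unfolding prime_sum_eq using assms by simp
    also have "\<dots> < e * prime_sum (prime_polys :: 'k poly set) s" using elim(3) e by (simp add: field_simps)
    finally show ?case using elim(2) prime_sum_nonneg[of S s] by (simp add: field_simps)
  qed
qed

lemma density_zero_Un:
  assumes "has_dirichlet_density S 0" "has_dirichlet_density S' 0" "S \<subseteq> prime_polys" "S' \<subseteq> (prime_polys :: 'k::{field,finite} poly set)"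
  shows "has_dirichlet_density (S \<union> S') 0"
  unfolding has_dirichlet_density_def
proof (rule tendsto_sandwich[OF _ _ tendsto_const])
  let ?T = "prime_sum (prime_polys :: 'k poly set)"
  show "((\<lambda>s. prime_sum S s / ?T s + prime_sum S' s / ?T s) \<longlongrightarrow> 0) (at_right 1)"
    using tendsto_add[OF assms(1,2)[unfolded has_dirichlet_density_def]] by simp
  have ev: "eventually (\<lambda>s :: real. s \<in> {1<..<2}) (at_right 1)" by (rule eventually_at_right_real) simp
  show "eventually (\<lambda>s. 0 \<le> prime_sum (S \<union> S') s / ?T s) (at_right 1)"
    by (simp add: prime_sum_nonneg)
  show "eventually (\<lambda>s. prime_sum (S \<union> S') s / ?T s \<le> prime_sum S s / ?T s + prime_sum S' s / ?T s) (at_right 1)"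
    using ev
  proof eventually_elim
    case (elim s)
    then have s: "1 < s" "s \<le> 2" by auto
    have "prime_sum (S \<union> (S' - S)) s = prime_sum S s + prime_sum (S' - S) s"
      unfolding prime_sum_eq using assms(3,4) by (intro infsum_Un_disjoint summable_primes s) auto
    also have "\<dots> \<le> prime_sum S s + prime_sum S' s" using prime_sum_mono[OF s, of "S' - S" S'] assms(4) by auto
    finally have "prime_sum (S \<union> S') s \<le> prime_sum S s + prime_sum S' s" by simp
    then show ?case by (simp add: divide_right_mono prime_sum_nonneg flip: add_divide_distrib)
  qed
qed

text \<open>A bounded weight supported on Z has a sum at most a constant times that of Z. Density
  zero would make it negligible against the sum over all primes, but it grows like M times that
  sum.\<close>

lemma log_asymp_not_density_zero:
  fixes I :: "'k::{field,finite} poly set"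
  assumes f: "log_asymp I f M" "0 < M" "\<And>p. p \<in> I \<Longrightarrow> 0 \<le> f p" "\<And>p. p \<in> I \<Longrightarrow> f p \<le> C"
    and Z: "{p \<in> I. f p \<noteq> 0} \<subseteq> Z" "Z \<subseteq> prime_polys"
  shows "\<not> has_dirichlet_density Z 0"
proof
  let ?q = "real CARD('k)" and ?T = "prime_sum (prime_polys :: 'k poly set)"
  assume "has_dirichlet_density Z 0"
  then have lim: "((\<lambda>s. prime_sum Z s / ?T s) \<longlongrightarrow> 0) (at_right 1)" by (simp add: has_dirichlet_density_def)
  obtain B where B: "\<And>z. 1 / ?q\<^sup>2 \<le> z \<Longrightarrow> z < 1 / ?q \<Longrightarrow>
     (\<lambda>p. f p * z ^ degree p) summable_on I \<and> \<bar>(\<Sum>\<^sub>\<infinity>p\<in>I. f p * z ^ degree p) + M * ln (1 - ?q * z)\<bar> \<le> B"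
    using f(1) unfolding log_asymp_def by blast
  obtain B' where B': "\<And>z. 1 / ?q\<^sup>2 \<le> z \<Longrightarrow> z < 1 / ?q \<Longrightarrow>
     \<bar>(\<Sum>\<^sub>\<infinity>p\<in>(prime_polys :: 'k poly set). z ^ degree p) + ln (1 - ?q * z)\<bar> \<le> B'"
    using prime_sum_asymptotics[where 'k='k] by blast
  define C' where "C' = max C 1"
  have C': "0 < C'" "\<And>p. p \<in> I \<Longrightarrow> f p \<le> C'" using f(4) by (auto simp: C'_def max.coboundedI1)
  have ev: "eventually (\<lambda>s :: real. s \<in> {1<..<2}) (at_right 1)" by (rule eventually_at_right_real) simp
  have ev2: "eventually (\<lambda>s. prime_sum Z s / ?T s < M / (2 * C')) (at_right 1)"
    using lim by (rule order_tendstoD(2)) (use f(2) C' in auto)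
  \<comment> \<open>Near s = 1, density zero keeps C' times the sum over Z below half of M times the
    sum over all primes, and the last threshold keeps the bounded errors below the other
    half.\<close>
  have "eventually (\<lambda>s :: real. False) (at_right 1)"
    using ev ev2 eventually_prime_sum_large[of 0, where 'k='k] eventually_prime_sum_large[of "2 * (M * B' + B) / M", where 'k='k]
  proof eventually_elim
    case (elim s)
    define z where "z = ?q powr (- s)"
    have s: "1 < s" "s \<le> 2" using elim(1) by auto
    have z: "1 / ?q\<^sup>2 \<le> z" "z < 1 / ?q" "0 \<le> z" using powr_range[OF s, where 'k='k] by (simp_all add: z_def)
    have "(\<Sum>\<^sub>\<infinity>p\<in>I. f p * z ^ degree p) \<le> (\<Sum>\<^sub>\<infinity>p\<in>Z. C' * z ^ degree p)"
    proof (rule infsum_mono_neutral)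
      show "(\<lambda>p. C' * z ^ degree p) summable_on Z"
        using summable_primes[OF s Z(2)] by (intro summable_on_cmult_right) (simp add: z_def)
    qed (use B[OF z(1,2)] C' Z(1) z(3) in \<open>auto intro: mult_right_mono\<close>)
    also have "\<dots> = C' * prime_sum Z s"
      using infsum_cmult_right[OF summable_primes[OF s Z(2)], of C'] by (simp add: prime_sum_eq z_def)
    finally have 1: "(\<Sum>\<^sub>\<infinity>p\<in>I. f p * z ^ degree p) \<le> C' * prime_sum Z s" .
    have 2: "- B - M * ln (1 - ?q * z) \<le> (\<Sum>\<^sub>\<infinity>p\<in>I. f p * z ^ degree p)" using B[OF z(1,2)] by (simp add: abs_le_iff)
    have "?T s - B' \<le> - ln (1 - ?q * z)" using B'[OF z(1,2)] by (simp add: abs_le_iff prime_sum_eq z_def)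
    then have "M * (?T s - B') \<le> M * (- ln (1 - ?q * z))" using f(2) by (intro mult_left_mono) auto
    with 1 2 have 3: "M * ?T s \<le> C' * prime_sum Z s + (M * B' + B)" by (simp add: algebra_simps)
    have "prime_sum Z s < M / (2 * C') * ?T s" using elim(2,3) by (simp add: pos_divide_less_eq)
    then have "C' * prime_sum Z s < C' * (M / (2 * C') * ?T s)" by (rule mult_strict_left_mono[OF _ C'(1)])
    also have "\<dots> = M * ?T s / 2" using C' by simp
    finally have "C' * prime_sum Z s < M * ?T s / 2" .
    moreover have "M * B' + B < M * ?T s / 2" using elim(4) f(2) by (simp add: field_simps)
    ultimately show False using 3 by linarith
  qed
  then show False by (simp add: trivial_limit_at_right_real)
qed

section \<open>Equidistribution of Frobenius elements\<close>

context group
begin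

definition powers :: "'a \<Rightarrow> 'a set"
  where "powers y = {y [^] i | i :: nat. True}"

definition gens :: "'a \<Rightarrow> 'a set"
  where "gens y = {x \<in> powers y. ord x = ord y}"

lemma powersI: "y [^] (i :: nat) \<in> powers y" by (auto simp: powers_def)

lemma powers_carrier: "y \<in> carrier G \<Longrightarrow> powers y \<subseteq> carrier G" by (auto simp: powers_def)

lemma self_in_gens: "y \<in> carrier G \<Longrightarrow> y \<in> gens y"
  using powersI[of y 1] by (simp add: gens_def)

lemma subgroup_powers:
  assumes "finite (carrier G)" "y \<in> carrier G" shows "subgroup (powers y) G"
  using generate_is_subgroup[of "{y}"] generate_pow_on_finite_carrier[OF assms] assms(2) by (simp add: powers_def)

lemma gens_coprime_pow:
  assumes "finite (carrier G)" "y \<in> carrier G" "x \<in> gens y"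
  obtains i :: nat where "x = y [^] i" "coprime i (ord y)"
proof -
  obtain i :: nat where i: "x = y [^] i" "ord x = ord y" using assms(3) by (auto simp: gens_def powers_def)
  then have "coprime i (ord y)" using pow_ord_eq_ord_iff[OF assms(1,2)] by simp
  then show ?thesis using that i(1) by blast
qed

text \<open>A cyclic group has one subgroup of each order e dividing its order, and the elements of
  order e are the generators of that subgroup.\<close>

lemma gens_subgroup_eq:
  assumes "finite (carrier G)" "y \<in> carrier G" "e dvd ord y"
  shows "gens (y [^] (ord y div e)) = {x \<in> powers y. ord x = e}" "ord (y [^] (ord y div e)) = e"
proof -
  let ?n = "ord y" and ?y = "y [^] (ord y div e)"
  have n: "0 < ?n" using ord_ge_1[OF assms(1,2)] by simp
  have e: "0 < e" "?n = e * (?n div e)" using assms(3) n by (auto intro: Nat.gr0I)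
  have ne: "0 < ?n div e" using n e(2) by (metis mult_0_right neq0_conv)
  have "ord ?y = ?n div (?n div e)" using ord_pow[OF assms(2), of "?n div e"] ne e(2) by (metis dvd_triv_right neq0_conv)
  also have "\<dots> = e" using e(2) ne by (metis nonzero_mult_div_cancel_right neq0_conv)
  finally show ord: "ord ?y = e" .
  show "gens ?y = {x \<in> powers y. ord x = e}"
  proof (intro equalityI subsetI)
    fix x assume "x \<in> gens ?y"
    then obtain i :: nat where i: "x = ?y [^] i" "ord x = e" using ord by (auto simp: gens_def powers_def)
    then have "x = y [^] (?n div e * i)" using assms(2) by (simp add: nat_pow_pow)
    then show "x \<in> {x \<in> powers y. ord x = e}" using i(2) powersI by simp
  next
    fix x assume "x \<in> {x \<in> powers y. ord x = e}"
    then obtain i :: nat where i: "x = y [^] i" "ord x = e" by (auto simp: powers_def)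
    have "?n div e dvd i"
    proof (cases "i = 0")
      case False
      then have g: "e = ?n div gcd ?n i" using ord_pow_gen[OF assms(2), of i] i by simp
      have "?n = ?n div gcd ?n i * gcd ?n i" by simp
      then have "?n div e = gcd ?n i" using g e(1) by (metis nonzero_mult_div_cancel_left neq0_conv)
      then show ?thesis by simp
    qed simp
    then obtain j where "i = ?n div e * j" by (elim dvdE)
    then have "x = ?y [^] j" using assms(2) i(1) by (simp add: nat_pow_pow)
    then show "x \<in> gens ?y" using powersI i(2) ord by (simp add: gens_def)
  qed
qed

lemma card_powers_decompose:
  assumes "finite (carrier G)" "y \<in> carrier G"
  shows "card {c \<in> carrier G. g c \<in> powers y} =
    (\<Sum>e | e dvd ord y. card {c \<in> carrier G. g c \<in> gens (y [^] (ord y div e))})"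
proof -
  have n: "0 < ord y" using ord_ge_1[OF assms] by simp
  have fin: "finite {e. e dvd ord y}" using n by simp
  have "ord x dvd ord y" if "x \<in> powers y" for x
  proof -
    obtain i :: nat where i: "x = y [^] i" using \<open>x \<in> powers y\<close> by (auto simp: powers_def)
    have "x [^] ord y = \<one>" unfolding i using assms(2) by (simp add: nat_pow_pow pow_eq_id)
    then show ?thesis using pow_eq_id[of x] assms(2) i by simp
  qed
  then have "{c \<in> carrier G. g c \<in> powers y} = (\<Union>e\<in>{e. e dvd ord y}. {c \<in> carrier G. g c \<in> gens (y [^] (ord y div e))})"
    using gens_subgroup_eq(1)[OF assms] by auto
  moreover have "card \<dots> = (\<Sum>e | e dvd ord y. card {c \<in> carrier G. g c \<in> gens (y [^] (ord y div e))})"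
    using fin assms(1) gens_subgroup_eq(1)[OF assms] by (intro card_UN_disjoint) auto
  ultimately show ?thesis by simp
qed

end

lemma infinite_poly_embed: "infinite (range (poly_embed :: 'k::field poly \<Rightarrow> _))"
proof -
  have "inj (poly_embed :: 'k poly \<Rightarrow> _)" by (auto intro!: injI)
  moreover have "infinite (UNIV :: 'k poly set)"
  proof -
    have "inj (\<lambda>n. monom (1 :: 'k) n)" by (auto intro!: injI simp: monom_eq_iff')
    then show ?thesis using infinite_UNIV_nat by (metis finite_imageD finite_subset subset_UNIV)
  qed
  ultimately show ?thesis by (simp add: finite_image_iff)
qed

lemma integral_prod: "(\<And>i. i \<in> I \<Longrightarrow> integral_element (g i)) \<Longrightarrow> integral_element (prod g I)"
  by (induction I rule: infinite_finite_induct) (auto intro: integral_mult integral_1)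

context galois_curve
begin

lemma gal_prod:
  assumes "\<sigma> \<in> carrier gal" "finite I" "\<And>i. i \<in> I \<Longrightarrow> g i \<in> adj \<gamma>"
  shows "prod g I \<in> adj \<gamma> \<and> \<sigma> (prod g I) = (\<Prod>i\<in>I. \<sigma> (g i))"
  using assms(2,3)
proof (induction I rule: finite_induct)
  case empty
  then show ?case using gal_embed[OF assms(1), of 1] subfield_ambientD(2)[OF subfield_adj] by simp
next
  case (insert i I)
  then show ?case
    using gal_times[OF assms(1), of "g i" "prod g I"] subfield_ambientD(4)[OF subfield_adj, of "g i" \<gamma> "prod g I"] by simp
qed

text \<open>For all but finitely many constants \<open>c\<close>, the product of the \<open>c - \<tau> \<gamma>\<close> with \<open>\<tau> \<in> H\<close> has stabilizer \<open>H\<close>.\<close>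

lemma exists_with_stabilizer:
  assumes H: "subgroup H gal"
  obtains \<mu> where "\<mu> \<in> adj \<gamma>" "integral_element \<mu>" "{\<sigma> \<in> carrier gal. \<sigma> \<mu> = \<mu>} = H"
proof -
  interpret G: group gal by (rule group_gal)
  have Hsub: "H \<subseteq> carrier gal" by (rule subgroup.subset[OF H])
  have finH: "finite H" by (rule finite_subset[OF Hsub finite_gal])
  \<comment> \<open>The value of \<open>Q \<sigma>\<close> at c will be \<sigma> \<mu>. Outside H it
    differs from \<open>Q id\<close>: otherwise \<gamma> = \<sigma> (\<tau> \<gamma>) for some
    \<tau> in H, and \<sigma> would be the inverse of \<tau>.\<close>
  define Q where "Q \<sigma> = (\<Prod>\<tau>\<in>H. [:- \<sigma> (\<tau> \<gamma>), 1:])" for \<sigma> :: "'k poly fract alg_closure \<Rightarrow> 'k poly fract alg_closure"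
  have Q_root: "poly (Q \<sigma>) x = 0 \<longleftrightarrow> (\<exists>\<tau>\<in>H. x = \<sigma> (\<tau> \<gamma>))" for \<sigma> x
    using finH by (auto simp: Q_def poly_prod prod_zero_iff)
  have one: "(\<lambda>x\<in>adj \<gamma>. x) \<in> H" using subgroup.one_closed[OF H] by (simp add: gal_one)
  have Q_neq: "Q \<sigma> - Q id \<noteq> 0" if \<sigma>: "\<sigma> \<in> carrier gal" "\<sigma> \<notin> H" for \<sigma>
  proof
    assume "Q \<sigma> - Q id = 0"
    then have "poly (Q \<sigma>) \<gamma> = poly (Q id) \<gamma>" by simp
    moreover have "poly (Q id) \<gamma> = 0" unfolding Q_root by (intro bexI[OF _ one]) (simp add: self_in_adj)
    ultimately obtain \<tau> where \<tau>: "\<tau> \<in> H" "\<gamma> = \<sigma> (\<tau> \<gamma>)" using Q_root[of \<sigma> \<gamma>] by auto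
    have \<tau>c: "\<tau> \<in> carrier gal" using \<tau>(1) Hsub by blast
    have "\<sigma> \<otimes>\<^bsub>gal\<^esub> \<tau> = \<one>\<^bsub>gal\<^esub>"
    proof (rule gal_eqI[OF G.m_closed[OF \<sigma>(1) \<tau>c] G.one_closed])
      show "(\<sigma> \<otimes>\<^bsub>gal\<^esub> \<tau>) \<gamma> = \<one>\<^bsub>gal\<^esub> \<gamma>"
        using \<tau>(2) by (simp add: gal_mult[OF \<sigma>(1) \<tau>c] gal_one compose_eq self_in_adj)
    qed
    then have "\<sigma> = inv\<^bsub>gal\<^esub> \<tau>" using G.inv_equality[OF _ \<tau>c \<sigma>(1)] by simp
    then show False using \<sigma>(2) subgroup.m_inv_closed[OF H \<tau>(1)] by simp
  qed
  have "finite (\<Union>\<sigma>\<in>carrier gal - H. {x. poly (Q \<sigma> - Q id) x = 0})"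
    using finite_gal Q_neq by (intro finite_UN_I poly_roots_finite) auto
  then have "\<exists>c. c \<in> range (poly_embed :: 'k poly \<Rightarrow> _) \<and> c \<notin> (\<Union>\<sigma>\<in>carrier gal - H. {x. poly (Q \<sigma> - Q id) x = 0})"
    using infinite_poly_embed[where 'k='k] by (meson finite_subset subsetI)
  then obtain c where c: "\<And>\<sigma>. \<sigma> \<in> carrier gal \<Longrightarrow> \<sigma> \<notin> H \<Longrightarrow> poly (Q \<sigma> - Q id) (poly_embed c) \<noteq> 0" by blast
  define \<mu> where "\<mu> = (\<Prod>\<tau>\<in>H. poly_embed c - \<tau> \<gamma>)"
  have \<tau>\<gamma>: "\<tau> \<gamma> \<in> adj \<gamma>" if "\<tau> \<in> carrier gal" for \<tau> using gal_mem[OF that self_in_adj] .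
  have lin: "poly_embed c - x = aev x [:c, - 1:]" for x by simp
  have diff: "poly_embed c - x \<in> adj \<gamma>" "\<sigma> (poly_embed c - x) = poly_embed c - \<sigma> x"
    if "x \<in> adj \<gamma>" "\<sigma> \<in> carrier gal" for x \<sigma>
  proof -
    have "poly_embed c \<in> adj \<gamma>" using N.OK_embed[of c] by (simp add: N.OK_iff)
    then show "poly_embed c - x \<in> adj \<gamma>" using subfield_ambientD(6)[OF subfield_adj] that(1) by blast
    show "\<sigma> (poly_embed c - x) = poly_embed c - \<sigma> x" unfolding lin by (rule gal_aev[OF that(2,1)])
  qed
  have \<mu>_adj: "\<mu> \<in> adj \<gamma>" and \<sigma>\<mu>: "\<sigma> \<mu> = poly (Q \<sigma>) (poly_embed c)" if "\<sigma> \<in> carrier gal" for \<sigma>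
  proof -
    have "poly_embed c - \<tau> \<gamma> \<in> adj \<gamma>" if "\<tau> \<in> H" for \<tau> using diff(1) \<tau>\<gamma> Hsub that \<open>\<sigma> \<in> carrier gal\<close> by blast
    then have *: "\<mu> \<in> adj \<gamma> \<and> \<sigma> \<mu> = (\<Prod>\<tau>\<in>H. \<sigma> (poly_embed c - \<tau> \<gamma>))"
      unfolding \<mu>_def by (intro gal_prod[OF that finH])
    then show "\<mu> \<in> adj \<gamma>" by simp
    have "\<sigma> (poly_embed c - \<tau> \<gamma>) = poly_embed c - \<sigma> (\<tau> \<gamma>)" if "\<tau> \<in> H" for \<tau>
      using diff(2) \<tau>\<gamma> Hsub that \<open>\<sigma> \<in> carrier gal\<close> by blast
    then show "\<sigma> \<mu> = poly (Q \<sigma>) (poly_embed c)" using * by (simp add: Q_def poly_prod)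
  qed
  have \<mu>_Q: "\<mu> = poly (Q id) (poly_embed c)" by (simp add: \<mu>_def Q_def poly_prod)
  have "integral_element \<mu>"
    unfolding \<mu>_def
  proof (rule integral_prod)
    fix \<tau> assume "\<tau> \<in> H"
    then have "\<tau> \<gamma> \<in> N.OK" using gal_OK[OF _ N.OK_gen] Hsub by blast
    then have "integral_element (poly_embed c + - (\<tau> \<gamma>))"
      by (intro integral_add integral_embed integral_uminus) (simp add: N.OK_iff)
    then show "integral_element (poly_embed c - \<tau> \<gamma>)" by simp
  qed
  moreover have "{\<sigma> \<in> carrier gal. \<sigma> \<mu> = \<mu>} = H"
  proof (intro equalityI subsetI)
    fix \<sigma> assume "\<sigma> \<in> {\<sigma> \<in> carrier gal. \<sigma> \<mu> = \<mu>}"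
    then have \<sigma>: "\<sigma> \<in> carrier gal" "\<sigma> \<mu> = \<mu>" by auto
    then have "poly (Q \<sigma> - Q id) (poly_embed c) = 0" using \<sigma>\<mu>[OF \<sigma>(1)] \<mu>_Q by simp
    then show "\<sigma> \<in> H" using c[OF \<sigma>(1)] by blast
  next
    fix \<sigma> assume \<sigma>: "\<sigma> \<in> H"
    then have \<sigma>c: "\<sigma> \<in> carrier gal" using Hsub by blast
    have bij: "bij_betw (\<lambda>\<tau>. \<sigma> \<otimes>\<^bsub>gal\<^esub> \<tau>) H H"
    proof (rule bij_betw_byWitness[where f' = "\<lambda>\<tau>. inv\<^bsub>gal\<^esub> \<sigma> \<otimes>\<^bsub>gal\<^esub> \<tau>"])
      show "\<forall>\<tau>\<in>H. inv\<^bsub>gal\<^esub> \<sigma> \<otimes>\<^bsub>gal\<^esub> (\<sigma> \<otimes>\<^bsub>gal\<^esub> \<tau>) = \<tau>" "\<forall>\<tau>\<in>H. \<sigma> \<otimes>\<^bsub>gal\<^esub> (inv\<^bsub>gal\<^esub> \<sigma> \<otimes>\<^bsub>gal\<^esub> \<tau>) = \<tau>"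
        using \<sigma>c Hsub by (auto simp: G.m_assoc[symmetric])
    qed (use \<sigma> subgroup.m_closed[OF H] subgroup.m_inv_closed[OF H] in auto)
    have "\<sigma> \<mu> = (\<Prod>\<tau>\<in>H. poly_embed c - \<sigma> (\<tau> \<gamma>))" using \<sigma>\<mu>[OF \<sigma>c] by (simp add: Q_def poly_prod)
    also have "\<dots> = (\<Prod>\<tau>\<in>H. poly_embed c - (\<sigma> \<otimes>\<^bsub>gal\<^esub> \<tau>) \<gamma>)"
    proof (rule prod.cong[OF refl])
      fix \<tau> assume "\<tau> \<in> H"
      then have "\<tau> \<in> carrier gal" using Hsub by blast
      then show "poly_embed c - \<sigma> (\<tau> \<gamma>) = poly_embed c - (\<sigma> \<otimes>\<^bsub>gal\<^esub> \<tau>) \<gamma>"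
        using \<sigma>c by (simp add: gal_mult compose_eq self_in_adj)
    qed
    also have "\<dots> = \<mu>" unfolding \<mu>_def by (rule prod.reindex_bij_betw[OF bij])
    finally show "\<sigma> \<in> {\<sigma> \<in> carrier gal. \<sigma> \<mu> = \<mu>}" using \<sigma>c by simp
  qed
  moreover have "\<mu> \<in> adj \<gamma>" using \<mu>_adj G.one_closed by blast
  ultimately show ?thesis using that by blast
qed

lemma separable_adj: "x \<in> adj \<gamma> \<Longrightarrow> separable_element x"
  using galois_extension by (simp add: finite_galois_extension_def finite_separable_extension_def)

lemma exists_subcurve:
  assumes "\<alpha> \<in> adj \<gamma>" "integral_element \<alpha>"
  obtains f' \<Delta>' u' v' where "galois_subcurve f \<Delta> u v \<gamma> f' \<Delta>' u' v' \<alpha>"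
proof -
  obtain f' \<Delta>' u' v' where "integral_generator f' \<Delta>' u' v' \<alpha>"
    using exists_integral_generator[OF assms(2) separable_adj[OF assms(1)]] .
  then have "galois_subcurve f \<Delta> u v \<gamma> f' \<Delta>' u' v' \<alpha>"
    using assms(1) galois_curve_axioms by (simp add: galois_subcurve_def galois_subcurve_axioms_def)
  then show ?thesis by (rule that)
qed

end

lemma (in affine_curve) finite_bad_primes: "finite (prime_polys - good_primes)"
  by (rule finite_subset[OF _ finite_dividing_polys[OF discriminant_nz]]) (auto simp: good_primes_def)

lemma (in affine_curve) good_primes_subset: "good_primes \<subseteq> prime_polys"
  by (auto simp: good_primes_def)

lemma (in galois_subcurve) log_asymp_fixpts:
  "log_asymp N.good_primes (\<lambda>p. real (card (act.fixpts (Frob p)))) 1"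
proof (rule log_asymp_change)
  show "log_asymp A.good_primes (\<lambda>p. real (card (A.fixed_roots p))) 1"
    unfolding log_asymp_def using A.fixed_roots_asymptotics by simp
  show "finite (A.good_primes - N.good_primes)" "finite (N.good_primes - A.good_primes)"
    using finite_subset[OF _ N.finite_bad_primes] finite_subset[OF _ A.finite_bad_primes]
      A.good_primes_subset N.good_primes_subset by (meson Diff_mono order_refl)+
  show "real (card (A.fixed_roots p)) = real (card (act.fixpts (Frob p)))" if "p \<in> A.good_primes \<inter> N.good_primes" for p
    using card_fixed_roots[of p] that by simp
qed

context galois_curve
begin

text \<open>Additive over disjoint unions in A, which makes sieving possible; for a subgroup it is
  the order of the subgroup times the number of fixed points of the Frobenius element on the
  cosets.\<close>

definition conj_count :: "('k poly fract alg_closure \<Rightarrow> 'k poly fract alg_closure) set \<Rightarrow> 'k poly \<Rightarrow> nat"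
  where "conj_count A p = card {c \<in> carrier gal. inv\<^bsub>gal\<^esub> c \<otimes>\<^bsub>gal\<^esub> Frob p \<otimes>\<^bsub>gal\<^esub> c \<in> A}"

text \<open>An element \<mu> with stabilizer H gives a curve whose degree one places above p are the
  fixed points of the Frobenius element on the conjugates of \<mu>.\<close>

lemma log_asymp_subgroup:
  assumes "subgroup H gal"
  shows "log_asymp N.good_primes (\<lambda>p. real (conj_count H p)) (real (card H))"
proof -
  obtain \<mu> where \<mu>: "\<mu> \<in> adj \<gamma>" "integral_element \<mu>" "{\<sigma> \<in> carrier gal. \<sigma> \<mu> = \<mu>} = H"
    by (rule exists_with_stabilizer[OF assms])
  obtain f' \<Delta>' u' v' where "galois_subcurve f \<Delta> u v \<gamma> f' \<Delta>' u' v' \<mu>" using exists_subcurve[OF \<mu>(1,2)] .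
  then interpret S: galois_subcurve f \<Delta> u v \<gamma> f' \<Delta>' u' v' \<mu> .
  have stab: "S.act.stab = H" using \<mu>(3) by (simp add: S.act.stab_def)
  have "log_asymp N.good_primes (\<lambda>p. real (card H) * real (card (S.act.fixpts (Frob p)))) (real (card H) * 1)"
    by (rule log_asymp_cmult[OF S.log_asymp_fixpts])
  then have *: "log_asymp N.good_primes (\<lambda>p. real (card H) * real (card (S.act.fixpts (Frob p)))) (real (card H))"
    by simp
  have eq: "real (card H) * real (card (S.act.fixpts (Frob p))) = real (conj_count H p)" if "p \<in> N.good_primes" for p
    unfolding conj_count_def S.act.card_conj_stab[OF Frob(1)[OF that], unfolded stab] by (simp only: of_nat_mult mult.commute)
  show ?thesis by (rule log_asymp_change[OF *]) (use eq in auto)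
qed

text \<open>By induction on the order of \<open>y\<close>: sieve the generators out of the cyclic group of \<open>y\<close>.\<close>

lemma log_asymp_gens:
  assumes "y \<in> carrier gal"
  shows "log_asymp N.good_primes (\<lambda>p. real (conj_count (group.gens gal y) p)) (real (card (group.gens gal y)))"
  using assms
proof (induction "group.ord gal y" arbitrary: y rule: less_induct)
  case less
  interpret G: group gal by (rule group_gal)
  let ?n = "G.ord y" and ?y = "\<lambda>e. y [^]\<^bsub>gal\<^esub> (G.ord y div e)"
  let ?E = "{e. e dvd G.ord y} - {G.ord y}"
  have n: "0 < ?n" using G.ord_ge_1[OF finite_gal less.prems] by simp
  have fin: "finite {e. e dvd ?n}" using n by simp
  have yn: "?y ?n = y" using n less.prems by simp
  have split: "(\<Sum>e | e dvd ?n. t e) = t ?n + sum t ?E" for t :: "nat \<Rightarrow> nat"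
    using fin by (intro sum.remove) auto
  have count: "real (conj_count (G.gens y) p) = real (conj_count (G.powers y) p) - (\<Sum>e\<in>?E. real (conj_count (G.gens (?y e)) p))" for p
    unfolding conj_count_def G.card_powers_decompose[OF finite_gal less.prems] split yn by simp
  have card_eq: "card {c \<in> carrier gal. c \<in> A} = card A" if "A \<subseteq> carrier gal" for A
    using that by (intro arg_cong[of _ _ card]) auto
  have gens_sub: "G.gens z \<subseteq> carrier gal" if "z \<in> carrier gal" for z
    using G.powers_carrier[OF that] by (auto simp: G.gens_def)
  have card: "real (card (G.gens y)) = real (card (G.powers y)) - (\<Sum>e\<in>?E. real (card (G.gens (?y e))))"
  proof -
    have "card (G.powers y) = card {c \<in> carrier gal. c \<in> G.powers y}"
      by (rule card_eq[symmetric, OF G.powers_carrier[OF less.prems]])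
    also have "\<dots> = (\<Sum>e | e dvd ?n. card {c \<in> carrier gal. c \<in> G.gens (?y e)})"
      by (rule G.card_powers_decompose[OF finite_gal less.prems])
    also have "\<dots> = (\<Sum>e | e dvd ?n. card (G.gens (?y e)))"
      using less.prems by (intro sum.cong refl card_eq gens_sub) auto
    also have "\<dots> = card (G.gens y) + (\<Sum>e\<in>?E. card (G.gens (?y e)))" by (simp only: split yn)
    finally show ?thesis by simp
  qed
  have "log_asymp N.good_primes (\<lambda>p. real (conj_count (G.gens (?y e)) p)) (real (card (G.gens (?y e))))" if "e \<in> ?E" for e
  proof (rule less.hyps)
    have "e dvd ?n" "e \<noteq> ?n" using that by auto
    then show "G.ord (?y e) < ?n" using G.gens_subgroup_eq(2)[OF finite_gal less.prems] n by (simp add: dvd_imp_le le_neq_implies_less)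
  qed (use less.prems in simp)
  then have "log_asymp N.good_primes (\<lambda>p. \<Sum>e\<in>?E. real (conj_count (G.gens (?y e)) p)) (\<Sum>e\<in>?E. real (card (G.gens (?y e))))"
    using fin by (intro log_asymp_sum) auto
  then show ?case
    unfolding count card
    by (intro log_asymp_diff log_asymp_subgroup[OF G.subgroup_powers[OF finite_gal less.prems]])
qed

theorem Frobenius_not_density_zero:
  assumes y: "y \<in> carrier gal"
    and Z: "{p \<in> N.good_primes. \<exists>c\<in>carrier gal. \<exists>x\<in>group.gens gal y. Frob p = c \<otimes>\<^bsub>gal\<^esub> x \<otimes>\<^bsub>gal\<^esub> inv\<^bsub>gal\<^esub> c} \<subseteq> Z"
    and "Z \<subseteq> prime_polys"
  shows "\<not> has_dirichlet_density Z 0"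
proof (rule log_asymp_not_density_zero[OF log_asymp_gens[OF y] _ _ _ _ assms(3)])
  interpret G: group gal by (rule group_gal)
  have sub: "G.gens y \<subseteq> carrier gal" using G.powers_carrier[OF y] by (auto simp: G.gens_def)
  show "0 < real (card (G.gens y))"
    using G.self_in_gens[OF y] finite_subset[OF sub finite_gal] by (auto simp: card_gt_0_iff)
  show "real (conj_count (G.gens y) p) \<le> real (card (carrier gal))" for p
    using finite_gal by (auto simp: conj_count_def intro!: card_mono)
  show "{p \<in> N.good_primes. real (conj_count (G.gens y) p) \<noteq> 0} \<subseteq> Z"
  proof (rule order_trans[OF subsetI Z])
    fix p assume "p \<in> {p \<in> N.good_primes. real (conj_count (G.gens y) p) \<noteq> 0}"
    then have p: "p \<in> N.good_primes" "conj_count (G.gens y) p \<noteq> 0" by auto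
    have "{c \<in> carrier gal. inv\<^bsub>gal\<^esub> c \<otimes>\<^bsub>gal\<^esub> Frob p \<otimes>\<^bsub>gal\<^esub> c \<in> G.gens y} \<noteq> {}"
      using p(2) unfolding conj_count_def by (metis card.empty)
    then obtain c where c: "c \<in> carrier gal" "inv\<^bsub>gal\<^esub> c \<otimes>\<^bsub>gal\<^esub> Frob p \<otimes>\<^bsub>gal\<^esub> c \<in> G.gens y" by blast
    have "c \<otimes>\<^bsub>gal\<^esub> (inv\<^bsub>gal\<^esub> c \<otimes>\<^bsub>gal\<^esub> Frob p \<otimes>\<^bsub>gal\<^esub> c) \<otimes>\<^bsub>gal\<^esub> inv\<^bsub>gal\<^esub> c = Frob p"
      using c(1) Frob(1)[OF p(1)] by (simp add: G.m_assoc) (simp add: G.m_assoc[symmetric])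
    then show "p \<in> {p \<in> N.good_primes. \<exists>c\<in>carrier gal. \<exists>x\<in>G.gens y. Frob p = c \<otimes>\<^bsub>gal\<^esub> x \<otimes>\<^bsub>gal\<^esub> inv\<^bsub>gal\<^esub> c}"
      using c p(1) by (metis (mono_tags, lifting) mem_Collect_eq)
  qed
qed simp

end

section \<open>Equivalence of the three conditions\<close>

lemma infinite_fract_poly: "infinite (UNIV :: 'k::field poly fract set)"
proof
  assume "finite (UNIV :: 'k poly fract set)"
  then have "finite (range (to_ac :: 'k poly fract \<Rightarrow> _))" by (rule finite_imageI)
  then have "finite (range (poly_embed :: 'k poly \<Rightarrow> _))" by (rule rev_finite_subset) auto
  then show False using infinite_poly_embed[where 'k='k] by blast
qed

lemma adj_poly_embed_mult:
  assumes "c \<noteq> 0" shows "adj (poly_embed c * x) = adj x"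
proof (intro equalityI adj_mono)
  have emb: "poly_embed c \<in> adj z" "inverse (poly_embed c) \<in> adj z" for z
  proof -
    show "poly_embed c \<in> adj z" using base_subset_adj[of z] poly_embed_in_base by blast
    then show "inverse (poly_embed c) \<in> adj z" by (rule subfield_ambientD(7)[OF subfield_adj])
  qed
  show "poly_embed c * x \<in> adj x" using emb(1) self_in_adj by (rule subfield_ambientD(4)[OF subfield_adj])
  have "inverse (poly_embed c) * (poly_embed c * x) \<in> adj (poly_embed c * x)"
    using emb(2) self_in_adj by (rule subfield_ambientD(4)[OF subfield_adj])
  moreover have "inverse (poly_embed c) * (poly_embed c * x) = x" using assms by simp
  ultimately show "x \<in> adj (poly_embed c * x)" by simp
qed

lemma integral_primitive_element:
  fixes K :: "'k::{field,finite} poly fract alg_closure set"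
  assumes "finite_separable_extension K"
  obtains \<alpha> where "K = adj \<alpha>" "integral_element \<alpha>"
proof -
  obtain \<alpha> where \<alpha>: "K = adj \<alpha>" using primitive_element[OF infinite_fract_poly assms] .
  obtain c where "c \<noteq> 0" "integral_element (poly_embed c * \<alpha>)" by (rule exists_integral_multiple)
  then show ?thesis using that[of "poly_embed c * \<alpha>"] \<alpha> adj_poly_embed_mult by blast
qed

lemma exists_galois_curve:
  assumes "galois_generator \<gamma> (h :: 'k::{field,finite} poly fract poly)"
  obtains f \<Delta> u v \<gamma>' where "galois_curve f \<Delta> u v \<gamma>'" "adj \<gamma>' = adj \<gamma>"
proof -
  interpret galois_generator \<gamma> h by (rule assms)
  have N: "finite_separable_extension (adj \<gamma>)" using galois_extension by (simp add: finite_galois_extension_def)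
  obtain \<gamma>' where \<gamma>': "adj \<gamma> = adj \<gamma>'" "integral_element \<gamma>'" by (rule integral_primitive_element[OF N])
  have mem: "\<gamma>' \<in> adj \<gamma>" using \<gamma>'(1) self_in_adj by simp
  have "separable_element \<gamma>'" using N mem by (simp add: finite_separable_extension_def)
  then obtain f \<Delta> u v where f: "integral_generator f \<Delta> u v \<gamma>'" using exists_integral_generator[OF \<gamma>'(2)] by blast
  interpret I: integral_generator f \<Delta> u v \<gamma>' by (rule f)
  have root: "tev \<gamma>' (map_poly to_fract f) = 0" using I.root_f by (simp add: aev_eq_tev)
  note R = roots_eq_orbit[OF mem I.irreducible_fract root]
  have "galois_generator \<gamma>' (map_poly to_fract f)"
  proof
    show "z \<in> adj \<gamma>'" if "tev z (map_poly to_fract f) = 0" for z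
    proof -
      have "z \<in> (\<lambda>\<sigma>. \<sigma> \<gamma>') ` carrier gal" using that unfolding R(1)[symmetric] by simp
      then show ?thesis using gal_mem[OF _ mem] unfolding \<gamma>'(1)[symmetric] by blast
    qed
  qed (use I.irreducible_fract root R(2) in auto)
  then have "galois_curve f \<Delta> u v \<gamma>'" using f by (simp add: galois_curve_def)
  then show ?thesis using that \<gamma>'(1) by metis
qed

locale galois_pair =
  A: galois_subcurve f \<Delta> u v \<gamma> f\<^sub>1 \<Delta>\<^sub>1 u\<^sub>1 v\<^sub>1 \<alpha> + B: galois_subcurve f \<Delta> u v \<gamma> f\<^sub>2 \<Delta>\<^sub>2 u\<^sub>2 v\<^sub>2 \<beta>
  for f :: "'k::{field,finite} poly poly" and \<Delta> u v \<gamma>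
    and f\<^sub>1 :: "'k poly poly" and \<Delta>\<^sub>1 u\<^sub>1 v\<^sub>1 \<alpha> and f\<^sub>2 :: "'k poly poly" and \<Delta>\<^sub>2 u\<^sub>2 v\<^sub>2 \<beta>
begin

sublocale acts: two_transitive_actions A.gal "\<lambda>\<sigma>. \<sigma>" \<alpha> "\<lambda>\<sigma>. \<sigma>" \<beta>
  by (intro two_transitive_actions.intro A.act.transitive_action_axioms B.act.transitive_action_axioms)

definition usable :: "'k poly set"
  where "usable = A.N.good_primes \<inter> A.A.good_primes \<inter> B.A.good_primes"

lemma finite_unusable: "finite (prime_polys - usable)"
proof -
  have "prime_polys - usable = (prime_polys - A.N.good_primes) \<union> (prime_polys - A.A.good_primes) \<union> (prime_polys - B.A.good_primes)"
    by (auto simp: usable_def)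
  then show ?thesis using A.N.finite_bad_primes A.A.finite_bad_primes B.A.finite_bad_primes by simp
qed

lemma for_almost_all_primes_mono:
  assumes "for_almost_all_primes Q" "\<And>p. p \<in> usable \<Longrightarrow> Q p \<Longrightarrow> Q' p"
  shows "for_almost_all_primes Q'"
  unfolding for_almost_all_primes_def
proof (rule density_zero_subset)
  show "has_dirichlet_density ({p \<in> prime_polys. \<not> Q p} \<union> (prime_polys - usable)) 0"
    using assms(1) by (intro density_zero_Un density_zero_finite[OF finite_unusable]) (auto simp: for_almost_all_primes_def)
qed (use assms(2) in auto)

lemma length_splitting_type:
  assumes "p \<in> usable"
  shows "length (splitting_type (adj \<alpha>) p) = card (primes_above (adj \<alpha>) p)"
    "length (splitting_type (adj \<beta>) p) = card (primes_above (adj \<beta>) p)"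
proof -
  have p: "p \<in> A.N.good_primes" "p \<in> A.A.good_primes" "p \<in> B.A.good_primes" using assms by (auto simp: usable_def)
  have len: "length (sorted_list_of_multiset M) = size M" for M :: "nat multiset"
    by (metis mset_sorted_list_of_multiset size_mset)
  show "length (splitting_type (adj \<alpha>) p) = card (primes_above (adj \<alpha>) p)"
    by (simp add: A.splitting_type_eq_cycle_type[OF p(1,2)] A.card_primes_above_eq_num_orbits[OF p(1,2)] len)
  show "length (splitting_type (adj \<beta>) p) = card (primes_above (adj \<beta>) p)"
    by (simp add: B.splitting_type_eq_cycle_type[OF p(1,3)] B.card_primes_above_eq_num_orbits[OF p(1,3)] len)
qed

lemma arithmetic_imp_split:
  assumes "arithmetically_equivalent (adj \<alpha>) (adj \<beta>)" shows "split_equivalent (adj \<alpha>) (adj \<beta>)"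
  using for_almost_all_primes_mono[OF assms[unfolded arithmetically_equivalent_def], of "\<lambda>p. card (primes_above (adj \<alpha>) p) = card (primes_above (adj \<beta>) p)"]
    length_splitting_type
  unfolding split_equivalent_def by metis

lemma gassmann_in_iff:
  "(\<forall>C\<in>conjugacy_classes A.gal. card (C \<inter> carrier (galois_group (adj \<gamma>) (adj \<alpha>))) = card (C \<inter> carrier (galois_group (adj \<gamma>) (adj \<beta>))))
    \<longleftrightarrow> (\<forall>\<sigma>\<in>carrier A.gal. card (A.act.fixpts \<sigma>) = card (B.act.fixpts \<sigma>))"
  using acts.gassmann_iff by (simp only: A.stab_eq B.stab_eq)

lemma gassmann_imp_arithmetic:
  assumes "gassmann_equivalent (adj \<alpha>) (adj \<beta>)" shows "arithmetically_equivalent (adj \<alpha>) (adj \<beta>)"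
proof -
  have "\<forall>C\<in>conjugacy_classes A.gal. card (C \<inter> carrier (galois_group (adj \<gamma>) (adj \<alpha>))) = card (C \<inter> carrier (galois_group (adj \<gamma>) (adj \<beta>)))"
    using assms A.galois_extension adj_mono[OF A.subfield] adj_mono[OF B.subfield]
    unfolding gassmann_equivalent_def by blast
  then have fix_eq: "\<forall>\<sigma>\<in>carrier A.gal. card (A.act.fixpts \<sigma>) = card (B.act.fixpts \<sigma>)" unfolding gassmann_in_iff .
  show ?thesis unfolding arithmetically_equivalent_def
  proof (rule for_almost_all_primes_mono)
    show "for_almost_all_primes (\<lambda>p :: 'k poly. True)"
      unfolding for_almost_all_primes_def by (rule density_zero_finite) simp
    fix p assume "p \<in> usable"
    then have p: "p \<in> A.N.good_primes" "p \<in> A.A.good_primes" "p \<in> B.A.good_primes" by (auto simp: usable_def)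
    show "splitting_type (adj \<alpha>) p = splitting_type (adj \<beta>) p"
      unfolding A.splitting_type_eq_cycle_type[OF p(1,2)] B.splitting_type_eq_cycle_type[OF p(1,3)]
        acts.cycle_types_eq[OF fix_eq A.Frob(1)[OF p(1)]] by (rule refl)
  qed
qed

text \<open>The number of orbits is unchanged under conjugation and under passing to another
  generator of the cyclic group. If it differed at \<sigma>, every usable prime with Frobenius
  element conjugate to a generator of the group of \<sigma> would be exceptional, and these primes
  are too many.\<close>

lemma split_imp_gassmann_in:
  assumes "split_equivalent (adj \<alpha>) (adj \<beta>)"
  shows "\<forall>C\<in>conjugacy_classes A.gal. card (C \<inter> carrier (galois_group (adj \<gamma>) (adj \<alpha>))) = card (C \<inter> carrier (galois_group (adj \<gamma>) (adj \<beta>)))"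
  unfolding gassmann_in_iff
proof
  let ?Z = "{p \<in> prime_polys. card (primes_above (adj \<alpha>) p) \<noteq> card (primes_above (adj \<beta>) p)} \<union> (prime_polys - usable)"
  have Z: "has_dirichlet_density ?Z 0"
    using assms
    by (intro density_zero_Un density_zero_finite[OF finite_unusable]) (auto simp: split_equivalent_def for_almost_all_primes_def)
  have "\<forall>\<sigma>\<in>carrier A.gal. A.act.num_orbits \<sigma> = B.act.num_orbits \<sigma>"
  proof (rule ccontr)
    assume "\<not> ?thesis"
    then obtain \<sigma> where \<sigma>: "\<sigma> \<in> carrier A.gal" "A.act.num_orbits \<sigma> \<noteq> B.act.num_orbits \<sigma>" by blast
    have "\<not> has_dirichlet_density ?Z 0"
    proof (rule A.Frobenius_not_density_zero[OF \<sigma>(1)])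
      show "{p \<in> A.N.good_primes. \<exists>c\<in>carrier A.gal. \<exists>x\<in>group.gens A.gal \<sigma>. A.Frob p = c \<otimes>\<^bsub>A.gal\<^esub> x \<otimes>\<^bsub>A.gal\<^esub> inv\<^bsub>A.gal\<^esub> c} \<subseteq> ?Z"
      proof
        fix p assume "p \<in> {p \<in> A.N.good_primes. \<exists>c\<in>carrier A.gal. \<exists>x\<in>group.gens A.gal \<sigma>. A.Frob p = c \<otimes>\<^bsub>A.gal\<^esub> x \<otimes>\<^bsub>A.gal\<^esub> inv\<^bsub>A.gal\<^esub> c}"
        then obtain c x where p: "p \<in> A.N.good_primes" and c: "c \<in> carrier A.gal" and x: "x \<in> group.gens A.gal \<sigma>"
          and Frob: "A.Frob p = c \<otimes>\<^bsub>A.gal\<^esub> x \<otimes>\<^bsub>A.gal\<^esub> inv\<^bsub>A.gal\<^esub> c" by blast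
        obtain i :: nat where i: "x = \<sigma> [^]\<^bsub>A.gal\<^esub> i" "coprime i (group.ord A.gal \<sigma>)"
          using A.act.gens_coprime_pow[OF A.finite_gal \<sigma>(1) x] .
        have xc: "x \<in> carrier A.gal" using i(1) \<sigma>(1) by simp
        have "A.act.num_orbits (A.Frob p) = A.act.num_orbits \<sigma>" "B.act.num_orbits (A.Frob p) = B.act.num_orbits \<sigma>"
          unfolding Frob A.act.num_orbits_conj[OF xc c] B.act.num_orbits_conj[OF xc c]
          unfolding i(1) A.act.num_orbits_coprime_pow[OF \<sigma>(1) i(2)] B.act.num_orbits_coprime_pow[OF \<sigma>(1) i(2)] by (rule refl)+
        then have ne: "A.act.num_orbits (A.Frob p) \<noteq> B.act.num_orbits (A.Frob p)" using \<sigma>(2) by simp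
        show "p \<in> ?Z"
        proof (cases "p \<in> usable")
          case True
          then have p': "p \<in> A.A.good_primes" "p \<in> B.A.good_primes" by (auto simp: usable_def)
          have "card (primes_above (adj \<alpha>) p) \<noteq> card (primes_above (adj \<beta>) p)"
            unfolding A.card_primes_above_eq_num_orbits[OF p p'(1)] B.card_primes_above_eq_num_orbits[OF p p'(2)] by (rule ne)
          then show ?thesis using p A.N.good_primes_subset by blast
        next
          case False
          then show ?thesis using p A.N.good_primes_subset by blast
        qed
      qed
    qed auto
    then show False using Z by simp
  qed
  then show "card (A.act.fixpts \<sigma>) = card (B.act.fixpts \<sigma>)" if "\<sigma> \<in> carrier A.gal" for \<sigma>
    by (rule acts.fixpts_eq_of_num_orbits[OF _ that])
qed

end

lemma exists_galois_pair:
  assumes "galois_generator \<gamma> (h :: 'k::{field,finite} poly fract poly)"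
    and "\<alpha> \<in> adj \<gamma>" "integral_element \<alpha>" "\<beta> \<in> adj \<gamma>" "integral_element \<beta>"
  obtains f \<Delta> u v \<gamma>' f\<^sub>1 \<Delta>\<^sub>1 u\<^sub>1 v\<^sub>1 f\<^sub>2 \<Delta>\<^sub>2 u\<^sub>2 v\<^sub>2
  where "galois_pair f \<Delta> u v \<gamma>' f\<^sub>1 \<Delta>\<^sub>1 u\<^sub>1 v\<^sub>1 \<alpha> f\<^sub>2 \<Delta>\<^sub>2 u\<^sub>2 v\<^sub>2 \<beta>" "adj \<gamma>' = adj \<gamma>"
proof -
  obtain f \<Delta> u v \<gamma>' where f: "galois_curve f \<Delta> u v \<gamma>'" "adj \<gamma>' = adj \<gamma>" by (rule exists_galois_curve[OF assms(1)])
  interpret galois_curve f \<Delta> u v \<gamma>' by (rule f(1))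
  obtain f\<^sub>1 \<Delta>\<^sub>1 u\<^sub>1 v\<^sub>1 where A: "galois_subcurve f \<Delta> u v \<gamma>' f\<^sub>1 \<Delta>\<^sub>1 u\<^sub>1 v\<^sub>1 \<alpha>"
    using exists_subcurve[of \<alpha>] assms(2,3) f(2) by metis
  obtain f\<^sub>2 \<Delta>\<^sub>2 u\<^sub>2 v\<^sub>2 where B: "galois_subcurve f \<Delta> u v \<gamma>' f\<^sub>2 \<Delta>\<^sub>2 u\<^sub>2 v\<^sub>2 \<beta>"
    using exists_subcurve[of \<beta>] assms(4,5) f(2) by metis
  show ?thesis using that[OF galois_pair.intro[OF A B] f(2)] .
qed

theorem theorem4:
  fixes K L :: "'k::{field,finite} poly fract alg_closure set"
  assumes "finite_separable_extension K" and "finite_separable_extension L"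
  shows "(arithmetically_equivalent K L \<longleftrightarrow> gassmann_equivalent K L) \<and>
         (gassmann_equivalent K L \<longleftrightarrow> split_equivalent K L)"
proof -
  obtain \<alpha> where \<alpha>: "K = adj \<alpha>" "integral_element \<alpha>" by (rule integral_primitive_element[OF assms(1)])
  obtain \<beta> where \<beta>: "L = adj \<beta>" "integral_element \<beta>" by (rule integral_primitive_element[OF assms(2)])
  obtain \<gamma> h where N: "galois_generator \<gamma> (h :: 'k poly fract poly)" "K \<subseteq> adj \<gamma>" "L \<subseteq> adj \<gamma>"
    by (rule exists_galois_closure[OF infinite_fract_poly assms])
  have mem: "\<alpha> \<in> adj \<gamma>" "\<beta> \<in> adj \<gamma>" using N(2,3) \<alpha>(1) \<beta>(1) self_in_adj by blast+
  obtain f \<Delta> u v \<gamma>' f\<^sub>1 \<Delta>\<^sub>1 u\<^sub>1 v\<^sub>1 f\<^sub>2 \<Delta>\<^sub>2 u\<^sub>2 v\<^sub>2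
    where pair: "galois_pair f \<Delta> u v \<gamma>' f\<^sub>1 \<Delta>\<^sub>1 u\<^sub>1 v\<^sub>1 \<alpha> f\<^sub>2 \<Delta>\<^sub>2 u\<^sub>2 v\<^sub>2 \<beta>"
    using exists_galois_pair[OF N(1) mem(1) \<alpha>(2) mem(2) \<beta>(2)] by metis
  have "arithmetically_equivalent K L" if "gassmann_equivalent K L"
    using galois_pair.gassmann_imp_arithmetic[OF pair] that \<alpha>(1) \<beta>(1) by simp
  moreover have "split_equivalent K L" if "arithmetically_equivalent K L"
    using galois_pair.arithmetic_imp_split[OF pair] that \<alpha>(1) \<beta>(1) by simp
  moreover have "gassmann_equivalent K L" if "split_equivalent K L"
    unfolding gassmann_equivalent_def
  proof (intro allI impI)
    \<comment> \<open>Gassmann equivalence speaks of every Galois extension containing both fields,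
      so the density argument is carried out inside M itself, with the same \<alpha> and
      \<beta>.\<close>
    fix M assume M: "finite_galois_extension M \<and> K \<subseteq> M \<and> L \<subseteq> M"
    obtain \<delta> g where \<delta>: "galois_generator \<delta> (g :: 'k poly fract poly)" "M = adj \<delta>"
      using galois_generator_of_extension[OF infinite_fract_poly] M by blast
    have "\<alpha> \<in> adj \<delta>" "\<beta> \<in> adj \<delta>" using M \<delta>(2) \<alpha>(1) \<beta>(1) self_in_adj by blast+
    then obtain f \<Delta> u v \<delta>' f\<^sub>1 \<Delta>\<^sub>1 u\<^sub>1 v\<^sub>1 f\<^sub>2 \<Delta>\<^sub>2 u\<^sub>2 v\<^sub>2
      where pair: "galois_pair f \<Delta> u v \<delta>' f\<^sub>1 \<Delta>\<^sub>1 u\<^sub>1 v\<^sub>1 \<alpha> f\<^sub>2 \<Delta>\<^sub>2 u\<^sub>2 v\<^sub>2 \<beta>" "adj \<delta>' = adj \<delta>"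
      using exists_galois_pair[OF \<delta>(1) _ \<alpha>(2) _ \<beta>(2)] by metis
    have "split_equivalent (adj \<alpha>) (adj \<beta>)" using that \<alpha>(1) \<beta>(1) by simp
    from galois_pair.split_imp_gassmann_in[OF pair(1) this]
    show "\<forall>C\<in>conjugacy_classes (galois_group M base_field).
        card (C \<inter> carrier (galois_group M K)) = card (C \<inter> carrier (galois_group M L))"
      unfolding \<delta>(2) \<alpha>(1) \<beta>(1) pair(2) .
  qed
  ultimately show ?thesis by blast
qed

end
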